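(* The Hilbert spaces $\mathcal H$ (the space of differential $1$-forms associated with $(\mathcal E,\mathcal F)$) and $\int_X^{\oplus}\mathcal H_x\,m(dx)$ are isometrically isomorphic. In particular, writing $(\omega_x)_{x\in X}$ for the measurable section corresponding to $\omega\in\mathcal H$, for all $\omega,\eta\in\mathcal H$ $$\langle\omega,\eta\rangle_{\mathcal H}=\int_X\langle\omega_x,\eta_x\rangle_{\mathcal H_x}\,m(dx).$$
   Context: $X$ is a locally compact separable metric space. $\mathcal M(X)$ is the space of signed Radon measures on $X$ and $\mathcal M_+(X)$ the cone of nonnegative ones. A measure $\mu\in\mathcal M_+(X)$ is an admissible reference measure if $\mu(U)>0$ for every nonempty open $U\subset X$. Let $\mu$ be an admissible reference measure and $(\mathcal E,\mathcal F)$ a regular symmetric Dirichlet form on $L_2(X,\mu)$; write $\mathcal E(f)=\mathcal E(f,f)$. $C_0(X)$ is the space of continuous functions with compact support, $\mathcal C:=C_0(X)\cap\mathcal F$, and $\mathcal B_b(X)$ is the space of bounded Borel functions. Energy measures: for $g,h\in\mathcal C$, $\Gamma(g,h)\in\mathcal M(X)$ is the unique finite signed measure with $2\int_X f\,d\Gamma(g,h)=\mathcal E(fg,h)+\mathcal E(fh,g)-\mathcal E(gh,f)$ for all $f\in\mathcal C$; $\Gamma(g):=\Gamma(g,g)\ge 0$. The space $\mathcal H$: on $\mathcal C\otimes\mathcal B_b(X)$ consider the nonnegative definite symmetric bilinear form determined by $\langle a\otimes b,c\otimes d\rangle_{\mathcal H}:=\int_X bd\,d\Gamma(a,c)$, with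 seminorm $\|\cdot\|_{\mathcal H}$. $\mathcal H$ is the Hilbert space completion of $\mathcal C\otimes\mathcal B_b(X)/\ker\|\cdot\|_{\mathcal H}$. Fibers: let $m$ be an admissible reference measure such that for every $f\in\mathcal C$ the measure $\Gamma(f)$ is absolutely continuous with respect to $m$; $\Gamma(f,g)$ also denotes the density in $L_1(X,m)$. Let $\mathcal A_0=\{f_n\}_n\subset\mathcal C$ be countable and $\mathcal E$-dense in $\mathcal C$ (for each $f\in\mathcal C$ there is a sequence $(f_{n_j})_j\subset \mathcal A_0$ with $\mathcal E(f-f_{n_j})\to0$), and $\mathcal A:=\mathrm{span}(\mathcal A_0)$. Choose Borel versions $x\mapsto\Gamma_x(f_i,f_j)$ of the densities such that for all $N$ and all $x\in X$ the matrix $(\Gamma_x(f_i,f_j))_{i,j\le N}$ is symmetric and nonnegative definite, and extend bilinearly to $\mathcal A$ (versions are chosen so that this is well defined). For $x\in X$ put $\Gamma_{\mathcal H,x}(a\otimes b,c\otimes d):=b(x)d(x)\Gamma_x(a,c)$ on $\mathcal A\otimes\mathcal B_b(X)$, a nonnegative definite bilinear form; $\mathcal H_x$ is the Hilbert space completion of $\mathcal A\otimes\mathcal B_b(X)/\ker\Gamma_{\mathcal H,x}$ with scalar product $\langle[a\otimes b]_x,[c\otimes d]_x\rangle_{\mathcal H_x}=\Gamma_{\mathcal H,x}(a\otimes b,c\otimes d)$. $(\mathcal H_x)_{x\in X}$ is a measurable field of Hilbert spaces, its measurable sections being those $\xi\in\prod_x\mathcal H_x$ for which $x\mapsto\langle\xi(x),[f_n\otimes\mathbf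 1]_x\rangle_{\mathcal H_x}$ is measurable for all $n$. The direct integral $\int_X^\oplus\mathcal H_x\,m(dx)$ is the Hilbert space of ($m$-a.e. classes of) measurable sections $\xi$ with $\int_X\|\xi(x)\|_{\mathcal H_x}^2m(dx)<\infty$. *)

theory Defs
  imports "HOL-Analysis.Analysis"
begin

section \<open>Spaces of real functions\<close>

definition fun_subspace :: "('z \<Rightarrow> real) set \<Rightarrow> bool" where
  "fun_subspace V \<longleftrightarrow> (\<lambda>_. 0) \<in> V
     \<and> (\<forall>f\<in>V. \<forall>g\<in>V. (\<lambda>x. f x + g x) \<in> V)
     \<and> (\<forall>c. \<forall>f\<in>V. (\<lambda>x. c * f x) \<in> V)"

text \<open>Functions carry no \<open>real_vector\<close> instance in the library, so the library's definition of
  the linear span as a subspace hull is repeated with pointwise operations.\<close>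

definition fun_span :: "('z \<Rightarrow> real) set \<Rightarrow> ('z \<Rightarrow> real) set" where
  "fun_span S = fun_subspace hull S"

definition bilinear_form_on ::
  "('z \<Rightarrow> real) set \<Rightarrow> (('z \<Rightarrow> real) \<Rightarrow> ('z \<Rightarrow> real) \<Rightarrow> real) \<Rightarrow> bool" where
  "bilinear_form_on V B \<longleftrightarrow>
     (\<forall>f\<in>V. \<forall>g\<in>V. \<forall>h\<in>V. B (\<lambda>x. f x + g x) h = B f h + B g h
                      \<and> B h (\<lambda>x. f x + g x) = B h f + B h g)
     \<and> (\<forall>c. \<forall>f\<in>V. \<forall>h\<in>V. B (\<lambda>x. c * f x) h = c * B f h
                      \<and> B h (\<lambda>x. c * f x) = c * B h f)"

definition C0_fun :: "('a::topological_space \<Rightarrow> real) set" where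
  "C0_fun = {f. continuous_on UNIV f \<and> compact (closure {x. f x \<noteq> 0})}"

definition bounded_borel :: "('a::topological_space \<Rightarrow> real) set" where
  "bounded_borel = {f. f \<in> borel_measurable borel \<and> bounded (range f)}"

section \<open>Measures and signed measures\<close>

definition radon_measure :: "'a::topological_space measure \<Rightarrow> bool" where
  "radon_measure M \<longleftrightarrow> sets M = sets borel
     \<and> (\<forall>K. compact K \<longrightarrow> emeasure M K < \<infinity>)
     \<and> (\<forall>A\<in>sets borel. emeasure M A = (SUP K\<in>{K. K \<subseteq> A \<and> compact K}. emeasure M K))"

definition admissible_reference_measure :: "'a::topological_space measure \<Rightarrow> bool" where
  "admissible_reference_measure M \<longleftrightarrow>
     radon_measure M \<and> (\<forall>U. open U \<and> U \<noteq> {} \<longrightarrow> emeasure M U > 0)"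

text \<open>On a locally compact separable metric space every finite signed Borel measure is a
  (finite) signed Radon measure. Only the values on Borel sets matter.\<close>

definition finite_signed_measure :: "('a::topological_space set \<Rightarrow> real) \<Rightarrow> bool" where
  "finite_signed_measure \<nu> \<longleftrightarrow> \<nu> {} = 0
     \<and> (\<forall>A :: nat \<Rightarrow> 'a set. range A \<subseteq> sets borel \<and> disjoint_family A
           \<longrightarrow> (\<lambda>i. \<nu> (A i)) sums \<nu> (\<Union>i. A i))"

text \<open>Positive part in the Jordan decomposition. The function \<open>ennreal\<close> sends negative numbers
  to \<open>0\<close>, which is harmless because the empty set takes part in the supremum.\<close>

definition positive_variation :: "('a::topological_space set \<Rightarrow> real) \<Rightarrow> 'a measure" where
  "positive_variation \<nu> = measure_of UNIV (sets borel)
     (\<lambda>A. SUP B\<in>{B \<in> sets borel. B \<subseteq> A}. ennreal (\<nu> B))"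

definition signed_integral :: "('a::topological_space set \<Rightarrow> real) \<Rightarrow> ('a \<Rightarrow> real) \<Rightarrow> real" where
  "signed_integral \<nu> f =
     integral\<^sup>L (positive_variation \<nu>) f - integral\<^sup>L (positive_variation (\<lambda>A. - \<nu> A)) f"

section \<open>Dirichlet forms\<close>

text \<open>Elements of \<open>L\<^sub>2\<close> are represented by square integrable Borel functions; a domain
  is a set of such functions saturated under almost everywhere equality, on which the form
  depends on classes only.\<close>

definition L2_fun :: "'a measure \<Rightarrow> ('a \<Rightarrow> real) set" where
  "L2_fun \<mu> = {f. f \<in> borel_measurable \<mu> \<and> integrable \<mu> (\<lambda>x. (f x)\<^sup>2)}"

text \<open>The squared norm of the form domain.\<close>

definition energy1 ::
  "'a measure \<Rightarrow> (('a \<Rightarrow> real) \<Rightarrow> ('a \<Rightarrow> real) \<Rightarrow> real) \<Rightarrow> ('a \<Rightarrow> real) \<Rightarrow> real" where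
  "energy1 \<mu> E f = E f f + (\<integral>x. (f x)\<^sup>2 \<partial>\<mu>)"

definition symmetric_dirichlet_form ::
  "'a measure \<Rightarrow> ('a \<Rightarrow> real) set \<Rightarrow> (('a \<Rightarrow> real) \<Rightarrow> ('a \<Rightarrow> real) \<Rightarrow> real) \<Rightarrow> bool" where
  "symmetric_dirichlet_form \<mu> F E \<longleftrightarrow>
     F \<subseteq> L2_fun \<mu> \<and> fun_subspace F
     \<comment> \<open>well defined on almost everywhere classes\<close>
     \<and> (\<forall>f\<in>F. \<forall>g\<in>L2_fun \<mu>. (AE x in \<mu>. f x = g x) \<longrightarrow> g \<in> F \<and> (\<forall>h\<in>F. E g h = E f h))
     \<comment> \<open>densely defined\<close>
     \<and> (\<forall>g\<in>L2_fun \<mu>. \<forall>e>0. \<exists>f\<in>F. (\<integral>x. (g x - f x)\<^sup>2 \<partial>\<mu>) < e)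
     \<comment> \<open>nonnegative definite symmetric bilinear form\<close>
     \<and> bilinear_form_on F E
     \<and> (\<forall>f\<in>F. \<forall>g\<in>F. E f g = E g f)
     \<and> (\<forall>f\<in>F. 0 \<le> E f f)
     \<comment> \<open>closed\<close>
     \<and> (\<forall>u :: nat \<Rightarrow> 'a \<Rightarrow> real. range u \<subseteq> F
          \<and> (\<forall>e>0. \<exists>N. \<forall>i\<ge>N. \<forall>j\<ge>N. energy1 \<mu> E (\<lambda>x. u i x - u j x) < e)
          \<longrightarrow> (\<exists>f\<in>F. (\<lambda>n. energy1 \<mu> E (\<lambda>x. u n x - f x)) \<longlonglongrightarrow> 0))
     \<comment> \<open>Markovian: the unit contraction operates\<close>
     \<and> (\<forall>f\<in>F. (\<lambda>x. min (max (f x) 0) 1) \<in> F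
          \<and> E (\<lambda>x. min (max (f x) 0) 1) (\<lambda>x. min (max (f x) 0) 1) \<le> E f f)"

definition core :: "('a::topological_space \<Rightarrow> real) set \<Rightarrow> ('a \<Rightarrow> real) set" where
  "core F = C0_fun \<inter> F"

definition regular_form ::
  "'a::topological_space measure \<Rightarrow> ('a \<Rightarrow> real) set
     \<Rightarrow> (('a \<Rightarrow> real) \<Rightarrow> ('a \<Rightarrow> real) \<Rightarrow> real) \<Rightarrow> bool" where
  "regular_form \<mu> F E \<longleftrightarrow>
     (\<forall>f\<in>F. \<forall>e>0. \<exists>g\<in>core F. energy1 \<mu> E (\<lambda>x. f x - g x) < e)
     \<and> (\<forall>f\<in>C0_fun. \<forall>e>0. \<exists>g\<in>core F. \<forall>x. \<bar>f x - g x\<bar> < e)"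

text \<open>The defining identity determines every \<open>\<Gamma> g h\<close> on the Borel sets.\<close>

definition energy_measures ::
  "('a::topological_space \<Rightarrow> real) set \<Rightarrow> (('a \<Rightarrow> real) \<Rightarrow> ('a \<Rightarrow> real) \<Rightarrow> real)
     \<Rightarrow> (('a \<Rightarrow> real) \<Rightarrow> ('a \<Rightarrow> real) \<Rightarrow> 'a set \<Rightarrow> real) \<Rightarrow> bool" where
  "energy_measures F E \<Gamma> \<longleftrightarrow>
     (\<forall>g\<in>core F. \<forall>h\<in>core F. finite_signed_measure (\<Gamma> g h)
        \<and> (\<forall>f\<in>core F. 2 * signed_integral (\<Gamma> g h) f =
              E (\<lambda>x. f x * g x) h + E (\<lambda>x. f x * h x) g - E (\<lambda>x. g x * h x) f))
     \<and> (\<forall>g\<in>core F. \<forall>A\<in>sets borel. 0 \<le> \<Gamma> g g A)"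

section \<open>Hilbert spaces with explicit carriers\<close>

record 'h hspace =
  hcarrier :: "'h set"
  hadd :: "'h \<Rightarrow> 'h \<Rightarrow> 'h"
  hscale :: "real \<Rightarrow> 'h \<Rightarrow> 'h"
  hinner :: "'h \<Rightarrow> 'h \<Rightarrow> real"

definition isometric_isomorphism :: "('h \<Rightarrow> 'k) \<Rightarrow> 'h hspace \<Rightarrow> 'k hspace \<Rightarrow> bool" where
  "isometric_isomorphism \<Phi> H K \<longleftrightarrow> bij_betw \<Phi> (hcarrier H) (hcarrier K)
     \<and> (\<forall>u\<in>hcarrier H. \<forall>v\<in>hcarrier H. \<Phi> (hadd H u v) = hadd K (\<Phi> u) (\<Phi> v))
     \<and> (\<forall>c. \<forall>u\<in>hcarrier H. \<Phi> (hscale H c u) = hscale K c (\<Phi> u))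
     \<and> (\<forall>u\<in>hcarrier H. \<forall>v\<in>hcarrier H. hinner K (\<Phi> u) (\<Phi> v) = hinner H u v)"

text \<open>Let \<open>B\<close> be a nonnegative definite symmetric bilinear form on a space \<open>V\<close> of functions.
  The Hilbert space completion of \<open>V / ker B\<close> is the space of \<open>B\<close>-Cauchy sequences in \<open>V\<close>
  modulo sequences of vanishing seminorm; this factors out \<open>ker B\<close> at the same time.\<close>

definition cauchy_seqs ::
  "('z \<Rightarrow> real) set \<Rightarrow> (('z \<Rightarrow> real) \<Rightarrow> ('z \<Rightarrow> real) \<Rightarrow> real) \<Rightarrow> (nat \<Rightarrow> 'z \<Rightarrow> real) set" where
  "cauchy_seqs V B = {u. range u \<subseteq> V
     \<and> (\<forall>e>0. \<exists>N. \<forall>i\<ge>N. \<forall>j\<ge>N. B (\<lambda>z. u i z - u j z) (\<lambda>z. u i z - u j z) < e)}"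

definition completion_rel ::
  "('z \<Rightarrow> real) set \<Rightarrow> (('z \<Rightarrow> real) \<Rightarrow> ('z \<Rightarrow> real) \<Rightarrow> real)
     \<Rightarrow> ((nat \<Rightarrow> 'z \<Rightarrow> real) \<times> (nat \<Rightarrow> 'z \<Rightarrow> real)) set" where
  "completion_rel V B = {(u, v). u \<in> cauchy_seqs V B \<and> v \<in> cauchy_seqs V B
     \<and> (\<lambda>n. B (\<lambda>z. u n z - v n z) (\<lambda>z. u n z - v n z)) \<longlonglongrightarrow> 0}"

definition hilbert_completion ::
  "('z \<Rightarrow> real) set \<Rightarrow> (('z \<Rightarrow> real) \<Rightarrow> ('z \<Rightarrow> real) \<Rightarrow> real)
     \<Rightarrow> (nat \<Rightarrow> 'z \<Rightarrow> real) set hspace" where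
  "hilbert_completion V B = \<lparr>
     hcarrier = cauchy_seqs V B // completion_rel V B,
     hadd = (\<lambda>P Q. \<Union>u\<in>P. \<Union>v\<in>Q. completion_rel V B `` {\<lambda>n z. u n z + v n z}),
     hscale = (\<lambda>c P. \<Union>u\<in>P. completion_rel V B `` {\<lambda>n z. c * u n z}),
     hinner = (\<lambda>P Q. THE r. \<forall>u\<in>P. \<forall>v\<in>Q. (\<lambda>n. B (u n) (v n)) \<longlonglongrightarrow> r)\<rparr>"

text \<open>The canonical map from \<open>V\<close> into the completion of \<open>V / ker B\<close>.\<close>

definition completion_class ::
  "('z \<Rightarrow> real) set \<Rightarrow> (('z \<Rightarrow> real) \<Rightarrow> ('z \<Rightarrow> real) \<Rightarrow> real) \<Rightarrow> ('z \<Rightarrow> real)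
     \<Rightarrow> (nat \<Rightarrow> 'z \<Rightarrow> real) set" where
  "completion_class V B v = completion_rel V B `` {\<lambda>_. v}"

section \<open>Tensor products of function spaces\<close>

text \<open>For spaces \<open>S\<close>, \<open>T\<close> of real functions on sets, the linear map sending \<open>a \<otimes> b\<close> to
  the function \<open>(x, y) \<mapsto> a x * b y\<close> is injective on the algebraic tensor product, which
  is therefore realized as the span of these functions. Scalars can be moved into
  the first factor, so every element is a finite sum of elementary tensors.\<close>

definition tensor :: "('x \<Rightarrow> real) \<Rightarrow> ('y \<Rightarrow> real) \<Rightarrow> 'x \<times> 'y \<Rightarrow> real" where
  "tensor a b = (\<lambda>(x, y). a x * b y)"

definition tensor_sum :: "(('x \<Rightarrow> real) \<times> ('y \<Rightarrow> real)) list \<Rightarrow> 'x \<times> 'y \<Rightarrow> real" where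
  "tensor_sum ps = (\<lambda>z. \<Sum>(a, b)\<leftarrow>ps. tensor a b z)"

definition tensor_space ::
  "('x \<Rightarrow> real) set \<Rightarrow> ('y \<Rightarrow> real) set \<Rightarrow> ('x \<times> 'y \<Rightarrow> real) set" where
  "tensor_space S T = {tensor_sum ps | ps. set ps \<subseteq> S \<times> T}"

text \<open>The bilinear form on \<open>tensor_space S T\<close> determined by the values \<open>q a b c d\<close> on
  pairs of elementary tensors \<open>a \<otimes> b\<close>, \<open>c \<otimes> d\<close>, for \<open>q\<close> linear in each argument.\<close>

definition tensor_form ::
  "('x \<Rightarrow> real) set \<Rightarrow> ('y \<Rightarrow> real) set
     \<Rightarrow> (('x \<Rightarrow> real) \<Rightarrow> ('y \<Rightarrow> real) \<Rightarrow> ('x \<Rightarrow> real) \<Rightarrow> ('y \<Rightarrow> real) \<Rightarrow> real)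
     \<Rightarrow> ('x \<times> 'y \<Rightarrow> real) \<Rightarrow> ('x \<times> 'y \<Rightarrow> real) \<Rightarrow> real" where
  "tensor_form S T q s t = (THE r. \<exists>ps qs. set ps \<subseteq> S \<times> T \<and> set qs \<subseteq> S \<times> T
     \<and> s = tensor_sum ps \<and> t = tensor_sum qs
     \<and> r = (\<Sum>(a, b)\<leftarrow>ps. \<Sum>(c, d)\<leftarrow>qs. q a b c d))"

section \<open>The space of differential 1-forms\<close>

definition one_forms ::
  "('a::topological_space \<Rightarrow> real) set \<Rightarrow> (('a \<Rightarrow> real) \<Rightarrow> ('a \<Rightarrow> real) \<Rightarrow> 'a set \<Rightarrow> real)
     \<Rightarrow> (nat \<Rightarrow> 'a \<times> 'a \<Rightarrow> real) set hspace" where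
  "one_forms F \<Gamma> = hilbert_completion (tensor_space (core F) bounded_borel)
     (tensor_form (core F) bounded_borel (\<lambda>a b c d. signed_integral (\<Gamma> a c) (\<lambda>x. b x * d x)))"

section \<open>Fibers and direct integrals\<close>

definition energy_dense_sequence ::
  "('a::topological_space \<Rightarrow> real) set \<Rightarrow> (('a \<Rightarrow> real) \<Rightarrow> ('a \<Rightarrow> real) \<Rightarrow> real)
     \<Rightarrow> (nat \<Rightarrow> 'a \<Rightarrow> real) \<Rightarrow> bool" where
  "energy_dense_sequence F E f \<longleftrightarrow> range f \<subseteq> core F
     \<and> (\<forall>g\<in>core F. \<exists>k :: nat \<Rightarrow> nat.
           (\<lambda>j. E (\<lambda>x. g x - f (k j) x) (\<lambda>x. g x - f (k j) x)) \<longlonglongrightarrow> 0)"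

text \<open>A choice \<open>\<gamma> x\<close> of versions of the densities of the energy measures with respect to \<open>m\<close>,
  bilinear on the span of the sequence \<open>f\<close> for every \<open>x\<close>.\<close>

definition energy_density_versions ::
  "'a::topological_space measure \<Rightarrow> (('a \<Rightarrow> real) \<Rightarrow> ('a \<Rightarrow> real) \<Rightarrow> 'a set \<Rightarrow> real)
     \<Rightarrow> (nat \<Rightarrow> 'a \<Rightarrow> real) \<Rightarrow> ('a \<Rightarrow> ('a \<Rightarrow> real) \<Rightarrow> ('a \<Rightarrow> real) \<Rightarrow> real) \<Rightarrow> bool" where
  "energy_density_versions m \<Gamma> f \<gamma> \<longleftrightarrow>
     (\<forall>i j. (\<lambda>x. \<gamma> x (f i) (f j)) \<in> borel_measurable borel
        \<and> integrable m (\<lambda>x. \<gamma> x (f i) (f j))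
        \<and> (\<forall>A\<in>sets borel. \<Gamma> (f i) (f j) A = (LINT x:A|m. \<gamma> x (f i) (f j))))
     \<and> (\<forall>N x. (\<forall>i\<le>N. \<forall>j\<le>N. \<gamma> x (f i) (f j) = \<gamma> x (f j) (f i))
        \<and> (\<forall>c :: nat \<Rightarrow> real. 0 \<le> (\<Sum>i\<le>N. \<Sum>j\<le>N. c i * c j * \<gamma> x (f i) (f j))))
     \<and> (\<forall>x. bilinear_form_on (fun_span (range f)) (\<gamma> x))"

definition fiber_form ::
  "('a::topological_space \<Rightarrow> real) set \<Rightarrow> ('a \<Rightarrow> ('a \<Rightarrow> real) \<Rightarrow> ('a \<Rightarrow> real) \<Rightarrow> real) \<Rightarrow> 'a
     \<Rightarrow> ('a \<times> 'a \<Rightarrow> real) \<Rightarrow> ('a \<times> 'a \<Rightarrow> real) \<Rightarrow> real" where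
  "fiber_form A \<gamma> x = tensor_form A bounded_borel (\<lambda>a b c d. b x * d x * \<gamma> x a c)"

definition fiber ::
  "('a::topological_space \<Rightarrow> real) set \<Rightarrow> ('a \<Rightarrow> ('a \<Rightarrow> real) \<Rightarrow> ('a \<Rightarrow> real) \<Rightarrow> real) \<Rightarrow> 'a
     \<Rightarrow> (nat \<Rightarrow> 'a \<times> 'a \<Rightarrow> real) set hspace" where
  "fiber A \<gamma> x = hilbert_completion (tensor_space A bounded_borel) (fiber_form A \<gamma> x)"

definition fiber_class ::
  "('a::topological_space \<Rightarrow> real) set \<Rightarrow> ('a \<Rightarrow> ('a \<Rightarrow> real) \<Rightarrow> ('a \<Rightarrow> real) \<Rightarrow> real) \<Rightarrow> 'a
     \<Rightarrow> ('a \<times> 'a \<Rightarrow> real) \<Rightarrow> (nat \<Rightarrow> 'a \<times> 'a \<Rightarrow> real) set" where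
  "fiber_class A \<gamma> x v = completion_class (tensor_space A bounded_borel) (fiber_form A \<gamma> x) v"

text \<open>Below, \<open>Hx\<close> is a field of Hilbert spaces and \<open>e\<close> a fundamental sequence of sections that
  defines its measurable structure.\<close>

definition measurable_sections ::
  "'x measure \<Rightarrow> ('x \<Rightarrow> 'h hspace) \<Rightarrow> (nat \<Rightarrow> 'x \<Rightarrow> 'h) \<Rightarrow> ('x \<Rightarrow> 'h) set" where
  "measurable_sections m Hx e = {\<xi>. (\<forall>x. \<xi> x \<in> hcarrier (Hx x))
     \<and> (\<forall>n. (\<lambda>x. hinner (Hx x) (\<xi> x) (e n x)) \<in> borel_measurable m)}"

definition L2_sections ::
  "'x measure \<Rightarrow> ('x \<Rightarrow> 'h hspace) \<Rightarrow> (nat \<Rightarrow> 'x \<Rightarrow> 'h) \<Rightarrow> ('x \<Rightarrow> 'h) set" where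
  "L2_sections m Hx e = {\<xi> \<in> measurable_sections m Hx e.
     (\<integral>\<^sup>+x. ennreal (hinner (Hx x) (\<xi> x) (\<xi> x)) \<partial>m) < \<infinity>}"

definition ae_rel ::
  "'x measure \<Rightarrow> ('x \<Rightarrow> 'h hspace) \<Rightarrow> (nat \<Rightarrow> 'x \<Rightarrow> 'h) \<Rightarrow> (('x \<Rightarrow> 'h) \<times> ('x \<Rightarrow> 'h)) set" where
  "ae_rel m Hx e = {(\<xi>, \<zeta>). \<xi> \<in> L2_sections m Hx e \<and> \<zeta> \<in> L2_sections m Hx e
     \<and> (AE x in m. \<xi> x = \<zeta> x)}"

definition direct_integral ::
  "'x measure \<Rightarrow> ('x \<Rightarrow> 'h hspace) \<Rightarrow> (nat \<Rightarrow> 'x \<Rightarrow> 'h) \<Rightarrow> ('x \<Rightarrow> 'h) set hspace" where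
  "direct_integral m Hx e = \<lparr>
     hcarrier = L2_sections m Hx e // ae_rel m Hx e,
     hadd = (\<lambda>P Q. \<Union>\<xi>\<in>P. \<Union>\<zeta>\<in>Q. ae_rel m Hx e `` {\<lambda>x. hadd (Hx x) (\<xi> x) (\<zeta> x)}),
     hscale = (\<lambda>c P. \<Union>\<xi>\<in>P. ae_rel m Hx e `` {\<lambda>x. hscale (Hx x) c (\<xi> x)}),
     hinner = (\<lambda>P Q. THE r. \<forall>\<xi>\<in>P. \<forall>\<zeta>\<in>Q. r = (\<integral>x. hinner (Hx x) (\<xi> x) (\<zeta> x) \<partial>m))\<rparr>"

definition fiber_direct_integral ::
  "'a::topological_space measure \<Rightarrow> (nat \<Rightarrow> 'a \<Rightarrow> real)
     \<Rightarrow> ('a \<Rightarrow> ('a \<Rightarrow> real) \<Rightarrow> ('a \<Rightarrow> real) \<Rightarrow> real)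
     \<Rightarrow> ('a \<Rightarrow> (nat \<Rightarrow> 'a \<times> 'a \<Rightarrow> real) set) set hspace" where
  "fiber_direct_integral m f \<gamma> = direct_integral m (fiber (fun_span (range f)) \<gamma>)
     (\<lambda>n x. fiber_class (fun_span (range f)) \<gamma> x (tensor (f n) (\<lambda>_. 1)))"

end

theory Submission
  imports Defs
begin

text \<open>Both spaces are Hilbert spaces, and the elements \<open>f\<^sub>n \<otimes> b\<close> with \<open>b\<close> bounded Borel have in
  both of them the Gram matrix \<open>\<integral> b d \<Gamma>(f\<^sub>n, f\<^sub>k) dm\<close>. The isometry therefore exists as soon as
  these elements are total on both sides. In the direct integral, a section orthogonal to all of
  them is orthogonal to every \<open>f\<^sub>n\<close> in almost every fiber. In \<open>\<H>\<close>, totality follows from the density of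
  \<open>(f\<^sub>n)\<close> and the bound \<open>\<Gamma>(g)(X) \<le> \<E>(g)\<close>, which is read off from the resolvent of the
  Dirichlet form.\<close>

section \<open>Semi-inner product spaces with explicit carriers\<close>

text \<open>Sending \<open>tensor a b\<close> to its field of fiber classes makes sense only for
  \<open>a\<close> in the span of \<open>f\<close>, because \<open>\<gamma> x\<close> is a form on
  that span; a general core function has no class over a point. Hence the isometry comes from Gram
  matrices of the \<open>f n\<close> and not from a formula on all tensors. The same gap affects
  \<open>\<H>\<close> itself: nonnegativity of its form on the core is not part of the data. It
  holds for the \<open>f n\<close> by pointwise positivity of \<open>\<gamma>\<close> and must be
  carried over by continuity. As density refers to the energy seminorm alone, the estimates here and
  for totality must involve \<open>E g g\<close> without the \<open>L2\<close> norm. The mass bound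
  for \<open>\<Gamma> g g\<close> would be the defining identity at the constant 1, but 1 need not
  lie in the domain, and for a cutoff \<open>\<phi>\<close> the term \<open>E (g g) \<phi>\<close>
  has no obvious sign. Moreover every term of the identity contains a product, so bounded functions
  of the domain have to be shown to form an algebra; this, too, comes from the Markov property
  through the resolvent.\<close>

lemma discriminant_le:
  fixes a b c :: real
  assumes "\<And>t. 0 \<le> a + 2 * t * b + t\<^sup>2 * c"
  shows "b\<^sup>2 \<le> a * c"
proof (cases "c = 0")
  case True
  show ?thesis
  proof (cases "b = 0")
    case False
    \<comment> \<open>The affine function takes the value -1 at this \<open>t\<close>.\<close>
    have "0 \<le> a + 2 * (-(a + 1) / (2 * b)) * b" using assms[of "-(a + 1) / (2 * b)"] True by simp
    then show ?thesis using False by (simp add: field_simps)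
  qed (use True in simp)
next
  case False
  have c: "c > 0"
  proof (rule ccontr)
    assume "\<not> c > 0"
    then have c0: "c < 0" using False by simp
    \<comment> \<open>Chosen so that \<open>t \<ge> 1\<close> and
      \<open>t * (- c) \<ge> \<bar>a\<bar> + 2 * \<bar>b\<bar> + 1\<close>; then the negative
      quadratic term outweighs the other two together.\<close>
    define t where "t = (\<bar>a\<bar> + 2 * \<bar>b\<bar> + 1) / (- c) + 1"
    have t1: "t \<ge> 1" using c0 unfolding t_def by (simp add: divide_le_0_iff)
    have "t * (- c) \<ge> \<bar>a\<bar> + 2 * \<bar>b\<bar> + 1" using c0 unfolding t_def by (simp add: field_simps)
    then have "t * (t * (- c)) \<ge> t * (\<bar>a\<bar> + 2 * \<bar>b\<bar> + 1)" using t1 by (intro mult_left_mono) auto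
    moreover have "t * (\<bar>a\<bar> + 1) \<ge> 1 * (\<bar>a\<bar> + 1)" using t1 by (intro mult_right_mono) auto
    moreover have "t * (2 * \<bar>b\<bar>) \<ge> 2 * t * b" using t1 by (simp add: mult_left_mono)
    ultimately show False using assms[of t] by (simp add: algebra_simps power2_eq_square)
  qed
  \<comment> \<open>\<open>- b / c\<close> is the minimizer of the quadratic.\<close>
  have "0 \<le> a + 2 * (- b / c) * b + (- b / c)\<^sup>2 * c" by (rule assms)
  also have "\<dots> = a - b\<^sup>2 / c" using c by (simp add: power2_eq_square field_simps)
  finally show ?thesis using c by (simp add: field_simps)
qed

text \<open>Carriers come with addition and scaling only, so the squared distance is expanded in
  inner products instead of being the norm of a difference; \<open>hdist2_eq\<close> recovers the
  latter with the scalar -1.\<close>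

definition hdist2 :: "'h hspace \<Rightarrow> 'h \<Rightarrow> 'h \<Rightarrow> real" where
  "hdist2 H u v = hinner H u u - 2 * hinner H u v + hinner H v v"

definition hcauchy :: "'h hspace \<Rightarrow> (nat \<Rightarrow> 'h) \<Rightarrow> bool" where
  "hcauchy H u \<longleftrightarrow> (\<forall>e>0. \<exists>N. \<forall>i\<ge>N. \<forall>j\<ge>N. hdist2 H (u i) (u j) < e)"

locale semi_inner_space =
  fixes H :: "'h hspace"
  assumes nonempty: "hcarrier H \<noteq> {}"
    and add_closed [simp, intro]: "\<lbrakk>u \<in> hcarrier H; v \<in> hcarrier H\<rbrakk> \<Longrightarrow> hadd H u v \<in> hcarrier H"
    and scale_closed [simp, intro]: "u \<in> hcarrier H \<Longrightarrow> hscale H c u \<in> hcarrier H"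
    and inner_commute: "\<lbrakk>u \<in> hcarrier H; v \<in> hcarrier H\<rbrakk> \<Longrightarrow> hinner H u v = hinner H v u"
    and inner_add_left [simp]: "\<lbrakk>u \<in> hcarrier H; v \<in> hcarrier H; w \<in> hcarrier H\<rbrakk>
          \<Longrightarrow> hinner H (hadd H u v) w = hinner H u w + hinner H v w"
    and inner_scale_left [simp]: "\<lbrakk>u \<in> hcarrier H; w \<in> hcarrier H\<rbrakk>
          \<Longrightarrow> hinner H (hscale H c u) w = c * hinner H u w"
    and inner_nonneg [simp]: "u \<in> hcarrier H \<Longrightarrow> 0 \<le> hinner H u u"
begin

lemma inner_add_right [simp]: "\<lbrakk>u \<in> hcarrier H; v \<in> hcarrier H; w \<in> hcarrier H\<rbrakk>
    \<Longrightarrow> hinner H w (hadd H u v) = hinner H w u + hinner H w v"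
  by (metis add_closed inner_add_left inner_commute)

lemma inner_scale_right [simp]: "\<lbrakk>u \<in> hcarrier H; w \<in> hcarrier H\<rbrakk>
    \<Longrightarrow> hinner H w (hscale H c u) = c * hinner H w u"
  by (metis scale_closed inner_scale_left inner_commute)

lemma cauchy_schwarz:
  assumes "u \<in> hcarrier H" "v \<in> hcarrier H"
  shows "(hinner H u v)\<^sup>2 \<le> hinner H u u * hinner H v v"
proof (rule discriminant_le)
  fix t
  have "0 \<le> hinner H (hadd H u (hscale H t v)) (hadd H u (hscale H t v))"
    using assms by (intro inner_nonneg add_closed scale_closed)
  then show "0 \<le> hinner H u u + 2 * t * hinner H u v + t\<^sup>2 * hinner H v v"
    using assms by (simp add: inner_commute[of v u] algebra_simps power2_eq_square)
qed

lemma hdist2_eq: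
  assumes "u \<in> hcarrier H" "v \<in> hcarrier H"
  shows "hdist2 H u v = hinner H (hadd H u (hscale H (-1) v)) (hadd H u (hscale H (-1) v))"
  using assms by (simp add: hdist2_def inner_commute[of v u])

lemma hdist2_nonneg [simp]: "\<lbrakk>u \<in> hcarrier H; v \<in> hcarrier H\<rbrakk> \<Longrightarrow> 0 \<le> hdist2 H u v"
  unfolding hdist2_eq by (intro inner_nonneg add_closed scale_closed)

lemma hdist2_commute: "\<lbrakk>u \<in> hcarrier H; v \<in> hcarrier H\<rbrakk> \<Longrightarrow> hdist2 H u v = hdist2 H v u"
  by (simp add: hdist2_def inner_commute[of v u])

lemma hdist2_self [simp]: "hdist2 H u u = 0"
  by (simp add: hdist2_def)

lemma hdist2_triangle:
  assumes [simp]: "u \<in> hcarrier H" "v \<in> hcarrier H" "w \<in> hcarrier H"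
  shows "hdist2 H u w \<le> 2 * hdist2 H u v + 2 * hdist2 H v w"
proof -
  \<comment> \<open>Parallelogram identity: for \<open>a = u - v\<close> and
    \<open>b = v - w\<close> the difference of the two sides is the squared norm of
    \<open>a - b\<close>, which is \<open>?x\<close>. The constant 2 is the price for working
    without square roots.\<close>
  let ?x = "hadd H (hadd H u w) (hscale H (-2) v)"
  have "0 \<le> hinner H ?x ?x" by (intro inner_nonneg add_closed scale_closed assms)
  then show ?thesis
    by (simp add: hdist2_def inner_commute[of v u] inner_commute[of w u] inner_commute[of w v])
qed

lemma inner_diff_le:
  assumes [simp]: "u \<in> hcarrier H" "v \<in> hcarrier H" "w \<in> hcarrier H"
  shows "(hinner H u w - hinner H v w)\<^sup>2 \<le> hdist2 H u v * hinner H w w"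
  using cauchy_schwarz[of "hadd H u (hscale H (-1) v)" w] by (simp add: hdist2_eq)

lemma tendsto_inner_left:
  assumes "range s \<subseteq> hcarrier H" "w \<in> hcarrier H" "v \<in> hcarrier H"
    and "(\<lambda>n. hdist2 H (s n) w) \<longlonglongrightarrow> 0"
  shows "(\<lambda>n. hinner H (s n) v) \<longlonglongrightarrow> hinner H w v"
proof -
  have s: "s n \<in> hcarrier H" for n using assms by auto
  have "(\<lambda>n. (hinner H (s n) v - hinner H w v)\<^sup>2) \<longlonglongrightarrow> 0"
  proof (rule tendsto_sandwich[OF _ _ tendsto_const])
    show "(\<lambda>n. hdist2 H (s n) w * hinner H v v) \<longlonglongrightarrow> 0"
      using tendsto_mult_right[OF assms(4), of "hinner H v v"] by simp
  qed (use inner_diff_le s assms in \<open>auto intro!: always_eventually\<close>)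
  then have "(\<lambda>n. hinner H (s n) v - hinner H w v) \<longlonglongrightarrow> 0"
    using tendsto_real_sqrt by (fastforce simp: tendsto_rabs_zero_iff)
  then show ?thesis by (simp add: LIM_zero_iff)
qed

lemma tendsto_norm2:
  assumes "range s \<subseteq> hcarrier H" "w \<in> hcarrier H" "(\<lambda>n. hdist2 H (s n) w) \<longlonglongrightarrow> 0"
  shows "(\<lambda>n. hinner H (s n) (s n)) \<longlonglongrightarrow> hinner H w w"
proof -
  have "(\<lambda>n. hdist2 H (s n) w + 2 * hinner H (s n) w - hinner H w w)
      \<longlonglongrightarrow> 0 + 2 * hinner H w w - hinner H w w"
    by (intro tendsto_intros assms tendsto_inner_left)
  then show ?thesis by (simp add: hdist2_def)
qed

lemma hcauchy_if_convergent:
  assumes "range s \<subseteq> hcarrier H" "w \<in> hcarrier H" "(\<lambda>n. hdist2 H (s n) w) \<longlonglongrightarrow> 0"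
  shows "hcauchy H s"
  unfolding hcauchy_def
proof (intro allI impI)
  fix e :: real assume "e > 0"
  then have "eventually (\<lambda>n. hdist2 H (s n) w < e / 4) sequentially"
    using assms(3) by (intro order_tendstoD) auto
  then obtain N where N: "\<And>n. n \<ge> N \<Longrightarrow> hdist2 H (s n) w < e / 4"
    by (auto simp: eventually_sequentially)
  have s: "s n \<in> hcarrier H" for n using assms by auto
  have "hdist2 H (s i) (s j) < e" if "i \<ge> N" "j \<ge> N" for i j
    using hdist2_triangle[OF s assms(2) s, of i j] N[OF that(1)] N[OF that(2)]
      hdist2_commute[OF s assms(2), of j] by simp
  then show "\<exists>N. \<forall>i\<ge>N. \<forall>j\<ge>N. hdist2 H (s i) (s j) < e" by blast
qed

lemma tendsto_hdist2_unique:
  assumes "range s \<subseteq> hcarrier H" "v \<in> hcarrier H" "w \<in> hcarrier H"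
    and "(\<lambda>n. hdist2 H (s n) v) \<longlonglongrightarrow> 0" "(\<lambda>n. hdist2 H (s n) w) \<longlonglongrightarrow> 0"
  shows "hdist2 H v w = 0"
proof -
  have s: "s n \<in> hcarrier H" for n using assms by auto
  have "(\<lambda>n. 2 * hdist2 H (s n) v + 2 * hdist2 H (s n) w) \<longlonglongrightarrow> 2 * 0 + 2 * 0"
    by (intro tendsto_intros assms)
  moreover have "hdist2 H v w \<le> 2 * hdist2 H (s n) v + 2 * hdist2 H (s n) w" for n
    using hdist2_triangle[of v "s n" w] hdist2_commute[of v "s n"] s assms by simp
  ultimately have "hdist2 H v w \<le> 0"
    by (intro tendsto_lowerbound[of "\<lambda>n. 2 * hdist2 H (s n) v + 2 * hdist2 H (s n) w" 0 sequentially])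
      auto
  moreover have "0 \<le> hdist2 H v w" using assms by simp
  ultimately show ?thesis by simp
qed

end

section \<open>Riesz representation and separation\<close>

locale complete_semi_inner_space = semi_inner_space +
  assumes complete: "\<lbrakk>range u \<subseteq> hcarrier H; hcauchy H u\<rbrakk>
    \<Longrightarrow> \<exists>l\<in>hcarrier H. (\<lambda>n. hdist2 H (u n) l) \<longlonglongrightarrow> 0"
begin

text \<open>The functional \<open>J\<close> is minimized over \<open>S\<close>. As \<open>S\<close>
  need not be closed, the representing vector \<open>w\<close> may lie outside; the approximating
  sequence is therefore part of the conclusion, and density of spans is drawn from it. A second use,
  with a whole form domain as \<open>S\<close>, yields the resolvent.\<close>

lemma riesz_subspace:
  assumes S: "S \<subseteq> hcarrier H" "S \<noteq> {}"
    and S_add: "\<And>u v. u \<in> S \<Longrightarrow> v \<in> S \<Longrightarrow> hadd H u v \<in> S"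
    and S_scale: "\<And>c u. u \<in> S \<Longrightarrow> hscale H c u \<in> S"
    and l_add: "\<And>u v. u \<in> S \<Longrightarrow> v \<in> S \<Longrightarrow> l (hadd H u v) = l u + l v"
    and l_scale: "\<And>c u. u \<in> S \<Longrightarrow> l (hscale H c u) = c * l u"
    and l_bound: "\<And>u. u \<in> S \<Longrightarrow> (l u)\<^sup>2 \<le> M * hinner H u u" and M: "M \<ge> 0"
  obtains s w where "range s \<subseteq> S" "w \<in> hcarrier H" "(\<lambda>n. hdist2 H (s n) w) \<longlonglongrightarrow> 0"
    "\<And>v. v \<in> S \<Longrightarrow> hinner H w v = l v"
proof -
  define J where "J v = hinner H v v - 2 * l v" for v
  have J_ge: "- M \<le> J v" if "v \<in> S" for v
  proof -
    have "0 \<le> hinner H v v" using that S by auto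
    \<comment> \<open>Arithmetic-geometric mean: \<open>4 * M * y \<le> (y + M)\<^sup>2\<close> with
      \<open>y = hinner H v v\<close>.\<close>
    have "(2 * l v)\<^sup>2 \<le> 4 * (M * hinner H v v)" using l_bound[OF that] by simp
    also have "\<dots> \<le> (hinner H v v + M)\<^sup>2"
      using zero_le_power2[of "hinner H v v - M"] by (simp add: algebra_simps power2_eq_square)
    finally have "2 * l v \<le> hinner H v v + M"
      by (rule power2_le_imp_le) (use \<open>0 \<le> hinner H v v\<close> M in auto)
    then show ?thesis unfolding J_def by simp
  qed
  define I where "I = Inf (J ` S)"
  have bdd: "bdd_below (J ` S)" using J_ge by (intro bdd_belowI[of _ "- M"]) auto
  have I_le: "I \<le> J v" if "v \<in> S" for v
    unfolding I_def using bdd that by (intro cInf_lower) auto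
  have "\<exists>v\<in>S. J v < I + 1 / real (Suc n)" for n
  proof -
    have "Inf (J ` S) < I + 1 / real (Suc n)" unfolding I_def by simp
    then show ?thesis using S bdd by (subst (asm) cInf_less_iff) auto
  qed
  then obtain s where s: "\<And>n. s n \<in> S" "\<And>n. J (s n) < I + 1 / real (Suc n)" by metis
  have sc: "s n \<in> hcarrier H" for n using s S by auto
  \<comment> \<open>The midpoint of \<open>u\<close> and \<open>v\<close> lies in \<open>S\<close>,
    so its value is at least \<open>I\<close>; by the parallelogram law this value is the average of
    \<open>J u\<close> and \<open>J v\<close> minus a quarter of the squared distance.
    Near-minimizers are therefore close to each other.\<close>
  have mid: "hdist2 H u v \<le> 2 * (J u - I) + 2 * (J v - I)" if "u \<in> S" "v \<in> S" for u v
  proof -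
    have uv[simp]: "u \<in> hcarrier H" "v \<in> hcarrier H" using that S by auto
    have "hscale H (1/2) (hadd H u v) \<in> S" using that S_add S_scale by auto
    moreover have "J (hscale H (1/2) (hadd H u v)) = J u / 2 + J v / 2 - hdist2 H u v / 4"
      unfolding J_def using that
      by (simp add: l_scale l_add S_add hdist2_def inner_commute[of v u] field_simps)
    ultimately show ?thesis using I_le by fastforce
  qed
  have "hcauchy H s" unfolding hcauchy_def
  proof (intro allI impI)
    fix e :: real assume "e > 0"
    then obtain N where N: "1 / real (Suc N) < e / 4"
      using reals_Archimedean[of "e/4"] by (auto simp: inverse_eq_divide)
    have small: "J (s i) - I < e / 4" if "i \<ge> N" for i
    proof -
      have "1 / real (Suc i) \<le> 1 / real (Suc N)" using that by (simp add: frac_le)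
      then show ?thesis using s(2)[of i] N by linarith
    qed
    have "hdist2 H (s i) (s j) < e" if "i \<ge> N" "j \<ge> N" for i j
      using mid[OF s(1) s(1), of i j] small[OF that(1)] small[OF that(2)] by argo
    then show "\<exists>N. \<forall>i\<ge>N. \<forall>j\<ge>N. hdist2 H (s i) (s j) < e" by blast
  qed
  then obtain w where w: "w \<in> hcarrier H" "(\<lambda>n. hdist2 H (s n) w) \<longlonglongrightarrow> 0"
    using complete[of s] sc by auto
  have "hinner H w v = l v" if v: "v \<in> S" for v
  proof -
    have [simp]: "v \<in> hcarrier H" using v S by auto
    \<comment> \<open>First-order condition in the limit: \<open>J\<close> at
      \<open>s n + t v\<close> is at least \<open>I\<close>, while \<open>J (s n)\<close> exceeds
      \<open>I\<close> by less than \<open>1 / Suc n\<close>. A quadratic in \<open>t\<close>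
      without constant term is nonnegative everywhere only if its linear coefficient
      vanishes.\<close>
    have "(hinner H w v - l v)\<^sup>2 \<le> 0 * hinner H v v"
    proof (rule discriminant_le)
      fix t
      have "(\<lambda>n. 1 / real (Suc n) + 2 * t * (hinner H (s n) v - l v) + t\<^sup>2 * hinner H v v)
          \<longlonglongrightarrow> 0 + 2 * t * (hinner H w v - l v) + t\<^sup>2 * hinner H v v"
        using LIMSEQ_inverse_real_of_nat
        by (intro tendsto_intros tendsto_inner_left w) (use sc in \<open>auto simp: inverse_eq_divide\<close>)
      moreover have "0 \<le> 1 / real (Suc n) + 2 * t * (hinner H (s n) v - l v) + t\<^sup>2 * hinner H v v" for n
      proof -
        have "I \<le> J (hadd H (s n) (hscale H t v))" using s v by (intro I_le S_add S_scale)
        also have "\<dots> = J (s n) + 2 * t * (hinner H (s n) v - l v) + t\<^sup>2 * hinner H v v"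
          unfolding J_def using s v sc
          by (simp add: l_add l_scale S_scale inner_commute[of v "s n"] algebra_simps power2_eq_square)
        finally show ?thesis using s(2)[of n] by linarith
      qed
      ultimately show "0 \<le> 0 + 2 * t * (hinner H w v - l v) + t\<^sup>2 * hinner H v v"
        by (intro tendsto_lowerbound) auto
    qed
    then show ?thesis by simp
  qed
  then show ?thesis using that s w by blast
qed

end

locale hilbert_space = complete_semi_inner_space +
  assumes separated: "\<lbrakk>u \<in> hcarrier H; v \<in> hcarrier H; hdist2 H u v = 0\<rbrakk> \<Longrightarrow> u = v"
begin

lemma eqI_total:
  assumes T: "T \<subseteq> hcarrier H"
    and total: "\<And>h. h \<in> hcarrier H \<Longrightarrow> (\<And>t. t \<in> T \<Longrightarrow> hinner H h t = 0) \<Longrightarrow> hinner H h h = 0"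
    and uv: "u \<in> hcarrier H" "v \<in> hcarrier H"
    and eq: "\<And>t. t \<in> T \<Longrightarrow> hinner H u t = hinner H v t"
  shows "u = v"
proof (rule separated[OF uv])
  have "hinner H (hadd H u (hscale H (-1) v)) (hadd H u (hscale H (-1) v)) = 0"
    using T uv eq by (intro total) (auto simp: subset_eq)
  then show "hdist2 H u v = 0" using uv by (simp add: hdist2_eq)
qed

end

section \<open>Isometries from equal Gram matrices of total families\<close>

text \<open>A carrier has no named zero, so the empty combination is 0 times an arbitrary element;
  all its inner products vanish, which is what counts.\<close>

definition lincomb :: "'h hspace \<Rightarrow> ('i \<Rightarrow> 'h) \<Rightarrow> (real \<times> 'i) list \<Rightarrow> 'h" where
  "lincomb H j ps = foldr (\<lambda>(c, i). hadd H (hscale H c (j i))) ps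
     (hscale H 0 (SOME h. h \<in> hcarrier H))"

context semi_inner_space
begin

lemma lincomb_closed:
  assumes "set ps \<subseteq> UNIV \<times> I" "j ` I \<subseteq> hcarrier H"
  shows "lincomb H j ps \<in> hcarrier H"
  using assms(1)
proof (induction ps)
  case Nil
  show ?case using nonempty by (simp add: lincomb_def some_in_eq)
next
  case (Cons p ps)
  then show ?case using assms(2) by (auto simp: lincomb_def)
qed

lemma inner_lincomb:
  assumes "set ps \<subseteq> UNIV \<times> I" "j ` I \<subseteq> hcarrier H" "v \<in> hcarrier H"
  shows "hinner H (lincomb H j ps) v = (\<Sum>(c, i)\<leftarrow>ps. c * hinner H (j i) v)"
  using assms(1)
proof (induction ps)
  case Nil
  have "(SOME h. h \<in> hcarrier H) \<in> hcarrier H" using nonempty by (simp add: some_in_eq)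
  then show ?case using assms(3) by (simp add: lincomb_def)
next
  case (Cons p ps)
  obtain c i where p: "p = (c, i)" by force
  have "lincomb H j ps \<in> hcarrier H" using Cons.prems by (intro lincomb_closed[OF _ assms(2)]) auto
  then have "hinner H (lincomb H j (p # ps)) v = c * hinner H (j i) v + hinner H (lincomb H j ps) v"
    using Cons.prems assms p by (auto simp: lincomb_def image_subset_iff)
  then show ?case using Cons p by simp
qed

end

lemma inner_lincomb_eq:
  assumes "semi_inner_space H" "semi_inner_space K"
    and "j ` I \<subseteq> hcarrier H" "T ` I \<subseteq> hcarrier K"
    and "\<And>i k. i \<in> I \<Longrightarrow> k \<in> I \<Longrightarrow> hinner H (j i) (j k) = hinner K (T i) (T k)"
    and "set ps \<subseteq> UNIV \<times> I" "set qs \<subseteq> UNIV \<times> I"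
  shows "hinner H (lincomb H j ps) (lincomb H j qs) = hinner K (lincomb K T ps) (lincomb K T qs)"
proof -
  interpret H: semi_inner_space H by fact
  interpret K: semi_inner_space K by fact
  have 1: "hinner H (j i) (lincomb H j qs) = hinner K (T i) (lincomb K T qs)" if i: "i \<in> I" for i
  proof -
    have ji: "j i \<in> hcarrier H" "T i \<in> hcarrier K" using assms(3,4) i by auto
    have "hinner H (lincomb H j qs) (j i) = hinner K (lincomb K T qs) (T i)"
      using ji assms i
      by (simp add: H.inner_lincomb[where I = I] K.inner_lincomb[where I = I])
        (intro arg_cong[where f = sum_list] map_cong, auto)
    then show ?thesis
      using H.inner_commute[OF ji(1) H.lincomb_closed[OF assms(7,3)]]
        K.inner_commute[OF ji(2) K.lincomb_closed[OF assms(7,4)]] by simp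
  qed
  show ?thesis
    using assms 1
    by (simp add: H.inner_lincomb[where I = I] K.inner_lincomb[where I = I]
        H.lincomb_closed[where I = I] K.lincomb_closed[where I = I])
      (intro arg_cong[where f = sum_list] map_cong, auto)
qed

text \<open>\<open>h\<close> is approximated by combinations of its family; the same coefficients on
  the other side form a Cauchy sequence because distances between combinations are determined by the
  Gram matrix. That a total family has dense span comes from \<open>riesz_subspace\<close>: the
  functional of \<open>h\<close> on the span is represented by a limit \<open>w\<close> of the span,
  and totality identifies \<open>w\<close> with \<open>h\<close>.\<close>

lemma gram_partner:
  assumes "hilbert_space H" "hilbert_space K"
    and j: "j ` I \<subseteq> hcarrier H" and T: "T ` I \<subseteq> hcarrier K"
    and gram: "\<And>i k. i \<in> I \<Longrightarrow> k \<in> I \<Longrightarrow> hinner H (j i) (j k) = hinner K (T i) (T k)"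
    and total: "\<And>h. h \<in> hcarrier H \<Longrightarrow> (\<And>i. i \<in> I \<Longrightarrow> hinner H h (j i) = 0) \<Longrightarrow> hinner H h h = 0"
    and h: "h \<in> hcarrier H"
  shows "\<exists>k ps. k \<in> hcarrier K \<and> (\<forall>n. set (ps n) \<subseteq> UNIV \<times> I)
    \<and> (\<lambda>n. hdist2 H (lincomb H j (ps n)) h) \<longlonglongrightarrow> 0
    \<and> (\<lambda>n. hdist2 K (lincomb K T (ps n)) k) \<longlonglongrightarrow> 0"
proof -
  interpret H: hilbert_space H by fact
  interpret K: hilbert_space K by fact
  \<comment> \<open>Taking every element that has the inner products of some combination makes
    \<open>S\<close> closed under \<open>hadd\<close> and \<open>hscale\<close> without computing
    sums of combinations as elements.\<close>
  define S where "S = {u \<in> hcarrier H. \<exists>ps. set ps \<subseteq> UNIV \<times> I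
    \<and> (\<forall>v\<in>hcarrier H. hinner H u v = hinner H (lincomb H j ps) v)}"
  have lin_in: "lincomb H j ps \<in> S" if "set ps \<subseteq> UNIV \<times> I" for ps
    using that H.lincomb_closed[OF that j] by (auto simp: S_def)
  have add: "hadd H u v \<in> S" if uv: "u \<in> S" "v \<in> S" for u v
  proof -
    obtain ps where ps1: "set ps \<subseteq> UNIV \<times> I"
      "\<forall>w\<in>hcarrier H. hinner H u w = hinner H (lincomb H j ps) w"
      using uv(1) unfolding S_def by blast
    obtain qs where qs1: "set qs \<subseteq> UNIV \<times> I"
      "\<forall>w\<in>hcarrier H. hinner H v w = hinner H (lincomb H j qs) w"
      using uv(2) unfolding S_def by blast
    note ps = ps1 qs1
    have "\<forall>w\<in>hcarrier H. hinner H (hadd H u v) w = hinner H (lincomb H j (ps @ qs)) w"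
      using that ps j by (auto simp: S_def H.inner_lincomb[where I = I])
    then show ?thesis using that ps by (auto simp: S_def intro!: exI[of _ "ps @ qs"])
  qed
  have scale: "hscale H c u \<in> S" if u: "u \<in> S" for c u
  proof -
    obtain ps where ps: "set ps \<subseteq> UNIV \<times> I"
      "\<forall>w\<in>hcarrier H. hinner H u w = hinner H (lincomb H j ps) w"
      using u unfolding S_def by blast
    define qs where "qs = map (\<lambda>(d, i). (c * d, i)) ps"
    have qs: "set qs \<subseteq> UNIV \<times> I" using ps(1) by (auto simp: qs_def)
    have "(\<Sum>(d, i)\<leftarrow>qs. d * hinner H (j i) w) = c * (\<Sum>(d, i)\<leftarrow>ps. d * hinner H (j i) w)" for w
      unfolding qs_def by (induction ps) (auto simp: algebra_simps)
    then have "\<forall>w\<in>hcarrier H. hinner H (hscale H c u) w = hinner H (lincomb H j qs) w"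
      using that ps qs j by (auto simp: S_def H.inner_lincomb[where I = I])
    then show ?thesis using that qs by (auto simp: S_def)
  qed
  obtain s w where s: "range s \<subseteq> S" and w: "w \<in> hcarrier H"
    and lim: "(\<lambda>n. hdist2 H (s n) w) \<longlonglongrightarrow> 0" and wv: "\<And>v. v \<in> S \<Longrightarrow> hinner H w v = hinner H h v"
  proof (rule H.riesz_subspace[of S "hinner H h" "hinner H h h"])
    show "S \<noteq> {}" using lin_in[of "[]"] by auto
  qed (use add scale h H.cauchy_schwarz in \<open>auto simp: S_def\<close>)
  have jS: "hinner H w (j i) = hinner H h (j i)" if "i \<in> I" for i
  proof -
    have ji: "j i \<in> hcarrier H" using that j by auto
    have "hinner H v (j i) = hinner H (lincomb H j [(1, i)]) v" if v: "v \<in> hcarrier H" for v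
      using \<open>i \<in> I\<close> v ji j by (subst H.inner_lincomb[where I = I]) (auto simp: H.inner_commute)
    then have "j i \<in> S" using ji \<open>i \<in> I\<close>
      by (auto simp: S_def H.inner_commute intro!: exI[of _ "[(1, i)]"])
    then show ?thesis by (rule wv)
  qed
  have wh: "w = h" using jS total j by (intro H.eqI_total[where T = "j ` I"] w h) auto
  have "\<exists>ps. set ps \<subseteq> UNIV \<times> I \<and> (\<forall>v\<in>hcarrier H. hinner H (s n) v = hinner H (lincomb H j ps) v)" for n
    using s by (auto simp: S_def)
  then obtain ps where ps: "\<And>n. set (ps n) \<subseteq> UNIV \<times> I"
    and psv: "\<And>n v. v \<in> hcarrier H \<Longrightarrow> hinner H (s n) v = hinner H (lincomb H j (ps n)) v" by metis
  have lc: "lincomb H j (ps n) \<in> hcarrier H" for n using H.lincomb_closed[OF ps j] .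
  have sn: "s n \<in> hcarrier H" for n using s by (auto simp: S_def)
  have "hinner H (s n) (s n) = hinner H (lincomb H j (ps n)) (lincomb H j (ps n))" for n
    using psv[of "s n" n] psv[of "lincomb H j (ps n)" n] H.inner_commute[OF sn lc] sn lc by simp
  then have limH: "(\<lambda>n. hdist2 H (lincomb H j (ps n)) h) \<longlonglongrightarrow> 0"
    using lim psv[OF h] wh by (simp add: hdist2_def)
  then have "hcauchy H (\<lambda>n. lincomb H j (ps n))"
    using lc h by (intro H.hcauchy_if_convergent) auto
  moreover have "hdist2 H (lincomb H j (ps n)) (lincomb H j (ps k))
      = hdist2 K (lincomb K T (ps n)) (lincomb K T (ps k))" for n k
    unfolding hdist2_def
    using inner_lincomb_eq[OF H.semi_inner_space_axioms K.semi_inner_space_axioms j T gram ps ps]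
    by simp
  ultimately have "hcauchy K (\<lambda>n. lincomb K T (ps n))" by (simp add: hcauchy_def)
  then obtain k where "k \<in> hcarrier K" "(\<lambda>n. hdist2 K (lincomb K T (ps n)) k) \<longlonglongrightarrow> 0"
    using K.complete[of "\<lambda>n. lincomb K T (ps n)"] K.lincomb_closed[OF ps T] by auto
  then show ?thesis using ps limH by blast
qed

text \<open>The map is introduced as the relation \<open>R\<close> of having the same inner products
  with the two families. Totality makes partners unique on either side, \<open>gram_partner\<close>
  provides them, and \<open>R\<close> respects sums and multiples. Thus no choice of approximating
  combinations enters the definition of \<open>\<Phi>\<close>.\<close>

lemma isometric_isomorphism_if_gram:
  assumes HS: "hilbert_space H" "hilbert_space K"
    and j: "j ` I \<subseteq> hcarrier H" and T: "T ` I \<subseteq> hcarrier K"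
    and gram: "\<And>i k. i \<in> I \<Longrightarrow> k \<in> I \<Longrightarrow> hinner H (j i) (j k) = hinner K (T i) (T k)"
    and totalH: "\<And>h. h \<in> hcarrier H \<Longrightarrow> (\<And>i. i \<in> I \<Longrightarrow> hinner H h (j i) = 0) \<Longrightarrow> hinner H h h = 0"
    and totalK: "\<And>k. k \<in> hcarrier K \<Longrightarrow> (\<And>i. i \<in> I \<Longrightarrow> hinner K k (T i) = 0) \<Longrightarrow> hinner K k k = 0"
  shows "\<exists>\<Phi>. isometric_isomorphism \<Phi> H K"
proof -
  interpret H: hilbert_space H by fact
  interpret K: hilbert_space K by fact
  define R where "R h k \<longleftrightarrow> h \<in> hcarrier H \<and> k \<in> hcarrier K
    \<and> (\<forall>i\<in>I. hinner H h (j i) = hinner K k (T i))" for h k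
  \<comment> \<open>Limits of combinations with equal coefficients behave alike against any pair of
    partners, since both inner products are limits of the same numbers. Applied to the pairs
    \<open>j i\<close>, \<open>T i\<close> this shows that the limits are partners; applied to
    arbitrary partners it gives the isometry.\<close>
  have lim_eq: "hinner H a a' = hinner K b b'"
    if ps: "\<And>n. set (ps n) \<subseteq> UNIV \<times> I" and R': "R a' b'"
      and ab: "a \<in> hcarrier H" "b \<in> hcarrier K"
      and lim: "(\<lambda>n. hdist2 H (lincomb H j (ps n)) a) \<longlonglongrightarrow> 0"
        "(\<lambda>n. hdist2 K (lincomb K T (ps n)) b) \<longlonglongrightarrow> 0" for a b a' b' ps
  proof -
    have a'b': "a' \<in> hcarrier H" "b' \<in> hcarrier K" using R' by (auto simp: R_def)
    have "hinner H (lincomb H j (ps n)) a' = hinner K (lincomb K T (ps n)) b'" for n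
    proof -
      have *: "hinner H (j i) a' = hinner K (T i) b'" if "i \<in> I" for i
      proof -
        have "j i \<in> hcarrier H" "T i \<in> hcarrier K" using that j T by auto
        then show ?thesis
          using R' that a'b' H.inner_commute[of a' "j i"] K.inner_commute[of b' "T i"] by (simp add: R_def)
      qed
      show ?thesis unfolding H.inner_lincomb[OF ps j a'b'(1)] K.inner_lincomb[OF ps T a'b'(2)]
        using ps[of n] * by (intro arg_cong[where f = sum_list] map_cong) auto
    qed
    moreover have "(\<lambda>n. hinner H (lincomb H j (ps n)) a') \<longlonglongrightarrow> hinner H a a'"
      using H.lincomb_closed[OF ps j] a'b' lim ab by (intro H.tendsto_inner_left) auto
    moreover have "(\<lambda>n. hinner K (lincomb K T (ps n)) b') \<longlonglongrightarrow> hinner K b b'"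
      using K.lincomb_closed[OF ps T] a'b' lim ab by (intro K.tendsto_inner_left) auto
    ultimately show ?thesis by (simp add: LIMSEQ_unique)
  qed
  have RT: "R (j i) (T i)" if "i \<in> I" for i using that j T gram by (auto simp: R_def)
  have ex1: "\<exists>k. R h k" if h: "h \<in> hcarrier H" for h
  proof -
    obtain k ps where "k \<in> hcarrier K" "\<And>n. set (ps n) \<subseteq> UNIV \<times> I"
      "(\<lambda>n. hdist2 H (lincomb H j (ps n)) h) \<longlonglongrightarrow> 0"
      "(\<lambda>n. hdist2 K (lincomb K T (ps n)) k) \<longlonglongrightarrow> 0"
      using gram_partner[OF HS j T gram totalH h] by blast
    then show ?thesis using lim_eq[of ps _ _ h k] RT h by (auto simp: R_def)
  qed
  have ex2: "\<exists>h. R h k" if k: "k \<in> hcarrier K" for k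
  proof -
    obtain h ps where "h \<in> hcarrier H" "\<And>n. set (ps n) \<subseteq> UNIV \<times> I"
      "(\<lambda>n. hdist2 H (lincomb H j (ps n)) h) \<longlonglongrightarrow> 0"
      "(\<lambda>n. hdist2 K (lincomb K T (ps n)) k) \<longlonglongrightarrow> 0"
      using gram_partner[OF HS(2,1) T j gram[symmetric] totalK k] by blast
    then show ?thesis using lim_eq[of ps _ _ h k] RT k by (auto simp: R_def)
  qed
  have uniqK: "k = k'" if "R h k" "R h k'" for h k k'
    using that totalK T by (intro K.eqI_total[where T = "T ` I"]) (auto simp: R_def)
  have uniqH: "h = h'" if "R h k" "R h' k" for h h' k
    using that totalH j by (intro H.eqI_total[where T = "j ` I"]) (auto simp: R_def)
  define \<Phi> where "\<Phi> h = (SOME k. R h k)" for h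
  have \<Phi>: "R h (\<Phi> h)" if "h \<in> hcarrier H" for h unfolding \<Phi>_def using ex1[OF that] by (rule someI_ex)
  have \<Phi>c: "\<Phi> h \<in> hcarrier K" if "h \<in> hcarrier H" for h using \<Phi>[OF that] by (simp add: R_def)
  have "bij_betw \<Phi> (hcarrier H) (hcarrier K)"
  proof (rule bij_betwI')
    fix x y assume "x \<in> hcarrier H" "y \<in> hcarrier H"
    then show "(\<Phi> x = \<Phi> y) = (x = y)" using \<Phi>[of x] \<Phi>[of y] uniqH by metis
  next
    fix y assume "y \<in> hcarrier K"
    then obtain h where "R h y" using ex2 by blast
    moreover have "h \<in> hcarrier H" using \<open>R h y\<close> by (simp add: R_def)
    ultimately show "\<exists>x\<in>hcarrier H. y = \<Phi> x" using \<Phi> uniqK by blast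
  qed (rule \<Phi>c)
  moreover have "\<Phi> (hadd H u v) = hadd K (\<Phi> u) (\<Phi> v)" if "u \<in> hcarrier H" "v \<in> hcarrier H" for u v
    using \<Phi>[of u] \<Phi>[of v] that j T
    by (intro uniqK[of "hadd H u v"] \<Phi>) (auto simp: R_def image_subset_iff)
  moreover have "\<Phi> (hscale H c u) = hscale K c (\<Phi> u)" if "u \<in> hcarrier H" for c u
    using \<Phi>[of u] that j T
    by (intro uniqK[of "hscale H c u"] \<Phi>) (auto simp: R_def image_subset_iff)
  moreover have "hinner K (\<Phi> u) (\<Phi> v) = hinner H u v" if uv: "u \<in> hcarrier H" "v \<in> hcarrier H" for u v
  proof -
    obtain k ps where kp: "k \<in> hcarrier K" "\<And>n. set (ps n) \<subseteq> UNIV \<times> I"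
      "(\<lambda>n. hdist2 H (lincomb H j (ps n)) u) \<longlonglongrightarrow> 0"
      "(\<lambda>n. hdist2 K (lincomb K T (ps n)) k) \<longlonglongrightarrow> 0"
      using gram_partner[OF HS j T gram totalH uv(1)] by blast
    then have eq: "hinner H u a' = hinner K k b'" if "R a' b'" for a' b'
      using lim_eq[of ps a' b' u k] kp that \<open>u \<in> hcarrier H\<close> by auto
    have "R u k" using eq[OF RT] kp \<open>u \<in> hcarrier H\<close> by (auto simp: R_def)
    then have "k = \<Phi> u" using \<Phi> uniqK uv by blast
    then show ?thesis using eq[OF \<Phi>[OF uv(2)]] by simp
  qed
  ultimately have "isometric_isomorphism \<Phi> H K" unfolding isometric_isomorphism_def by blast
  then show ?thesis by blast
qed

section \<open>Completions\<close>

context semi_inner_space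
begin

lemma norm_diff_le:
  assumes "u \<in> hcarrier H" "v \<in> hcarrier H"
  shows "(sqrt (hinner H u u) - sqrt (hinner H v v))\<^sup>2 \<le> hdist2 H u v"
proof -
  have "hinner H u v \<le> \<bar>hinner H u v\<bar>" by simp
  also have "\<dots> = sqrt ((hinner H u v)\<^sup>2)" by simp
  also have "\<dots> \<le> sqrt (hinner H u u * hinner H v v)"
    using cauchy_schwarz[OF assms] by (rule real_sqrt_le_mono)
  finally show ?thesis
    using assms by (simp add: hdist2_def power2_diff real_sqrt_mult)
qed

lemma hdist2_add_le:
  assumes [simp]: "u \<in> hcarrier H" "v \<in> hcarrier H" "u' \<in> hcarrier H" "v' \<in> hcarrier H"
  shows "hdist2 H (hadd H u v) (hadd H u' v') \<le> 2 * hdist2 H u u' + 2 * hdist2 H v v'"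
proof -
  let ?x = "hadd H (hadd H u (hscale H (-1) u')) (hscale H (-1) (hadd H v (hscale H (-1) v')))"
  have "0 \<le> hinner H ?x ?x" by (intro inner_nonneg add_closed scale_closed assms)
  then show ?thesis
    by (simp add: hdist2_def inner_commute[of v u] inner_commute[of u' u] inner_commute[of v' u]
        inner_commute[of u' v] inner_commute[of v' v] inner_commute[of v' u'] algebra_simps)
qed

lemma hdist2_scale:
  assumes [simp]: "u \<in> hcarrier H" "v \<in> hcarrier H"
  shows "hdist2 H (hscale H c u) (hscale H c v) = c\<^sup>2 * hdist2 H u v"
  by (simp add: hdist2_def algebra_simps power2_eq_square)

lemma hcauchy_add:
  assumes "range u \<subseteq> hcarrier H" "range v \<subseteq> hcarrier H" "hcauchy H u" "hcauchy H v"
  shows "hcauchy H (\<lambda>n. hadd H (u n) (v n))"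
  unfolding hcauchy_def
proof (intro allI impI)
  fix e :: real assume "e > 0"
  then obtain M N where M: "\<And>i j. i \<ge> M \<Longrightarrow> j \<ge> M \<Longrightarrow> hdist2 H (u i) (u j) < e / 4"
    and N: "\<And>i j. i \<ge> N \<Longrightarrow> j \<ge> N \<Longrightarrow> hdist2 H (v i) (v j) < e / 4"
    using assms(3,4) unfolding hcauchy_def by (metis zero_less_divide_iff zero_less_numeral)
  have "hdist2 H (hadd H (u i) (v i)) (hadd H (u j) (v j)) < e" if "i \<ge> max M N" "j \<ge> max M N" for i j
    using hdist2_add_le[of "u i" "v i" "u j" "v j"] M[of i j] N[of i j] that assms(1,2)
    by (auto simp: image_subset_iff)
  then show "\<exists>N. \<forall>i\<ge>N. \<forall>j\<ge>N. hdist2 H (hadd H (u i) (v i)) (hadd H (u j) (v j)) < e" by blast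
qed

lemma hcauchy_scale:
  assumes "range u \<subseteq> hcarrier H" "hcauchy H u"
  shows "hcauchy H (\<lambda>n. hscale H c (u n))"
  unfolding hcauchy_def
proof (intro allI impI)
  fix e :: real assume "e > 0"
  have u: "u n \<in> hcarrier H" for n using assms(1) by auto
  \<comment> \<open>The summand 1 covers \<open>c = 0\<close>.\<close>
  have "0 < e / (c\<^sup>2 + 1)" using \<open>e > 0\<close> by (simp add: add_nonneg_pos)
  then obtain N where N: "\<And>i j. i \<ge> N \<Longrightarrow> j \<ge> N \<Longrightarrow> hdist2 H (u i) (u j) < e / (c\<^sup>2 + 1)"
    using assms(2) unfolding hcauchy_def by metis
  have "hdist2 H (hscale H c (u i)) (hscale H c (u j)) < e" if "i \<ge> N" "j \<ge> N" for i j
  proof -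
    have "hdist2 H (hscale H c (u i)) (hscale H c (u j)) = c\<^sup>2 * hdist2 H (u i) (u j)"
      using u by (simp add: hdist2_scale)
    also have "\<dots> \<le> (c\<^sup>2 + 1) * hdist2 H (u i) (u j)"
      using hdist2_nonneg[OF u u, of i j] by (intro mult_right_mono) auto
    also have "\<dots> < (c\<^sup>2 + 1) * (e / (c\<^sup>2 + 1))"
      using N[OF that] by (intro mult_strict_left_mono) (auto simp: add_nonneg_pos)
    also have "\<dots> = e" using zero_le_power2[of c] by (simp add: add_nonneg_eq_0_iff)
    finally show ?thesis .
  qed
  then show "\<exists>N. \<forall>i\<ge>N. \<forall>j\<ge>N. hdist2 H (hscale H c (u i)) (hscale H c (u j)) < e" by blast
qed

lemma norm2_convergent:
  assumes "range u \<subseteq> hcarrier H" "hcauchy H u"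
  shows "\<exists>L. (\<lambda>n. hinner H (u n) (u n)) \<longlonglongrightarrow> L"
proof -
  have u: "u n \<in> hcarrier H" for n using assms(1) by auto
  have "Cauchy (\<lambda>n. sqrt (hinner H (u n) (u n)))"
  proof (rule metric_CauchyI)
    fix e :: real assume "e > 0"
    then obtain N where N: "\<And>i j. i \<ge> N \<Longrightarrow> j \<ge> N \<Longrightarrow> hdist2 H (u i) (u j) < e\<^sup>2"
      using assms(2) unfolding hcauchy_def by (metis zero_less_power)
    have "dist (sqrt (hinner H (u i) (u i))) (sqrt (hinner H (u j) (u j))) < e" if "i \<ge> N" "j \<ge> N" for i j
    proof -
      have "(dist (sqrt (hinner H (u i) (u i))) (sqrt (hinner H (u j) (u j))))\<^sup>2 < e\<^sup>2"
        using norm_diff_le[OF u u, of i j] N[OF that] by (simp add: dist_real_def)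
      then show ?thesis using \<open>e > 0\<close> by (simp add: power2_less_imp_less)
    qed
    then show "\<exists>N. \<forall>m\<ge>N. \<forall>n\<ge>N. dist (sqrt (hinner H (u m) (u m))) (sqrt (hinner H (u n) (u n))) < e"
      by blast
  qed
  then obtain L where "(\<lambda>n. sqrt (hinner H (u n) (u n))) \<longlonglongrightarrow> L"
    using Cauchy_convergent convergentD by blast
  then have "(\<lambda>n. (sqrt (hinner H (u n) (u n)))\<^sup>2) \<longlonglongrightarrow> L\<^sup>2" by (rule tendsto_power)
  then show ?thesis using u by auto
qed

lemma norm2_tendsto_cong:
  assumes u: "range u \<subseteq> hcarrier H" and v: "range v \<subseteq> hcarrier H"
    and d: "(\<lambda>n. hdist2 H (u n) (v n)) \<longlonglongrightarrow> 0" and L: "(\<lambda>n. hinner H (u n) (u n)) \<longlonglongrightarrow> L"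
  shows "(\<lambda>n. hinner H (v n) (v n)) \<longlonglongrightarrow> L"
proof -
  have uv: "u n \<in> hcarrier H" "v n \<in> hcarrier H" for n using u v by auto
  have "(\<lambda>n. (sqrt (hinner H (u n) (u n)) - sqrt (hinner H (v n) (v n)))\<^sup>2) \<longlonglongrightarrow> 0"
    using norm_diff_le[OF uv] by (intro tendsto_sandwich[OF _ _ tendsto_const d]) (auto intro!: always_eventually)
  then have "(\<lambda>n. sqrt (hinner H (u n) (u n)) - sqrt (hinner H (v n) (v n))) \<longlonglongrightarrow> 0"
    using tendsto_real_sqrt by (fastforce simp: tendsto_rabs_zero_iff)
  then have "(\<lambda>n. sqrt (hinner H (u n) (u n)) - (sqrt (hinner H (u n) (u n)) - sqrt (hinner H (v n) (v n))))
      \<longlonglongrightarrow> sqrt L - 0" by (intro tendsto_diff tendsto_real_sqrt L)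
  then have "(\<lambda>n. (sqrt (hinner H (v n) (v n)))\<^sup>2) \<longlonglongrightarrow> (sqrt L)\<^sup>2"
    by (intro tendsto_power) simp
  moreover have "L \<ge> 0" using L uv by (intro LIMSEQ_le_const[OF L]) auto
  ultimately show ?thesis using uv by simp
qed

text \<open>Polarization reduces convergence, congruence and later measurability of inner products
  to those of norms.\<close>

lemma inner_polar:
  assumes [simp]: "u \<in> hcarrier H" "v \<in> hcarrier H"
  shows "hinner H u v = (hinner H (hadd H u v) (hadd H u v) - hinner H u u - hinner H v v) / 2"
  by (simp add: inner_commute[of v u])

lemma inner_convergent:
  assumes u: "range u \<subseteq> hcarrier H" "hcauchy H u" and v: "range v \<subseteq> hcarrier H" "hcauchy H v"
  shows "\<exists>L. (\<lambda>n. hinner H (u n) (v n)) \<longlonglongrightarrow> L"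
proof -
  have uv: "u n \<in> hcarrier H" "v n \<in> hcarrier H" for n using u v by auto
  obtain a b c where "(\<lambda>n. hinner H (u n) (u n)) \<longlonglongrightarrow> a" "(\<lambda>n. hinner H (v n) (v n)) \<longlonglongrightarrow> b"
    "(\<lambda>n. hinner H (hadd H (u n) (v n)) (hadd H (u n) (v n))) \<longlonglongrightarrow> c"
    using norm2_convergent[OF u] norm2_convergent[OF v]
      norm2_convergent[OF _ hcauchy_add[OF u(1) v(1) u(2) v(2)]] uv
    by (metis (no_types, lifting) UNIV_I add_closed image_subset_iff)
  then have "(\<lambda>n. (hinner H (hadd H (u n) (v n)) (hadd H (u n) (v n)) - hinner H (u n) (u n)
      - hinner H (v n) (v n)) / 2) \<longlonglongrightarrow> (c - a - b) / 2" by (intro tendsto_intros) auto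
  then show ?thesis using uv by (subst inner_polar) auto
qed

lemma inner_tendsto_cong:
  assumes u: "range u \<subseteq> hcarrier H" "range u' \<subseteq> hcarrier H" "(\<lambda>n. hdist2 H (u n) (u' n)) \<longlonglongrightarrow> 0" "hcauchy H u"
    and v: "range v \<subseteq> hcarrier H" "range v' \<subseteq> hcarrier H" "(\<lambda>n. hdist2 H (v n) (v' n)) \<longlonglongrightarrow> 0" "hcauchy H v"
    and L: "(\<lambda>n. hinner H (u n) (v n)) \<longlonglongrightarrow> L"
  shows "(\<lambda>n. hinner H (u' n) (v' n)) \<longlonglongrightarrow> L"
proof -
  have uv[simp]: "u n \<in> hcarrier H" "v n \<in> hcarrier H" "u' n \<in> hcarrier H" "v' n \<in> hcarrier H" for n
    using u v by auto
  have r: "range (\<lambda>n. hadd H (u n) (v n)) \<subseteq> hcarrier H" "range (\<lambda>n. hadd H (u' n) (v' n)) \<subseteq> hcarrier H"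
    by auto
  obtain a where a: "(\<lambda>n. hinner H (u n) (u n)) \<longlonglongrightarrow> a" using norm2_convergent[OF u(1,4)] by blast
  obtain b where b: "(\<lambda>n. hinner H (v n) (v n)) \<longlonglongrightarrow> b" using norm2_convergent[OF v(1,4)] by blast
  obtain c where c: "(\<lambda>n. hinner H (hadd H (u n) (v n)) (hadd H (u n) (v n))) \<longlonglongrightarrow> c"
    using norm2_convergent[OF r(1) hcauchy_add[OF u(1) v(1) u(4) v(4)]] by blast
  have "(\<lambda>n. 2 * hdist2 H (u n) (u' n) + 2 * hdist2 H (v n) (v' n)) \<longlonglongrightarrow> 2 * 0 + 2 * 0"
    by (intro tendsto_intros u v)
  then have s0: "(\<lambda>n. 2 * hdist2 H (u n) (u' n) + 2 * hdist2 H (v n) (v' n)) \<longlonglongrightarrow> 0" by simp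
  have "(\<lambda>n. hdist2 H (hadd H (u n) (v n)) (hadd H (u' n) (v' n))) \<longlonglongrightarrow> 0"
    using hdist2_add_le by (intro tendsto_sandwich[OF _ _ tendsto_const s0]) (auto intro!: always_eventually)
  from norm2_tendsto_cong[OF r this c] norm2_tendsto_cong[OF u(1,2,3) a] norm2_tendsto_cong[OF v(1,2,3) b]
  have "(\<lambda>n. (hinner H (hadd H (u' n) (v' n)) (hadd H (u' n) (v' n)) - hinner H (u' n) (u' n)
      - hinner H (v' n) (v' n)) / 2) \<longlonglongrightarrow> (c - a - b) / 2" by (intro tendsto_intros) auto
  moreover have "(\<lambda>n. (hinner H (hadd H (u n) (v n)) (hadd H (u n) (v n)) - hinner H (u n) (u n)
      - hinner H (v n) (v n)) / 2) \<longlonglongrightarrow> (c - a - b) / 2" using a b c by (intro tendsto_intros) auto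
  ultimately show ?thesis using L
    by (subst inner_polar, simp, simp, subst (asm) (1) inner_polar, simp, simp)
       (metis (no_types, lifting) LIMSEQ_unique)
qed

end

definition fun_hspace ::
  "('z \<Rightarrow> real) set \<Rightarrow> (('z \<Rightarrow> real) \<Rightarrow> ('z \<Rightarrow> real) \<Rightarrow> real) \<Rightarrow> ('z \<Rightarrow> real) hspace" where
  "fun_hspace V B = \<lparr>hcarrier = V, hadd = (\<lambda>u v x. u x + v x), hscale = (\<lambda>c u x. c * u x), hinner = B\<rparr>"

lemma fun_hspace_simps [simp]:
  "hcarrier (fun_hspace V B) = V"
  "hadd (fun_hspace V B) u v = (\<lambda>x. u x + v x)"
  "hscale (fun_hspace V B) c u = (\<lambda>x. c * u x)"
  "hinner (fun_hspace V B) = B"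
  by (auto simp: fun_hspace_def)

lemma semi_inner_space_fun_hspace:
  assumes "fun_subspace V" "bilinear_form_on V B"
    and "\<And>u v. u \<in> V \<Longrightarrow> v \<in> V \<Longrightarrow> B u v = B v u" "\<And>u. u \<in> V \<Longrightarrow> 0 \<le> B u u"
  shows "semi_inner_space (fun_hspace V B)"
  using assms unfolding fun_subspace_def bilinear_form_on_def
  by unfold_locales auto

locale fun_semi_inner =
  fixes V :: "('z \<Rightarrow> real) set" and B
  assumes semi_inner: "semi_inner_space (fun_hspace V B)"
begin

sublocale S: semi_inner_space "fun_hspace V B" by (rule semi_inner)

lemma form_diff_eq:
  assumes "u \<in> V" "v \<in> V"
  shows "B (\<lambda>x. u x - v x) (\<lambda>x. u x - v x) = hdist2 (fun_hspace V B) u v"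
  using S.hdist2_eq[of u v] assms by simp

lemma cauchy_seqs_iff: "u \<in> cauchy_seqs V B \<longleftrightarrow> range u \<subseteq> V \<and> hcauchy (fun_hspace V B) u"
proof (cases "range u \<subseteq> V")
  case True
  then have "u i \<in> V" for i by auto
  then show ?thesis unfolding cauchy_seqs_def hcauchy_def using form_diff_eq by simp
qed (simp add: cauchy_seqs_def)

lemma cauchy_seqs_in: "u \<in> cauchy_seqs V B \<Longrightarrow> u n \<in> V"
  by (auto simp: cauchy_seqs_iff)

lemma completion_rel_iff: "(u, v) \<in> completion_rel V B \<longleftrightarrow>
    u \<in> cauchy_seqs V B \<and> v \<in> cauchy_seqs V B \<and> (\<lambda>n. hdist2 (fun_hspace V B) (u n) (v n)) \<longlonglongrightarrow> 0"
proof (cases "u \<in> cauchy_seqs V B \<and> v \<in> cauchy_seqs V B")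
  case True
  then have "u i \<in> V" "v i \<in> V" for i by (auto simp: cauchy_seqs_iff)
  then show ?thesis unfolding completion_rel_def using form_diff_eq by simp
qed (auto simp: completion_rel_def)

lemma equiv_completion_rel: "equiv (cauchy_seqs V B) (completion_rel V B)"
proof (rule equivI)
  show "refl_on (cauchy_seqs V B) (completion_rel V B)"
    by (auto simp: refl_on_def completion_rel_iff)
  show "completion_rel V B \<subseteq> cauchy_seqs V B \<times> cauchy_seqs V B" by (auto simp: completion_rel_iff)
  show "sym (completion_rel V B)"
  proof (rule symI)
    fix u v assume uv: "(u, v) \<in> completion_rel V B"
    then have "u i \<in> V" "v i \<in> V" for i by (auto simp: completion_rel_iff cauchy_seqs_iff)
    then have "hdist2 (fun_hspace V B) (v i) (u i) = hdist2 (fun_hspace V B) (u i) (v i)" for i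
      using S.hdist2_commute[of "u i" "v i"] by simp
    then show "(v, u) \<in> completion_rel V B" using uv by (simp add: completion_rel_iff)
  qed
  show "trans (completion_rel V B)"
  proof (rule transI)
    fix u v w assume uv: "(u, v) \<in> completion_rel V B" "(v, w) \<in> completion_rel V B"
    then have V: "u i \<in> V" "v i \<in> V" "w i \<in> V" for i by (auto simp: completion_rel_iff cauchy_seqs_iff)
    have "(\<lambda>n. 2 * hdist2 (fun_hspace V B) (u n) (v n) + 2 * hdist2 (fun_hspace V B) (v n) (w n)) \<longlonglongrightarrow> 2 * 0 + 2 * 0"
      using uv by (intro tendsto_intros) (auto simp: completion_rel_iff)
    then have s0: "(\<lambda>n. 2 * hdist2 (fun_hspace V B) (u n) (v n) + 2 * hdist2 (fun_hspace V B) (v n) (w n)) \<longlonglongrightarrow> 0"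
      by simp
    have "(\<lambda>n. hdist2 (fun_hspace V B) (u n) (w n)) \<longlonglongrightarrow> 0"
      using S.hdist2_triangle V S.hdist2_nonneg
      by (intro tendsto_sandwich[OF _ _ tendsto_const s0]) (auto intro!: always_eventually)
    then show "(u, w) \<in> completion_rel V B" using uv by (simp add: completion_rel_iff)
  qed
qed

abbreviation "cls u \<equiv> completion_rel V B `` {u}"
abbreviation "HC \<equiv> hilbert_completion V B"

lemma carrier_HC: "hcarrier HC = cauchy_seqs V B // completion_rel V B"
  by (simp add: hilbert_completion_def)

lemma cls_in [simp, intro]: "u \<in> cauchy_seqs V B \<Longrightarrow> cls u \<in> hcarrier HC"
  by (simp add: carrier_HC quotientI)

lemma carrier_HC_E:
  assumes "P \<in> hcarrier HC"
  obtains u where "u \<in> cauchy_seqs V B" "P = cls u"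
  using assms unfolding carrier_HC by (rule quotientE)

lemma cls_eq_iff: "u \<in> cauchy_seqs V B \<Longrightarrow> v \<in> cauchy_seqs V B \<Longrightarrow> cls u = cls v \<longleftrightarrow> (u, v) \<in> completion_rel V B"
  using equiv_completion_rel by (simp add: eq_equiv_class_iff)

lemma in_cls: "u \<in> cauchy_seqs V B \<Longrightarrow> u \<in> cls u"
  using equiv_completion_rel by (rule equiv_class_self)

lemma inner_cls:
  assumes u: "u \<in> cauchy_seqs V B" and v: "v \<in> cauchy_seqs V B"
    and L: "(\<lambda>n. B (u n) (v n)) \<longlonglongrightarrow> L"
  shows "hinner HC (cls u) (cls v) = L"
proof -
  have "(THE r. \<forall>x\<in>cls u. \<forall>y\<in>cls v. (\<lambda>n. B (x n) (y n)) \<longlonglongrightarrow> r) = L"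
  proof (rule the_equality)
    show "\<forall>x\<in>cls u. \<forall>y\<in>cls v. (\<lambda>n. B (x n) (y n)) \<longlonglongrightarrow> L"
    proof safe
      fix x y assume "(u, x) \<in> completion_rel V B" "(v, y) \<in> completion_rel V B"
      then show "(\<lambda>n. B (x n) (y n)) \<longlonglongrightarrow> L"
        using S.inner_tendsto_cong[of u x v y L] L by (auto simp: completion_rel_iff cauchy_seqs_iff)
    qed
  next
    fix r assume "\<forall>x\<in>cls u. \<forall>y\<in>cls v. (\<lambda>n. B (x n) (y n)) \<longlonglongrightarrow> r"
    then have "(\<lambda>n. B (u n) (v n)) \<longlonglongrightarrow> r" using in_cls u v by blast
    then show "r = L" using L by (rule LIMSEQ_unique)
  qed
  then show ?thesis by (simp add: hilbert_completion_def)
qed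

lemma tendsto_inner_cls:
  assumes u: "u \<in> cauchy_seqs V B" and v: "v \<in> cauchy_seqs V B"
  shows "(\<lambda>n. B (u n) (v n)) \<longlonglongrightarrow> hinner HC (cls u) (cls v)"
proof -
  obtain L where "(\<lambda>n. B (u n) (v n)) \<longlonglongrightarrow> L"
    using S.inner_convergent[of u v] u v by (auto simp: cauchy_seqs_iff)
  then show ?thesis using inner_cls[OF u v] by simp
qed

lemma cauchy_seqs_add: "u \<in> cauchy_seqs V B \<Longrightarrow> v \<in> cauchy_seqs V B \<Longrightarrow> (\<lambda>n z. u n z + v n z) \<in> cauchy_seqs V B"
  using S.hcauchy_add[of u v] S.add_closed by (auto simp: cauchy_seqs_iff image_subset_iff)

lemma cauchy_seqs_scale: "u \<in> cauchy_seqs V B \<Longrightarrow> (\<lambda>n z. c * u n z) \<in> cauchy_seqs V B"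
  using S.hcauchy_scale[of u c] S.scale_closed by (auto simp: cauchy_seqs_iff image_subset_iff)

lemma hadd_cls:
  assumes u: "u \<in> cauchy_seqs V B" and v: "v \<in> cauchy_seqs V B"
  shows "hadd HC (cls u) (cls v) = cls (\<lambda>n z. u n z + v n z)"
proof -
  have eq: "cls (\<lambda>n z. x n z + y n z) = cls (\<lambda>n z. u n z + v n z)"
    if "x \<in> cls u" "y \<in> cls v" for x y
  proof -
    have uv: "(x, u) \<in> completion_rel V B" "(y, v) \<in> completion_rel V B"
      using that equiv_completion_rel by (auto simp: equiv_def sym_def)
    then have V: "u i \<in> V" "v i \<in> V" "x i \<in> V" "y i \<in> V" for i
      by (auto simp: completion_rel_iff cauchy_seqs_iff)
    have "(\<lambda>n. 2 * hdist2 (fun_hspace V B) (x n) (u n) + 2 * hdist2 (fun_hspace V B) (y n) (v n)) \<longlonglongrightarrow> 2 * 0 + 2 * 0"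
      using uv by (intro tendsto_intros) (auto simp: completion_rel_iff)
    then have s0: "(\<lambda>n. 2 * hdist2 (fun_hspace V B) (x n) (u n) + 2 * hdist2 (fun_hspace V B) (y n) (v n)) \<longlonglongrightarrow> 0"
      by simp
    have "(\<lambda>n. hdist2 (fun_hspace V B) (\<lambda>z. x n z + y n z) (\<lambda>z. u n z + v n z)) \<longlonglongrightarrow> 0"
      using S.hdist2_add_le[of "x _" "y _" "u _" "v _"] S.hdist2_nonneg S.add_closed V
      by (intro tendsto_sandwich[OF _ _ tendsto_const s0]) (auto intro!: always_eventually)
    then show ?thesis
      using uv by (subst cls_eq_iff) (auto simp: completion_rel_iff intro!: cauchy_seqs_add)
  qed
  have ne: "cls u \<noteq> {}" "cls v \<noteq> {}" using in_cls u v by blast+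
  have "hadd HC (cls u) (cls v) = (\<Union>x\<in>cls u. \<Union>y\<in>cls v. cls (\<lambda>n z. x n z + y n z))"
    by (simp add: hilbert_completion_def)
  also have "\<dots> = cls (\<lambda>n z. u n z + v n z)"
    by (rule SUP_eq_const[OF ne(1)], rule SUP_eq_const[OF ne(2)], rule eq)
  finally show ?thesis .
qed

lemma hscale_cls:
  assumes u: "u \<in> cauchy_seqs V B"
  shows "hscale HC c (cls u) = cls (\<lambda>n z. c * u n z)"
proof -
  have eq: "cls (\<lambda>n z. c * x n z) = cls (\<lambda>n z. c * u n z)" if "x \<in> cls u" for x
  proof -
    have uv: "(x, u) \<in> completion_rel V B"
      using that equiv_completion_rel by (auto simp: equiv_def sym_def)
    then have V: "u i \<in> V" "x i \<in> V" for i
      by (auto simp: completion_rel_iff cauchy_seqs_iff)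
    have "(\<lambda>n. c\<^sup>2 * hdist2 (fun_hspace V B) (x n) (u n)) \<longlonglongrightarrow> c\<^sup>2 * 0"
      using uv by (intro tendsto_intros) (auto simp: completion_rel_iff)
    then have "(\<lambda>n. hdist2 (fun_hspace V B) (\<lambda>z. c * x n z) (\<lambda>z. c * u n z)) \<longlonglongrightarrow> 0"
      using S.hdist2_scale V by simp
    then show ?thesis
      using uv by (subst cls_eq_iff) (auto simp: completion_rel_iff intro!: cauchy_seqs_scale)
  qed
  have ne: "cls u \<noteq> {}" using in_cls u by blast
  have "hscale HC c (cls u) = (\<Union>x\<in>cls u. cls (\<lambda>n z. c * x n z))"
    by (simp add: hilbert_completion_def)
  also have "\<dots> = cls (\<lambda>n z. c * u n z)" by (rule SUP_eq_const[OF ne], rule eq)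
  finally show ?thesis .
qed

lemma semi_inner_HC: "semi_inner_space HC"
proof
  obtain v where "v \<in> V" using S.nonempty by auto
  then have "(\<lambda>_. v) \<in> cauchy_seqs V B" by (auto simp: cauchy_seqs_iff hcauchy_def)
  then show "hcarrier HC \<noteq> {}" by (auto dest: cls_in)
next
  fix P Q assume "P \<in> hcarrier HC" "Q \<in> hcarrier HC"
  then obtain u v where uv: "u \<in> cauchy_seqs V B" "v \<in> cauchy_seqs V B" "P = cls u" "Q = cls v"
    by (metis carrier_HC_E)
  then show "hadd HC P Q \<in> hcarrier HC" by (simp add: hadd_cls cauchy_seqs_add)
  have "B (u n) (v n) = B (v n) (u n)" for n
    using S.inner_commute[of "u n" "v n"] uv by (auto simp: cauchy_seqs_iff)
  then have "(\<lambda>n. B (v n) (u n)) \<longlonglongrightarrow> hinner HC P Q"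
    using tendsto_inner_cls[OF uv(1,2)] uv(3,4) by simp
  then show "hinner HC P Q = hinner HC Q P"
    using inner_cls[OF uv(2,1)] uv(3,4) by simp
  fix R assume "R \<in> hcarrier HC"
  then obtain w where w: "w \<in> cauchy_seqs V B" "R = cls w" by (metis carrier_HC_E)
  have "(\<lambda>n. B (u n) (w n) + B (v n) (w n)) \<longlonglongrightarrow> hinner HC P R + hinner HC Q R"
    using tendsto_inner_cls uv w by (auto intro!: tendsto_add)
  moreover have "B (\<lambda>z. u n z + v n z) (w n) = B (u n) (w n) + B (v n) (w n)" for n
    using S.inner_add_left[of "u n" "v n" "w n"] uv w by (simp add: cauchy_seqs_in)
  ultimately show "hinner HC (hadd HC P Q) R = hinner HC P R + hinner HC Q R"
    using uv w by (auto simp: hadd_cls intro!: inner_cls cauchy_seqs_add)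
next
  fix P c assume "P \<in> hcarrier HC"
  then obtain u where u: "u \<in> cauchy_seqs V B" "P = cls u" by (metis carrier_HC_E)
  then show "hscale HC c P \<in> hcarrier HC" by (simp add: hscale_cls cauchy_seqs_scale)
  have "0 \<le> B (u n) (u n)" for n using u S.inner_nonneg[of "u n"] by (simp add: cauchy_seqs_in)
  then show "0 \<le> hinner HC P P"
    using u by (intro LIMSEQ_le_const[OF tendsto_inner_cls[of u u, folded u(2)]]) auto
  fix R assume "R \<in> hcarrier HC"
  then obtain w where w: "w \<in> cauchy_seqs V B" "R = cls w" by (metis carrier_HC_E)
  have "(\<lambda>n. c * B (u n) (w n)) \<longlonglongrightarrow> c * hinner HC P R"
    using tendsto_inner_cls u w by (auto intro!: tendsto_mult)
  moreover have "B (\<lambda>z. c * u n z) (w n) = c * B (u n) (w n)" for n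
    using S.inner_scale_left[of "u n" "w n"] u w by (simp add: cauchy_seqs_in)
  ultimately show "hinner HC (hscale HC c P) R = c * hinner HC P R"
    using u w by (auto simp: hscale_cls intro!: inner_cls cauchy_seqs_scale)
qed

sublocale HC: semi_inner_space HC by (rule semi_inner_HC)

lemma tendsto_hdist2_cls:
  assumes u: "u \<in> cauchy_seqs V B" and v: "v \<in> cauchy_seqs V B"
  shows "(\<lambda>n. hdist2 (fun_hspace V B) (u n) (v n)) \<longlonglongrightarrow> hdist2 HC (cls u) (cls v)"
  unfolding hdist2_def fun_hspace_simps
  by (intro tendsto_intros tendsto_inner_cls u v)

lemma const_cauchy [simp]: "v \<in> V \<Longrightarrow> (\<lambda>_. v) \<in> cauchy_seqs V B"
  by (auto simp: cauchy_seqs_iff hcauchy_def)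

lemma completion_class_in [simp, intro]: "v \<in> V \<Longrightarrow> completion_class V B v \<in> hcarrier HC"
  by (simp add: completion_class_def)

lemma inner_completion_class:
  "v \<in> V \<Longrightarrow> w \<in> V \<Longrightarrow> hinner HC (completion_class V B v) (completion_class V B w) = B v w"
  unfolding completion_class_def by (intro inner_cls) auto

lemma hdist2_completion_class:
  "v \<in> V \<Longrightarrow> w \<in> V \<Longrightarrow>
    hdist2 HC (completion_class V B v) (completion_class V B w) = hdist2 (fun_hspace V B) v w"
  by (simp add: hdist2_def inner_completion_class)

lemma tendsto_inner_completion_class:
  assumes u: "u \<in> cauchy_seqs V B" and v: "v \<in> V"
  shows "(\<lambda>n. B (u n) v) \<longlonglongrightarrow> hinner HC (cls u) (completion_class V B v)"
  unfolding completion_class_def using tendsto_inner_cls[OF u const_cauchy[OF v]] .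

lemma hdist2_class_cls_le:
  assumes u: "u \<in> cauchy_seqs V B" and v: "v \<in> V"
    and le: "\<And>n. n \<ge> N \<Longrightarrow> hdist2 (fun_hspace V B) v (u n) \<le> e"
  shows "hdist2 HC (completion_class V B v) (cls u) \<le> e"
  unfolding completion_class_def
  using tendsto_hdist2_cls[OF const_cauchy[OF v] u] le by (intro LIMSEQ_le_const2) auto

lemma completion_class_dense:
  assumes P: "P \<in> hcarrier HC" and e: "e > 0"
  obtains v where "v \<in> V" "hdist2 HC (completion_class V B v) P < e"
proof -
  obtain u where u: "u \<in> cauchy_seqs V B" "P = cls u" using P by (metis carrier_HC_E)
  then obtain N where N: "\<And>i j. i \<ge> N \<Longrightarrow> j \<ge> N \<Longrightarrow> hdist2 (fun_hspace V B) (u i) (u j) < e / 2"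
    using e unfolding cauchy_seqs_iff hcauchy_def by (metis half_gt_zero)
  have "u N \<in> V" using u by (auto simp: cauchy_seqs_iff)
  moreover have "hdist2 HC (completion_class V B (u N)) P \<le> e / 2"
    unfolding u(2) using N by (intro hdist2_class_cls_le[where N = N] u calculation) (auto intro: less_imp_le)
  ultimately show ?thesis using that e by force
qed

text \<open>If \<open>P\<close> is orthogonal to the class of \<open>v\<close>, the squared distance
  is the sum of both squared norms and so bounds the norm of \<open>P\<close>; but such classes come
  arbitrarily close to \<open>P\<close>.\<close>

lemma completion_total:
  assumes P: "P \<in> hcarrier HC" and 0: "\<And>v. v \<in> V \<Longrightarrow> hinner HC P (completion_class V B v) = 0"
  shows "hinner HC P P = 0"
proof -
  obtain u where u: "u \<in> cauchy_seqs V B" "P = cls u" using P by (metis carrier_HC_E)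
  have "hinner HC P P \<le> e" if e: "e > 0" for e
  proof -
    obtain v where v: "v \<in> V" "hdist2 HC (completion_class V B v) P < e"
      using completion_class_dense[OF P e] .
    have "hinner HC (completion_class V B v) P = 0"
      using 0[OF v(1)] HC.inner_commute[OF P completion_class_in[OF v(1)]] by simp
    then have "hdist2 HC (completion_class V B v) P
        = hinner HC (completion_class V B v) (completion_class V B v) + hinner HC P P"
      by (simp add: hdist2_def)
    then show ?thesis using v HC.inner_nonneg[OF completion_class_in[OF v(1)]] by linarith
  qed
  then show ?thesis using HC.inner_nonneg[OF P] by (meson antisym dense_ge)
qed

text \<open>Diagonal argument: each class is replaced by the class of a single vector
  \<open>v n\<close> at squared distance below \<open>1 / Suc n\<close>. The sequence
  \<open>v\<close> is itself Cauchy in \<open>V\<close>, and its class is the limit.\<close>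

lemma hilbert_space_HC: "hilbert_space HC"
proof unfold_locales
  fix P Q assume PQ: "P \<in> hcarrier HC" "Q \<in> hcarrier HC" "hdist2 HC P Q = 0"
  then obtain u v where uv: "u \<in> cauchy_seqs V B" "v \<in> cauchy_seqs V B" "P = cls u" "Q = cls v"
    by (metis carrier_HC_E)
  then show "P = Q" using PQ(3) tendsto_hdist2_cls[of u v] cls_eq_iff[of u v] by (simp add: completion_rel_iff)
next
  fix P :: "nat \<Rightarrow> (nat \<Rightarrow> 'z \<Rightarrow> real) set" assume P: "range P \<subseteq> hcarrier HC" "hcauchy HC P"
  have Pn[simp]: "P n \<in> hcarrier HC" for n using P by auto
  have "\<exists>v\<in>V. hdist2 HC (completion_class V B v) (P n) < 1 / real (Suc n)" for n
    using completion_class_dense[OF Pn, of "1 / real (Suc n)"] by (metis of_nat_0_less_iff zero_less_Suc zero_less_divide_1_iff)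
  then obtain v where v: "\<And>n. v n \<in> V" "\<And>n. hdist2 HC (completion_class V B (v n)) (P n) < 1 / real (Suc n)"
    by metis
  have small: "\<exists>N. \<forall>n\<ge>N. hdist2 HC (completion_class V B (v n)) (P n) < e" if e: "e > 0" for e
  proof -
    obtain N where N: "1 / real (Suc N) < e" using reals_Archimedean[OF e] by (auto simp: inverse_eq_divide)
    have "hdist2 HC (completion_class V B (v n)) (P n) < e" if "n \<ge> N" for n
    proof -
      have "1 / real (Suc n) \<le> 1 / real (Suc N)" using that by (simp add: frac_le)
      then show ?thesis using v(2)[of n] N by linarith
    qed
    then show ?thesis by blast
  qed
  have "v \<in> cauchy_seqs V B" unfolding cauchy_seqs_iff hcauchy_def
  proof (intro conjI allI impI)
    fix e :: real assume e: "e > 0"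
    \<comment> \<open>Two uses of the triangle inequality with constant 2 add up to
      \<open>2/12 + 4/12 + 4/12\<close> of \<open>e\<close>.\<close>
    then have "e / 12 > 0" by simp
    from small[OF this] obtain N where N: "\<And>n. n \<ge> N \<Longrightarrow> hdist2 HC (completion_class V B (v n)) (P n) < e / 12"
      by blast
    obtain M where M: "\<And>i j. i \<ge> M \<Longrightarrow> j \<ge> M \<Longrightarrow> hdist2 HC (P i) (P j) < e / 12"
      using P(2) \<open>e / 12 > 0\<close> unfolding hcauchy_def by metis
    have "hdist2 (fun_hspace V B) (v i) (v j) < e" if "i \<ge> max M N" "j \<ge> max M N" for i j
    proof -
      let ?c = "\<lambda>n. completion_class V B (v n)"
      have c: "?c n \<in> hcarrier HC" for n using v by simp
      have "hdist2 HC (?c i) (?c j) \<le> 2 * hdist2 HC (?c i) (P i) + 2 * hdist2 HC (P i) (?c j)"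
        by (rule HC.hdist2_triangle) (use c in auto)
      moreover have "hdist2 HC (P i) (?c j) \<le> 2 * hdist2 HC (P i) (P j) + 2 * hdist2 HC (P j) (?c j)"
        by (rule HC.hdist2_triangle) (use c in auto)
      moreover have "hdist2 HC (P j) (?c j) = hdist2 HC (?c j) (P j)"
        by (rule HC.hdist2_commute) (use c in auto)
      moreover have "hdist2 HC (?c i) (P i) < e / 12" "hdist2 HC (?c j) (P j) < e / 12" "hdist2 HC (P i) (P j) < e / 12"
        using N M that by auto
      ultimately have "hdist2 HC (?c i) (?c j) < e" using e by argo
      then show ?thesis using v by (simp add: hdist2_completion_class)
    qed
    then show "\<exists>N. \<forall>i\<ge>N. \<forall>j\<ge>N. hdist2 (fun_hspace V B) (v i) (v j) < e" by blast
  qed (use v in auto)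
  note vc = this
  have "(\<lambda>n. hdist2 HC (P n) (cls v)) \<longlonglongrightarrow> 0"
  proof (rule LIMSEQ_I)
    fix e :: real assume e: "e > 0"
    then have e6: "e / 6 > 0" by simp
    from small[OF this] obtain N where N: "\<And>n. n \<ge> N \<Longrightarrow> hdist2 HC (completion_class V B (v n)) (P n) < e / 6"
      by blast
    obtain M where M: "\<And>i j. i \<ge> M \<Longrightarrow> j \<ge> M \<Longrightarrow> hdist2 (fun_hspace V B) (v i) (v j) < e / 6"
      using vc e6 unfolding cauchy_seqs_iff hcauchy_def by metis
    have "hdist2 HC (P n) (cls v) < e" if n: "n \<ge> max M N" for n
    proof -
      let ?c = "completion_class V B (v n)"
      have c: "?c \<in> hcarrier HC" using v by simp
      have "hdist2 HC ?c (cls v) \<le> e / 6" using n M by (intro hdist2_class_cls_le[where N = M] vc v) (auto intro: less_imp_le)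
      moreover have "hdist2 HC (P n) (cls v) \<le> 2 * hdist2 HC (P n) ?c + 2 * hdist2 HC ?c (cls v)"
        by (rule HC.hdist2_triangle) (use c vc in auto)
      moreover have "hdist2 HC (P n) ?c = hdist2 HC ?c (P n)" by (rule HC.hdist2_commute) (use c in auto)
      moreover have "hdist2 HC ?c (P n) < e / 6" using N n by auto
      ultimately show ?thesis using e by argo
    qed
    then show "\<exists>N. \<forall>n\<ge>N. norm (hdist2 HC (P n) (cls v) - 0) < e"
      using HC.hdist2_nonneg[OF Pn cls_in[OF vc]] by (metis abs_of_nonneg diff_zero real_norm_def)
  qed
  then show "\<exists>l\<in>hcarrier HC. (\<lambda>n. hdist2 HC (P n) l) \<longlonglongrightarrow> 0" using vc by blast
qed

end

section \<open>Direct integrals\<close>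

lemma (in semi_inner_space) tendsto_hdist2:
  assumes "range s \<subseteq> hcarrier H" "w \<in> hcarrier H" "v \<in> hcarrier H"
    and "(\<lambda>n. hdist2 H (s n) w) \<longlonglongrightarrow> 0"
  shows "(\<lambda>n. hdist2 H v (s n)) \<longlonglongrightarrow> hdist2 H v w"
proof -
  have s: "s n \<in> hcarrier H" for n using assms by auto
  have "(\<lambda>n. hinner H v v - 2 * hinner H (s n) v + hinner H (s n) (s n))
      \<longlonglongrightarrow> hinner H v v - 2 * hinner H w v + hinner H w w"
    by (intro tendsto_intros tendsto_inner_left tendsto_norm2 assms)
  moreover have "hinner H v (s n) = hinner H (s n) v" "hinner H v w = hinner H w v" for n
    using s assms by (auto intro: inner_commute)
  ultimately show ?thesis by (simp add: hdist2_def)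
qed

text \<open>The triangle inequality for squared distances loses a factor 2 at every step; increments
  decaying like the powers of 1/4 absorb this loss.\<close>

lemma (in semi_inner_space) hcauchy_geometric:
  assumes u: "range u \<subseteq> hcarrier H" and M: "\<And>j. 4 ^ j * hdist2 H (u j) (u (Suc j)) \<le> M"
  shows "hcauchy H u"
proof -
  have uc: "u n \<in> hcarrier H" for n using u by auto
  have M0: "0 \<le> M" using M[of 0] hdist2_nonneg[OF uc uc, of 0 1] by simp
  have step: "hdist2 H (u j) (u (Suc j)) \<le> M / 4 ^ j" for j using M[of j] by (simp add: field_simps)
  \<comment> \<open>\<open>4 * M / 4 ^ i\<close> solves the recursion
    \<open>x i = 2 * M / 4 ^ i + 2 * x (i + 1)\<close>, so the induction reproduces it.\<close>
  have tail: "hdist2 H (u i) (u (i + n)) \<le> 4 * M / 4 ^ i" for i n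
  proof (induction n arbitrary: i)
    case 0
    show ?case using M0 by simp
  next
    case (Suc n)
    have "hdist2 H (u i) (u (i + Suc n)) \<le> 2 * hdist2 H (u i) (u (Suc i)) + 2 * hdist2 H (u (Suc i)) (u (i + Suc n))"
      by (intro hdist2_triangle uc)
    also have "\<dots> \<le> 2 * (M / 4 ^ i) + 2 * (4 * M / 4 ^ Suc i)"
      using step[of i] Suc.IH[of "Suc i"] by simp
    also have "\<dots> = 4 * M / 4 ^ i" by simp
    finally show ?case .
  qed
  show ?thesis unfolding hcauchy_def
  proof (intro allI impI)
    fix e :: real assume e: "e > 0"
    have "(\<lambda>n. 4 * M * (1 / 4) ^ n) \<longlonglongrightarrow> 4 * M * 0"
      by (intro tendsto_mult_left LIMSEQ_power_zero) simp
    then have "eventually (\<lambda>n. 4 * M * (1 / 4) ^ n < e) sequentially"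
      using e by (intro order_tendstoD(2)) auto
    then obtain N where N: "\<And>n. n \<ge> N \<Longrightarrow> 4 * M * (1 / 4) ^ n < e" by (auto simp: eventually_sequentially)
    have *: "hdist2 H (u i) (u j) < e" if "N \<le> i" "i \<le> j" for i j
      using tail[of i "j - i"] N[of i] that by (simp add: power_divide)
    have "hdist2 H (u i) (u j) < e" if ij: "N \<le> i" "N \<le> j" for i j
      using *[of i j] *[of j i] ij hdist2_commute[OF uc uc, of i j] by (cases "i \<le> j") auto
    then show "\<exists>N. \<forall>i\<ge>N. \<forall>j\<ge>N. hdist2 H (u i) (u j) < e" by blast
  qed
qed

text \<open>Rational coefficients leave only countably many combinations of a sequence, so that
  suprema over them stay measurable.\<close>

definition rat_lincomb :: "'h hspace \<Rightarrow> ('i \<Rightarrow> 'h) \<Rightarrow> (rat \<times> 'i) list \<Rightarrow> 'h" where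
  "rat_lincomb H j qs = lincomb H j (map (\<lambda>(q, i). (of_rat q, i)) qs)"

lemma (in semi_inner_space) rat_lincomb_approx:
  assumes j: "range j \<subseteq> hcarrier H" and e: "e > 0"
  shows "\<exists>qs. hdist2 H (lincomb H j ps) (rat_lincomb H j qs) < e"
  using e
proof (induction ps arbitrary: e)
  case Nil
  then show ?case by (intro exI[of _ "[]"]) (simp add: rat_lincomb_def)
next
  case (Cons p ps)
  obtain c i where p: "p = (c, i)" by force
  obtain qs where qs: "hdist2 H (lincomb H j ps) (rat_lincomb H j qs) < e / 4"
    using Cons.IH[of "e / 4"] Cons.prems by auto
  define A where "A = hinner H (j i) (j i)"
  have ji: "j i \<in> hcarrier H" using j by auto
  then have A: "A \<ge> 0" by (simp add: A_def)
  \<comment> \<open>\<open>A + 1\<close> instead of \<open>A\<close>, because \<open>j i\<close> may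
    have norm zero.\<close>
  have "0 < sqrt (e / (4 * (A + 1)))" using Cons.prems A by simp
  then obtain q where q: "c < of_rat q" "of_rat q < c + sqrt (e / (4 * (A + 1)))"
    using of_rat_dense[of c "c + sqrt (e / (4 * (A + 1)))"] by auto
  have "(of_rat q - c)\<^sup>2 \<le> (sqrt (e / (4 * (A + 1))))\<^sup>2" using q by (intro power_mono) auto
  also have "\<dots> = e / (4 * (A + 1))" using Cons.prems A by simp
  finally have q2: "(of_rat q - c)\<^sup>2 * (A + 1) \<le> e / 4" using A by (simp add: field_simps)
  have "(of_rat q - c)\<^sup>2 * A \<le> (of_rat q - c)\<^sup>2 * (A + 1)" by (intro mult_left_mono) auto
  then have q3: "(of_rat q - c)\<^sup>2 * A \<le> e / 4" using q2 by linarith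
  have lc: "lincomb H j ps \<in> hcarrier H" "rat_lincomb H j qs \<in> hcarrier H"
    using j unfolding rat_lincomb_def by (auto intro!: lincomb_closed[where I = UNIV])
  have "hdist2 H (lincomb H j (p # ps)) (rat_lincomb H j ((q, i) # qs))
      = hdist2 H (hadd H (hscale H c (j i)) (lincomb H j ps)) (hadd H (hscale H (of_rat q) (j i)) (rat_lincomb H j qs))"
    by (simp add: lincomb_def rat_lincomb_def p)
  also have "\<dots> \<le> 2 * hdist2 H (hscale H c (j i)) (hscale H (of_rat q) (j i))
      + 2 * hdist2 H (lincomb H j ps) (rat_lincomb H j qs)"
    using lc ji by (intro hdist2_add_le) auto
  also have "hdist2 H (hscale H c (j i)) (hscale H (of_rat q) (j i)) = (of_rat q - c)\<^sup>2 * A"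
    using ji by (simp add: hdist2_def A_def algebra_simps power2_eq_square)
  finally show ?case using qs q3 by (intro exI[of _ "(q, i) # qs"]) argo
qed

section \<open>Measurable fields of Hilbert spaces and their sections\<close>

locale measurable_field =
  fixes m :: "'x measure" and Hx :: "'x \<Rightarrow> 'h hspace" and e :: "nat \<Rightarrow> 'x \<Rightarrow> 'h"
  assumes hilbert: "hilbert_space (Hx x)"
    and e_in: "e n x \<in> hcarrier (Hx x)"
    and e_meas: "(\<lambda>x. hinner (Hx x) (e i x) (e k x)) \<in> borel_measurable m"
    and e_total: "\<lbrakk>h \<in> hcarrier (Hx x); \<And>n. hinner (Hx x) h (e n x) = 0\<rbrakk> \<Longrightarrow> hinner (Hx x) h h = 0"
begin

sublocale Hx: hilbert_space "Hx x" for x by (rule hilbert)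

abbreviation "MSec \<equiv> measurable_sections m Hx e"
abbreviation "L2S \<equiv> L2_sections m Hx e"

lemma MS_in: "\<xi> \<in> MSec \<Longrightarrow> \<xi> x \<in> hcarrier (Hx x)"
  by (simp add: measurable_sections_def)

lemma e_MS: "e n \<in> MSec"
  using e_in e_meas by (simp add: measurable_sections_def)

lemma MS_add: "\<xi> \<in> MSec \<Longrightarrow> \<zeta> \<in> MSec \<Longrightarrow> (\<lambda>x. hadd (Hx x) (\<xi> x) (\<zeta> x)) \<in> MSec"
  using e_in by (auto simp: measurable_sections_def intro!: borel_measurable_add)

lemma MS_scale: "\<xi> \<in> MSec \<Longrightarrow> (\<lambda>x. hscale (Hx x) c (\<xi> x)) \<in> MSec"
  using e_in by (auto simp: measurable_sections_def intro!: borel_measurable_times)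

lemma lincomb_in: "lincomb (Hx x) (\<lambda>n. e n x) ps \<in> hcarrier (Hx x)"
  using e_in by (auto intro!: Hx.lincomb_closed[where I = UNIV])

lemma inner_lincomb_measurable:
  assumes "\<xi> \<in> MSec"
  shows "(\<lambda>x. hinner (Hx x) (lincomb (Hx x) (\<lambda>n. e n x) ps) (\<xi> x)) \<in> borel_measurable m"
proof -
  have eq: "hinner (Hx x) (lincomb (Hx x) (\<lambda>n. e n x) ps) (\<xi> x)
      = (\<Sum>(c, i)\<leftarrow>ps. c * hinner (Hx x) (\<xi> x) (e i x))" for x
    using e_in MS_in[OF assms] Hx.inner_commute[OF MS_in[OF assms] e_in]
    by (subst Hx.inner_lincomb[where I = UNIV]) auto
  show ?thesis unfolding eq
  proof (induction ps)
    case (Cons p ps)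
    obtain c i where "p = (c, i)" by force
    moreover have "(\<lambda>x. hinner (Hx x) (\<xi> x) (e i x)) \<in> borel_measurable m"
      using assms by (simp add: measurable_sections_def)
    ultimately show ?case using Cons by simp
  qed simp
qed

lemma lincomb_MS: "(\<lambda>x. lincomb (Hx x) (\<lambda>n. e n x) ps) \<in> MSec"
  using inner_lincomb_measurable[OF e_MS] lincomb_in by (auto simp: measurable_sections_def)

text \<open>Since \<open>2 \<langle>v, h\<rangle> - \<parallel>v\<parallel>\<^sup>2 = \<parallel>h\<parallel>\<^sup>2 - \<parallel>v - h\<parallel>\<^sup>2\<close>, a countable dense set of sections \<open>v\<close> makes the
  norm of a measurable section measurable without orthonormalization.\<close>

lemma norm2_eq_SUP:
  defines "F \<equiv> (\<lambda>x h qs. 2 * hinner (Hx x) (rat_lincomb (Hx x) (\<lambda>n. e n x) qs) h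
        - hinner (Hx x) (rat_lincomb (Hx x) (\<lambda>n. e n x) qs) (rat_lincomb (Hx x) (\<lambda>n. e n x) qs))"
  assumes h: "h \<in> hcarrier (Hx x)"
  shows "bdd_above (range (F x h))" and "hinner (Hx x) h h = (SUP qs. F x h qs)"
proof -
  let ?F = "F x h"
  let ?l = "\<lambda>qs. rat_lincomb (Hx x) (\<lambda>n. e n x) qs"
  have lc: "?l qs \<in> hcarrier (Hx x)" for qs unfolding rat_lincomb_def by (rule lincomb_in)
  have F: "?F qs = hinner (Hx x) h h - hdist2 (Hx x) (?l qs) h" for qs
    by (simp add: hdist2_def F_def)
  have le: "?F qs \<le> hinner (Hx x) h h" for qs unfolding F using Hx.hdist2_nonneg[OF lc h] by simp
  then show bdd: "bdd_above (range ?F)" by (intro bdd_aboveI) auto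
  have "hinner (Hx x) h h \<le> (SUP qs. ?F qs) + d" if d: "d > 0" for d
  proof -
    \<comment> \<open>With both spaces and both families equal, \<open>gram_partner\<close> is just
      the density of the combinations of the \<open>e n x\<close>.\<close>
    obtain ps where ps: "\<And>n. set (ps n) \<subseteq> UNIV \<times> UNIV"
      "(\<lambda>n. hdist2 (Hx x) (lincomb (Hx x) (\<lambda>n. e n x) (ps n)) h) \<longlonglongrightarrow> 0"
      using gram_partner[OF hilbert[of x] hilbert[of x], where I = UNIV and j = "\<lambda>n. e n x" and T = "\<lambda>n. e n x" and h = h] e_in e_total h by auto
    have "eventually (\<lambda>n. hdist2 (Hx x) (lincomb (Hx x) (\<lambda>n. e n x) (ps n)) h < d / 4) sequentially"
      using ps(2) d by (intro order_tendstoD(2)) auto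
    then obtain n where n: "hdist2 (Hx x) (lincomb (Hx x) (\<lambda>n. e n x) (ps n)) h < d / 4"
      by (auto simp: eventually_sequentially)
    obtain qs where qs: "hdist2 (Hx x) (lincomb (Hx x) (\<lambda>n. e n x) (ps n)) (?l qs) < d / 4"
      using Hx.rat_lincomb_approx[where x = x and j = "\<lambda>n. e n x" and e = "d / 4" and ps = "ps n"] d e_in by auto
    have "hdist2 (Hx x) (?l qs) h \<le> 2 * hdist2 (Hx x) (?l qs) (lincomb (Hx x) (\<lambda>n. e n x) (ps n))
        + 2 * hdist2 (Hx x) (lincomb (Hx x) (\<lambda>n. e n x) (ps n)) h"
      by (intro Hx.hdist2_triangle lc lincomb_in h)
    moreover have "hdist2 (Hx x) (?l qs) (lincomb (Hx x) (\<lambda>n. e n x) (ps n)) < d / 4"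
      using qs Hx.hdist2_commute[OF lc[of qs] lincomb_in[of x "ps n"]] by simp
    ultimately have "hdist2 (Hx x) (?l qs) h < d" using n by argo
    moreover have "?F qs \<le> (SUP qs. ?F qs)" by (intro cSUP_upper bdd) auto
    ultimately show ?thesis unfolding F by argo
  qed
  then have "hinner (Hx x) h h \<le> (SUP qs. ?F qs)" by (rule field_le_epsilon)
  moreover have "(SUP qs. ?F qs) \<le> hinner (Hx x) h h" by (intro cSUP_least le) auto
  ultimately show "hinner (Hx x) h h = (SUP qs. ?F qs)" by simp
qed

lemma norm2_measurable:
  assumes \<xi>: "\<xi> \<in> MSec"
  shows "(\<lambda>x. hinner (Hx x) (\<xi> x) (\<xi> x)) \<in> borel_measurable m"
  unfolding norm2_eq_SUP(2)[OF MS_in[OF \<xi>]]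
proof (rule borel_measurable_cSUP)
  fix qs :: "(rat \<times> nat) list"
  show "(\<lambda>x. 2 * hinner (Hx x) (rat_lincomb (Hx x) (\<lambda>n. e n x) qs) (\<xi> x)
        - hinner (Hx x) (rat_lincomb (Hx x) (\<lambda>n. e n x) qs) (rat_lincomb (Hx x) (\<lambda>n. e n x) qs))
      \<in> borel_measurable m"
    unfolding rat_lincomb_def
    by (intro borel_measurable_diff borel_measurable_times borel_measurable_const
        inner_lincomb_measurable \<xi> lincomb_MS)
qed (use norm2_eq_SUP(1) MS_in[OF \<xi>] in auto)

lemma inner_measurable:
  assumes "\<xi> \<in> MSec" "\<zeta> \<in> MSec"
  shows "(\<lambda>x. hinner (Hx x) (\<xi> x) (\<zeta> x)) \<in> borel_measurable m"
  unfolding Hx.inner_polar[OF MS_in[OF assms(1)] MS_in[OF assms(2)]]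
  using norm2_measurable[OF assms(1)] norm2_measurable[OF assms(2)] norm2_measurable[OF MS_add[OF assms]]
  by measurable

lemma hdist2_measurable:
  assumes "\<xi> \<in> MSec" "\<zeta> \<in> MSec"
  shows "(\<lambda>x. hdist2 (Hx x) (\<xi> x) (\<zeta> x)) \<in> borel_measurable m"
  unfolding hdist2_def by (intro borel_measurable_add borel_measurable_diff borel_measurable_times
      borel_measurable_const inner_measurable assms)

lemma L2S_iff: "\<xi> \<in> L2S \<longleftrightarrow> \<xi> \<in> MSec \<and> integrable m (\<lambda>x. hinner (Hx x) (\<xi> x) (\<xi> x))"
proof (cases "\<xi> \<in> MSec")
  case True
  then have "norm (hinner (Hx x) (\<xi> x) (\<xi> x)) = hinner (Hx x) (\<xi> x) (\<xi> x)" for x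
    using Hx.inner_nonneg[OF MS_in] by simp
  then show ?thesis using True norm2_measurable[OF True]
    unfolding L2_sections_def by (simp add: integrable_iff_bounded)
qed (simp add: L2_sections_def)

lemma L2S_in: "\<xi> \<in> L2S \<Longrightarrow> \<xi> x \<in> hcarrier (Hx x)"
  using MS_in L2S_iff by blast

lemma L2S_add:
  assumes "\<xi> \<in> L2S" "\<zeta> \<in> L2S"
  shows "(\<lambda>x. hadd (Hx x) (\<xi> x) (\<zeta> x)) \<in> L2S"
proof -
  have MS: "\<xi> \<in> MSec" "\<zeta> \<in> MSec" and int: "integrable m (\<lambda>x. hinner (Hx x) (\<xi> x) (\<xi> x))"
    "integrable m (\<lambda>x. hinner (Hx x) (\<zeta> x) (\<zeta> x))" using assms L2S_iff by auto
  have "integrable m (\<lambda>x. hinner (Hx x) (hadd (Hx x) (\<xi> x) (\<zeta> x)) (hadd (Hx x) (\<xi> x) (\<zeta> x)))"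
  proof (rule Bochner_Integration.integrable_bound)
    show "integrable m (\<lambda>x. 2 * hinner (Hx x) (\<xi> x) (\<xi> x) + 2 * hinner (Hx x) (\<zeta> x) (\<zeta> x))"
      using int by simp
    have c: "\<xi> x \<in> hcarrier (Hx x)" "\<zeta> x \<in> hcarrier (Hx x)" for x using MS MS_in by auto
    have "hinner (Hx x) (hadd (Hx x) (\<xi> x) (\<zeta> x)) (hadd (Hx x) (\<xi> x) (\<zeta> x))
        \<le> 2 * hinner (Hx x) (\<xi> x) (\<xi> x) + 2 * hinner (Hx x) (\<zeta> x) (\<zeta> x)" for x
      using Hx.hdist2_nonneg[OF c(1)[of x] c(2)[of x]] Hx.inner_commute[OF c(1)[of x] c(2)[of x]] c[of x]
      by (simp add: hdist2_def)
    moreover have "0 \<le> hinner (Hx x) (hadd (Hx x) (\<xi> x) (\<zeta> x)) (hadd (Hx x) (\<xi> x) (\<zeta> x))" for x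
      by (intro Hx.inner_nonneg Hx.add_closed c)
    moreover have "0 \<le> hinner (Hx x) (\<xi> x) (\<xi> x)" "0 \<le> hinner (Hx x) (\<zeta> x) (\<zeta> x)" for x
      by (intro Hx.inner_nonneg c)+
    ultimately show "AE x in m. norm (hinner (Hx x) (hadd (Hx x) (\<xi> x) (\<zeta> x)) (hadd (Hx x) (\<xi> x) (\<zeta> x)))
        \<le> norm (2 * hinner (Hx x) (\<xi> x) (\<xi> x) + 2 * hinner (Hx x) (\<zeta> x) (\<zeta> x))"
      by (intro always_eventually allI) (smt (verit) real_norm_def)
  qed (intro norm2_measurable MS_add MS)
  then show ?thesis using MS MS_add L2S_iff by blast
qed

lemma L2S_scale:
  assumes "\<xi> \<in> L2S"
  shows "(\<lambda>x. hscale (Hx x) c (\<xi> x)) \<in> L2S"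
  using assms MS_scale[of \<xi> c] MS_in[of \<xi>] by (auto simp: L2S_iff)

lemma inner_integrable:
  assumes "\<xi> \<in> L2S" "\<zeta> \<in> L2S"
  shows "integrable m (\<lambda>x. hinner (Hx x) (\<xi> x) (\<zeta> x))"
  unfolding Hx.inner_polar[OF L2S_in[OF assms(1)] L2S_in[OF assms(2)]]
  using assms L2S_add[OF assms] by (auto simp: L2S_iff)

lemma hdist2_integrable:
  assumes "\<xi> \<in> L2S" "\<zeta> \<in> L2S"
  shows "integrable m (\<lambda>x. hdist2 (Hx x) (\<xi> x) (\<zeta> x))"
  unfolding hdist2_def using inner_integrable assms by auto

lemma equiv_ae_rel: "equiv L2S (ae_rel m Hx e)"
  by (rule equivI) (auto simp: refl_on_def sym_def trans_def ae_rel_def)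

abbreviation "aecls \<xi> \<equiv> ae_rel m Hx e `` {\<xi>}"
abbreviation "DI \<equiv> direct_integral m Hx e"

lemma carrier_DI: "hcarrier DI = L2S // ae_rel m Hx e"
  by (simp add: direct_integral_def)

lemma aecls_in [simp, intro]: "\<xi> \<in> L2S \<Longrightarrow> aecls \<xi> \<in> hcarrier DI"
  by (simp add: carrier_DI quotientI)

lemma carrier_DI_E:
  assumes "P \<in> hcarrier DI"
  obtains \<xi> where "\<xi> \<in> L2S" "P = aecls \<xi>"
  using assms unfolding carrier_DI by (rule quotientE)

lemma in_aecls: "\<xi> \<in> L2S \<Longrightarrow> \<xi> \<in> aecls \<xi>"
  using equiv_ae_rel by (rule equiv_class_self)

lemma inner_aecls_rep:
  assumes "x \<in> aecls \<xi>" "y \<in> aecls \<zeta>"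
  shows "(\<integral>t. hinner (Hx t) (x t) (y t) \<partial>m) = (\<integral>t. hinner (Hx t) (\<xi> t) (\<zeta> t) \<partial>m)"
proof (rule integral_cong_AE)
  have r: "(\<xi>, x) \<in> ae_rel m Hx e" "(\<zeta>, y) \<in> ae_rel m Hx e" using assms by auto
  then show "(\<lambda>t. hinner (Hx t) (x t) (y t)) \<in> borel_measurable m"
    "(\<lambda>t. hinner (Hx t) (\<xi> t) (\<zeta> t)) \<in> borel_measurable m"
    by (auto simp: ae_rel_def L2S_iff intro!: inner_measurable)
  from r have "AE t in m. \<xi> t = x t" "AE t in m. \<zeta> t = y t" by (auto simp: ae_rel_def)
  then show "AE t in m. hinner (Hx t) (x t) (y t) = hinner (Hx t) (\<xi> t) (\<zeta> t)"
    by eventually_elim simp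
qed

lemma inner_aecls:
  assumes "\<xi> \<in> L2S" "\<zeta> \<in> L2S"
  shows "hinner DI (aecls \<xi>) (aecls \<zeta>) = (\<integral>t. hinner (Hx t) (\<xi> t) (\<zeta> t) \<partial>m)"
proof -
  have "(THE r. \<forall>x\<in>aecls \<xi>. \<forall>y\<in>aecls \<zeta>. r = (\<integral>t. hinner (Hx t) (x t) (y t) \<partial>m))
      = (\<integral>t. hinner (Hx t) (\<xi> t) (\<zeta> t) \<partial>m)"
  proof (rule the_equality)
    show "\<forall>x\<in>aecls \<xi>. \<forall>y\<in>aecls \<zeta>. (\<integral>t. hinner (Hx t) (\<xi> t) (\<zeta> t) \<partial>m) = (\<integral>t. hinner (Hx t) (x t) (y t) \<partial>m)"
      using inner_aecls_rep[symmetric] by blast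
  next
    fix r assume "\<forall>x\<in>aecls \<xi>. \<forall>y\<in>aecls \<zeta>. r = (\<integral>t. hinner (Hx t) (x t) (y t) \<partial>m)"
    then show "r = (\<integral>t. hinner (Hx t) (\<xi> t) (\<zeta> t) \<partial>m)" using in_aecls assms by blast
  qed
  then show ?thesis by (simp add: direct_integral_def)
qed

lemma hadd_aecls:
  assumes "\<xi> \<in> L2S" "\<zeta> \<in> L2S"
  shows "hadd DI (aecls \<xi>) (aecls \<zeta>) = aecls (\<lambda>t. hadd (Hx t) (\<xi> t) (\<zeta> t))"
proof -
  have eq: "aecls (\<lambda>t. hadd (Hx t) (x t) (y t)) = aecls (\<lambda>t. hadd (Hx t) (\<xi> t) (\<zeta> t))"
    if "x \<in> aecls \<xi>" "y \<in> aecls \<zeta>" for x y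
  proof -
    have r: "(\<xi>, x) \<in> ae_rel m Hx e" "(\<zeta>, y) \<in> ae_rel m Hx e" using that by auto
    then have "AE t in m. \<xi> t = x t" "AE t in m. \<zeta> t = y t" by (auto simp: ae_rel_def)
    then have "AE t in m. hadd (Hx t) (x t) (y t) = hadd (Hx t) (\<xi> t) (\<zeta> t)" by eventually_elim simp
    then have "((\<lambda>t. hadd (Hx t) (x t) (y t)), (\<lambda>t. hadd (Hx t) (\<xi> t) (\<zeta> t))) \<in> ae_rel m Hx e"
      using r L2S_add by (auto simp: ae_rel_def)
    then show ?thesis by (rule equiv_class_eq[OF equiv_ae_rel])
  qed
  have ne: "aecls \<xi> \<noteq> {}" "aecls \<zeta> \<noteq> {}" using in_aecls assms by blast+
  have "hadd DI (aecls \<xi>) (aecls \<zeta>) = (\<Union>x\<in>aecls \<xi>. \<Union>y\<in>aecls \<zeta>. aecls (\<lambda>t. hadd (Hx t) (x t) (y t)))"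
    by (simp add: direct_integral_def)
  also have "\<dots> = aecls (\<lambda>t. hadd (Hx t) (\<xi> t) (\<zeta> t))"
    by (rule SUP_eq_const[OF ne(1)], rule SUP_eq_const[OF ne(2)], rule eq)
  finally show ?thesis .
qed

lemma hscale_aecls:
  assumes "\<xi> \<in> L2S"
  shows "hscale DI c (aecls \<xi>) = aecls (\<lambda>t. hscale (Hx t) c (\<xi> t))"
proof -
  have eq: "aecls (\<lambda>t. hscale (Hx t) c (x t)) = aecls (\<lambda>t. hscale (Hx t) c (\<xi> t))" if "x \<in> aecls \<xi>" for x
  proof -
    have r: "(\<xi>, x) \<in> ae_rel m Hx e" using that by auto
    then have "AE t in m. \<xi> t = x t" by (auto simp: ae_rel_def)
    then have "AE t in m. hscale (Hx t) c (x t) = hscale (Hx t) c (\<xi> t)" by eventually_elim simp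
    then have "((\<lambda>t. hscale (Hx t) c (x t)), (\<lambda>t. hscale (Hx t) c (\<xi> t))) \<in> ae_rel m Hx e"
      using r L2S_scale by (auto simp: ae_rel_def)
    then show ?thesis by (rule equiv_class_eq[OF equiv_ae_rel])
  qed
  have ne: "aecls \<xi> \<noteq> {}" using in_aecls assms by blast
  have "hscale DI c (aecls \<xi>) = (\<Union>x\<in>aecls \<xi>. aecls (\<lambda>t. hscale (Hx t) c (x t)))"
    by (simp add: direct_integral_def)
  also have "\<dots> = aecls (\<lambda>t. hscale (Hx t) c (\<xi> t))" by (rule SUP_eq_const[OF ne], rule eq)
  finally show ?thesis .
qed

lemma semi_inner_DI: "semi_inner_space DI"
proof
  have "(\<lambda>x. hscale (Hx x) 0 (e 0 x)) \<in> L2S"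
    using MS_scale[OF e_MS[of 0], of 0] e_in by (simp add: L2S_iff)
  then show "hcarrier DI \<noteq> {}" by (auto dest: aecls_in)
next
  fix P Q assume "P \<in> hcarrier DI" "Q \<in> hcarrier DI"
  then obtain \<xi> \<zeta> where \<xi>: "\<xi> \<in> L2S" "\<zeta> \<in> L2S" "P = aecls \<xi>" "Q = aecls \<zeta>" by (metis carrier_DI_E)
  then show "hadd DI P Q \<in> hcarrier DI" by (simp add: hadd_aecls L2S_add)
  show "hinner DI P Q = hinner DI Q P"
    using \<xi> Hx.inner_commute[OF L2S_in[OF \<xi>(1)] L2S_in[OF \<xi>(2)]] by (simp add: inner_aecls)
  fix R assume "R \<in> hcarrier DI"
  then obtain \<theta> where \<theta>: "\<theta> \<in> L2S" "R = aecls \<theta>" by (metis carrier_DI_E)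
  show "hinner DI (hadd DI P Q) R = hinner DI P R + hinner DI Q R"
    using \<xi> \<theta> inner_integrable[OF \<xi>(1) \<theta>(1)] inner_integrable[OF \<xi>(2) \<theta>(1)]
    by (simp add: hadd_aecls inner_aecls L2S_add L2S_in)
next
  fix P c assume "P \<in> hcarrier DI"
  then obtain \<xi> where \<xi>: "\<xi> \<in> L2S" "P = aecls \<xi>" by (metis carrier_DI_E)
  then show "hscale DI c P \<in> hcarrier DI" by (simp add: hscale_aecls L2S_scale)
  show "0 \<le> hinner DI P P" using \<xi> by (simp add: inner_aecls L2S_in)
  fix R assume "R \<in> hcarrier DI"
  then obtain \<theta> where \<theta>: "\<theta> \<in> L2S" "R = aecls \<theta>" by (metis carrier_DI_E)
  show "hinner DI (hscale DI c P) R = c * hinner DI P R"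
    using \<xi> \<theta> by (simp add: hscale_aecls inner_aecls L2S_scale L2S_in)
qed

sublocale DI: semi_inner_space DI by (rule semi_inner_DI)

lemma hdist2_aecls:
  assumes "\<xi> \<in> L2S" "\<zeta> \<in> L2S"
  shows "hdist2 DI (aecls \<xi>) (aecls \<zeta>) = (\<integral>t. hdist2 (Hx t) (\<xi> t) (\<zeta> t) \<partial>m)"
  unfolding hdist2_def using assms inner_integrable by (simp add: inner_aecls)

lemma nn_hdist2_aecls:
  assumes "\<xi> \<in> L2S" "\<zeta> \<in> L2S"
  shows "(\<integral>\<^sup>+t. ennreal (hdist2 (Hx t) (\<xi> t) (\<zeta> t)) \<partial>m) = ennreal (hdist2 DI (aecls \<xi>) (aecls \<zeta>))"
  unfolding hdist2_aecls[OF assms]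
  using assms by (intro nn_integral_eq_integral hdist2_integrable) (auto intro!: always_eventually L2S_in Hx.hdist2_nonneg)

text \<open>Riesz-Fischer for sections: a fast subsequence converges in almost every fiber, and
  Fatou's lemma upgrades the fiberwise limit to a limit in the integrated distance.\<close>

lemma L2S_complete:
  assumes \<xi>: "\<And>n. \<xi> n \<in> L2S"
    and cauchy: "\<And>\<epsilon>. \<epsilon> > 0 \<Longrightarrow> \<exists>N. \<forall>i\<ge>N. \<forall>j\<ge>N. hdist2 DI (aecls (\<xi> i)) (aecls (\<xi> j)) < \<epsilon>"
  shows "\<exists>\<eta>\<in>L2S. (\<lambda>n. hdist2 DI (aecls (\<xi> n)) (aecls \<eta>)) \<longlonglongrightarrow> 0"
proof -
  have c: "\<xi> n x \<in> hcarrier (Hx x)" for n x using L2S_in[OF \<xi>] .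
  have MS: "\<xi> n \<in> MSec" for n using \<xi> L2S_iff by blast
  \<comment> \<open>At the rate of powers of 1/8, the weights \<open>4 ^ j\<close> demanded by
    \<open>hcauchy_geometric\<close> still leave the summable bound \<open>(1 / 2) ^ j\<close>, so
    the weighted increments have an integrable sum.\<close>
  have "\<exists>N. \<forall>i\<ge>N. \<forall>j\<ge>N. hdist2 DI (aecls (\<xi> i)) (aecls (\<xi> j)) < (1 / 8) ^ k" for k :: nat
    by (rule cauchy) simp
  then obtain N where N: "\<And>k i j. N k \<le> i \<Longrightarrow> N k \<le> j \<Longrightarrow> hdist2 DI (aecls (\<xi> i)) (aecls (\<xi> j)) < (1 / 8) ^ k"
    by metis
  \<comment> \<open>The maximum makes \<open>r j\<close> admissible for every
    \<open>k \<le> j\<close>, so that two consecutive terms are both admissible at level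
    \<open>j\<close>; adding \<open>k\<close> forces \<open>r k\<close> to infinity.\<close>
  define r where "r k = Max (N ` {..k}) + k" for k
  have r_ge: "N k \<le> r j" if "k \<le> j" for k j
    using that unfolding r_def by (intro trans_le_add1 Max_ge) auto
  have r_lim: "k \<le> r k" for k by (simp add: r_def)
  define \<delta> where "\<delta> j x = hdist2 (Hx x) (\<xi> (r j) x) (\<xi> (r (Suc j)) x)" for j x
  have \<delta>_nn: "0 \<le> \<delta> j x" for j x unfolding \<delta>_def by (intro Hx.hdist2_nonneg c)
  have \<delta>_meas [measurable]: "\<delta> j \<in> borel_measurable m" for j
    unfolding \<delta>_def by (intro hdist2_measurable MS)
  define S where "S x = (\<Sum>j. ennreal (4 ^ j * \<delta> j x))" for x
  have S_meas [measurable]: "S \<in> borel_measurable m" unfolding S_def by measurable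
  have term_le: "(\<integral>\<^sup>+x. ennreal (4 ^ j * \<delta> j x) \<partial>m) \<le> ennreal ((1 / 2) ^ j)" for j
  proof -
    have "(\<integral>\<^sup>+x. ennreal (4 ^ j * \<delta> j x) \<partial>m) = ennreal (4 ^ j) * (\<integral>\<^sup>+x. ennreal (\<delta> j x) \<partial>m)"
      by (simp add: ennreal_mult' nn_integral_cmult)
    also have "(\<integral>\<^sup>+x. ennreal (\<delta> j x) \<partial>m) = ennreal (hdist2 DI (aecls (\<xi> (r j))) (aecls (\<xi> (r (Suc j)))))"
      unfolding \<delta>_def by (intro nn_hdist2_aecls \<xi>)
    also have "ennreal (4 ^ j) * \<dots> \<le> ennreal (4 ^ j) * ennreal ((1 / 8) ^ j)"
      by (intro mult_left_mono ennreal_leI less_imp_le[OF N] r_ge) auto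
    also have "\<dots> = ennreal ((1 / 2) ^ j)"
      by (simp add: ennreal_mult'[symmetric] power_mult_distrib[symmetric])
    finally show ?thesis .
  qed
  have "(\<integral>\<^sup>+x. S x \<partial>m) = (\<Sum>j. \<integral>\<^sup>+x. ennreal (4 ^ j * \<delta> j x) \<partial>m)"
    unfolding S_def by (intro nn_integral_suminf) measurable
  also have "\<dots> \<le> (\<Sum>j. ennreal ((1 / 2) ^ j))" by (intro suminf_le term_le) auto
  also have "\<dots> = ennreal (\<Sum>j. (1 / 2) ^ j)" by (intro suminf_ennreal2) (auto intro!: summable_geometric)
  finally have "(\<integral>\<^sup>+x. S x \<partial>m) \<noteq> \<infinity>" by (metis ennreal_neq_top neq_top_trans infinity_ennreal_def)
  then have AE_S: "AE x in m. S x \<noteq> \<infinity>" by (intro nn_integral_noteq_infinite S_meas)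
  define G where "G = {x. S x \<noteq> \<infinity>}"
  have lim: "\<exists>l\<in>hcarrier (Hx x). (\<lambda>j. hdist2 (Hx x) (\<xi> (r j) x) l) \<longlonglongrightarrow> 0" if x: "x \<in> G" for x
  proof (rule Hx.complete)
    show "range (\<lambda>j. \<xi> (r j) x) \<subseteq> hcarrier (Hx x)" using c by auto
    then show "hcauchy (Hx x) (\<lambda>j. \<xi> (r j) x)"
    proof (rule Hx.hcauchy_geometric)
      fix j
      have "ennreal (4 ^ j * \<delta> j x) \<le> S x"
        unfolding S_def using sum_le_suminf[of "\<lambda>j. ennreal (4 ^ j * \<delta> j x)" "{j}"] by simp
      then have "ennreal (4 ^ j * \<delta> j x) \<le> ennreal (enn2real (S x))" using x by (simp add: G_def top.not_eq_extremum)
      then show "4 ^ j * hdist2 (Hx x) (\<xi> (r j) x) (\<xi> (r (Suc j)) x) \<le> enn2real (S x)"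
        by (simp add: \<delta>_def)
    qed
  qed
  \<comment> \<open>Off the convergence set the zero vector of the fiber is taken: its inner
    products vanish, so those of \<open>\<eta>\<close> are everywhere limits of inner products
    multiplied by an indicator, hence measurable.\<close>
  define \<eta> where "\<eta> x = (if x \<in> G then SOME l. l \<in> hcarrier (Hx x) \<and> (\<lambda>j. hdist2 (Hx x) (\<xi> (r j) x) l) \<longlonglongrightarrow> 0
      else hscale (Hx x) 0 (\<xi> 0 x))" for x
  have \<eta>G: "\<eta> x \<in> hcarrier (Hx x)" "(\<lambda>j. hdist2 (Hx x) (\<xi> (r j) x) (\<eta> x)) \<longlonglongrightarrow> 0" if x: "x \<in> G" for x
    using someI_ex[OF lim[OF x, unfolded Bex_def]] x unfolding \<eta>_def by auto
  have \<eta>c: "\<eta> x \<in> hcarrier (Hx x)" for x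
    using \<eta>G[of x] c by (cases "x \<in> G") (auto simp: \<eta>_def)
  have range: "range (\<lambda>j. \<xi> (r j) x) \<subseteq> hcarrier (Hx x)" for x using c by auto
  have "(\<lambda>x. hinner (Hx x) (\<eta> x) (e n x)) \<in> borel_measurable m" for n
  proof (rule borel_measurable_LIMSEQ_real)
    fix x
    show "(\<lambda>j. indicator {x. S x \<noteq> \<infinity>} x * hinner (Hx x) (\<xi> (r j) x) (e n x)) \<longlonglongrightarrow> hinner (Hx x) (\<eta> x) (e n x)"
    proof (cases "x \<in> G")
      case True
      then show ?thesis using Hx.tendsto_inner_left[OF range \<eta>c e_in \<eta>G(2)] by (simp add: G_def)
    next
      case False
      then show ?thesis using c e_in by (simp add: G_def \<eta>_def)
    qed
  next
    fix j
    have [measurable]: "(\<lambda>x. hinner (Hx x) (\<xi> (r j) x) (e n x)) \<in> borel_measurable m"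
      by (intro inner_measurable MS e_MS)
    show "(\<lambda>x. indicator {x. S x \<noteq> \<infinity>} x * hinner (Hx x) (\<xi> (r j) x) (e n x)) \<in> borel_measurable m"
      by measurable
  qed
  then have \<eta>MS: "\<eta> \<in> MSec" using \<eta>c by (simp add: measurable_sections_def)
  \<comment> \<open>One estimate serves twice: with bound 1 it puts \<open>\<eta>\<close> into the
    space, with small bounds it gives convergence of the whole sequence and not only of the
    subsequence \<open>r\<close>.\<close>
  have fatou: "(\<integral>\<^sup>+x. ennreal (hdist2 (Hx x) (\<xi> k x) (\<eta> x)) \<partial>m) \<le> ennreal \<epsilon>"
    if K: "\<And>i j. i \<ge> K \<Longrightarrow> j \<ge> K \<Longrightarrow> hdist2 DI (aecls (\<xi> i)) (aecls (\<xi> j)) < \<epsilon>" and k: "k \<ge> K" for k K \<epsilon>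
  proof -
    have "(\<integral>\<^sup>+x. ennreal (hdist2 (Hx x) (\<xi> k x) (\<eta> x)) \<partial>m)
        = (\<integral>\<^sup>+x. liminf (\<lambda>j. ennreal (hdist2 (Hx x) (\<xi> k x) (\<xi> (r j) x))) \<partial>m)"
    proof (rule nn_integral_cong_AE)
      show "AE x in m. ennreal (hdist2 (Hx x) (\<xi> k x) (\<eta> x)) = liminf (\<lambda>j. ennreal (hdist2 (Hx x) (\<xi> k x) (\<xi> (r j) x)))"
        using AE_S
      proof eventually_elim
        case (elim x)
        then have "x \<in> G" by (simp add: G_def)
        then have "(\<lambda>j. ennreal (hdist2 (Hx x) (\<xi> k x) (\<xi> (r j) x))) \<longlonglongrightarrow> ennreal (hdist2 (Hx x) (\<xi> k x) (\<eta> x))"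
          by (intro tendsto_ennrealI Hx.tendsto_hdist2[OF range \<eta>c c] \<eta>G(2))
        then show ?case by (simp add: lim_imp_Liminf)
      qed
    qed
    also have "\<dots> \<le> liminf (\<lambda>j. \<integral>\<^sup>+x. ennreal (hdist2 (Hx x) (\<xi> k x) (\<xi> (r j) x)) \<partial>m)"
      using hdist2_measurable[OF MS MS] by (intro nn_integral_liminf) measurable
    also have "\<dots> \<le> ennreal \<epsilon>"
    proof (rule Liminf_le)
      show "\<forall>\<^sub>F j in sequentially. (\<integral>\<^sup>+x. ennreal (hdist2 (Hx x) (\<xi> k x) (\<xi> (r j) x)) \<partial>m) \<le> ennreal \<epsilon>"
        using eventually_ge_at_top[of K]
      proof eventually_elim
        case (elim j)
        then show ?case using K[of k "r j"] k r_lim[of j] by (simp add: nn_hdist2_aecls[OF \<xi> \<xi>] ennreal_leI)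
      qed
    qed simp
    finally show ?thesis .
  qed
  have \<eta>L2: "\<eta> \<in> L2S"
  proof -
    obtain K where K: "\<And>i j. i \<ge> K \<Longrightarrow> j \<ge> K \<Longrightarrow> hdist2 DI (aecls (\<xi> i)) (aecls (\<xi> j)) < 1"
      using cauchy[of 1] by auto
    have "(\<integral>\<^sup>+x. ennreal (hdist2 (Hx x) (\<xi> K x) (\<eta> x)) \<partial>m) \<le> ennreal 1"
      by (rule fatou[OF K]) auto
    also have "ennreal 1 < \<infinity>" by simp
    finally have "(\<integral>\<^sup>+x. ennreal (hdist2 (Hx x) (\<xi> K x) (\<eta> x)) \<partial>m) < \<infinity>" .
    then have int: "integrable m (\<lambda>x. hdist2 (Hx x) (\<xi> K x) (\<eta> x))"
      using hdist2_measurable[OF MS \<eta>MS] Hx.hdist2_nonneg[OF c \<eta>c]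
      by (simp add: integrable_iff_bounded)
    have "integrable m (\<lambda>x. hinner (Hx x) (\<eta> x) (\<eta> x))"
    proof (rule Bochner_Integration.integrable_bound)
      show "integrable m (\<lambda>x. 2 * hdist2 (Hx x) (\<xi> K x) (\<eta> x) + 2 * hinner (Hx x) (\<xi> K x) (\<xi> K x))"
        using int \<xi>[of K] by (simp add: L2S_iff)
      show "AE x in m. norm (hinner (Hx x) (\<eta> x) (\<eta> x))
          \<le> norm (2 * hdist2 (Hx x) (\<xi> K x) (\<eta> x) + 2 * hinner (Hx x) (\<xi> K x) (\<xi> K x))"
      proof (intro always_eventually allI)
        fix x
        \<comment> \<open>The squared norm of \<open>\<eta> - 2 \<xi>\<close> is exactly the gap in
          the estimate derived from it.\<close>
        let ?v = "hadd (Hx x) (\<eta> x) (hscale (Hx x) (-2) (\<xi> K x))"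
        have "0 \<le> hinner (Hx x) ?v ?v" by (intro Hx.inner_nonneg Hx.add_closed Hx.scale_closed c \<eta>c)
        then have "hinner (Hx x) (\<eta> x) (\<eta> x) \<le> 2 * hdist2 (Hx x) (\<xi> K x) (\<eta> x) + 2 * hinner (Hx x) (\<xi> K x) (\<xi> K x)"
          using c[of K x] \<eta>c[of x] by (simp add: hdist2_def Hx.inner_commute[OF \<eta>c c])
        then show "norm (hinner (Hx x) (\<eta> x) (\<eta> x))
          \<le> norm (2 * hdist2 (Hx x) (\<xi> K x) (\<eta> x) + 2 * hinner (Hx x) (\<xi> K x) (\<xi> K x))"
          using Hx.inner_nonneg[OF \<eta>c, of x] by simp
      qed
    qed (intro norm2_measurable \<eta>MS)
    then show ?thesis using \<eta>MS by (simp add: L2S_iff)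
  qed
  have "(\<lambda>n. hdist2 DI (aecls (\<xi> n)) (aecls \<eta>)) \<longlonglongrightarrow> 0"
  proof (rule LIMSEQ_I)
    fix \<epsilon> :: real assume \<epsilon>: "\<epsilon> > 0"
    then obtain K where K: "\<And>i j. i \<ge> K \<Longrightarrow> j \<ge> K \<Longrightarrow> hdist2 DI (aecls (\<xi> i)) (aecls (\<xi> j)) < \<epsilon> / 2"
      using cauchy[of "\<epsilon> / 2"] by auto
    have "norm (hdist2 DI (aecls (\<xi> n)) (aecls \<eta>) - 0) < \<epsilon>" if n: "n \<ge> K" for n
    proof -
      have "ennreal (hdist2 DI (aecls (\<xi> n)) (aecls \<eta>)) \<le> ennreal (\<epsilon> / 2)"
        using fatou[OF K n] by (simp add: nn_hdist2_aecls[OF \<xi> \<eta>L2])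
      then have "hdist2 DI (aecls (\<xi> n)) (aecls \<eta>) \<le> \<epsilon> / 2" using \<epsilon> by (simp add: ennreal_le_iff)
      moreover have "0 \<le> hdist2 DI (aecls (\<xi> n)) (aecls \<eta>)" by (intro DI.hdist2_nonneg aecls_in \<xi> \<eta>L2)
      ultimately show ?thesis using \<epsilon> by simp
    qed
    then show "\<exists>K. \<forall>n\<ge>K. norm (hdist2 DI (aecls (\<xi> n)) (aecls \<eta>) - 0) < \<epsilon>" by blast
  qed
  then show ?thesis using \<eta>L2 by blast
qed

lemma hilbert_space_DI: "hilbert_space DI"
proof unfold_locales
  fix P Q assume PQ: "P \<in> hcarrier DI" "Q \<in> hcarrier DI" "hdist2 DI P Q = 0"
  then obtain \<xi> \<zeta> where \<xi>: "\<xi> \<in> L2S" "\<zeta> \<in> L2S" "P = aecls \<xi>" "Q = aecls \<zeta>" by (metis carrier_DI_E)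
  have c: "\<xi> t \<in> hcarrier (Hx t)" "\<zeta> t \<in> hcarrier (Hx t)" for t using \<xi> L2S_in by auto
  have "(\<integral>t. hdist2 (Hx t) (\<xi> t) (\<zeta> t) \<partial>m) = 0" using PQ(3) \<xi> hdist2_aecls by simp
  then have "AE t in m. hdist2 (Hx t) (\<xi> t) (\<zeta> t) = 0"
    using integral_nonneg_eq_0_iff_AE[OF hdist2_integrable[OF \<xi>(1,2)]] Hx.hdist2_nonneg[OF c] by simp
  then have "AE t in m. \<xi> t = \<zeta> t" by eventually_elim (use Hx.separated c in blast)
  then have "(\<xi>, \<zeta>) \<in> ae_rel m Hx e" using \<xi> by (simp add: ae_rel_def)
  then show "P = Q" unfolding \<xi> by (rule equiv_class_eq[OF equiv_ae_rel])
next
  fix P :: "nat \<Rightarrow> ('x \<Rightarrow> 'h) set" assume P: "range P \<subseteq> hcarrier DI" "hcauchy DI P"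
  have "\<exists>\<xi>\<in>L2S. P n = aecls \<xi>" for n using P(1) carrier_DI_E[of "P n"] by (metis range_subsetD)
  then obtain \<xi> where \<xi>: "\<And>n. \<xi> n \<in> L2S" "\<And>n. P n = aecls (\<xi> n)" by metis
  have "\<exists>\<eta>\<in>L2S. (\<lambda>n. hdist2 DI (aecls (\<xi> n)) (aecls \<eta>)) \<longlonglongrightarrow> 0"
    using P(2) unfolding hcauchy_def \<xi>(2) by (intro L2S_complete \<xi>(1)) blast
  then show "\<exists>l\<in>hcarrier DI. (\<lambda>n. hdist2 DI (P n) l) \<longlonglongrightarrow> 0" unfolding \<xi>(2) by blast
qed

end

section \<open>Forms on tensor products of function spaces\<close>

lemma fun_subspace_zero: "fun_subspace V \<Longrightarrow> (\<lambda>_. 0) \<in> V"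
  and fun_subspace_add: "fun_subspace V \<Longrightarrow> u \<in> V \<Longrightarrow> v \<in> V \<Longrightarrow> (\<lambda>x. u x + v x) \<in> V"
  and fun_subspace_scale: "fun_subspace V \<Longrightarrow> u \<in> V \<Longrightarrow> (\<lambda>x. c * u x) \<in> V"
  by (auto simp: fun_subspace_def)

lemma fun_subspace_diff: "fun_subspace V \<Longrightarrow> u \<in> V \<Longrightarrow> v \<in> V \<Longrightarrow> (\<lambda>x. u x - v x) \<in> V"
  using fun_subspace_add[of V u "\<lambda>x. (-1) * v x"] fun_subspace_scale[of V v "-1"] by simp

lemma fun_subspace_list_sum:
  assumes "fun_subspace V" "\<And>a b. (a, b) \<in> set ps \<Longrightarrow> a \<in> V"
  shows "(\<lambda>x. \<Sum>(a, b)\<leftarrow>ps. c b * a x) \<in> V"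
  using assms(2)
proof (induction ps)
  case Nil
  then show ?case using assms(1) by (simp add: fun_subspace_def)
next
  case (Cons p ps)
  obtain a b where p: "p = (a, b)" by force
  have "a \<in> V" using Cons.prems p by auto
  then have "(\<lambda>x. c b * a x) \<in> V" by (rule fun_subspace_scale[OF assms(1)])
  moreover have "(\<lambda>x. \<Sum>(a, b)\<leftarrow>ps. c b * a x) \<in> V" using Cons.prems by (intro Cons.IH) auto
  ultimately have "(\<lambda>x. c b * a x + (\<Sum>(a, b)\<leftarrow>ps. c b * a x)) \<in> V"
    by (rule fun_subspace_add[OF assms(1)])
  then show ?case by (simp add: p)
qed

text \<open>The coefficient is a function of the second factor, so that one statement serves both
  for evaluating second factors at a point, as in the fibers, and for eliminating a summand from a
  tensor.\<close>

lemma linear_on_list_sum: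
  assumes V: "fun_subspace V"
    and add: "\<And>u v. u \<in> V \<Longrightarrow> v \<in> V \<Longrightarrow> l (\<lambda>x. u x + v x) = l u + (l v :: real)"
    and scale: "\<And>c u. u \<in> V \<Longrightarrow> l (\<lambda>x. c * u x) = c * l u"
    and ps: "\<And>a b. (a, b) \<in> set ps \<Longrightarrow> a \<in> V"
  shows "l (\<lambda>x. \<Sum>(a, b)\<leftarrow>ps. c b * a x) = (\<Sum>(a, b)\<leftarrow>ps. c b * l a)"
  using ps
proof (induction ps)
  case Nil
  have "(\<lambda>_. 0) \<in> V" using V by (simp add: fun_subspace_def)
  from scale[OF this, of 0] show ?case by simp
next
  case (Cons p ps)
  obtain a b where p: "p = (a, b)" by force
  have a: "a \<in> V" using Cons.prems p by auto
  then have "(\<lambda>x. c b * a x) \<in> V" by (rule fun_subspace_scale[OF V])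
  moreover have "(\<lambda>x. \<Sum>(a, b)\<leftarrow>ps. c b * a x) \<in> V"
    using Cons.prems by (intro fun_subspace_list_sum V) auto
  moreover have "l (\<lambda>x. \<Sum>(a, b)\<leftarrow>ps. c b * a x) = (\<Sum>(a, b)\<leftarrow>ps. c b * l a)"
    using Cons.prems by (intro Cons.IH) auto
  ultimately show ?case by (simp add: p add scale a)
qed

definition bilinear_pair ::
  "('x \<Rightarrow> real) set \<Rightarrow> ('y \<Rightarrow> real) set \<Rightarrow> (('x \<Rightarrow> real) \<Rightarrow> ('y \<Rightarrow> real) \<Rightarrow> real) \<Rightarrow> bool" where
  "bilinear_pair S T q \<longleftrightarrow>
     (\<forall>a\<in>S. \<forall>a'\<in>S. \<forall>b\<in>T. q (\<lambda>x. a x + a' x) b = q a b + q a' b)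
     \<and> (\<forall>c. \<forall>a\<in>S. \<forall>b\<in>T. q (\<lambda>x. c * a x) b = c * q a b)
     \<and> (\<forall>a\<in>S. \<forall>b\<in>T. \<forall>b'\<in>T. q a (\<lambda>y. b y + b' y) = q a b + q a b')
     \<and> (\<forall>c. \<forall>a\<in>S. \<forall>b\<in>T. q a (\<lambda>y. c * b y) = c * q a b)"

lemma bilinear_pairD:
  assumes "bilinear_pair S T q"
  shows "\<And>a a' b. a \<in> S \<Longrightarrow> a' \<in> S \<Longrightarrow> b \<in> T \<Longrightarrow> q (\<lambda>x. a x + a' x) b = q a b + q a' b"
    and "\<And>c a b. a \<in> S \<Longrightarrow> b \<in> T \<Longrightarrow> q (\<lambda>x. c * a x) b = c * q a b"
    and "\<And>a b b'. a \<in> S \<Longrightarrow> b \<in> T \<Longrightarrow> b' \<in> T \<Longrightarrow> q a (\<lambda>y. b y + b' y) = q a b + q a b'"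
    and "\<And>c a b. a \<in> S \<Longrightarrow> b \<in> T \<Longrightarrow> q a (\<lambda>y. c * b y) = c * q a b"
  using assms by (auto simp: bilinear_pair_def)

lemma tensor_sum_Nil [simp]: "tensor_sum [] = (\<lambda>_. 0)"
  by (simp add: tensor_sum_def)

lemma tensor_sum_Cons: "tensor_sum ((a, b) # ps) = (\<lambda>z. tensor a b z + tensor_sum ps z)"
  by (simp add: tensor_sum_def)

lemma tensor_sum_append: "tensor_sum (ps @ qs) = (\<lambda>z. tensor_sum ps z + tensor_sum qs z)"
  by (simp add: tensor_sum_def)

lemma tensor_sum_apply: "tensor_sum ps (x, y) = (\<Sum>(a, b)\<leftarrow>ps. a x * b y)"
  by (simp add: tensor_sum_def tensor_def)

lemma tensor_sum_scale: "tensor_sum (map (\<lambda>(a, b). (\<lambda>x. c * a x, b)) ps) = (\<lambda>z. c * tensor_sum ps z)"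
proof (induction ps)
  case (Cons p ps)
  then show ?case by (cases p) (auto simp: tensor_sum_Cons tensor_def fun_eq_iff algebra_simps)
qed simp

text \<open>The head \<open>a \<otimes> b\<close> is eliminated by evaluating the second factor at a point \<open>y\<^sub>0\<close> with
  \<open>b y\<^sub>0 \<noteq> 0\<close>: this expresses \<open>a\<close> through the remaining first factors.\<close>

lemma tensor_sum_zero_imp_sum_zero:
  assumes S: "fun_subspace S" and T: "fun_subspace T" and q: "bilinear_pair S T q"
    and "set ps \<subseteq> S \<times> T" "tensor_sum ps = (\<lambda>_. 0)"
  shows "(\<Sum>(a, b)\<leftarrow>ps. q a b) = 0"
  using assms(4,5)
proof (induction "length ps" arbitrary: ps)
  case (Suc n)
  then obtain a b ps' where ps: "ps = (a, b) # ps'" by (metis length_Suc_conv surj_pair)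
  have ab: "a \<in> S" "b \<in> T" and ps': "set ps' \<subseteq> S \<times> T" "length ps' = n" using Suc ps by auto
  have zero: "a x * b y + (\<Sum>(a', b')\<leftarrow>ps'. a' x * b' y) = 0" for x y
    using Suc.prems(2) fun_cong[of _ _ "(x, y)"] tensor_sum_apply[of ps x y] unfolding ps by fastforce
  show ?case
  proof (cases "\<forall>y. b y = 0")
    case True
    then have b0: "b = (\<lambda>y. 0 * b y)" by auto
    have "q a b = 0" using bilinear_pairD(4)[OF q ab, of 0] b0 by simp
    moreover have "tensor_sum ps' = (\<lambda>_. 0)" using zero True by (auto simp: tensor_sum_apply fun_eq_iff)
    ultimately show ?thesis using Suc.hyps(1)[OF ps'(2)[symmetric] ps'(1)] by (simp add: ps)
  next
    case False
    then obtain y0 where y0: "b y0 \<noteq> 0" by auto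
    \<comment> \<open>Evaluating \<open>zero\<close> at \<open>y0\<close> and solving for
      \<open>a\<close> gives these coefficients. Inserting them distributes the head over the
      remaining summands, so \<open>ps''\<close> is shorter by one, and \<open>q\<close> follows the
      same substitution by bilinearity.\<close>
    define k where "k b' = - (b' y0 / b y0)" for b'
    define ps'' where "ps'' = map (\<lambda>(a', b'). (a', \<lambda>y. b' y + k b' * b y)) ps'"
    have sub'': "set ps'' \<subseteq> S \<times> T" using ps'(1) ab T unfolding ps''_def by (auto simp: fun_subspace_def)
    have ka: "(\<lambda>x. \<Sum>(a', b')\<leftarrow>ps'. k b' * a' x) = a"
    proof
      fix x
      have "(\<Sum>(a', b')\<leftarrow>ps'. k b' * a' x) = - (1 / b y0) * (\<Sum>(a', b')\<leftarrow>ps'. a' x * b' y0)"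
        unfolding k_def by (induction ps') (auto simp: divide_inverse algebra_simps)
      also have "(\<Sum>(a', b')\<leftarrow>ps'. a' x * b' y0) = - (a x * b y0)" using zero[of x y0] by simp
      finally show "(\<Sum>(a', b')\<leftarrow>ps'. k b' * a' x) = a x" using y0 by simp
    qed
    have "tensor_sum ps'' = (\<lambda>_. 0)"
    proof
      fix z :: "'a \<times> 'b"
      obtain x y where z: "z = (x, y)" by force
      have "tensor_sum ps'' (x, y) = (\<Sum>(a', b')\<leftarrow>ps'. a' x * b' y) + (\<Sum>(a', b')\<leftarrow>ps'. k b' * a' x) * b y"
        unfolding tensor_sum_apply ps''_def by (induction ps') (auto simp: algebra_simps)
      also have "\<dots> = 0" using zero[of x y] fun_cong[OF ka, of x] by simp
      finally show "tensor_sum ps'' z = 0" by (simp add: z)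
    qed
    then have "(\<Sum>(a, b)\<leftarrow>ps''. q a b) = 0"
      using Suc.hyps(1)[of ps''] ps'(2) sub'' by (simp add: ps''_def)
    moreover have "(\<Sum>(a, b)\<leftarrow>ps''. q a b) = (\<Sum>(a', b')\<leftarrow>ps'. q a' b') + (\<Sum>(a', b')\<leftarrow>ps'. k b' * q a' b)"
      using ps'(1) unfolding ps''_def
    proof (induction ps')
      case (Cons p ps')
      obtain a' b' where p: "p = (a', b')" by force
      have "a' \<in> S" "b' \<in> T" "(\<lambda>y. k b' * b y) \<in> T" using Cons.prems p ab T by (auto simp: fun_subspace_def)
      then have "q a' (\<lambda>y. b' y + k b' * b y) = q a' b' + k b' * q a' b"
        using ab by (simp add: bilinear_pairD[OF q])
      then show ?case using Cons by (simp add: p)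
    qed simp
    moreover have "q (\<lambda>x. \<Sum>(a', b')\<leftarrow>ps'. k b' * a' x) b = (\<Sum>(a', b')\<leftarrow>ps'. k b' * q a' b)"
      using ps'(1) ab by (intro linear_on_list_sum[OF S, of "\<lambda>a. q a b"]) (auto simp: bilinear_pairD[OF q])
    ultimately show ?thesis unfolding ka by (simp add: ps)
  qed
qed simp

lemma sum_list_cong_tensor_sum:
  assumes S: "fun_subspace S" and T: "fun_subspace T" and q: "bilinear_pair S T q"
    and ps: "set ps \<subseteq> S \<times> T" "set ps' \<subseteq> S \<times> T" "tensor_sum ps = tensor_sum ps'"
  shows "(\<Sum>(a, b)\<leftarrow>ps. q a b) = (\<Sum>(a, b)\<leftarrow>ps'. q a b)"
proof -
  define ns where "ns = map (\<lambda>(a, b). (\<lambda>x. (-1) * a x, b)) ps'"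
  have ns: "set (ps @ ns) \<subseteq> S \<times> T"
    using ps fun_subspace_scale[OF S, where c = "-1"] unfolding ns_def by auto
  have "tensor_sum (ps @ ns) = (\<lambda>_. 0)"
    unfolding tensor_sum_append ns_def tensor_sum_scale ps(3) by simp
  from tensor_sum_zero_imp_sum_zero[OF S T q ns this]
  have "(\<Sum>(a, b)\<leftarrow>ps. q a b) + (\<Sum>(a, b)\<leftarrow>ns. q a b) = 0" by simp
  moreover have "(\<Sum>(a, b)\<leftarrow>ns. q a b) = - (\<Sum>(a, b)\<leftarrow>ps'. q a b)"
    using ps(2) unfolding ns_def
  proof (induction ps')
    case (Cons p ps')
    obtain a b where p: "p = (a, b)" by force
    have "q (\<lambda>x. (-1) * a x) b = (-1) * q a b" using Cons.prems p by (intro bilinear_pairD(2)[OF q]) auto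
    then show ?case using Cons by (simp add: p)
  qed simp
  ultimately show ?thesis by simp
qed

text \<open>Positivity is demanded for arbitrary lists, that is, on the whole tensor space; on
  elementary tensors alone it would say less. By symmetry, bilinearity in the first pair of
  arguments yields that in the second.\<close>

locale tensor_bilinear =
  fixes S :: "('x \<Rightarrow> real) set" and T :: "('y \<Rightarrow> real) set" and q
  assumes S: "fun_subspace S" and T: "fun_subspace T"
    and left: "c \<in> S \<Longrightarrow> d \<in> T \<Longrightarrow> bilinear_pair S T (\<lambda>a b. q a b c d)"
    and sym: "a \<in> S \<Longrightarrow> b \<in> T \<Longrightarrow> c \<in> S \<Longrightarrow> d \<in> T \<Longrightarrow> q a b c d = q c d a b"
    and nonneg: "set ps \<subseteq> S \<times> T \<Longrightarrow> 0 \<le> (\<Sum>(a, b)\<leftarrow>ps. \<Sum>(c, d)\<leftarrow>ps. q a b c d)"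
begin

lemma right: "a \<in> S \<Longrightarrow> b \<in> T \<Longrightarrow> bilinear_pair S T (\<lambda>c d. q a b c d)"
  using left[of a b] S T unfolding bilinear_pair_def fun_subspace_def by (simp add: sym[of a b])

lemma sum_cong_right:
  assumes "set qs \<subseteq> S \<times> T" "set qs' \<subseteq> S \<times> T" "tensor_sum qs = tensor_sum qs'" "a \<in> S" "b \<in> T"
  shows "(\<Sum>(c, d)\<leftarrow>qs. q a b c d) = (\<Sum>(c, d)\<leftarrow>qs'. q a b c d)"
  using sum_list_cong_tensor_sum[OF S T right[OF assms(4,5)] assms(1-3)] .

lemma sum_bilinear_left:
  assumes "set qs \<subseteq> S \<times> T"
  shows "bilinear_pair S T (\<lambda>a b. \<Sum>(c, d)\<leftarrow>qs. q a b c d)"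
  using assms
proof (induction qs)
  case Nil
  then show ?case by (simp add: bilinear_pair_def)
next
  case (Cons p qs)
  obtain c d where p: "p = (c, d)" by force
  have "bilinear_pair S T (\<lambda>a b. q a b c d)" using Cons.prems p by (intro left) auto
  moreover have "bilinear_pair S T (\<lambda>a b. \<Sum>(c, d)\<leftarrow>qs. q a b c d)" using Cons by simp
  ultimately show ?case unfolding bilinear_pair_def p by (auto simp: algebra_simps)
qed

abbreviation "tspace \<equiv> tensor_space S T"
abbreviation "tform \<equiv> tensor_form S T q"

text \<open>The description by \<open>THE\<close> is meaningful because the double sum depends on
  the two tensors and not on the lists. One list is exchanged at a time, the other being fixed, so
  that each exchange concerns a form that is bilinear in one pair.\<close>

lemma tensor_form_sum:
  assumes ps: "set ps \<subseteq> S \<times> T" and qs: "set qs \<subseteq> S \<times> T"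
  shows "tform (tensor_sum ps) (tensor_sum qs) = (\<Sum>(a, b)\<leftarrow>ps. \<Sum>(c, d)\<leftarrow>qs. q a b c d)"
  unfolding tensor_form_def
proof (rule the_equality)
  show "\<exists>ps' qs'. set ps' \<subseteq> S \<times> T \<and> set qs' \<subseteq> S \<times> T \<and> tensor_sum ps = tensor_sum ps' \<and> tensor_sum qs = tensor_sum qs'
      \<and> (\<Sum>(a, b)\<leftarrow>ps. \<Sum>(c, d)\<leftarrow>qs. q a b c d) = (\<Sum>(a, b)\<leftarrow>ps'. \<Sum>(c, d)\<leftarrow>qs'. q a b c d)"
    using assms by blast
next
  fix r
  assume "\<exists>ps' qs'. set ps' \<subseteq> S \<times> T \<and> set qs' \<subseteq> S \<times> T \<and> tensor_sum ps = tensor_sum ps' \<and> tensor_sum qs = tensor_sum qs'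
      \<and> r = (\<Sum>(a, b)\<leftarrow>ps'. \<Sum>(c, d)\<leftarrow>qs'. q a b c d)"
  then obtain ps' qs' where r: "r = (\<Sum>(a, b)\<leftarrow>ps'. \<Sum>(c, d)\<leftarrow>qs'. q a b c d)"
    and ps': "set ps' \<subseteq> S \<times> T" "tensor_sum ps = tensor_sum ps'"
    and qs': "set qs' \<subseteq> S \<times> T" "tensor_sum qs = tensor_sum qs'" by blast
  have "r = (\<Sum>(a, b)\<leftarrow>ps'. \<Sum>(c, d)\<leftarrow>qs. q a b c d)"
    unfolding r using ps'(1) sum_cong_right[OF qs'(1) qs qs'(2)[symmetric]]
    by (intro arg_cong[where f = sum_list] map_cong) auto
  also have "\<dots> = (\<Sum>(a, b)\<leftarrow>ps. \<Sum>(c, d)\<leftarrow>qs. q a b c d)"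
    by (rule sum_list_cong_tensor_sum[OF S T sum_bilinear_left[OF qs] ps'(1) ps ps'(2)[symmetric]])
  finally show "r = (\<Sum>(a, b)\<leftarrow>ps. \<Sum>(c, d)\<leftarrow>qs. q a b c d)" .
qed

lemma tspace_E:
  assumes "v \<in> tspace"
  obtains ps where "set ps \<subseteq> S \<times> T" "v = tensor_sum ps"
  using assms by (auto simp: tensor_space_def)

lemma tensor_sum_in: "set ps \<subseteq> S \<times> T \<Longrightarrow> tensor_sum ps \<in> tspace"
  by (auto simp: tensor_space_def)

lemma tensor_eq_sum: "tensor a b = tensor_sum [(a, b)]"
  by (simp add: tensor_sum_Cons)

lemma tensor_in [simp, intro]: "a \<in> S \<Longrightarrow> b \<in> T \<Longrightarrow> tensor a b \<in> tspace"
  unfolding tensor_eq_sum by (rule tensor_sum_in) auto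

lemma tensor_form_tensor:
  assumes "a \<in> S" "b \<in> T" "c \<in> S" "d \<in> T"
  shows "tform (tensor a b) (tensor c d) = q a b c d"
  using assms unfolding tensor_eq_sum by (subst tensor_form_sum) auto

lemma subspace_tspace: "fun_subspace tspace"
  unfolding fun_subspace_def
proof (intro conjI ballI allI)
  show "(\<lambda>_. 0) \<in> tspace" using tensor_sum_in[of "[]"] by simp
next
  fix u v assume "u \<in> tspace" "v \<in> tspace"
  then obtain ps qs where "set ps \<subseteq> S \<times> T" "u = tensor_sum ps" "set qs \<subseteq> S \<times> T" "v = tensor_sum qs"
    by (metis tspace_E)
  then show "(\<lambda>z. u z + v z) \<in> tspace" using tensor_sum_in[of "ps @ qs"] by (simp add: tensor_sum_append)
next
  fix c u assume "u \<in> tspace"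
  then obtain ps where "set ps \<subseteq> S \<times> T" "u = tensor_sum ps" by (metis tspace_E)
  then show "(\<lambda>z. c * u z) \<in> tspace"
    using tensor_sum_in[of "map (\<lambda>(a, b). (\<lambda>x. c * a x, b)) ps"] fun_subspace_scale[OF S]
    by (force simp: tensor_sum_scale)
qed

lemma tform_sym:
  assumes "u \<in> tspace" "v \<in> tspace"
  shows "tform u v = tform v u"
proof -
  obtain ps qs where uv: "set ps \<subseteq> S \<times> T" "u = tensor_sum ps" "set qs \<subseteq> S \<times> T" "v = tensor_sum qs"
    using assms by (metis tspace_E)
  have "(\<Sum>(a, b)\<leftarrow>ps. \<Sum>(c, d)\<leftarrow>qs. q a b c d) = (\<Sum>(c, d)\<leftarrow>qs. \<Sum>(a, b)\<leftarrow>ps. q c d a b)"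
    using uv(1)
  proof (induction ps)
    case (Cons p ps)
    obtain a b where p: "p = (a, b)" by force
    have "(\<Sum>(c, d)\<leftarrow>qs. q a b c d) = (\<Sum>(c, d)\<leftarrow>qs. q c d a b)"
      using uv(3) Cons.prems p by (intro arg_cong[where f = sum_list] map_cong) (auto intro!: sym)
    then show ?case using Cons by (simp add: p split_def sum_list_addf)
  qed (simp add: split_def)
  then show ?thesis using uv by (simp add: tensor_form_sum)
qed

lemma tform_left:
  assumes "u \<in> tspace" "v \<in> tspace" "w \<in> tspace"
  shows "tform (\<lambda>z. u z + v z) w = tform u w + tform v w" "tform (\<lambda>z. c * u z) w = c * tform u w"
proof -
  obtain ps qs rs where uv: "set ps \<subseteq> S \<times> T" "u = tensor_sum ps" "set qs \<subseteq> S \<times> T" "v = tensor_sum qs"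
    "set rs \<subseteq> S \<times> T" "w = tensor_sum rs"
    using assms by (metis tspace_E)
  show "tform (\<lambda>z. u z + v z) w = tform u w + tform v w"
    using uv by (simp add: tensor_form_sum tensor_sum_append[symmetric])
  let ?ps = "map (\<lambda>(a, b). (\<lambda>x. c * a x, b)) ps"
  have "set ?ps \<subseteq> S \<times> T" using uv(1) S by (auto simp: fun_subspace_def)
  then have "tform (\<lambda>z. c * u z) w = (\<Sum>(a, b)\<leftarrow>?ps. \<Sum>(c, d)\<leftarrow>rs. q a b c d)"
    using uv by (simp add: tensor_form_sum tensor_sum_scale[symmetric])
  also have "\<dots> = c * (\<Sum>(a, b)\<leftarrow>ps. \<Sum>(c, d)\<leftarrow>rs. q a b c d)"
    using uv(1)
  proof (induction ps)
    case (Cons p ps)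
    obtain a b where p: "p = (a, b)" by force
    have "(\<Sum>(e, d)\<leftarrow>rs. q (\<lambda>x. c * a x) b e d) = c * (\<Sum>(e, d)\<leftarrow>rs. q a b e d)"
      using Cons.prems p by (intro bilinear_pairD(2)[OF sum_bilinear_left[OF uv(5)]]) auto
    then show ?case using Cons by (simp add: p algebra_simps)
  qed simp
  finally show "tform (\<lambda>z. c * u z) w = c * tform u w" using uv by (simp add: tensor_form_sum)
qed

lemma semi_inner_tensor: "semi_inner_space (fun_hspace tspace tform)"
proof (rule semi_inner_space_fun_hspace[OF subspace_tspace])
  show "bilinear_form_on tspace tform"
    unfolding bilinear_form_on_def
    using tform_left tform_sym subspace_tspace unfolding fun_subspace_def by (metis (no_types, lifting))
  show "tform u v = tform v u" if "u \<in> tspace" "v \<in> tspace" for u v using tform_sym that .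
  show "0 \<le> tform u u" if "u \<in> tspace" for u
    using that by (auto elim!: tspace_E simp: tensor_form_sum nonneg)
qed

sublocale fun_semi_inner tspace tform by (rule fun_semi_inner.intro[OF semi_inner_tensor])

lemma total_tensor:
  assumes P: "P \<in> hcarrier HC"
    and 0: "\<And>a b. a \<in> S \<Longrightarrow> b \<in> T \<Longrightarrow> hinner HC P (completion_class tspace tform (tensor a b)) = 0"
  shows "hinner HC P P = 0"
proof (rule completion_total[OF P])
  fix v assume "v \<in> tspace"
  then obtain ps where ps: "set ps \<subseteq> S \<times> T" "v = tensor_sum ps" by (metis tspace_E)
  have "hinner HC P (completion_class tspace tform (tensor_sum ps)) = 0"
    using ps(1)
  proof (induction ps)
    case Nil
    obtain u where u: "u \<in> cauchy_seqs tspace tform" "P = cls u" using P by (metis carrier_HC_E)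
    have z: "(\<lambda>_. 0) \<in> tspace" using subspace_tspace by (simp add: fun_subspace_def)
    have "tform (u n) (\<lambda>_. 0) = 0" for n
      using S.inner_scale_right[of "\<lambda>_. 0" "u n" 0] z cauchy_seqs_in[OF u(1)] by simp
    then show ?case using tendsto_inner_completion_class[OF u(1) z] u(2)
      by (simp add: LIMSEQ_const_iff)
  next
    case (Cons p ps)
    obtain a b where p: "p = (a, b)" by force
    have ab: "a \<in> S" "b \<in> T" and ts: "tensor_sum ps \<in> tspace" using Cons.prems p tensor_sum_in by auto
    have "hadd HC (completion_class tspace tform (tensor a b)) (completion_class tspace tform (tensor_sum ps))
        = completion_class tspace tform (tensor_sum (p # ps))"
      unfolding completion_class_def p tensor_sum_Cons using ab ts by (intro hadd_cls const_cauchy) auto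
    moreover have "hinner HC P (hadd HC (completion_class tspace tform (tensor a b)) (completion_class tspace tform (tensor_sum ps))) = 0"
      using Cons 0[OF ab] P ab ts by simp
    ultimately show ?case by simp
  qed
  then show "hinner HC P (completion_class tspace tform v) = 0" by (simp add: ps)
qed

end

section \<open>Fibers\<close>

lemma subspace_fun_span: "fun_subspace (fun_span V)"
  unfolding fun_span_def by (rule hull_in) (auto simp: fun_subspace_def)

lemma fun_span_superset: "V \<subseteq> fun_span V"
  unfolding fun_span_def by (rule hull_subset)

lemma fun_span_minimal: "V \<subseteq> W \<Longrightarrow> fun_subspace W \<Longrightarrow> fun_span V \<subseteq> W"
  unfolding fun_span_def by (rule hull_minimal)

lemma fun_span_range:
  assumes "u \<in> fun_span (range f)"
  obtains N :: nat and c where "u = (\<lambda>y. \<Sum>i\<le>N. c i * f i y)"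
proof -
  \<comment> \<open>Coefficients vanish beyond \<open>N\<close>, so two combinations can be brought
    to a common length before they are added.\<close>
  let ?W = "{u. \<exists>N (c :: nat \<Rightarrow> real). (\<forall>i>N. c i = 0) \<and> u = (\<lambda>y. \<Sum>i\<le>N. c i * f i y)}"
  have "fun_subspace ?W"
    unfolding fun_subspace_def
  proof (intro conjI ballI allI)
    show "(\<lambda>_. 0) \<in> ?W" by (auto intro!: exI[of _ "\<lambda>_. 0"])
  next
    fix u v assume "u \<in> ?W" "v \<in> ?W"
    then obtain N c M d where u: "\<forall>i>N. c i = 0" "u = (\<lambda>y. \<Sum>i\<le>N. c i * f i y)"
      and v: "\<forall>i>M. d i = 0" "v = (\<lambda>y. \<Sum>i\<le>M. d i * f i y)" by auto
    have "u = (\<lambda>y. \<Sum>i\<le>max N M. c i * f i y)" unfolding u(2)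
      using u(1) by (intro ext sum.mono_neutral_left) auto
    moreover have "v = (\<lambda>y. \<Sum>i\<le>max N M. d i * f i y)" unfolding v(2)
      using v(1) by (intro ext sum.mono_neutral_left) auto
    ultimately show "(\<lambda>x. u x + v x) \<in> ?W" using u(1) v(1)
      by (auto intro!: exI[of _ "max N M"] exI[of _ "\<lambda>i. c i + d i"] simp: algebra_simps sum.distrib)
  next
    fix k u assume "u \<in> ?W"
    then show "(\<lambda>x. k * u x) \<in> ?W"
      by (force simp: sum_distrib_left mult.assoc intro!: exI[of _ "\<lambda>i. k * _ i"])
  qed
  moreover have "range f \<subseteq> ?W"
  proof safe
    fix n
    have "f n y = (\<Sum>i\<le>n. (if i = n then 1 else 0) * f i y)" for y
      using sum.delta[of "{..n}" n "\<lambda>i. f i y"] by (simp add: if_distrib[of "\<lambda>t. t * _"] cong: if_cong)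
    then show "\<exists>N c. (\<forall>i>N. c i = 0) \<and> f n = (\<lambda>y. \<Sum>i\<le>N. c i * f i y)"
      by (intro exI[of _ n] exI[of _ "\<lambda>i. if i = n then 1 else 0"]) auto
  qed
  ultimately have "u \<in> ?W" using assms fun_span_minimal by blast
  then show ?thesis using that by blast
qed

lemma bounded_borelI:
  "f \<in> borel_measurable borel \<Longrightarrow> (\<And>x. \<bar>f x\<bar> \<le> B) \<Longrightarrow> f \<in> bounded_borel"
  unfolding bounded_borel_def by (auto simp: bounded_iff)

lemma bounded_borelE:
  assumes "f \<in> bounded_borel"
  obtains B where "f \<in> borel_measurable borel" "\<And>x. \<bar>f x\<bar> \<le> B" "B \<ge> 0"
proof -
  from assms obtain B where B: "\<And>x. \<bar>f x\<bar> \<le> B" by (auto simp: bounded_borel_def bounded_iff)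
  then have "B \<ge> 0" using abs_ge_zero order_trans by blast
  then show ?thesis using that B assms by (auto simp: bounded_borel_def)
qed

lemma bounded_borel_const [simp]: "(\<lambda>_. c) \<in> bounded_borel"
  by (rule bounded_borelI[of _ "\<bar>c\<bar>"]) auto

lemma bounded_borel_add:
  assumes "f \<in> bounded_borel" "g \<in> bounded_borel" shows "(\<lambda>x. f x + g x) \<in> bounded_borel"
proof -
  obtain B where B: "f \<in> borel_measurable borel" "\<And>x. \<bar>f x\<bar> \<le> B" using bounded_borelE[OF assms(1)] by metis
  obtain C where C: "g \<in> borel_measurable borel" "\<And>x. \<bar>g x\<bar> \<le> C" using bounded_borelE[OF assms(2)] by metis
  have "\<bar>f x + g x\<bar> \<le> B + C" for x using B(2)[of x] C(2)[of x] by linarith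
  then show ?thesis using B C by (intro bounded_borelI) auto
qed

lemma bounded_borel_mult:
  assumes "f \<in> bounded_borel" "g \<in> bounded_borel" shows "(\<lambda>x. f x * g x) \<in> bounded_borel"
proof -
  obtain B where B: "f \<in> borel_measurable borel" "\<And>x. \<bar>f x\<bar> \<le> B" using bounded_borelE[OF assms(1)] by metis
  obtain C where C: "g \<in> borel_measurable borel" "\<And>x. \<bar>g x\<bar> \<le> C" using bounded_borelE[OF assms(2)] by metis
  have "\<bar>f x * g x\<bar> \<le> B * C" for x
    using mult_mono[OF B(2)[of x] C(2)[of x]] order_trans[OF abs_ge_zero B(2)] by (simp add: abs_mult)
  then show ?thesis using B C by (intro bounded_borelI) auto
qed

lemma subspace_bounded_borel: "fun_subspace bounded_borel"
  unfolding fun_subspace_def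
  by (auto intro: bounded_borel_add bounded_borel_mult[OF bounded_borel_const])

locale fiber_setting =
  fixes m :: "'a :: {metric_space, second_countable_topology} measure"
    and \<Gamma> :: "('a \<Rightarrow> real) \<Rightarrow> ('a \<Rightarrow> real) \<Rightarrow> 'a set \<Rightarrow> real"
    and f :: "nat \<Rightarrow> 'a \<Rightarrow> real" and \<gamma>
  assumes sets_m: "sets m = sets borel" and versions: "energy_density_versions m \<Gamma> f \<gamma>"
begin

abbreviation "A \<equiv> fun_span (range f)"

lemma f_in_A: "f n \<in> A"
  using fun_span_superset[of "range f"] by auto

lemma \<gamma>_measurable: "(\<lambda>x. \<gamma> x (f i) (f j)) \<in> borel_measurable borel"
  and \<gamma>_integrable: "integrable m (\<lambda>x. \<gamma> x (f i) (f j))"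
  and \<gamma>_density: "B \<in> sets borel \<Longrightarrow> \<Gamma> (f i) (f j) B = (LINT x:B|m. \<gamma> x (f i) (f j))"
  using versions unfolding energy_density_versions_def by auto

lemma \<gamma>_sym_f: "\<gamma> x (f i) (f j) = \<gamma> x (f j) (f i)"
proof -
  have "\<forall>N x. \<forall>i\<le>N. \<forall>j\<le>N. \<gamma> x (f i) (f j) = \<gamma> x (f j) (f i)"
    using versions unfolding energy_density_versions_def by blast
  then show ?thesis by (metis max.cobounded1 max.cobounded2)
qed

lemma \<gamma>_nonneg_f: "0 \<le> (\<Sum>i\<le>(N::nat). \<Sum>j\<le>N. c i * c j * \<gamma> x (f i) (f j))"
  using versions unfolding energy_density_versions_def by blast

lemma \<gamma>_bilinear: "bilinear_form_on A (\<gamma> x)"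
  using versions unfolding energy_density_versions_def by blast

lemma \<gamma>_left: "u \<in> A \<Longrightarrow> v \<in> A \<Longrightarrow> w \<in> A \<Longrightarrow> \<gamma> x (\<lambda>y. u y + v y) w = \<gamma> x u w + \<gamma> x v w"
  "u \<in> A \<Longrightarrow> w \<in> A \<Longrightarrow> \<gamma> x (\<lambda>y. c * u y) w = c * \<gamma> x u w"
  and \<gamma>_right: "u \<in> A \<Longrightarrow> v \<in> A \<Longrightarrow> w \<in> A \<Longrightarrow> \<gamma> x w (\<lambda>y. u y + v y) = \<gamma> x w u + \<gamma> x w v"
  "u \<in> A \<Longrightarrow> w \<in> A \<Longrightarrow> \<gamma> x w (\<lambda>y. c * u y) = c * \<gamma> x w u"
  using \<gamma>_bilinear[of x] unfolding bilinear_form_on_def by blast+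

lemma sum_in_A: "(\<lambda>y. \<Sum>i\<le>(N::nat). c i * f i y) \<in> A"
proof (induction N)
  case (Suc N)
  have "(\<lambda>y. c (Suc N) * f (Suc N) y) \<in> A" by (intro fun_subspace_scale subspace_fun_span f_in_A)
  then have "(\<lambda>y. (\<Sum>i\<le>N. c i * f i y) + c (Suc N) * f (Suc N) y) \<in> A"
    by (intro fun_subspace_add subspace_fun_span Suc)
  then show ?case by simp
qed (simp add: fun_subspace_scale[OF subspace_fun_span f_in_A])

lemma \<gamma>_sum_left: "w \<in> A \<Longrightarrow> \<gamma> x (\<lambda>y. \<Sum>i\<le>(N::nat). c i * f i y) w = (\<Sum>i\<le>N. c i * \<gamma> x (f i) w)"
proof (induction N)
  case (Suc N)
  have "(\<lambda>y. c (Suc N) * f (Suc N) y) \<in> A" by (intro fun_subspace_scale subspace_fun_span f_in_A)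
  then show ?case using \<gamma>_left(1)[OF sum_in_A _ Suc.prems, of _ x c N] Suc f_in_A by (simp add: \<gamma>_left(2))
qed (simp add: \<gamma>_left f_in_A)

lemma \<gamma>_sum_right: "w \<in> A \<Longrightarrow> \<gamma> x w (\<lambda>y. \<Sum>i\<le>(N::nat). c i * f i y) = (\<Sum>i\<le>N. c i * \<gamma> x w (f i))"
proof (induction N)
  case (Suc N)
  have "(\<lambda>y. c (Suc N) * f (Suc N) y) \<in> A" by (intro fun_subspace_scale subspace_fun_span f_in_A)
  then show ?case using \<gamma>_right(1)[OF sum_in_A _ Suc.prems, of _ x c N] Suc f_in_A by (simp add: \<gamma>_right(2))
qed (simp add: \<gamma>_right f_in_A)

lemma \<gamma>_sym: assumes "u \<in> A" "v \<in> A" shows "\<gamma> x u v = \<gamma> x v u"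
proof -
  obtain N c where u: "u = (\<lambda>y. \<Sum>i\<le>N. c i * f i y)" using fun_span_range[OF assms(1)] .
  obtain M d where v: "v = (\<lambda>y. \<Sum>i\<le>M. d i * f i y)" using fun_span_range[OF assms(2)] .
  have "\<gamma> x u (f j) = \<gamma> x (f j) u" for j
    unfolding u by (simp add: \<gamma>_sum_left \<gamma>_sum_right f_in_A \<gamma>_sym_f[of x j])
  then show ?thesis unfolding v using assms by (simp add: \<gamma>_sum_left \<gamma>_sum_right)
qed

lemma \<gamma>_nonneg: assumes "u \<in> A" shows "0 \<le> \<gamma> x u u"
proof -
  obtain N c where u: "u = (\<lambda>y. \<Sum>i\<le>N. c i * f i y)" using fun_span_range[OF assms] .
  have "\<gamma> x u u = (\<Sum>i\<le>N. \<Sum>j\<le>N. c i * c j * \<gamma> x (f i) (f j))"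
    unfolding u by (simp add: \<gamma>_sum_left \<gamma>_sum_right f_in_A sum_in_A sum_distrib_left mult.assoc)
  then show ?thesis using \<gamma>_nonneg_f by simp
qed

text \<open>At a fixed \<open>x\<close> second factors are mere numbers. Moving them into the first
  factors turns the double sum into \<open>\<gamma> x u u\<close> for one element \<open>u\<close>
  of the span.\<close>

lemma fiber_nonneg:
  assumes "set ps \<subseteq> A \<times> UNIV"
  shows "0 \<le> (\<Sum>(a, b)\<leftarrow>ps. \<Sum>(c, d)\<leftarrow>ps. b x * d x * \<gamma> x a c)"
proof -
  let ?u = "\<lambda>y. \<Sum>(a, b)\<leftarrow>ps. b x * a y"
  have u: "?u \<in> A" using assms by (intro fun_subspace_list_sum subspace_fun_span) auto
  have 1: "\<gamma> x ?u w = (\<Sum>(a, b)\<leftarrow>ps. b x * \<gamma> x a w)" if "w \<in> A" for w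
    using assms that by (intro linear_on_list_sum[OF subspace_fun_span, where l = "\<lambda>u. \<gamma> x u w"]) (auto simp: \<gamma>_left)
  have 2: "\<gamma> x w ?u = (\<Sum>(a, b)\<leftarrow>ps. b x * \<gamma> x w a)" if "w \<in> A" for w
    using assms that by (intro linear_on_list_sum[OF subspace_fun_span, where l = "\<gamma> x w"]) (auto simp: \<gamma>_right)
  have "(\<Sum>(a, b)\<leftarrow>ps. \<Sum>(c, d)\<leftarrow>ps. b x * d x * \<gamma> x a c) = (\<Sum>(a, b)\<leftarrow>ps. b x * \<gamma> x a ?u)"
  proof (intro arg_cong[where f = sum_list] map_cong refl)
    fix p assume p: "p \<in> set ps"
    obtain a b where ab: "p = (a, b)" by force
    then have "a \<in> A" using p assms by auto
    then show "(case p of (a, b) \<Rightarrow> \<Sum>(c, d)\<leftarrow>ps. b x * d x * \<gamma> x a c) = (case p of (a, b) \<Rightarrow> b x * \<gamma> x a ?u)"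
      using 2[of a] by (simp add: ab split_def sum_list_const_mult mult.assoc)
  qed
  also have "\<dots> = \<gamma> x ?u ?u" using 1[OF u] by simp
  finally show ?thesis using \<gamma>_nonneg[OF u] by simp
qed

lemma tensor_bilinear_fiber: "tensor_bilinear A bounded_borel (\<lambda>a b c d. b x * d x * \<gamma> x a c)"
proof
  show "fun_subspace A" "fun_subspace (bounded_borel :: ('a \<Rightarrow> real) set)"
    by (rule subspace_fun_span subspace_bounded_borel)+
next
  fix c d assume "c \<in> A" "d \<in> (bounded_borel :: ('a \<Rightarrow> real) set)"
  then show "bilinear_pair A bounded_borel (\<lambda>a b. b x * d x * \<gamma> x a c)"
    unfolding bilinear_pair_def by (auto simp: \<gamma>_left algebra_simps)
next
  fix a b c d assume "a \<in> A" "c \<in> A"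
  then show "b x * d x * \<gamma> x a c = d x * b x * \<gamma> x c a" by (simp add: \<gamma>_sym mult.commute)
next
  fix ps assume "set ps \<subseteq> A \<times> (bounded_borel :: ('a \<Rightarrow> real) set)"
  then show "0 \<le> (\<Sum>(a, b)\<leftarrow>ps. \<Sum>(c, d)\<leftarrow>ps. b x * d x * \<gamma> x a c)" by (intro fiber_nonneg) auto
qed

sublocale Fib: tensor_bilinear A bounded_borel "\<lambda>a b c d. b x * d x * \<gamma> x a c" for x
  by (rule tensor_bilinear_fiber)

lemma fiber_eq: "fiber A \<gamma> x = hilbert_completion (tensor_space A bounded_borel)
    (tensor_form A bounded_borel (\<lambda>a b c d. b x * d x * \<gamma> x a c))"
  by (simp add: fiber_def fiber_form_def)

lemma fiber_class_eq: "fiber_class A \<gamma> x v = completion_class (tensor_space A bounded_borel)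
    (tensor_form A bounded_borel (\<lambda>a b c d. b x * d x * \<gamma> x a c)) v"
  by (simp add: fiber_class_def fiber_form_def)

lemma hilbert_fiber: "hilbert_space (fiber A \<gamma> x)"
  unfolding fiber_eq by (rule Fib.hilbert_space_HC)

lemma fiber_class_in: "a \<in> A \<Longrightarrow> b \<in> bounded_borel \<Longrightarrow> fiber_class A \<gamma> x (tensor a b) \<in> hcarrier (fiber A \<gamma> x)"
  unfolding fiber_class_eq fiber_eq by (intro Fib.completion_class_in Fib.tensor_in)

lemma inner_fiber_class:
  "a \<in> A \<Longrightarrow> b \<in> bounded_borel \<Longrightarrow> c \<in> A \<Longrightarrow> d \<in> bounded_borel \<Longrightarrow>
    hinner (fiber A \<gamma> x) (fiber_class A \<gamma> x (tensor a b)) (fiber_class A \<gamma> x (tensor c d)) = b x * d x * \<gamma> x a c"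
  unfolding fiber_class_eq fiber_eq
  by (simp add: Fib.inner_completion_class Fib.tensor_in Fib.tensor_form_tensor)

text \<open>In the fiber over \<open>x\<close> a second factor acts only through its value at
  \<open>x\<close>: on representatives, the form against \<open>tensor a b\<close> is
  \<open>b x\<close> times a number independent of \<open>b\<close> and linear in \<open>a\<close>.
  Limits along a Cauchy sequence representing \<open>h\<close> inherit this.\<close>

lemma fiber_class_linear:
  assumes h: "h \<in> hcarrier (fiber A \<gamma> x)" and a: "a \<in> A" and b: "b \<in> bounded_borel"
  shows "hinner (fiber A \<gamma> x) h (fiber_class A \<gamma> x (tensor a b))
      = b x * hinner (fiber A \<gamma> x) h (fiber_class A \<gamma> x (tensor a (\<lambda>_. 1)))"
    and "a' \<in> A \<Longrightarrow> hinner (fiber A \<gamma> x) h (fiber_class A \<gamma> x (tensor (\<lambda>y. a y + a' y) (\<lambda>_. 1)))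
      = hinner (fiber A \<gamma> x) h (fiber_class A \<gamma> x (tensor a (\<lambda>_. 1))) + hinner (fiber A \<gamma> x) h (fiber_class A \<gamma> x (tensor a' (\<lambda>_. 1)))"
    and "hinner (fiber A \<gamma> x) h (fiber_class A \<gamma> x (tensor (\<lambda>y. c * a y) (\<lambda>_. 1)))
      = c * hinner (fiber A \<gamma> x) h (fiber_class A \<gamma> x (tensor a (\<lambda>_. 1)))"
proof -
  let ?B = "tensor_form A bounded_borel (\<lambda>a b c d. b x * d x * \<gamma> x a c)"
  let ?V = "tensor_space A (bounded_borel :: ('a \<Rightarrow> real) set)"
  obtain u where u: "u \<in> cauchy_seqs ?V ?B" "h = completion_rel ?V ?B `` {u}"
    using h unfolding fiber_eq by (metis Fib.carrier_HC_E)
  have lim: "(\<lambda>n. ?B (u n) (tensor a b)) \<longlonglongrightarrow> hinner (fiber A \<gamma> x) h (fiber_class A \<gamma> x (tensor a b))"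
    if "a \<in> A" "b \<in> bounded_borel" for a b
    unfolding fiber_class_eq fiber_eq u(2) using that u(1)
    by (intro Fib.tendsto_inner_completion_class Fib.tensor_in)
  have B: "\<exists>ps. set ps \<subseteq> A \<times> bounded_borel \<and> (\<forall>a\<in>A. \<forall>b\<in>bounded_borel. ?B (u n) (tensor a b) = b x * (\<Sum>(a', b')\<leftarrow>ps. b' x * \<gamma> x a' a))" for n
  proof -
    have "u n \<in> ?V" using u(1) by (rule Fib.cauchy_seqs_in)
    then obtain ps where ps: "set ps \<subseteq> A \<times> bounded_borel" "u n = tensor_sum ps" by (metis Fib.tspace_E)
    have "?B (u n) (tensor a b) = b x * (\<Sum>(a', b')\<leftarrow>ps. b' x * \<gamma> x a' a)" if "a \<in> A" "b \<in> bounded_borel" for a b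
      unfolding ps(2) Fib.tensor_eq_sum using ps(1) that
      by (subst Fib.tensor_form_sum) (auto simp: sum_list_const_mult[symmetric] split_def algebra_simps)
    then show ?thesis using ps(1) by blast
  qed
  then obtain ps where ps: "\<And>n. set (ps n) \<subseteq> A \<times> bounded_borel"
    "\<And>n a b. a \<in> A \<Longrightarrow> b \<in> bounded_borel \<Longrightarrow> ?B (u n) (tensor a b) = b x * (\<Sum>(a', b')\<leftarrow>ps n. b' x * \<gamma> x a' a)"
    by metis
  have "(\<lambda>n. ?B (u n) (tensor a b)) \<longlonglongrightarrow> b x * hinner (fiber A \<gamma> x) h (fiber_class A \<gamma> x (tensor a (\<lambda>_. 1)))"
    using tendsto_mult_left[OF lim[OF a bounded_borel_const, of 1], of "b x"] a b by (simp add: ps)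
  then show "hinner (fiber A \<gamma> x) h (fiber_class A \<gamma> x (tensor a b))
      = b x * hinner (fiber A \<gamma> x) h (fiber_class A \<gamma> x (tensor a (\<lambda>_. 1)))"
    using lim[OF a b] LIMSEQ_unique by blast
  show "hinner (fiber A \<gamma> x) h (fiber_class A \<gamma> x (tensor (\<lambda>y. a y + a' y) (\<lambda>_. 1)))
      = hinner (fiber A \<gamma> x) h (fiber_class A \<gamma> x (tensor a (\<lambda>_. 1))) + hinner (fiber A \<gamma> x) h (fiber_class A \<gamma> x (tensor a' (\<lambda>_. 1)))"
    if a': "a' \<in> A"
  proof -
    have aa: "(\<lambda>y. a y + a' y) \<in> A" by (intro fun_subspace_add subspace_fun_span a a')
    have "(\<Sum>(c, b')\<leftarrow>ps n. b' x * \<gamma> x c (\<lambda>y. a y + a' y))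
        = (\<Sum>(c, b')\<leftarrow>ps n. b' x * \<gamma> x c a) + (\<Sum>(c, b')\<leftarrow>ps n. b' x * \<gamma> x c a')" for n
      unfolding sum_list_addf[symmetric] using ps(1)[of n] a a'
      by (intro arg_cong[where f = sum_list] map_cong) (auto simp: \<gamma>_right algebra_simps)
    then show ?thesis
      using tendsto_add[OF lim[OF a bounded_borel_const, of 1] lim[OF a' bounded_borel_const, of 1]]
        lim[OF aa bounded_borel_const, of 1] a a' aa by (simp add: ps LIMSEQ_unique)
  qed
  have ca: "(\<lambda>y. c * a y) \<in> A" by (intro fun_subspace_scale subspace_fun_span a)
  have "(\<Sum>(d, b')\<leftarrow>ps n. b' x * \<gamma> x d (\<lambda>y. c * a y)) = c * (\<Sum>(d, b')\<leftarrow>ps n. b' x * \<gamma> x d a)" for n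
    unfolding sum_list_const_mult[symmetric] using ps(1)[of n] a
    by (intro arg_cong[where f = sum_list] map_cong) (auto simp: \<gamma>_right algebra_simps)
  then show "hinner (fiber A \<gamma> x) h (fiber_class A \<gamma> x (tensor (\<lambda>y. c * a y) (\<lambda>_. 1)))
      = c * hinner (fiber A \<gamma> x) h (fiber_class A \<gamma> x (tensor a (\<lambda>_. 1)))"
    using tendsto_mult_left[OF lim[OF a bounded_borel_const, of 1], of c]
        lim[OF ca bounded_borel_const, of 1] a ca by (simp add: ps LIMSEQ_unique)
qed

abbreviation "e n x \<equiv> fiber_class A \<gamma> x (tensor (f n) (\<lambda>_. 1))"

text \<open>The \<open>a\<close> for which \<open>h\<close> is orthogonal to \<open>a\<close> tensor
  1 form a subspace that contains every \<open>f n\<close>, hence all of \<open>A\<close>; an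
  arbitrary second factor contributes only its value at \<open>x\<close>.\<close>

lemma fiber_total:
  assumes h: "h \<in> hcarrier (fiber A \<gamma> x)" and 0: "\<And>n. hinner (fiber A \<gamma> x) h (e n x) = 0"
  shows "hinner (fiber A \<gamma> x) h h = 0"
proof -
  let ?W = "{a \<in> A. hinner (fiber A \<gamma> x) h (fiber_class A \<gamma> x (tensor a (\<lambda>_. 1))) = 0}"
  have "(\<lambda>y. 0 * f 0 y) \<in> ?W"
    using fiber_class_linear(3)[OF h f_in_A bounded_borel_const, of 0 0] subspace_fun_span
    by (auto simp: fun_subspace_def)
  then have "fun_subspace ?W"
    using subspace_fun_span fiber_class_linear(2,3)[OF h _ bounded_borel_const] unfolding fun_subspace_def by auto
  then have "A \<subseteq> ?W" using 0 f_in_A by (intro fun_span_minimal) auto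
  then have "hinner (fiber A \<gamma> x) h (fiber_class A \<gamma> x (tensor a b)) = 0" if "a \<in> A" "b \<in> bounded_borel" for a b
    using fiber_class_linear(1)[OF h that] that by auto
  then show ?thesis using Fib.total_tensor[of h x] h unfolding fiber_eq fiber_class_eq by blast
qed

lemma measurable_field_fiber: "measurable_field m (fiber A \<gamma>) e"
proof (rule measurable_field.intro)
  show "hilbert_space (fiber A \<gamma> x)" for x by (rule hilbert_fiber)
  show "e n x \<in> hcarrier (fiber A \<gamma> x)" for n x by (intro fiber_class_in f_in_A bounded_borel_const)
  show "(\<lambda>x. hinner (fiber A \<gamma> x) (e i x) (e k x)) \<in> borel_measurable m" for i k
    using \<gamma>_measurable[of i k] by (simp add: inner_fiber_class f_in_A measurable_cong_sets[OF sets_m refl])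
qed (rule fiber_total)

end

section \<open>Finite signed measures\<close>

lemma fsm_empty: "finite_signed_measure \<nu> \<Longrightarrow> \<nu> {} = 0"
  by (simp add: finite_signed_measure_def)

lemma fsm_sums:
  "finite_signed_measure \<nu> \<Longrightarrow> range A \<subseteq> sets borel \<Longrightarrow> disjoint_family A \<Longrightarrow> (\<lambda>i. \<nu> (A i)) sums \<nu> (\<Union>i. A i)"
  by (simp add: finite_signed_measure_def)

lemma fsm_Un:
  assumes "finite_signed_measure \<nu>" "A \<in> sets borel" "B \<in> sets borel" "A \<inter> B = {}"
  shows "\<nu> (A \<union> B) = \<nu> A + \<nu> B"
proof -
  have "(\<lambda>i. \<nu> (binaryset A B i)) sums \<nu> (\<Union>i. binaryset A B i)"
    using assms by (intro fsm_sums) (auto simp: range_binaryset_eq disjoint_family_on_def binaryset_def)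
  moreover have "(\<lambda>i. \<nu> (binaryset A B i)) sums (\<nu> A + \<nu> B)"
    by (rule binaryset_sums) (rule fsm_empty[OF assms(1)])
  ultimately show ?thesis by (simp add: UN_binaryset_eq sums_unique2)
qed

lemma fsm_split:
  assumes "finite_signed_measure \<nu>" "A \<in> sets borel" "B \<in> sets borel" "B \<subseteq> A"
  shows "\<nu> A = \<nu> B + \<nu> (A - B)"
proof -
  have "\<nu> (B \<union> (A - B)) = \<nu> B + \<nu> (A - B)" using assms by (intro fsm_Un) auto
  moreover have "B \<union> (A - B) = A" using assms by auto
  ultimately show ?thesis by simp
qed

lemma fsm_lincomb:
  assumes "finite_signed_measure \<nu>1" "finite_signed_measure \<nu>2"
  shows "finite_signed_measure (\<lambda>A. a * \<nu>1 A + b * \<nu>2 A)"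
  using assms unfolding finite_signed_measure_def by (auto intro!: sums_add sums_mult)

lemma fsm_uminus: "finite_signed_measure \<nu> \<Longrightarrow> finite_signed_measure (\<lambda>A. - \<nu> A)"
  using fsm_lincomb[of \<nu> \<nu> "-1" 0] by simp

text \<open>If \<open>\<nu>\<close> were unbounded on \<open>A\<close>, then \<open>A\<close> could be cut into a part on which \<open>\<nu>\<close> is still
  unbounded and a part of \<open>\<nu>\<close>-mass at least one; iterating this contradicts countable additivity.\<close>

lemma fsm_bounded:
  assumes \<nu>: "finite_signed_measure \<nu>"
  shows "\<exists>C. \<forall>A\<in>sets borel. \<bar>\<nu> A\<bar> \<le> C"
proof (rule ccontr)
  assume unb: "\<not> ?thesis"
  define bad where "bad A \<longleftrightarrow> A \<in> sets borel \<and> (\<forall>C. \<exists>B\<in>sets borel. B \<subseteq> A \<and> \<bar>\<nu> B\<bar> > C)" for A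
  have bad_UNIV: "bad UNIV" using unb unfolding bad_def by (auto simp: not_le)
  have split: "bad B \<or> bad (A - B)" if A: "bad A" and B: "B \<in> sets borel" "B \<subseteq> A" for A B
  proof (rule ccontr)
    assume "\<not> ?thesis"
    then have nb: "\<not> bad B" "\<not> bad (A - B)" by auto
    have AB: "A - B \<in> sets borel" using A B by (auto simp: bad_def)
    obtain C1 where C1: "\<And>E. E \<in> sets borel \<Longrightarrow> E \<subseteq> B \<Longrightarrow> \<bar>\<nu> E\<bar> \<le> C1"
      using nb(1) B(1) unfolding bad_def by (meson not_le)
    obtain C2 where C2: "\<And>E. E \<in> sets borel \<Longrightarrow> E \<subseteq> A - B \<Longrightarrow> \<bar>\<nu> E\<bar> \<le> C2"
      using nb(2) AB unfolding bad_def by (meson not_le)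
    obtain E where E: "E \<in> sets borel" "E \<subseteq> A" "\<bar>\<nu> E\<bar> > C1 + C2" using A unfolding bad_def by blast
    have "\<nu> E = \<nu> (E \<inter> B) + \<nu> (E - E \<inter> B)" using E B by (intro fsm_split \<nu>) auto
    moreover have "\<bar>\<nu> (E \<inter> B)\<bar> \<le> C1" "\<bar>\<nu> (E - E \<inter> B)\<bar> \<le> C2" using E B A by (auto intro!: C1 C2 simp: bad_def)
    ultimately show False using E(3) by linarith
  qed
  have step: "\<exists>B. bad B \<and> B \<subseteq> A \<and> \<bar>\<nu> (A - B)\<bar> \<ge> 1" if A: "bad A" for A
  proof -
    \<comment> \<open>The margin makes both parts heavy: \<open>\<bar>\<nu> B\<bar>\<close> exceeds
      1, and so does \<open>\<bar>\<nu> (A - B)\<bar>\<close>, which is at least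
      \<open>\<bar>\<nu> B\<bar> - \<bar>\<nu> A\<bar>\<close>. Whichever part stays unbounded, the
      discarded one has mass at least 1.\<close>
    obtain B where B: "B \<in> sets borel" "B \<subseteq> A" "\<bar>\<nu> B\<bar> > \<bar>\<nu> A\<bar> + 1" using A unfolding bad_def by blast
    have AB: "A \<in> sets borel" using A by (simp add: bad_def)
    have eq: "\<nu> A = \<nu> B + \<nu> (A - B)" using B AB by (intro fsm_split \<nu>) auto
    show ?thesis
    proof (cases "bad B")
      case True
      then show ?thesis using B eq by (intro exI[of _ B]) linarith
    next
      case False
      then have "bad (A - B)" using split[OF A B(1,2)] by blast
      moreover have "A - (A - B) = B" using B by auto
      ultimately show ?thesis using B by (intro exI[of _ "A - B"]) auto
    qed
  qed
  obtain S where S: "\<And>n. bad (S n)" "\<And>n. S (Suc n) \<subseteq> S n \<and> \<bar>\<nu> (S n - S (Suc n))\<bar> \<ge> 1"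
    using dependent_nat_choice[of "\<lambda>_. bad" "\<lambda>_ A B. B \<subseteq> A \<and> \<bar>\<nu> (A - B)\<bar> \<ge> 1"] bad_UNIV step by metis
  have mono: "S j \<subseteq> S i" if "i \<le> j" for i j using lift_Suc_antimono_le[of S i j] S(2) that by blast
  have "disjoint_family (\<lambda>n. S n - S (Suc n))"
    unfolding disjoint_family_on_def
  proof (intro ballI impI)
    fix i j :: nat assume "i \<noteq> j"
    then consider "Suc i \<le> j" | "Suc j \<le> i" by linarith
    then show "(S i - S (Suc i)) \<inter> (S j - S (Suc j)) = {}" by cases (use mono in blast)+
  qed
  moreover have "range (\<lambda>n. S n - S (Suc n)) \<subseteq> sets borel" using S(1) by (auto simp: bad_def)
  ultimately have "(\<lambda>n. \<nu> (S n - S (Suc n))) \<longlonglongrightarrow> 0"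
    using fsm_sums[OF \<nu>] sums_summable summable_LIMSEQ_zero by blast
  then have "eventually (\<lambda>n. \<bar>\<nu> (S n - S (Suc n))\<bar> < 1) sequentially"
    by (intro order_tendstoD(2)[OF tendsto_rabs_zero]) auto
  then show False using S(2) by (auto simp: eventually_sequentially not_less[symmetric])
qed

section \<open>The Jordan decomposition\<close>

definition upper_variation :: "('a::topological_space set \<Rightarrow> real) \<Rightarrow> 'a set \<Rightarrow> real" where
  "upper_variation \<nu> A = (SUP B\<in>{B \<in> sets borel. B \<subseteq> A}. \<nu> B)"

context
  fixes \<nu> :: "'a::topological_space set \<Rightarrow> real"
  assumes \<nu>: "finite_signed_measure \<nu>"
begin

lemma upper_variation_bdd: "bdd_above (\<nu> ` {B \<in> sets borel. B \<subseteq> A})"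
proof -
  obtain C where "\<forall>A\<in>sets borel. \<bar>\<nu> A\<bar> \<le> C" using fsm_bounded[OF \<nu>] by blast
  then show ?thesis by (intro bdd_aboveI[of _ C]) force
qed

lemma upper_variation_ge: "B \<in> sets borel \<Longrightarrow> B \<subseteq> A \<Longrightarrow> \<nu> B \<le> upper_variation \<nu> A"
  unfolding upper_variation_def by (intro cSUP_upper upper_variation_bdd) auto

lemma upper_variation_le: "(\<And>B. B \<in> sets borel \<Longrightarrow> B \<subseteq> A \<Longrightarrow> \<nu> B \<le> c) \<Longrightarrow> upper_variation \<nu> A \<le> c"
  unfolding upper_variation_def by (intro cSUP_least) auto

lemma upper_variation_nonneg: "0 \<le> upper_variation \<nu> A"
  using upper_variation_ge[of "{}" A] fsm_empty[OF \<nu>] by simp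

lemma upper_variation_superadd:
  assumes "A \<in> sets borel" "B \<in> sets borel" "A \<inter> B = {}"
  shows "upper_variation \<nu> A + upper_variation \<nu> B \<le> upper_variation \<nu> (A \<union> B)"
proof -
  have "\<nu> D \<le> upper_variation \<nu> (A \<union> B) - upper_variation \<nu> A" if D: "D \<in> sets borel" "D \<subseteq> B" for D
  proof -
    have "\<nu> C \<le> upper_variation \<nu> (A \<union> B) - \<nu> D" if C: "C \<in> sets borel" "C \<subseteq> A" for C
    proof -
      have "\<nu> (C \<union> D) = \<nu> C + \<nu> D" using C D assms by (intro fsm_Un \<nu>) auto
      moreover have "\<nu> (C \<union> D) \<le> upper_variation \<nu> (A \<union> B)"
        using C D by (intro upper_variation_ge) auto
      ultimately show ?thesis by simp
    qed
    then have "upper_variation \<nu> A \<le> upper_variation \<nu> (A \<union> B) - \<nu> D" by (rule upper_variation_le)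
    then show ?thesis by simp
  qed
  then have "upper_variation \<nu> B \<le> upper_variation \<nu> (A \<union> B) - upper_variation \<nu> A" by (rule upper_variation_le)
  then show ?thesis by simp
qed

lemma upper_variation_mono: "A \<subseteq> B \<Longrightarrow> upper_variation \<nu> A \<le> upper_variation \<nu> B"
  by (intro upper_variation_le upper_variation_ge) auto

text \<open>Superadditivity on disjoint sets bounds the partial sums by the value at the union.
  Conversely, a competitor \<open>B\<close> for the union is cut along the \<open>A i\<close>, where
  countable additivity of \<open>\<nu>\<close> applies.\<close>

lemma upper_variation_sums:
  assumes A: "range A \<subseteq> sets borel" "disjoint_family A"
  shows "(\<lambda>i. upper_variation \<nu> (A i)) sums upper_variation \<nu> (\<Union>i. A i)"
proof -
  have Ai: "A i \<in> sets borel" for i using A by auto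
  have partial: "(\<Sum>i<n. upper_variation \<nu> (A i)) \<le> upper_variation \<nu> (\<Union>i<n. A i)" for n
  proof (induction n)
    case (Suc n)
    have "A i \<inter> A n = {}" if "i < n" for i using disjoint_family_onD[OF A(2), of i n] that by auto
    then have "(\<Union>i<n. A i) \<inter> A n = {}" by blast
    then have "upper_variation \<nu> (\<Union>i<n. A i) + upper_variation \<nu> (A n) \<le> upper_variation \<nu> ((\<Union>i<n. A i) \<union> A n)"
      using Ai by (intro upper_variation_superadd) auto
    moreover have "(\<Union>i<n. A i) \<union> A n = (\<Union>i<Suc n. A i)" by (auto simp: less_Suc_eq)
    ultimately show ?case using Suc by simp
  qed (simp add: upper_variation_nonneg)
  have le: "(\<Sum>i<n. upper_variation \<nu> (A i)) \<le> upper_variation \<nu> (\<Union>i. A i)" for n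
    using partial[of n] upper_variation_mono[of "\<Union>i<n. A i" "\<Union>i. A i"] by force
  have sm: "summable (\<lambda>i. upper_variation \<nu> (A i))"
    by (rule summableI_nonneg_bounded[OF upper_variation_nonneg le])
  moreover have "(\<Sum>i. upper_variation \<nu> (A i)) = upper_variation \<nu> (\<Union>i. A i)"
  proof (rule antisym)
    show "(\<Sum>i. upper_variation \<nu> (A i)) \<le> upper_variation \<nu> (\<Union>i. A i)"
      using sm le by (rule suminf_le_const)
    show "upper_variation \<nu> (\<Union>i. A i) \<le> (\<Sum>i. upper_variation \<nu> (A i))"
    proof (rule upper_variation_le)
      fix B :: "'a set" assume B: "B \<in> sets borel" "B \<subseteq> (\<Union>i. A i)"
      have s: "(\<lambda>i. \<nu> (B \<inter> A i)) sums \<nu> (\<Union>i. B \<inter> A i)"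
        using A B by (intro fsm_sums \<nu>) (auto simp: disjoint_family_on_def)
      have "(\<Union>i. B \<inter> A i) = B" using B by auto
      then have "\<nu> B = (\<Sum>i. \<nu> (B \<inter> A i))" using s by (simp add: sums_iff)
      also have "\<dots> \<le> (\<Sum>i. upper_variation \<nu> (A i))"
        using s Ai B by (intro suminf_le sm upper_variation_ge) (auto simp: sums_iff)
      finally show "\<nu> B \<le> (\<Sum>i. upper_variation \<nu> (A i))" .
    qed
  qed
  ultimately show ?thesis by (simp add: sums_iff)
qed

lemma sets_positive_variation [simp]: "sets (positive_variation \<nu>) = sets borel"
  and space_positive_variation [simp]: "space (positive_variation \<nu>) = UNIV"
  unfolding positive_variation_def using sets.sigma_sets_eq[of borel]
  by (auto simp: sets_measure_of_conv space_measure_of_conv)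

text \<open>\<open>measure_of\<close> returns the prescribed set function only once it is known to
  be countably additive. The supremum is computed in the reals, which boundedness of
  \<open>\<nu>\<close> permits, and then carried to \<open>ennreal\<close>.\<close>

lemma emeasure_positive_variation:
  assumes A: "A \<in> sets borel"
  shows "emeasure (positive_variation \<nu>) A = ennreal (upper_variation \<nu> A)"
proof -
  let ?\<mu> = "\<lambda>A. SUP B\<in>{B \<in> sets borel. B \<subseteq> A}. ennreal (\<nu> B)"
  have eq: "?\<mu> A = ennreal (upper_variation \<nu> A)" for A
  proof (rule SUP_eqI)
    fix y assume y: "\<And>B. B \<in> {B \<in> sets borel. B \<subseteq> A} \<Longrightarrow> ennreal (\<nu> B) \<le> y"
    show "ennreal (upper_variation \<nu> A) \<le> y"
    proof (cases y)
      case (real r)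
      then show ?thesis using y by (auto intro!: upper_variation_le simp: ennreal_leI)
    qed simp
  qed (auto intro!: ennreal_leI upper_variation_ge)
  show ?thesis unfolding positive_variation_def eq
  proof (rule emeasure_measure_of_sigma[OF _ _ _ A])
    show "sigma_algebra UNIV (sets (borel :: 'a measure))"
      using sets.sigma_algebra_axioms[of "borel :: 'a measure"] by simp
    show "positive (sets borel) (\<lambda>A. ennreal (upper_variation \<nu> A))"
    proof -
      have "upper_variation \<nu> {} \<le> 0" using fsm_empty[OF \<nu>] by (intro upper_variation_le) auto
      then show ?thesis by (simp add: positive_def ennreal_neg)
    qed
    show "countably_additive (sets borel) (\<lambda>A. ennreal (upper_variation \<nu> A))"
      unfolding countably_additive_def
    proof (intro allI impI)
      fix A :: "nat \<Rightarrow> 'a set" assume "range A \<subseteq> sets borel" "disjoint_family A"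
      from upper_variation_sums[OF this]
      show "(\<Sum>i. ennreal (upper_variation \<nu> (A i))) = ennreal (upper_variation \<nu> (\<Union> (range A)))"
        by (simp add: suminf_ennreal2 upper_variation_nonneg sums_iff)
    qed
  qed
qed

lemma finite_measure_positive_variation: "finite_measure (positive_variation \<nu>)"
  by (rule finite_measureI) (simp add: emeasure_positive_variation)

lemma measure_positive_variation:
  "A \<in> sets borel \<Longrightarrow> measure (positive_variation \<nu>) A = upper_variation \<nu> A"
  by (simp add: measure_def emeasure_positive_variation upper_variation_nonneg)

end

text \<open>Complementation within \<open>A\<close> exchanges the two suprema:
  \<open>\<nu> B\<close> is \<open>\<nu> A\<close> plus the value of \<open>- \<nu>\<close> at
  \<open>A - B\<close>. No Hahn decomposition is involved.\<close>

lemma jordan_decomposition: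
  assumes \<nu>: "finite_signed_measure \<nu>" and A: "A \<in> sets borel"
  shows "measure (positive_variation \<nu>) A - measure (positive_variation (\<lambda>A. - \<nu> A)) A = \<nu> A"
proof -
  note \<nu>' = fsm_uminus[OF \<nu>]
  have "upper_variation \<nu> A \<le> \<nu> A + upper_variation (\<lambda>A. - \<nu> A) A"
  proof (rule upper_variation_le[OF \<nu>])
    fix B assume B: "B \<in> sets borel" "B \<subseteq> A"
    then have "\<nu> A = \<nu> B + \<nu> (A - B)" using A by (intro fsm_split \<nu>)
    moreover have "- \<nu> (A - B) \<le> upper_variation (\<lambda>A. - \<nu> A) A" using A B by (intro upper_variation_ge[OF \<nu>']) auto
    ultimately show "\<nu> B \<le> \<nu> A + upper_variation (\<lambda>A. - \<nu> A) A" by simp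
  qed
  moreover have "upper_variation (\<lambda>A. - \<nu> A) A \<le> - \<nu> A + upper_variation \<nu> A"
  proof (rule upper_variation_le[OF \<nu>'])
    fix B assume B: "B \<in> sets borel" "B \<subseteq> A"
    then have "\<nu> A = \<nu> B + \<nu> (A - B)" using A by (intro fsm_split \<nu>)
    moreover have "\<nu> (A - B) \<le> upper_variation \<nu> A" using A B by (intro upper_variation_ge[OF \<nu>]) auto
    ultimately show "- \<nu> B \<le> - \<nu> A + upper_variation \<nu> A" by simp
  qed
  ultimately show ?thesis using A by (simp add: measure_positive_variation \<nu> \<nu>')
qed

section \<open>Bounded functionals on bounded Borel functions\<close>

text \<open>Linear functionals that are bounded for the supremum norm. They are determined by their
  values on indicators, and this is how identities between signed integrals are reduced to
  identities between set functions.\<close>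

definition bb_functional :: "(('a::topological_space \<Rightarrow> real) \<Rightarrow> real) \<Rightarrow> bool" where
  "bb_functional L \<longleftrightarrow> (\<forall>b\<in>bounded_borel. \<forall>b'\<in>bounded_borel. L (\<lambda>x. b x + b' x) = L b + L b')
     \<and> (\<forall>c. \<forall>b\<in>bounded_borel. L (\<lambda>x. c * b x) = c * L b)
     \<and> (\<exists>C. \<forall>b\<in>bounded_borel. \<forall>K. (\<forall>x. \<bar>b x\<bar> \<le> K) \<longrightarrow> \<bar>L b\<bar> \<le> C * K)"

lemma bb_functionalD:
  assumes "bb_functional L"
  shows "\<And>b b'. b \<in> bounded_borel \<Longrightarrow> b' \<in> bounded_borel \<Longrightarrow> L (\<lambda>x. b x + b' x) = L b + L b'"
    and "\<And>c b. b \<in> bounded_borel \<Longrightarrow> L (\<lambda>x. c * b x) = c * L b"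
    and "\<exists>C. \<forall>b\<in>bounded_borel. \<forall>K. (\<forall>x. \<bar>b x\<bar> \<le> K) \<longrightarrow> \<bar>L b\<bar> \<le> C * K"
  using assms unfolding bb_functional_def by auto

lemma bb_functional_lincomb:
  assumes L: "bb_functional L" and M: "bb_functional M"
  shows "bb_functional (\<lambda>b. a * L b + c * M b)"
proof -
  obtain C where C: "\<forall>b\<in>bounded_borel. \<forall>K. (\<forall>x. \<bar>b x\<bar> \<le> K) \<longrightarrow> \<bar>L b\<bar> \<le> C * K" using bb_functionalD(3)[OF L] by blast
  obtain D where D: "\<forall>b\<in>bounded_borel. \<forall>K. (\<forall>x. \<bar>b x\<bar> \<le> K) \<longrightarrow> \<bar>M b\<bar> \<le> D * K" using bb_functionalD(3)[OF M] by blast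
  have "\<bar>a * L b + c * M b\<bar> \<le> (\<bar>a\<bar> * C + \<bar>c\<bar> * D) * K" if "b \<in> bounded_borel" "\<forall>x. \<bar>b x\<bar> \<le> K" for b K
  proof -
    have "\<bar>a * L b + c * M b\<bar> \<le> \<bar>a\<bar> * \<bar>L b\<bar> + \<bar>c\<bar> * \<bar>M b\<bar>"
      by (metis abs_mult abs_triangle_ineq)
    also have "\<dots> \<le> \<bar>a\<bar> * (C * K) + \<bar>c\<bar> * (D * K)" using C D that by (intro add_mono mult_left_mono) auto
    finally show ?thesis by (simp add: algebra_simps)
  qed
  then have "\<exists>C. \<forall>b\<in>bounded_borel. \<forall>K. (\<forall>x. \<bar>b x\<bar> \<le> K) \<longrightarrow> \<bar>a * L b + c * M b\<bar> \<le> C * K" by blast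
  then show ?thesis unfolding bb_functional_def
    using bb_functionalD(1,2)[OF L] bb_functionalD(1,2)[OF M] by (simp add: algebra_simps)
qed

lemma indicator_bounded_borel: "A \<in> sets borel \<Longrightarrow> (\<lambda>x. indicator A x) \<in> bounded_borel"
  by (rule bounded_borelI[of _ 1]) (auto simp: indicator_def)

lemma sum_bounded_borel: "(\<And>k. k \<in> I \<Longrightarrow> g k \<in> bounded_borel) \<Longrightarrow> (\<lambda>x. \<Sum>k\<in>I. g k x) \<in> bounded_borel"
  by (induction I rule: infinite_finite_induct) (auto intro!: bounded_borel_add)

lemma bb_functional_sum:
  assumes "bb_functional L" "\<And>k. k \<in> I \<Longrightarrow> g k \<in> bounded_borel"
  shows "L (\<lambda>x. \<Sum>k\<in>I. g k x) = (\<Sum>k\<in>I. L (g k))"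
  using assms(2)
proof (induction I rule: infinite_finite_induct)
  case (insert k I)
  then show ?case using bb_functionalD(1)[OF assms(1), of "g k" "\<lambda>x. \<Sum>k\<in>I. g k x"]
    by (simp add: sum_bounded_borel)
qed (use bb_functionalD(2)[OF assms(1) bounded_borel_const, of 0 0] in auto)

text \<open>Functions with finitely many values, all multiples of \<open>1 / Suc n\<close>,
  approximate \<open>b\<close> uniformly; the functional vanishes on them and is continuous for
  uniform convergence.\<close>

lemma bb_functional_zero:
  assumes L: "bb_functional L" and zero: "\<And>A. A \<in> sets borel \<Longrightarrow> L (\<lambda>x. indicator A x) = 0"
    and b: "b \<in> bounded_borel"
  shows "L b = 0"
proof -
  obtain B where B: "b \<in> borel_measurable borel" "\<And>x. \<bar>b x\<bar> \<le> B" using bounded_borelE[OF b] by metis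
  obtain C where C: "\<forall>b\<in>bounded_borel. \<forall>K. (\<forall>x. \<bar>b x\<bar> \<le> K) \<longrightarrow> \<bar>L b\<bar> \<le> C * K"
    using bb_functionalD(3)[OF L] by blast
  have small: "\<bar>L b\<bar> \<le> C * (1 / real (Suc n))" for n
  proof -
    \<comment> \<open>Boundedness of \<open>b\<close> leaves only finitely many levels; the extra 1
      at both ends is slack.\<close>
    define I where "I = {-\<lceil>real (Suc n) * B\<rceil> - 1 .. \<lceil>real (Suc n) * B\<rceil> + 1}"
    define E where "E k = {x. \<lfloor>real (Suc n) * b x\<rfloor> = k}" for k :: int
    have E: "E k \<in> sets borel" for k unfolding E_def using B(1) by measurable
    define s where "s x = (\<Sum>k\<in>I. (of_int k / real (Suc n)) * indicator (E k) x)" for x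
    have s_eq: "s x = of_int \<lfloor>real (Suc n) * b x\<rfloor> / real (Suc n)" for x
    proof -
      have "\<bar>real (Suc n) * b x\<bar> \<le> real (Suc n) * B" using B(2)[of x] by (simp add: abs_mult)
      then have "\<lfloor>- (real (Suc n) * B)\<rfloor> \<le> \<lfloor>real (Suc n) * b x\<rfloor>" "\<lfloor>real (Suc n) * b x\<rfloor> \<le> \<lceil>real (Suc n) * B\<rceil>"
        by (auto simp: abs_le_iff intro: floor_mono order_trans[OF floor_mono floor_le_ceiling] simp del: of_nat_Suc)
      then have "\<lfloor>real (Suc n) * b x\<rfloor> \<in> I" unfolding I_def by (simp add: ceiling_def del: of_nat_Suc)
      then have "(\<Sum>k\<in>I. if k = \<lfloor>real (Suc n) * b x\<rfloor> then of_int k / real (Suc n) else 0)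
          = of_int \<lfloor>real (Suc n) * b x\<rfloor> / real (Suc n)"
        by (subst sum.delta) (auto simp: I_def)
      moreover have "s x = (\<Sum>k\<in>I. if k = \<lfloor>real (Suc n) * b x\<rfloor> then of_int k / real (Suc n) else 0)"
        unfolding s_def E_def by (intro sum.cong) (auto simp: indicator_def)
      ultimately show ?thesis by simp
    qed
    have term_bb: "(\<lambda>x. (of_int k / real (Suc n)) * indicator (E k) x) \<in> bounded_borel" for k
      by (intro bounded_borel_mult bounded_borel_const indicator_bounded_borel E)
    have s_bb: "s \<in> bounded_borel" unfolding s_def[abs_def] by (intro sum_bounded_borel term_bb)
    have "L s = (\<Sum>k\<in>I. L (\<lambda>x. (of_int k / real (Suc n)) * indicator (E k) x))"
      unfolding s_def[abs_def] by (rule bb_functional_sum[OF L term_bb])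
    also have "\<dots> = 0"
      using bb_functionalD(2)[OF L indicator_bounded_borel[OF E]] zero[OF E]
      by (intro sum.neutral ballI) (simp del: times_divide_eq_left of_nat_Suc)
    finally have "L s = 0" .
    moreover have "L b = L s + L (\<lambda>x. b x - s x)"
    proof -
      have d: "(\<lambda>x. b x - s x) \<in> bounded_borel" by (intro fun_subspace_diff subspace_bounded_borel b s_bb)
      show ?thesis using bb_functionalD(1)[OF L s_bb d] by simp
    qed
    moreover have "\<bar>L (\<lambda>x. b x - s x)\<bar> \<le> C * (1 / real (Suc n))"
    proof -
      have "\<bar>b x - s x\<bar> \<le> 1 / real (Suc n)" for x
      proof -
        have "b x - s x = (real (Suc n) * b x - of_int \<lfloor>real (Suc n) * b x\<rfloor>) / real (Suc n)"
          unfolding s_eq by (simp add: field_simps)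
        moreover have "\<bar>real (Suc n) * b x - of_int \<lfloor>real (Suc n) * b x\<rfloor>\<bar> \<le> 1" by linarith
        ultimately show ?thesis by (simp add: divide_right_mono abs_divide del: of_nat_Suc)
      qed
      moreover have "(\<lambda>x. b x - s x) \<in> bounded_borel" by (intro fun_subspace_diff subspace_bounded_borel b s_bb)
      ultimately show ?thesis by (intro C[rule_format]) auto
    qed
    ultimately show ?thesis by simp
  qed
  have "(\<lambda>n. C * (1 / real (Suc n))) \<longlonglongrightarrow> C * 0"
    using LIMSEQ_inverse_real_of_nat by (intro tendsto_mult_left) (simp add: inverse_eq_divide)
  then have "\<bar>L b\<bar> \<le> 0" using small by (intro LIMSEQ_le_const) auto
  then show ?thesis by simp
qed

lemma bb_functional_eq:
  assumes "bb_functional L" "bb_functional M"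
    and "\<And>A. A \<in> sets borel \<Longrightarrow> L (\<lambda>x. indicator A x) = M (\<lambda>x. indicator A x)" and "b \<in> bounded_borel"
  shows "L b = M b"
  using bb_functional_zero[OF bb_functional_lincomb[OF assms(1,2), of 1 "-1"], of b] assms(3,4) by simp

lemma integrable_bounded_borel:
  assumes "finite_measure M" "sets M = sets borel" "b \<in> bounded_borel"
  shows "integrable M b"
proof -
  interpret finite_measure M by fact
  obtain B where B: "b \<in> borel_measurable borel" "\<And>x. \<bar>b x\<bar> \<le> B" using bounded_borelE[OF assms(3)] by metis
  then show ?thesis
    by (intro integrable_const_bound[of _ B]) (auto simp: measurable_cong_sets[OF assms(2) refl])
qed

lemma integral_bounded_borel_le:
  assumes M: "finite_measure M" "sets M = sets borel" and b: "b \<in> bounded_borel" and K: "\<And>x. \<bar>b x\<bar> \<le> K"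
  shows "\<bar>\<integral>x. b x \<partial>M\<bar> \<le> measure M UNIV * K"
proof -
  interpret finite_measure M by fact
  have sp: "space M = UNIV" using sets_eq_imp_space_eq[OF M(2)] by simp
  have "\<bar>\<integral>x. b x \<partial>M\<bar> \<le> (\<integral>x. \<bar>b x\<bar> \<partial>M)" by (rule integral_abs_bound)
  also have "\<dots> \<le> (\<integral>x. K \<partial>M)"
    using integrable_bounded_borel[OF M b] K by (intro integral_mono) auto
  finally show ?thesis by (simp add: sp)
qed

lemma bb_functional_integral:
  assumes M: "finite_measure M" "sets M = sets borel"
  shows "bb_functional (\<lambda>b. \<integral>x. b x \<partial>M)"
proof -
  have "\<exists>C. \<forall>b\<in>bounded_borel. \<forall>K. (\<forall>x. \<bar>b x\<bar> \<le> K) \<longrightarrow> \<bar>\<integral>x. b x \<partial>M\<bar> \<le> C * K"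
    using integral_bounded_borel_le[OF M] by blast
  then show ?thesis unfolding bb_functional_def using integrable_bounded_borel[OF M] by simp
qed

lemma bb_functional_signed_integral:
  assumes "finite_signed_measure \<nu>"
  shows "bb_functional (signed_integral \<nu>)"
proof -
  have "bb_functional (\<lambda>b. 1 * (\<integral>x. b x \<partial>positive_variation \<nu>)
      + (-1) * (\<integral>x. b x \<partial>positive_variation (\<lambda>A. - \<nu> A)))"
    using assms fsm_uminus[OF assms]
    by (intro bb_functional_lincomb bb_functional_integral finite_measure_positive_variation) auto
  then show ?thesis by (simp add: signed_integral_def[abs_def])
qed

lemma signed_integral_indicator:
  assumes \<nu>: "finite_signed_measure \<nu>" and A: "A \<in> sets borel"
  shows "signed_integral \<nu> (\<lambda>x. indicator A x) = \<nu> A"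
  using jordan_decomposition[OF \<nu> A] A \<nu> fsm_uminus[OF \<nu>]
  by (simp add: signed_integral_def)

lemma signed_integral_eqI:
  assumes "finite_signed_measure \<nu>" "bb_functional L"
    and "\<And>A. A \<in> sets borel \<Longrightarrow> L (\<lambda>x. indicator A x) = \<nu> A" and "b \<in> bounded_borel"
  shows "signed_integral \<nu> b = L b"
  by (rule bb_functional_eq[OF bb_functional_signed_integral[OF assms(1)] assms(2) _ assms(4)])
    (simp add: signed_integral_indicator assms)

lemma signed_integral_lincomb:
  assumes "finite_signed_measure \<nu>1" "finite_signed_measure \<nu>2" "b \<in> bounded_borel"
  shows "signed_integral (\<lambda>A. c * \<nu>1 A + d * \<nu>2 A) b = c * signed_integral \<nu>1 b + d * signed_integral \<nu>2 b"
  by (rule signed_integral_eqI[OF fsm_lincomb[OF assms(1,2)] bb_functional_lincomb[OF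
        bb_functional_signed_integral[OF assms(1)] bb_functional_signed_integral[OF assms(2)]] _ assms(3)])
    (simp add: signed_integral_indicator assms)

text \<open>The factor 2 counts positive and negative variation separately; only continuity in the
  energy is drawn from the bound later.\<close>

lemma signed_integral_le:
  assumes \<nu>: "finite_signed_measure \<nu>" and C: "\<And>A. A \<in> sets borel \<Longrightarrow> \<bar>\<nu> A\<bar> \<le> C"
    and b: "b \<in> bounded_borel" and K: "\<And>x. \<bar>b x\<bar> \<le> K"
  shows "\<bar>signed_integral \<nu> b\<bar> \<le> 2 * C * K"
proof -
  note \<nu>' = fsm_uminus[OF \<nu>]
  have K0: "0 \<le> K" using K abs_ge_zero order_trans by blast
  have "upper_variation \<nu> UNIV \<le> C" by (rule upper_variation_le[OF \<nu>]) (use C in force)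
  moreover have "upper_variation (\<lambda>A. - \<nu> A) UNIV \<le> C" by (rule upper_variation_le[OF \<nu>']) (use C in force)
  moreover have "\<bar>\<integral>x. b x \<partial>positive_variation \<nu>\<bar> \<le> upper_variation \<nu> UNIV * K"
    using integral_bounded_borel_le[OF finite_measure_positive_variation[OF \<nu>] _ b K] \<nu>
    by (simp add: measure_positive_variation)
  moreover have "\<bar>\<integral>x. b x \<partial>positive_variation (\<lambda>A. - \<nu> A)\<bar> \<le> upper_variation (\<lambda>A. - \<nu> A) UNIV * K"
    using integral_bounded_borel_le[OF finite_measure_positive_variation[OF \<nu>'] _ b K] \<nu>'
    by (simp add: measure_positive_variation)
  moreover have "upper_variation \<nu> UNIV * K \<le> C * K" "upper_variation (\<lambda>A. - \<nu> A) UNIV * K \<le> C * K"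
    using calculation K0 by (auto intro: mult_right_mono)
  ultimately show ?thesis unfolding signed_integral_def by linarith
qed

section \<open>Uniqueness of signed measures on locally compact spaces\<close>

lemma C0_fun_bounded_borel: "C0_fun \<subseteq> bounded_borel"
proof
  fix f :: "'a \<Rightarrow> real" assume "f \<in> C0_fun"
  then have c: "continuous_on UNIV f" and k: "compact (closure {x. f x \<noteq> 0})" by (auto simp: C0_fun_def)
  have "compact (f ` closure {x. f x \<noteq> 0})"
    using k c by (intro compact_continuous_image) (auto intro: continuous_on_subset)
  then have "bounded (insert 0 (f ` closure {x. f x \<noteq> 0}))" by (simp add: compact_imp_bounded)
  moreover have "range f \<subseteq> insert 0 (f ` closure {x. f x \<noteq> 0})"
    using closure_subset[of "{x. f x \<noteq> 0}"] by auto
  ultimately have "bounded (range f)" by (rule bounded_subset)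
  then show "f \<in> bounded_borel" using c by (simp add: bounded_borel_def borel_measurable_continuous_onI)
qed

lemma locally_compact_nhd:
  fixes x :: "'a::topological_space"
  assumes "locally compact (UNIV :: 'a set)"
  obtains U K where "open U" "compact K" "x \<in> U" "U \<subseteq> K"
  using assms unfolding locally_def by (metis UNIV_I open_openin openin_subtopology_self subtopology_UNIV top_greatest)

lemma sigma_compact:
  assumes lc: "locally compact (UNIV :: 'a::second_countable_topology set)"
  obtains K :: "nat \<Rightarrow> 'a::second_countable_topology set" where "\<And>n. compact (K n)" "(\<Union>n. K n) = UNIV"
proof -
  have "\<exists>U K. open U \<and> compact K \<and> x \<in> U \<and> U \<subseteq> K" for x :: 'a using locally_compact_nhd[OF lc] by metis
  then obtain U K where UK: "\<And>x :: 'a. open (U x)" "\<And>x. compact (K x)" "\<And>x. x \<in> U x" "\<And>x. U x \<subseteq> K x" by metis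
  obtain F where F: "F \<subseteq> range U" "countable F" "\<Union>F = \<Union>(range U)"
    using Lindelof[of "range U"] UK(1) by blast
  then obtain X where X: "countable X" "F = U ` X" by (metis countable_subset_image)
  have cov: "(\<Union>x\<in>X. K x) = UNIV" using F(3) X UK(3,4) by blast
  then have "X \<noteq> {}" by auto
  show ?thesis
  proof (rule that)
    show "compact (K (from_nat_into X n))" for n by (rule UK)
    show "(\<Union>n. K (from_nat_into X n)) = UNIV"
      using cov range_from_nat_into[OF \<open>X \<noteq> {}\<close> X(1)] by (metis image_image)
  qed
qed

text \<open>Closed bounded sets need not be compact, so a function of the distance to
  \<open>K\<close> has compact support only if it vanishes outside a sufficiently small
  neighbourhood. Local compactness supplies one: finitely many compact neighbourhoods of points
  cover an \<open>\<epsilon>\<close>-neighbourhood of \<open>K\<close>.\<close>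

lemma compact_cutoff:
  fixes K :: "'a::metric_space set"
  assumes lc: "locally compact (UNIV :: 'a set)" and K: "compact K"
  obtains \<phi> :: "nat \<Rightarrow> 'a \<Rightarrow> real" where "\<And>n. \<phi> n \<in> C0_fun" "\<And>n x. 0 \<le> \<phi> n x" "\<And>n x. \<phi> n x \<le> 1"
    "\<And>n x. x \<in> K \<Longrightarrow> \<phi> n x = 1" "\<And>x. (\<lambda>n. \<phi> n x) \<longlonglongrightarrow> indicator K x"
proof (cases "K = {}")
  case True
  \<comment> \<open>The distance to the empty set is 0 by convention, so the formula used below
    would produce the constant 1.\<close>
  show ?thesis by (rule that[of "\<lambda>_ _. 0"]) (auto simp: True C0_fun_def)
next
  case False
  have "\<exists>U K. open U \<and> compact K \<and> x \<in> U \<and> U \<subseteq> K" for x :: 'a using locally_compact_nhd[OF lc] by metis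
  then obtain U C where UC: "\<And>x :: 'a. open (U x)" "\<And>x. compact (C x)" "\<And>x. x \<in> U x" "\<And>x. U x \<subseteq> C x" by metis
  have "K \<subseteq> (\<Union>x\<in>K. U x)" using UC(3) by blast
  then obtain X where X: "finite X" "K \<subseteq> (\<Union>x\<in>X. U x)"
    using compactE_image[OF K, of K U] UC(1) by metis
  have "open (\<Union>x\<in>X. U x)" using UC by auto
  then obtain \<epsilon> where \<epsilon>: "\<epsilon> > 0" "(\<Union>x\<in>K. ball x \<epsilon>) \<subseteq> (\<Union>x\<in>X. U x)"
    using compact_subset_open_imp_ball_epsilon_subset[OF K _ X(2)] by blast
  have cC: "compact (\<Union>x\<in>X. C x)" using X UC by (intro compact_UN) auto
  \<comment> \<open>Shifting the index by \<open>N\<close> keeps all supports inside the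
    \<open>\<epsilon>\<close>-neighbourhood, from \<open>n = 0\<close> on.\<close>
  obtain N where N: "1 / real (Suc N) < \<epsilon>" using reals_Archimedean[OF \<epsilon>(1)] by (auto simp: inverse_eq_divide)
  define \<phi> where "\<phi> n x = max 0 (1 - real (Suc (n + N)) * infdist x K)" for n x
  have supp: "{x. \<phi> n x \<noteq> 0} \<subseteq> (\<Union>x\<in>X. C x)" for n
  proof
    fix x assume "x \<in> {x. \<phi> n x \<noteq> 0}"
    then have "real (Suc (n + N)) * infdist x K < 1" by (simp add: \<phi>_def max_def split: if_splits)
    moreover have "real (Suc N) * infdist x K \<le> real (Suc (n + N)) * infdist x K"
      by (intro mult_right_mono) (auto simp: infdist_nonneg)
    ultimately have "real (Suc N) * infdist x K < 1" by linarith
    then have "infdist x K < 1 / real (Suc N)" by (simp add: field_simps del: of_nat_Suc)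
    then have d: "infdist x K < \<epsilon>" using N by linarith
    obtain k where "k \<in> K" "dist x k < \<epsilon>"
    proof -
      have "(INF k\<in>K. dist x k) < \<epsilon>" using d by (simp add: infdist_notempty[OF False])
      then show ?thesis
        using that False by (subst (asm) cINF_less_iff) (auto intro: bdd_belowI2[where m = 0])
    qed
    then have "x \<in> (\<Union>x\<in>K. ball x \<epsilon>)" using d by (auto simp: dist_commute)
    then show "x \<in> (\<Union>x\<in>X. C x)" using \<epsilon>(2) UC(4) by blast
  qed
  show ?thesis
  proof (rule that[of \<phi>])
    fix n
    have "closure {x. \<phi> n x \<noteq> 0} \<subseteq> (\<Union>x\<in>X. C x)"
      using supp cC by (intro closure_minimal compact_imp_closed)
    then have "compact (closure {x. \<phi> n x \<noteq> 0})"
      using cC compact_Int_closed[OF cC closed_closure, of "{x. \<phi> n x \<noteq> 0}"] by (simp add: Int_absorb1)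
    moreover have "continuous_on UNIV (\<phi> n)" unfolding \<phi>_def by (intro continuous_intros)
    ultimately show "\<phi> n \<in> C0_fun" by (simp add: C0_fun_def)
  next
    fix x
    show "(\<lambda>n. \<phi> n x) \<longlonglongrightarrow> indicator K x"
    proof (cases "x \<in> K")
      case True
      then show ?thesis by (simp add: \<phi>_def)
    next
      case x: False
      have d: "infdist x K > 0" using infdist_pos_not_in_closed[OF compact_imp_closed[OF K] False x] .
      obtain M where M: "1 / real (Suc M) < infdist x K" using reals_Archimedean[OF d] by (auto simp: inverse_eq_divide)
      have "\<phi> n x = 0" if "n \<ge> M" for n
      proof -
        have "1 < real (Suc M) * infdist x K" using M by (simp add: field_simps del: of_nat_Suc)
        also have "\<dots> \<le> real (Suc (n + N)) * infdist x K" using that d by (intro mult_right_mono) auto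
        finally show ?thesis by (simp add: \<phi>_def)
      qed
      then have "eventually (\<lambda>n. \<phi> n x = 0) sequentially" by (auto simp: eventually_sequentially)
      then show ?thesis using x by (simp add: tendsto_eventually)
    qed
  qed (auto simp: \<phi>_def infdist_nonneg)
qed

text \<open>Positive and negative variation integrate \<open>C0_fun\<close> alike. Cutoffs make them
  agree on compact sets, sigma-compactness on closed sets, and these form an intersection-stable
  generator of the Borel sets.\<close>

lemma signed_measure_zero:
  fixes \<nu> :: "'a::{metric_space, second_countable_topology} set \<Rightarrow> real"
  assumes lc: "locally compact (UNIV :: 'a set)" and \<nu>: "finite_signed_measure \<nu>"
    and zero: "\<And>\<phi>. \<phi> \<in> C0_fun \<Longrightarrow> signed_integral \<nu> \<phi> = 0" and A: "A \<in> sets borel"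
  shows "\<nu> A = 0"
proof -
  define M where "M = positive_variation \<nu>"
  define N where "N = positive_variation (\<lambda>A. - \<nu> A)"
  note \<nu>' = fsm_uminus[OF \<nu>]
  interpret M: finite_measure M unfolding M_def by (rule finite_measure_positive_variation[OF \<nu>])
  interpret N: finite_measure N unfolding N_def by (rule finite_measure_positive_variation[OF \<nu>'])
  have sets: "sets M = sets borel" "sets N = sets borel" by (simp_all add: M_def N_def \<nu> \<nu>')
  have eq: "(\<integral>x. \<phi> x \<partial>M) = (\<integral>x. \<phi> x \<partial>N)" if "\<phi> \<in> C0_fun" for \<phi>
    using zero[OF that] by (simp add: signed_integral_def M_def N_def)
  have eqK: "measure M K = measure N K" if K: "compact K" for K
  proof -
    obtain \<phi> where \<phi>: "\<And>n. \<phi> n \<in> C0_fun" "\<And>n x. 0 \<le> \<phi> n x" "\<And>n x. \<phi> n x \<le> 1"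
      "\<And>x. (\<lambda>n. \<phi> n x) \<longlonglongrightarrow> indicator K x" using compact_cutoff[OF lc K] by metis
    have Kb: "K \<in> sets borel" using K by (simp add: compact_imp_closed)
    have lim: "(\<lambda>n. \<integral>x. \<phi> n x \<partial>P) \<longlonglongrightarrow> measure P K" if P: "finite_measure P" "sets P = sets borel" for P
    proof -
      interpret P: finite_measure P by fact
      have "(\<lambda>n. \<integral>x. \<phi> n x \<partial>P) \<longlonglongrightarrow> (\<integral>x. indicator K x \<partial>P)"
      proof (rule integral_dominated_convergence[where w = "\<lambda>_. 1"])
        show "\<phi> n \<in> borel_measurable P" for n
          using \<phi>(1)[of n] C0_fun_bounded_borel by (auto simp: bounded_borel_def measurable_cong_sets[OF P(2) refl])
      qed (use \<phi> Kb P(2) in \<open>auto intro!: always_eventually\<close>)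
      then show ?thesis using Kb P(2) by simp
    qed
    show ?thesis
      using lim[OF M.finite_measure_axioms sets(1)] lim[OF N.finite_measure_axioms sets(2)] eq[OF \<phi>(1)]
      by (simp add: LIMSEQ_unique)
  qed
  have "M = N"
  proof (rule measure_eqI_generator_eq[where E = "Collect closed" and \<Omega> = UNIV and A = "\<lambda>_. UNIV"])
    show "emeasure M X = emeasure N X" if "X \<in> Collect closed" for X
    proof -
      obtain K :: "nat \<Rightarrow> 'a set" where K: "\<And>n. compact (K n)" "(\<Union>n. K n) = UNIV" using sigma_compact[OF lc] by metis
      define L where "L n = X \<inter> (\<Union>i\<le>n. K i)" for n
      have cL: "compact (L n)" for n
        unfolding L_def using that K by (intro closed_Int_compact compact_UN) auto
      then have Lb: "range L \<subseteq> sets borel" by (auto simp: compact_imp_closed)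
      have inc: "incseq L" unfolding L_def incseq_def by fastforce
      have UL: "(\<Union>n. L n) = X" unfolding L_def using K(2) by blast
      have "(\<lambda>n. measure M (L n)) \<longlonglongrightarrow> measure M X"
        using M.finite_Lim_measure_incseq[of L] Lb inc sets UL by simp
      moreover have "(\<lambda>n. measure N (L n)) \<longlonglongrightarrow> measure N X"
        using N.finite_Lim_measure_incseq[of L] Lb inc sets UL by simp
      ultimately have "measure M X = measure N X" using eqK[OF cL] by (simp add: LIMSEQ_unique)
      then show ?thesis by (simp add: M.emeasure_eq_measure N.emeasure_eq_measure)
    qed
  qed (auto simp: Int_stable_def sets borel_eq_closed)
  then show ?thesis using jordan_decomposition[OF \<nu> A] by (simp add: M_def N_def)
qed

section \<open>Dirichlet forms\<close>

definition L2_inner :: "'a measure \<Rightarrow> ('a \<Rightarrow> real) \<Rightarrow> ('a \<Rightarrow> real) \<Rightarrow> real" where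
  "L2_inner \<mu> u v = (\<integral>x. u x * v x \<partial>\<mu>)"

lemma L2_inner_zero [simp]: "L2_inner \<mu> (\<lambda>_. 0) v = 0"
  by (simp add: L2_inner_def)

lemma L2_inner_commute: "L2_inner \<mu> u v = L2_inner \<mu> v u"
  by (simp add: L2_inner_def mult.commute)

lemma L2_mult_integrable:
  assumes "u \<in> L2_fun \<mu>" "v \<in> L2_fun \<mu>"
  shows "integrable \<mu> (\<lambda>x. u x * v x)"
proof (rule Bochner_Integration.integrable_bound)
  show "integrable \<mu> (\<lambda>x. (u x)\<^sup>2 + (v x)\<^sup>2)" using assms by (simp add: L2_fun_def)
  have "\<bar>u x * v x\<bar> \<le> (u x)\<^sup>2 + (v x)\<^sup>2" for x
    using zero_le_power2[of "\<bar>u x\<bar> - \<bar>v x\<bar>"] zero_le_power2[of "u x"] zero_le_power2[of "v x"]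
    unfolding power2_diff abs_mult power2_abs by linarith
  then show "AE x in \<mu>. norm (u x * v x) \<le> norm ((u x)\<^sup>2 + (v x)\<^sup>2)" by simp
  show "(\<lambda>x. u x * v x) \<in> borel_measurable \<mu>"
    using assms by (intro borel_measurable_times) (auto simp: L2_fun_def)
qed

lemma L2_fun_bound:
  assumes "u \<in> borel_measurable \<mu>" "v \<in> L2_fun \<mu>" "\<And>x. \<bar>u x\<bar> \<le> K * \<bar>v x\<bar>"
  shows "u \<in> L2_fun \<mu>"
proof -
  have "integrable \<mu> (\<lambda>x. (u x)\<^sup>2)"
  proof (rule Bochner_Integration.integrable_bound)
    show "integrable \<mu> (\<lambda>x. K\<^sup>2 * (v x)\<^sup>2)" using assms(2) by (simp add: L2_fun_def)
    have "(u x)\<^sup>2 \<le> (K * \<bar>v x\<bar>)\<^sup>2" for x using power_mono[OF assms(3)[of x], of 2] by simp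
    then show "AE x in \<mu>. norm ((u x)\<^sup>2) \<le> norm (K\<^sup>2 * (v x)\<^sup>2)" by (simp add: power_mult_distrib)
  qed (use assms in simp)
  then show ?thesis using assms by (simp add: L2_fun_def)
qed

lemma subspace_L2_fun: "fun_subspace (L2_fun \<mu>)"
  unfolding fun_subspace_def
proof (intro conjI ballI allI)
  fix u v assume uv: "u \<in> L2_fun \<mu>" "v \<in> L2_fun \<mu>"
  then have "integrable \<mu> (\<lambda>x. (u x)\<^sup>2 + 2 * (u x * v x) + (v x)\<^sup>2)"
    using L2_mult_integrable[OF uv] by (auto simp: L2_fun_def)
  moreover have "(u x + v x)\<^sup>2 = (u x)\<^sup>2 + 2 * (u x * v x) + (v x)\<^sup>2" for x by (simp add: power2_sum)
  moreover have "(\<lambda>x. u x + v x) \<in> borel_measurable \<mu>"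
    using uv by (intro borel_measurable_add) (auto simp: L2_fun_def)
  ultimately show "(\<lambda>x. u x + v x) \<in> L2_fun \<mu>" by (simp add: L2_fun_def)
next
  fix c and u :: "'a \<Rightarrow> real" assume "u \<in> L2_fun \<mu>"
  moreover from this have "(\<lambda>x. c * u x) \<in> borel_measurable \<mu>"
    by (intro borel_measurable_times borel_measurable_const) (simp add: L2_fun_def)
  ultimately show "(\<lambda>x. c * u x) \<in> L2_fun \<mu>"
    using L2_fun_bound[of "\<lambda>x. c * u x" \<mu> u "\<bar>c\<bar>"] by (simp add: abs_mult)
qed (simp add: L2_fun_def)

lemma semi_inner_L2: "semi_inner_space (fun_hspace (L2_fun \<mu>) (L2_inner \<mu>))"
proof (rule semi_inner_space_fun_hspace[OF subspace_L2_fun])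
  show "bilinear_form_on (L2_fun \<mu>) (L2_inner \<mu>)"
    unfolding bilinear_form_on_def L2_inner_def
    by (simp add: L2_mult_integrable distrib_right distrib_left mult.assoc mult.left_commute)
qed (auto simp: L2_inner_def mult.commute)

locale dirichlet_form =
  fixes \<mu> :: "'a measure" and F and E
  assumes df: "symmetric_dirichlet_form \<mu> F E"
begin

abbreviation "ip \<equiv> L2_inner \<mu>"
abbreviation "L2 \<equiv> L2_fun \<mu>"

lemma F_L2: "u \<in> F \<Longrightarrow> u \<in> L2"
  and F_subspace: "fun_subspace F"
  and E_bilinear: "bilinear_form_on F E"
  and E_sym: "u \<in> F \<Longrightarrow> v \<in> F \<Longrightarrow> E u v = E v u"
  and E_nonneg: "u \<in> F \<Longrightarrow> 0 \<le> E u u"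
  and markov: "u \<in> F \<Longrightarrow> (\<lambda>x. min (max (u x) 0) 1) \<in> F"
  and markov_le: "u \<in> F \<Longrightarrow> E (\<lambda>x. min (max (u x) 0) 1) (\<lambda>x. min (max (u x) 0) 1) \<le> E u u"
  using df unfolding symmetric_dirichlet_form_def by auto

lemma F_AE:
  assumes "u \<in> F" "v \<in> L2" "AE x in \<mu>. u x = v x"
  shows "v \<in> F" "h \<in> F \<Longrightarrow> E v h = E u h"
  using df assms unfolding symmetric_dirichlet_form_def by blast+

lemma F_closed:
  assumes "range u \<subseteq> F" "\<forall>e>0. \<exists>N. \<forall>i\<ge>N. \<forall>j\<ge>N. energy1 \<mu> E (\<lambda>x. u i x - u j x) < e"
  shows "\<exists>f\<in>F. (\<lambda>n. energy1 \<mu> E (\<lambda>x. u n x - f x)) \<longlonglongrightarrow> 0"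
  using df assms unfolding symmetric_dirichlet_form_def by blast

lemma fun_semi_inner_F: "fun_semi_inner F E"
  by (intro fun_semi_inner.intro semi_inner_space_fun_hspace F_subspace E_bilinear E_sym E_nonneg)

lemma fun_semi_inner_L2: "fun_semi_inner L2 ip"
  by (intro fun_semi_inner.intro semi_inner_L2)

sublocale En: fun_semi_inner F E by (rule fun_semi_inner_F)
sublocale Lt: fun_semi_inner L2 ip by (rule fun_semi_inner_L2)

lemmas F_add = fun_subspace_add[OF F_subspace]
  and F_scale = fun_subspace_scale[OF F_subspace]
  and F_diff = fun_subspace_diff[OF F_subspace]
  and L2_add = fun_subspace_add[OF subspace_L2_fun]
  and L2_scale = fun_subspace_scale[OF subspace_L2_fun]
  and L2_diff = fun_subspace_diff[OF subspace_L2_fun]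

lemma E_diff_sq:
  assumes "u \<in> F" "v \<in> F"
  shows "E (\<lambda>x. u x - v x) (\<lambda>x. u x - v x) = E u u - 2 * E u v + E v v"
  using En.form_diff_eq[OF assms] by (simp add: hdist2_def)

lemma ip_diff_sq:
  assumes "u \<in> L2" "v \<in> L2"
  shows "ip (\<lambda>x. u x - v x) (\<lambda>x. u x - v x) = ip u u - 2 * ip u v + ip v v"
  using Lt.form_diff_eq[OF assms] by (simp add: hdist2_def)

lemma ip_nonneg [simp]: "0 \<le> ip u u"
  by (simp add: L2_inner_def)

lemma ip_diff_left:
  assumes "u \<in> L2" "v \<in> L2" "w \<in> L2"
  shows "ip (\<lambda>x. u x - v x) w = ip u w - ip v w"
  using L2_mult_integrable[OF assms(1,3)] L2_mult_integrable[OF assms(2,3)]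
  by (simp add: L2_inner_def left_diff_distrib)

lemma E_diff_left:
  assumes "u \<in> F" "v \<in> F" "w \<in> F"
  shows "E (\<lambda>x. u x - v x) w = E u w - E v w"
  using En.S.inner_add_left[of u "\<lambda>x. (-1) * v x" w] En.S.inner_scale_left[of v w "-1"] assms F_scale[of v "-1"]
  by simp

lemma ip_zero_AE:
  assumes "u \<in> L2" "v \<in> L2" "ip (\<lambda>x. u x - v x) (\<lambda>x. u x - v x) = 0"
  shows "AE x in \<mu>. u x = v x"
proof -
  have d: "(\<lambda>x. u x - v x) \<in> L2" using assms L2_diff by blast
  have "AE x in \<mu>. (u x - v x) * (u x - v x) = 0"
    using assms(3) integral_nonneg_eq_0_iff_AE[OF L2_mult_integrable[OF d d]] by (simp add: L2_inner_def)
  then show ?thesis by eventually_elim simp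
qed

lemma energy1_eq: "energy1 \<mu> E u = E u u + ip u u"
  by (simp add: energy1_def L2_inner_def power2_eq_square)

section \<open>The resolvent and its variational characterization\<close>

lemma complete_F:
  assumes \<beta>: "\<beta> > 0"
  shows "complete_semi_inner_space (fun_hspace F (\<lambda>u v. E u v + \<beta> * ip u v))"
proof -
  let ?B = "\<lambda>u v. E u v + \<beta> * ip u v"
  have si: "semi_inner_space (fun_hspace F ?B)"
  proof (rule semi_inner_space_fun_hspace[OF F_subspace])
    show "bilinear_form_on F ?B"
      using E_bilinear L2_mult_integrable[OF F_L2 F_L2] unfolding bilinear_form_on_def L2_inner_def
      by (simp add: algebra_simps)
  qed (use E_sym E_nonneg \<beta> in \<open>auto simp: L2_inner_commute intro!: add_nonneg_nonneg\<close>)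
  then interpret B: fun_semi_inner F ?B by (rule fun_semi_inner.intro)
  show ?thesis
  proof (intro complete_semi_inner_space.intro complete_semi_inner_space_axioms.intro si)
    fix u assume u: "range u \<subseteq> hcarrier (fun_hspace F ?B)" "hcauchy (fun_hspace F ?B) u"
    then have uF: "u n \<in> F" for n by auto
    \<comment> \<open>With the reverse estimate, whose constant is \<open>1 + \<beta>\<close>, this
      shows that \<open>E + \<beta> * ip\<close> and \<open>energy1\<close> have the same Cauchy and
      null sequences, so closedness of the form applies for every
      \<open>\<beta> > 0\<close>.\<close>
    have le: "energy1 \<mu> E w \<le> (1 + 1 / \<beta>) * ?B w w" if w: "w \<in> F" for w
    proof -
      have "E w w + ip w w \<le> (E w w + \<beta> * ip w w) + (1 / \<beta>) * (E w w + \<beta> * ip w w)"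
        using E_nonneg[OF w] \<beta> by (simp add: field_simps)
      then show ?thesis by (simp add: energy1_eq algebra_simps)
    qed
    have "\<forall>e>0. \<exists>N. \<forall>i\<ge>N. \<forall>j\<ge>N. energy1 \<mu> E (\<lambda>x. u i x - u j x) < e"
    proof (intro allI impI)
      fix e :: real assume e: "e > 0"
      have pos: "0 < 1 + 1 / \<beta>" using \<beta> by (simp add: add_pos_pos)
      then have "0 < e / (1 + 1 / \<beta>)" using e by simp
      from u(2)[unfolded hcauchy_def, rule_format, OF this] obtain N where N: "\<And>i j. i \<ge> N \<Longrightarrow> j \<ge> N \<Longrightarrow> hdist2 (fun_hspace F ?B) (u i) (u j) < e / (1 + 1 / \<beta>)"
        by blast
      have "energy1 \<mu> E (\<lambda>x. u i x - u j x) < e" if ij: "i \<ge> N" "j \<ge> N" for i j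
      proof -
        have "energy1 \<mu> E (\<lambda>x. u i x - u j x) \<le> (1 + 1 / \<beta>) * hdist2 (fun_hspace F ?B) (u i) (u j)"
          using le[OF F_diff[OF uF uF], of i j] B.form_diff_eq[OF uF uF, of i j] by simp
        also have "\<dots> < e" using N[OF ij] pos by (simp add: pos_less_divide_eq mult.commute)
        finally show ?thesis .
      qed
      then show "\<exists>N. \<forall>i\<ge>N. \<forall>j\<ge>N. energy1 \<mu> E (\<lambda>x. u i x - u j x) < e" by blast
    qed
    from F_closed[OF _ this] uF obtain f where f: "f \<in> F" "(\<lambda>n. energy1 \<mu> E (\<lambda>x. u n x - f x)) \<longlonglongrightarrow> 0"
      by blast
    have "(\<lambda>n. (1 + \<beta>) * energy1 \<mu> E (\<lambda>x. u n x - f x)) \<longlonglongrightarrow> (1 + \<beta>) * 0"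
      by (intro tendsto_mult_left f)
    then have lim: "(\<lambda>n. (1 + \<beta>) * energy1 \<mu> E (\<lambda>x. u n x - f x)) \<longlonglongrightarrow> 0" by simp
    have "hdist2 (fun_hspace F ?B) (u n) f \<le> (1 + \<beta>) * energy1 \<mu> E (\<lambda>x. u n x - f x)" for n
    proof -
      have "?B w w \<le> (1 + \<beta>) * energy1 \<mu> E w" if "w \<in> F" for w
        using E_nonneg[OF that] ip_nonneg[of w] \<beta> by (simp add: energy1_eq algebra_simps)
      from this[OF F_diff[OF uF[of n] f(1)]] show ?thesis using B.form_diff_eq[OF uF[of n] f(1)] by (simp only:)
    qed
    then have "(\<lambda>n. hdist2 (fun_hspace F ?B) (u n) f) \<longlonglongrightarrow> 0"
      using B.S.hdist2_nonneg uF f(1)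
      by (intro tendsto_sandwich[OF _ _ tendsto_const lim]) (auto intro!: always_eventually)
    then show "\<exists>l\<in>hcarrier (fun_hspace F ?B). (\<lambda>n. hdist2 (fun_hspace F ?B) (u n) l) \<longlonglongrightarrow> 0"
      using f(1) by auto
  qed
qed

text \<open>\<open>res \<beta>\<close> is \<open>\<beta> G\<^sub>\<beta>\<close> in terms of the resolvent \<open>G\<^sub>\<beta>\<close> of the form.\<close>

definition res :: "real \<Rightarrow> ('a \<Rightarrow> real) \<Rightarrow> 'a \<Rightarrow> real" where
  "res \<beta> u = (SOME w. w \<in> F \<and> (\<forall>v\<in>F. E w v + \<beta> * ip w v = \<beta> * ip u v))"

text \<open>Riesz representation of \<open>v \<mapsto> \<beta> * ip u v\<close> on \<open>F\<close>
  with the form \<open>E + \<beta> * ip\<close>; Cauchy-Schwarz in \<open>L2\<close> gives the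
  constant \<open>\<beta> * ip u u\<close>.\<close>

lemma res_exists:
  assumes \<beta>: "\<beta> > 0" and u: "u \<in> L2"
  shows "\<exists>w. w \<in> F \<and> (\<forall>v\<in>F. E w v + \<beta> * ip w v = \<beta> * ip u v)"
proof -
  interpret B: complete_semi_inner_space "fun_hspace F (\<lambda>u v. E u v + \<beta> * ip u v)"
    by (rule complete_F[OF \<beta>])
  obtain s w where "w \<in> F" "\<And>v. v \<in> F \<Longrightarrow> E w v + \<beta> * ip w v = \<beta> * ip u v"
  proof (rule B.riesz_subspace[of F "\<lambda>v. \<beta> * ip u v" "\<beta> * ip u u"])
    fix v assume v: "v \<in> F"
    have "(\<beta> * ip u v)\<^sup>2 \<le> \<beta>\<^sup>2 * (ip u u * ip v v)"
      using Lt.S.cauchy_schwarz[of u v] u F_L2[OF v] by (simp add: power_mult_distrib mult_left_mono)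
    also have "\<dots> = \<beta> * ip u u * (\<beta> * ip v v)" by (simp add: power2_eq_square)
    also have "\<dots> \<le> \<beta> * ip u u * (E v v + \<beta> * ip v v)"
      using E_nonneg[OF v] \<beta> by (intro mult_left_mono) auto
    finally show "(\<beta> * ip u v)\<^sup>2 \<le> \<beta> * ip u u * hinner (fun_hspace F (\<lambda>u v. E u v + \<beta> * ip u v)) v v"
      by simp
  next
    fix v v' assume "v \<in> F" "v' \<in> F"
    then show "\<beta> * ip u (hadd (fun_hspace F (\<lambda>u v. E u v + \<beta> * ip u v)) v v') = \<beta> * ip u v + \<beta> * ip u v'"
      using Lt.S.inner_add_right[of v v' u] F_L2 u by (simp add: algebra_simps)
  next
    fix c v assume "v \<in> F"
    then show "\<beta> * ip u (hscale (fun_hspace F (\<lambda>u v. E u v + \<beta> * ip u v)) c v) = c * (\<beta> * ip u v)"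
      using Lt.S.inner_scale_right[of v u c] F_L2 u by simp
  qed (use B.nonempty \<beta> F_add F_scale in auto)
  then show ?thesis by blast
qed

lemma res:
  assumes "\<beta> > 0" "u \<in> L2"
  shows res_F: "res \<beta> u \<in> F" and res_eq: "v \<in> F \<Longrightarrow> E (res \<beta> u) v + \<beta> * ip (res \<beta> u) v = \<beta> * ip u v"
  using someI_ex[OF res_exists[OF assms], folded res_def] by auto

lemma res_L2: "\<beta> > 0 \<Longrightarrow> u \<in> L2 \<Longrightarrow> res \<beta> u \<in> L2"
  using res_F F_L2 by blast

lemma res_E:
  assumes "\<beta> > 0" "u \<in> L2" "v \<in> F"
  shows "E (res \<beta> u) v = \<beta> * (ip u v - ip (res \<beta> u) v)"
  using res_eq[OF assms] by (simp add: algebra_simps)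

lemma res_unique:
  assumes \<beta>: "\<beta> > 0" and u: "u \<in> L2" and w: "w \<in> F"
    and eq: "\<And>v. v \<in> F \<Longrightarrow> E w v + \<beta> * ip w v = \<beta> * ip u v"
  shows "AE x in \<mu>. res \<beta> u x = w x"
proof -
  let ?r = "res \<beta> u" let ?d = "\<lambda>x. ?r x - w x"
  have F: "?r \<in> F" "?d \<in> F" using res_F[OF \<beta> u] w F_diff by auto
  have "E ?d ?d + \<beta> * ip ?d ?d = 0"
    using res_eq[OF \<beta> u F(2)] eq[OF F(2)]
    by (simp add: E_diff_left[OF F(1) w F(2)] ip_diff_left[OF F_L2[OF F(1)] F_L2[OF w] F_L2[OF F(2)]]
        right_diff_distrib[of \<beta>])
  moreover have "0 \<le> E ?d ?d" by (rule E_nonneg[OF F(2)])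
  moreover have "0 \<le> \<beta> * ip ?d ?d" using \<beta> by simp
  ultimately have "\<beta> * ip ?d ?d = 0" by linarith
  then have "ip ?d ?d = 0" using \<beta> by simp
  then show ?thesis using F w F_L2 by (intro ip_zero_AE) auto
qed

text \<open>\<open>res \<beta> u\<close> minimizes the energy plus \<open>\<beta>\<close> times the
  squared distance to \<open>u\<close>, and the excess of a competitor is precisely its squared
  distance from the minimizer. Energy bounds, membership in \<open>F\<close> and the Markov property
  are read off from this.\<close>

lemma res_minimal:
  assumes \<beta>: "\<beta> > 0" and u: "u \<in> L2" and v: "v \<in> F"
  defines "w \<equiv> res \<beta> u"
  shows "(E v v + \<beta> * ip (\<lambda>x. v x - u x) (\<lambda>x. v x - u x)) - (E w w + \<beta> * ip (\<lambda>x. w x - u x) (\<lambda>x. w x - u x))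
    = E (\<lambda>x. v x - w x) (\<lambda>x. v x - w x) + \<beta> * ip (\<lambda>x. v x - w x) (\<lambda>x. v x - w x)"
proof -
  have w: "w \<in> F" "w \<in> L2" "v \<in> L2" using res_F[OF \<beta> u] F_L2 v by (auto simp: w_def)
  have "E w v + \<beta> * ip w v = \<beta> * ip u v" "E w w + \<beta> * ip w w = \<beta> * ip u w"
    using res_eq[OF \<beta> u] v w by (auto simp: w_def)
  moreover have "ip v u = ip u v" "ip w u = ip u w" "ip v w = ip w v" by (rule L2_inner_commute)+
  moreover have "E v w = E w v" using E_sym v w by blast
  ultimately show ?thesis
    using v w u by (simp add: ip_diff_sq E_diff_sq algebra_simps)
qed

lemma res_energy_le:
  assumes \<beta>: "\<beta> > 0" and u: "u \<in> L2" and v: "v \<in> F"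
  shows "E (res \<beta> u) (res \<beta> u) + \<beta> * ip (\<lambda>x. res \<beta> u x - u x) (\<lambda>x. res \<beta> u x - u x)
    \<le> E v v + \<beta> * ip (\<lambda>x. v x - u x) (\<lambda>x. v x - u x)"
proof -
  have "0 \<le> E (\<lambda>x. v x - res \<beta> u x) (\<lambda>x. v x - res \<beta> u x)" by (intro E_nonneg F_diff v res_F \<beta> u)
  moreover have "0 \<le> \<beta> * ip (\<lambda>x. v x - res \<beta> u x) (\<lambda>x. v x - res \<beta> u x)" using \<beta> by simp
  ultimately show ?thesis using res_minimal[OF \<beta> u v] by linarith
qed

text \<open>The point is that \<open>E (res \<alpha> u)\<close> is nonnegative at the difference
  \<open>?D\<close>; expanding the square then gives the estimate. Bounded energies thereby force
  Cauchy sequences.\<close>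

lemma res_energy_mono:
  assumes \<alpha>: "0 < \<alpha>" "\<alpha> < \<beta>" and u: "u \<in> L2"
  shows "E (\<lambda>x. res \<beta> u x - res \<alpha> u x) (\<lambda>x. res \<beta> u x - res \<alpha> u x) \<le> E (res \<beta> u) (res \<beta> u) - E (res \<alpha> u) (res \<alpha> u)"
proof -
  let ?a = "res \<alpha> u" let ?b = "res \<beta> u" let ?D = "\<lambda>x. ?b x - ?a x"
  have \<beta>: "\<beta> > 0" using \<alpha> by simp
  have F: "?a \<in> F" "?b \<in> F" "?D \<in> F" using res_F \<alpha> \<beta> u F_diff by auto
  note L = F[THEN F_L2]
  define p where "p = ip u ?D - ip ?a ?D"
  define q where "q = ip u ?D - ip ?b ?D"
  have Ea: "E ?a ?D = \<alpha> * p" and Eb: "E ?b ?D = \<beta> * q"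
    unfolding p_def q_def by (rule res_E[OF _ u F(3)], fact)+
  have DD: "E ?D ?D = \<beta> * q - \<alpha> * p" using E_diff_left[OF F(2,1,3)] Ea Eb by simp
  have pq: "p - q = ip ?D ?D" unfolding p_def q_def using ip_diff_left[OF L(2,1,3)] by simp
  \<comment> \<open>Since \<open>q \<le> p\<close>, a negative \<open>p\<close> would give
    \<open>\<beta> * q \<le> \<beta> * p < \<alpha> * p\<close>, making the energy
    \<open>\<beta> * q - \<alpha> * p\<close> of \<open>?D\<close> negative.\<close>
  have "0 \<le> p"
  proof (rule ccontr)
    assume "\<not> 0 \<le> p"
    then have p: "p < 0" by simp
    have "q \<le> p" using pq ip_nonneg[of ?D] by linarith
    then have "\<beta> * q \<le> \<beta> * p" using \<beta> by simp
    also have "\<dots> < \<alpha> * p" using \<alpha> p by (simp add: mult_strict_right_mono_neg)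
    finally show False using DD E_nonneg[OF F(3)] by linarith
  qed
  then have "0 \<le> E ?a ?D" using Ea \<alpha> by simp
  moreover have "E ?D ?a = E ?b ?a - E ?a ?a" using E_diff_left[OF F(2,1,1)] .
  moreover have "E ?D ?a = E ?a ?D" using E_sym F by blast
  moreover have "E ?D ?D = E ?b ?b - 2 * E ?b ?a + E ?a ?a" using E_diff_sq[OF F(2,1)] .
  ultimately show ?thesis by linarith
qed

text \<open>The energies of the approximants increase, so the bound makes them Cauchy, and
  \<open>res_energy_mono\<close> turns this into a Cauchy sequence in energy. The second summand
  under the bound forces \<open>L2\<close> convergence to \<open>u\<close> at the rate
  \<open>C / Suc n\<close>. Closedness then produces a limit in \<open>F\<close> that agrees with
  \<open>u\<close> almost everywhere.\<close>

lemma res_converges: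
  assumes u: "u \<in> L2"
    and C: "\<And>n. E (res (real (Suc n)) u) (res (real (Suc n)) u)
      + real (Suc n) * ip (\<lambda>x. res (real (Suc n)) u x - u x) (\<lambda>x. res (real (Suc n)) u x - u x) \<le> C"
  shows "u \<in> F" "(\<lambda>n. hdist2 (fun_hspace F E) (res (real (Suc n)) u) u) \<longlonglongrightarrow> 0"
proof -
  define w where "w n = res (real (Suc n)) u" for n
  have wF: "w n \<in> F" for n unfolding w_def by (rule res_F) (use u in auto)
  then have wL: "w n \<in> L2" for n using F_L2 by blast
  define a where "a n = E (w n) (w n)" for n
  have dle: "E (\<lambda>x. w j x - w i x) (\<lambda>x. w j x - w i x) \<le> a j - a i" if "i < j" for i j
    unfolding w_def a_def using that u by (intro res_energy_mono) auto
  have a_inc: "incseq a"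
  proof (rule incseq_SucI)
    fix n show "a n \<le> a (Suc n)"
      using dle[of n "Suc n"] E_nonneg[OF F_diff[OF wF wF], of "Suc n" n] by simp
  qed
  have nonneg: "0 \<le> real (Suc n) * ip (\<lambda>x. w n x - u x) (\<lambda>x. w n x - u x)" for n
    by (intro mult_nonneg_nonneg ip_nonneg) auto
  have "a n \<le> C" for n using C[of n] nonneg[of n] unfolding a_def w_def by linarith
  then have aC: "Cauchy a" using incseq_convergent[OF a_inc] LIMSEQ_imp_Cauchy by blast
  have Ebd: "\<exists>N. \<forall>i\<ge>N. \<forall>j\<ge>N. E (\<lambda>x. w i x - w j x) (\<lambda>x. w i x - w j x) < e" if e: "e > 0" for e
  proof -
    obtain N where N: "\<And>i j. i \<ge> N \<Longrightarrow> j \<ge> N \<Longrightarrow> \<bar>a i - a j\<bar> < e"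
      using metric_CauchyD[OF aC e] by (auto simp: dist_real_def)
    have "E (\<lambda>x. w i x - w j x) (\<lambda>x. w i x - w j x) < e" if ij: "i \<ge> N" "j \<ge> N" for i j
    proof -
      have "E (\<lambda>x. w i x - w j x) (\<lambda>x. w i x - w j x) = hdist2 (fun_hspace F E) (w i) (w j)"
        by (rule En.form_diff_eq[OF wF wF])
      moreover have "E (\<lambda>x. w j x - w i x) (\<lambda>x. w j x - w i x) = hdist2 (fun_hspace F E) (w j) (w i)"
        by (rule En.form_diff_eq[OF wF wF])
      moreover have "hdist2 (fun_hspace F E) (w i) (w j) = hdist2 (fun_hspace F E) (w j) (w i)"
        using wF by (intro En.S.hdist2_commute) auto
      moreover consider "i < j" | "j < i" | "i = j" by linarith
      ultimately show ?thesis
        using dle[of i j] dle[of j i] N[OF ij] N[OF ij(2,1)] e by (cases rule: linorder_cases[of i j]) auto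
    qed
    then show ?thesis by blast
  qed
  have Lle: "ip (\<lambda>x. w n x - u x) (\<lambda>x. w n x - u x) \<le> C / real (Suc n)" for n
    using C[of n] E_nonneg[OF wF, of n] unfolding w_def by (simp add: field_simps)
  have C0: "(\<lambda>n. C / real (Suc n)) \<longlonglongrightarrow> 0"
    using tendsto_mult_left[OF LIMSEQ_inverse_real_of_nat, of C] by (simp add: divide_inverse)
  have Llim: "(\<lambda>n. hdist2 (fun_hspace L2 ip) (w n) u) \<longlonglongrightarrow> 0"
    using Lle Lt.form_diff_eq[OF wL u] ip_nonneg
    by (intro tendsto_sandwich[OF _ _ tendsto_const C0]) (auto intro!: always_eventually, metis ip_nonneg)
  then have "hcauchy (fun_hspace L2 ip) w" using wL u by (intro Lt.S.hcauchy_if_convergent) auto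
  then have Lbd: "\<exists>N. \<forall>i\<ge>N. \<forall>j\<ge>N. ip (\<lambda>x. w i x - w j x) (\<lambda>x. w i x - w j x) < e" if e: "e > 0" for e
    using e Lt.form_diff_eq[OF wL wL] unfolding hcauchy_def by simp
  have "\<forall>e>0. \<exists>N. \<forall>i\<ge>N. \<forall>j\<ge>N. energy1 \<mu> E (\<lambda>x. w i x - w j x) < e"
  proof (intro allI impI)
    fix e :: real assume "e > 0"
    then have "e / 2 > 0" by simp
    from Ebd[OF this] Lbd[OF this] obtain M N where
      "\<And>i j. i \<ge> M \<Longrightarrow> j \<ge> M \<Longrightarrow> E (\<lambda>x. w i x - w j x) (\<lambda>x. w i x - w j x) < e / 2"
      "\<And>i j. i \<ge> N \<Longrightarrow> j \<ge> N \<Longrightarrow> ip (\<lambda>x. w i x - w j x) (\<lambda>x. w i x - w j x) < e / 2" by blast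
    then have "energy1 \<mu> E (\<lambda>x. w i x - w j x) < e" if "i \<ge> max M N" "j \<ge> max M N" for i j
      unfolding energy1_eq using that by (metis add_strict_mono field_sum_of_halves max.bounded_iff)
    then show "\<exists>N. \<forall>i\<ge>N. \<forall>j\<ge>N. energy1 \<mu> E (\<lambda>x. w i x - w j x) < e" by blast
  qed
  from F_closed[OF _ this] wF obtain f where f: "f \<in> F" "(\<lambda>n. energy1 \<mu> E (\<lambda>x. w n x - f x)) \<longlonglongrightarrow> 0" by blast
  have fL: "f \<in> L2" using F_L2 f by blast
  have "(\<lambda>n. hdist2 (fun_hspace L2 ip) (w n) f) \<longlonglongrightarrow> 0"
  proof (rule tendsto_sandwich[OF _ _ tendsto_const f(2)])
    show "\<forall>\<^sub>F n in sequentially. 0 \<le> hdist2 (fun_hspace L2 ip) (w n) f" using wL fL by (intro always_eventually allI Lt.S.hdist2_nonneg) auto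
    show "\<forall>\<^sub>F n in sequentially. hdist2 (fun_hspace L2 ip) (w n) f \<le> energy1 \<mu> E (\<lambda>x. w n x - f x)"
      using E_nonneg[OF F_diff[OF wF f(1)]] Lt.form_diff_eq[OF wL fL] by (intro always_eventually allI) (simp add: energy1_eq)
  qed
  then have "hdist2 (fun_hspace L2 ip) f u = 0"
    using Llim wL fL u by (intro Lt.S.tendsto_hdist2_unique[of w]) auto
  then have fu: "AE x in \<mu>. f x = u x" using Lt.form_diff_eq[OF fL u] fL u by (intro ip_zero_AE) auto
  show uF: "u \<in> F" using F_AE(1)[OF f(1) u fu] .
  have "hdist2 (fun_hspace F E) (w n) u = hdist2 (fun_hspace F E) (w n) f" for n
    unfolding hdist2_def fun_hspace_simps
    using F_AE(2)[OF f(1) u fu] E_sym wF uF f(1) by metis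
  moreover have "(\<lambda>n. hdist2 (fun_hspace F E) (w n) f) \<longlonglongrightarrow> 0"
  proof (rule tendsto_sandwich[OF _ _ tendsto_const f(2)])
    show "\<forall>\<^sub>F n in sequentially. 0 \<le> hdist2 (fun_hspace F E) (w n) f" using wF f by (intro always_eventually allI En.S.hdist2_nonneg) auto
    show "\<forall>\<^sub>F n in sequentially. hdist2 (fun_hspace F E) (w n) f \<le> energy1 \<mu> E (\<lambda>x. w n x - f x)"
      using En.form_diff_eq[OF wF f(1)] by (intro always_eventually allI) (simp add: energy1_eq)
  qed
  ultimately show "(\<lambda>n. hdist2 (fun_hspace F E) (res (real (Suc n)) u) u) \<longlonglongrightarrow> 0" by (simp add: w_def)
qed

text \<open>A substitute for weak compactness: the approximants of \<open>u\<close> are minimizers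
  and compete with every \<open>v k\<close>; letting \<open>k\<close> grow leaves the bound
  \<open>C\<close>, uniformly in the parameter of the resolvent.\<close>

lemma F_bounded_limit:
  assumes u: "u \<in> L2" and v: "\<And>n. v n \<in> F" "\<And>n. E (v n) (v n) \<le> C"
    and lim: "(\<lambda>n. ip (\<lambda>x. v n x - u x) (\<lambda>x. v n x - u x)) \<longlonglongrightarrow> 0"
  shows "u \<in> F"
proof (rule res_converges(1)[OF u])
  fix n
  let ?w = "res (real (Suc n)) u"
  have "(\<lambda>k. C + real (Suc n) * ip (\<lambda>x. v k x - u x) (\<lambda>x. v k x - u x)) \<longlonglongrightarrow> C + real (Suc n) * 0"
    by (intro tendsto_intros lim)
  moreover have "E ?w ?w + real (Suc n) * ip (\<lambda>x. ?w x - u x) (\<lambda>x. ?w x - u x)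
      \<le> C + real (Suc n) * ip (\<lambda>x. v k x - u x) (\<lambda>x. v k x - u x)" for k
    using res_energy_le[OF _ u v(1), of "real (Suc n)" k] v(2)[of k] by linarith
  ultimately show "E ?w ?w + real (Suc n) * ip (\<lambda>x. ?w x - u x) (\<lambda>x. ?w x - u x) \<le> C"
    by (intro LIMSEQ_le_const[where a = "E ?w ?w + _"]) auto
qed

text \<open>As \<open>E (res \<beta> u) v\<close> is \<open>\<beta>\<close> times the pairing of
  \<open>u - res \<beta> u\<close> with \<open>v\<close>, this says that the approximating forms
  converge to \<open>E\<close> on \<open>F\<close>.\<close>

lemma res_tendsto:
  assumes u: "u \<in> F" and v: "v \<in> F"
  shows "(\<lambda>n. E (res (real (Suc n)) u) v) \<longlonglongrightarrow> E u v"
proof -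
  note uL = F_L2[OF u]
  have "(\<lambda>n. hdist2 (fun_hspace F E) (res (real (Suc n)) u) u) \<longlonglongrightarrow> 0"
    using res_energy_le[OF _ uL u] by (intro res_converges(2)[OF uL, where C = "E u u"]) (simp del: of_nat_Suc)
  moreover have "range (\<lambda>n. res (real (Suc n)) u) \<subseteq> F" using res_F[OF _ uL] by (auto simp del: of_nat_Suc)
  ultimately show ?thesis
    using En.S.tendsto_inner_left[of "\<lambda>n. res (real (Suc n)) u" u v] u v by (simp del: of_nat_Suc)
qed

text \<open>Only almost everywhere, since \<open>res\<close> selects an arbitrary
  representative.\<close>

lemma res_linear:
  assumes \<beta>: "\<beta> > 0" and u: "u \<in> L2" "v \<in> L2"
  shows "AE x in \<mu>. res \<beta> (\<lambda>x. a * u x + b * v x) x = a * res \<beta> u x + b * res \<beta> v x"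
proof (rule res_unique[OF \<beta>])
  show "(\<lambda>x. a * u x + b * v x) \<in> L2" by (intro L2_add L2_scale u)
  show "(\<lambda>x. a * res \<beta> u x + b * res \<beta> v x) \<in> F" by (intro F_add F_scale res_F \<beta> u)
  fix w assume w: "w \<in> F"
  note wL = F_L2[OF w]
  have lin: "ip (\<lambda>x. a * f x + b * g x) w = a * ip f w + b * ip g w" if "f \<in> L2" "g \<in> L2" for f g
    using Lt.S.inner_add_left[of "\<lambda>x. a * f x" "\<lambda>x. b * g x" w] Lt.S.inner_scale_left[of f w a]
      Lt.S.inner_scale_left[of g w b] that wL L2_scale by auto
  have "E (\<lambda>x. a * res \<beta> u x + b * res \<beta> v x) w = a * E (res \<beta> u) w + b * E (res \<beta> v) w"
    using En.S.inner_add_left[of "\<lambda>x. a * res \<beta> u x" "\<lambda>x. b * res \<beta> v x" w]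
      En.S.inner_scale_left[of "res \<beta> u" w a] En.S.inner_scale_left[of "res \<beta> v" w b]
      res_F[OF \<beta> u(1)] res_F[OF \<beta> u(2)] F_scale w by auto
  then show "E (\<lambda>x. a * res \<beta> u x + b * res \<beta> v x) w + \<beta> * ip (\<lambda>x. a * res \<beta> u x + b * res \<beta> v x) w
      = \<beta> * ip (\<lambda>x. a * u x + b * v x) w"
    by (simp only: lin[OF u] lin[OF res_L2[OF \<beta> u(1)] res_L2[OF \<beta> u(2)]]
        res_E[OF \<beta> u(1) w] res_E[OF \<beta> u(2) w]) (simp add: algebra_simps)
qed

lemma res_symmetric:
  assumes \<beta>: "\<beta> > 0" and u: "u \<in> L2" "v \<in> L2"
  shows "ip (res \<beta> u) v = ip u (res \<beta> v)"
proof -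
  have "\<beta> * ip u (res \<beta> v) = \<beta> * ip v (res \<beta> u)"
    using res_eq[OF \<beta> u(1) res_F[OF \<beta> u(2)]] res_eq[OF \<beta> u(2) res_F[OF \<beta> u(1)]]
      E_sym[OF res_F[OF \<beta> u(1)] res_F[OF \<beta> u(2)]] L2_inner_commute[of \<mu> "res \<beta> u" "res \<beta> v"] by metis
  then show ?thesis using \<beta> L2_inner_commute[of \<mu> v "res \<beta> u"] by simp
qed

section \<open>Truncations and the Markov property of the resolvent\<close>

lemma contraction:
  assumes u: "u \<in> F" and c: "c > 0"
  shows "(\<lambda>x. min (max (u x) 0) c) \<in> F" "E (\<lambda>x. min (max (u x) 0) c) (\<lambda>x. min (max (u x) 0) c) \<le> E u u"
proof -
  let ?u = "\<lambda>x. (1 / c) * u x"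
  let ?v = "\<lambda>x. min (max (?u x) 0) 1"
  have uF: "?u \<in> F" by (rule F_scale[OF u])
  have eq: "(\<lambda>x. c * ?v x) = (\<lambda>x. min (max (u x) 0) c)" using c by (auto simp: fun_eq_iff min_def max_def field_simps)
  show "(\<lambda>x. min (max (u x) 0) c) \<in> F" using F_scale[OF markov[OF uF], of c] unfolding eq .
  have sc: "E (\<lambda>x. d * v x) (\<lambda>x. d * v x) = d\<^sup>2 * E v v" if "v \<in> F" for d v
    using En.S.inner_scale_left[of v "\<lambda>x. d * v x" d] En.S.inner_scale_right[of v v d] that F_scale
    by (simp add: power2_eq_square)
  have "E (\<lambda>x. c * ?v x) (\<lambda>x. c * ?v x) = c\<^sup>2 * E ?v ?v" by (rule sc[OF markov[OF uF]])
  also have "\<dots> \<le> c\<^sup>2 * E ?u ?u" by (intro mult_left_mono markov_le uF) simp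
  also have "\<dots> = E u u" using sc[OF u, of "1 / c"] c by (simp add: power_divide)
  finally show "E (\<lambda>x. min (max (u x) 0) c) (\<lambda>x. min (max (u x) 0) c) \<le> E u u" unfolding eq .
qed

text \<open>The truncation of \<open>res \<beta> u\<close> to the interval from 0 to
  \<open>c\<close> has no larger energy and, since \<open>u\<close> takes values there, is no
  farther from \<open>u\<close>. By \<open>res_minimal\<close> its excess over the minimum is a
  squared distance, which must therefore vanish.\<close>

lemma res_markov:
  assumes \<beta>: "\<beta> > 0" and u: "u \<in> L2" and c: "c > 0" "\<And>x. 0 \<le> u x" "\<And>x. u x \<le> c"
  shows "AE x in \<mu>. 0 \<le> res \<beta> u x \<and> res \<beta> u x \<le> c"
proof -
  let ?w = "res \<beta> u"
  let ?v = "\<lambda>x. min (max (?w x) 0) c"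
  note wF = res_F[OF \<beta> u] and wL = res_L2[OF \<beta> u]
  note vF = contraction(1)[OF wF c(1)]
  have "ip (\<lambda>x. ?v x - u x) (\<lambda>x. ?v x - u x) \<le> ip (\<lambda>x. ?w x - u x) (\<lambda>x. ?w x - u x)"
    unfolding L2_inner_def
  proof (rule integral_mono)
    fix x
    have "\<bar>?v x - u x\<bar> \<le> \<bar>?w x - u x\<bar>" using c(1) c(2)[of x] c(3)[of x] by (auto simp: min_def max_def)
    then show "(?v x - u x) * (?v x - u x) \<le> (?w x - u x) * (?w x - u x)"
      using abs_le_square_iff by (metis power2_eq_square)
  qed (intro L2_mult_integrable L2_diff F_L2[OF vF] wL u)+
  then have "\<beta> * ip (\<lambda>x. ?v x - u x) (\<lambda>x. ?v x - u x) \<le> \<beta> * ip (\<lambda>x. ?w x - u x) (\<lambda>x. ?w x - u x)"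
    using \<beta> by simp
  then have "E (\<lambda>x. ?v x - ?w x) (\<lambda>x. ?v x - ?w x) + \<beta> * ip (\<lambda>x. ?v x - ?w x) (\<lambda>x. ?v x - ?w x) \<le> 0"
    using res_minimal[OF \<beta> u vF] contraction(2)[OF wF c(1)] by linarith
  moreover have "0 \<le> E (\<lambda>x. ?v x - ?w x) (\<lambda>x. ?v x - ?w x)" by (intro E_nonneg F_diff vF wF)
  moreover have "0 \<le> \<beta> * ip (\<lambda>x. ?v x - ?w x) (\<lambda>x. ?v x - ?w x)" using \<beta> by simp
  ultimately have "\<beta> * ip (\<lambda>x. ?v x - ?w x) (\<lambda>x. ?v x - ?w x) = 0" by linarith
  then have "ip (\<lambda>x. ?v x - ?w x) (\<lambda>x. ?v x - ?w x) = 0" using \<beta> by simp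
  then have "AE x in \<mu>. ?v x = ?w x" by (intro ip_zero_AE F_L2[OF vF] wL)
  then show ?thesis
  proof eventually_elim
    case (elim x)
    then show ?case using c(1) by (auto simp: min_def max_def split: if_splits)
  qed
qed

end

text \<open>Left Riemann sums of \<open>f\<^sup>2 = 2 \<integral> (f - t)\<^sup>+ dt\<close>.\<close>

lemma square_riemann_sum:
  fixes f h :: real
  assumes f: "0 \<le> f" "f \<le> real N * h" and h: "h > 0"
  shows "f\<^sup>2 \<le> (\<Sum>k<N. 2 * h * max (f - real k * h) 0)"
    and "(\<Sum>k<N. 2 * h * max (f - real k * h) 0) \<le> f\<^sup>2 + 2 * h * f"
proof -
  define y where "y k = max (f - real k * h) 0" for k
  have y0: "y 0 = f" and yN: "y N = 0" using f by (auto simp: y_def)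
  have y: "0 \<le> y (Suc k)" "y (Suc k) \<le> y k" "y k \<le> y (Suc k) + h" "y (Suc k) = 0 \<or> y k = y (Suc k) + h" for k
    using h by (auto simp: y_def max_def algebra_simps)
  have up: "(y k)\<^sup>2 - (y (Suc k))\<^sup>2 \<le> 2 * h * y k" for k
  proof -
    have "(y k)\<^sup>2 - (y (Suc k))\<^sup>2 = (y k - y (Suc k)) * (y k + y (Suc k))" by (simp add: power2_eq_square algebra_simps)
    also have "\<dots> \<le> h * (2 * y k)" using y[of k] by (intro mult_mono) auto
    finally show ?thesis by simp
  qed
  \<comment> \<open>While \<open>y (Suc k)\<close> is positive the drop is exactly \<open>h\<close>;
    a shorter drop can only end at 0, where the left-hand side vanishes.\<close>
  have low: "2 * h * y (Suc k) \<le> (y k)\<^sup>2 - (y (Suc k))\<^sup>2" for k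
    using y(4)[of k]
  proof
    assume "y k = y (Suc k) + h"
    then have "(y k)\<^sup>2 - (y (Suc k))\<^sup>2 = 2 * h * y (Suc k) + h\<^sup>2" by (simp add: power2_eq_square algebra_simps)
    then show ?thesis by simp
  qed simp
  have tel: "(\<Sum>k<N. (y k)\<^sup>2 - (y (Suc k))\<^sup>2) = f\<^sup>2"
    using sum_lessThan_telescope'[of "\<lambda>k. (y k)\<^sup>2" N] y0 yN by simp
  have "f\<^sup>2 \<le> (\<Sum>k<N. 2 * h * y k)" unfolding tel[symmetric] by (intro sum_mono up)
  then show "f\<^sup>2 \<le> (\<Sum>k<N. 2 * h * max (f - real k * h) 0)" by (simp add: y_def)
  have "(\<Sum>k<N. 2 * h * y (Suc k)) \<le> f\<^sup>2" unfolding tel[symmetric] by (intro sum_mono low)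
  moreover have "(\<Sum>k<N. 2 * h * y k - 2 * h * y (Suc k)) = 2 * h * f"
    using sum_lessThan_telescope'[of "\<lambda>k. 2 * h * y k" N] y0 yN by simp
  ultimately have "(\<Sum>k<N. 2 * h * y k) \<le> f\<^sup>2 + 2 * h * f" by (simp add: sum_subtractf)
  then show "(\<Sum>k<N. 2 * h * max (f - real k * h) 0) \<le> f\<^sup>2 + 2 * h * f" by (simp add: y_def)
qed

section \<open>Products of bounded functions in the form domain\<close>

context dirichlet_form
begin

lemma E_scale:
  assumes "v \<in> F" shows "E (\<lambda>x. d * v x) (\<lambda>x. d * v x) = d\<^sup>2 * E v v"
  using En.S.inner_scale_left[of v "\<lambda>x. d * v x" d] En.S.inner_scale_right[of v v d] assms F_scale
  by (simp add: power2_eq_square)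

lemma E_diff_le:
  assumes "u \<in> F" "v \<in> F"
  shows "E (\<lambda>x. u x - v x) (\<lambda>x. u x - v x) \<le> 2 * E u u + 2 * E v v"
proof -
  have "0 \<le> E (\<lambda>x. u x + v x) (\<lambda>x. u x + v x)" by (intro E_nonneg F_add assms)
  also have "\<dots> = E u u + 2 * E u v + E v v"
    using En.S.inner_add_left[of u v "\<lambda>x. u x + v x"] En.S.inner_add_right[of u v u] En.S.inner_add_right[of u v v]
      assms F_add E_sym[OF assms] by simp
  finally show ?thesis using E_diff_sq[OF assms] by linarith
qed

text \<open>Cauchy-Schwarz without regard to cancellation; the quadratic growth is harmless because
  the mesh of the Riemann sums enters their energy with its square.\<close>

lemma E_sum_le:
  assumes v: "\<And>k. v k \<in> F" "\<And>k. E (v k) (v k) \<le> M"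
  shows "(\<lambda>x. \<Sum>k<(n::nat). v k x) \<in> F \<and> E (\<lambda>x. \<Sum>k<n. v k x) (\<lambda>x. \<Sum>k<n. v k x) \<le> (real n)\<^sup>2 * M"
proof (induction n)
  case 0
  have z: "(\<lambda>_. 0) \<in> F" by (rule fun_subspace_zero[OF F_subspace])
  then show ?case using E_scale[OF z, of 0] by simp
next
  case (Suc n)
  let ?S = "\<lambda>x. \<Sum>k<n. v k x"
  have S: "?S \<in> F" "E ?S ?S \<le> (real n)\<^sup>2 * M" using Suc by auto
  have M: "0 \<le> M" using E_nonneg[OF v(1)] v(2) order_trans by blast
  have "(E ?S (v n))\<^sup>2 \<le> E ?S ?S * E (v n) (v n)" using En.S.cauchy_schwarz[of ?S "v n"] S v by simp
  also have "\<dots> \<le> ((real n)\<^sup>2 * M) * M" using S v M E_nonneg by (intro mult_mono) auto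
  also have "\<dots> = (real n * M)\<^sup>2" by (simp add: power2_eq_square)
  finally have cs: "E ?S (v n) \<le> real n * M" using M by (auto intro: power2_le_imp_le)
  have "E (\<lambda>x. ?S x + v n x) (\<lambda>x. ?S x + v n x) = E ?S ?S + 2 * E ?S (v n) + E (v n) (v n)"
    using En.S.inner_add_left[of ?S "v n" "\<lambda>x. ?S x + v n x"] En.S.inner_add_right[of ?S "v n" ?S]
      En.S.inner_add_right[of ?S "v n" "v n"] S v F_add E_sym[OF S(1) v(1)] by simp
  also have "\<dots> \<le> (real n)\<^sup>2 * M + 2 * (real n * M) + M" using S(2) cs v(2)[of n] by linarith
  also have "\<dots> = (real (Suc n))\<^sup>2 * M" by (simp add: power2_eq_square algebra_simps)
  finally show ?case using F_add[OF S(1) v(1)] by simp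
qed

text \<open>The Riemann sums of the square involve only the functions
  \<open>(u - t)\<^sup>+\<close>, each of which is \<open>u\<close> minus its truncation at
  \<open>t\<close> and so lies in \<open>F\<close> with controlled energy. The sums have bounded
  energy and converge in \<open>L2\<close>, whence \<open>F_bounded_limit\<close> applies; the unit
  contraction is the only contraction invoked.\<close>

lemma square_in_F_nonneg:
  assumes u: "u \<in> F" and c: "c > 0" "\<And>x. 0 \<le> u x" "\<And>x. u x \<le> c"
  shows "(\<lambda>x. (u x)\<^sup>2) \<in> F"
proof -
  \<comment> \<open>Mesh such that \<open>Suc n\<close> levels reach exactly the bound
    \<open>c\<close>.\<close>
  define h where "h n = c / real (Suc n)" for n
  have h: "h n > 0" "real (Suc n) * h n = c" for n using c by (auto simp: h_def)
  define y where "y n k x = max (u x - real k * h n) 0" for n k x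
  have y: "y n k \<in> F" "E (y n k) (y n k) \<le> 4 * E u u" for n k
  proof -
    \<comment> \<open>Level 0 is separate because \<open>contraction\<close> truncates at positive
      levels only. The 4 in the claim comes from \<open>E_diff_le\<close>, applied to
      \<open>u\<close> and a truncation of no larger energy.\<close>
    consider "k = 0" | "real k * h n > 0" using h(1)[of n] by (cases k) auto
    then have "y n k \<in> F \<and> E (y n k) (y n k) \<le> 4 * E u u"
    proof cases
      case 1
      then have "y n k = u" using c(2) by (auto simp: y_def fun_eq_iff)
      then show ?thesis using u E_nonneg[OF u] by simp
    next
      case 2
      let ?v = "\<lambda>x. min (max (u x) 0) (real k * h n)"
      have m: "max (u x) 0 = u x" for x using c(2) by simp
      have eq: "y n k = (\<lambda>x. u x - ?v x)" unfolding m using 2 by (auto simp: y_def fun_eq_iff min_def max_def)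
      have v: "?v \<in> F" "E ?v ?v \<le> E u u" using contraction[OF u 2] by auto
      show ?thesis unfolding eq using F_diff[OF u v(1)] E_diff_le[OF u v(1)] v(2) by simp
    qed
    then show "y n k \<in> F" "E (y n k) (y n k) \<le> 4 * E u u" by auto
  qed
  define s where "s n x = 2 * h n * (\<Sum>k<Suc n. y n k x)" for n x
  have sF: "s n \<in> F" for n
    unfolding s_def[abs_def] using E_sum_le[of "y n" "4 * E u u" "Suc n"] y by (intro F_scale) blast
  \<comment> \<open>The square of \<open>2 * h n\<close> cancels the square of the number of levels
    up to \<open>4 * c\<^sup>2\<close>, so the bound is independent of \<open>n\<close>.\<close>
  have sE: "E (s n) (s n) \<le> 16 * c\<^sup>2 * E u u" for n
  proof -
    note S = E_sum_le[of "y n" "4 * E u u" "Suc n", OF y]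
    have "E (s n) (s n) = (2 * h n)\<^sup>2 * E (\<lambda>x. \<Sum>k<Suc n. y n k x) (\<lambda>x. \<Sum>k<Suc n. y n k x)"
      unfolding s_def[abs_def] using S by (intro E_scale) blast
    also have "\<dots> \<le> (2 * h n)\<^sup>2 * ((real (Suc n))\<^sup>2 * (4 * E u u))" using S by (intro mult_left_mono) auto
    also have "\<dots> = 16 * (real (Suc n) * h n)\<^sup>2 * E u u" by (simp add: power_mult_distrib)
    also have "\<dots> = 16 * c\<^sup>2 * E u u" by (simp only: h(2))
    finally show ?thesis .
  qed
  have close: "\<bar>s n x - (u x)\<^sup>2\<bar> \<le> 2 * h n * u x" for n x
    using square_riemann_sum[of "u x" "Suc n" "h n"] c(2)[of x] c(3)[of x] h[of n]
    unfolding s_def y_def sum_distrib_left by (simp del: of_nat_Suc sum.lessThan_Suc add: abs_le_iff)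
  have uL: "u \<in> L2" using F_L2[OF u] .
  have u2L: "(\<lambda>x. (u x)\<^sup>2) \<in> L2"
  proof (rule L2_fun_bound[OF _ uL])
    show "(\<lambda>x. (u x)\<^sup>2) \<in> borel_measurable \<mu>"
      using uL by (intro borel_measurable_power) (simp add: L2_fun_def)
    show "\<bar>(u x)\<^sup>2\<bar> \<le> c * \<bar>u x\<bar>" for x
      using c(2)[of x] c(3)[of x] by (simp add: power2_eq_square mult_right_mono)
  qed
  have le: "ip (\<lambda>x. s n x - (u x)\<^sup>2) (\<lambda>x. s n x - (u x)\<^sup>2) \<le> (2 * h n)\<^sup>2 * ip u u" for n
  proof -
    have "ip (\<lambda>x. s n x - (u x)\<^sup>2) (\<lambda>x. s n x - (u x)\<^sup>2) \<le> (\<integral>x. (2 * h n)\<^sup>2 * (u x * u x) \<partial>\<mu>)"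
      unfolding L2_inner_def
    proof (rule integral_mono)
      show "integrable \<mu> (\<lambda>x. (s n x - (u x)\<^sup>2) * (s n x - (u x)\<^sup>2))"
        by (intro L2_mult_integrable L2_diff F_L2[OF sF] u2L)
      show "integrable \<mu> (\<lambda>x. (2 * h n)\<^sup>2 * (u x * u x))" using L2_mult_integrable[OF uL uL] by simp
      fix x
      have "\<bar>s n x - (u x)\<^sup>2\<bar>\<^sup>2 \<le> (2 * h n * u x)\<^sup>2" by (intro power_mono close) simp
      then show "(s n x - (u x)\<^sup>2) * (s n x - (u x)\<^sup>2) \<le> (2 * h n)\<^sup>2 * (u x * u x)"
        by (simp add: power2_eq_square algebra_simps)
    qed
    then show ?thesis by (simp add: L2_inner_def)
  qed
  show ?thesis
  proof (rule F_bounded_limit[OF u2L sF sE])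
    have "(\<lambda>n. inverse (real (Suc n))) \<longlonglongrightarrow> 0" by (rule LIMSEQ_inverse_real_of_nat)
    then have "(\<lambda>n. (2 * (c * inverse (real (Suc n))))\<^sup>2 * ip u u) \<longlonglongrightarrow> (2 * (c * 0))\<^sup>2 * ip u u"
      by (intro tendsto_intros)
    then have z: "(\<lambda>n. (2 * h n)\<^sup>2 * ip u u) \<longlonglongrightarrow> 0" by (simp add: h_def divide_inverse)
    show "(\<lambda>n. ip (\<lambda>x. s n x - (u x)\<^sup>2) (\<lambda>x. s n x - (u x)\<^sup>2)) \<longlonglongrightarrow> 0"
      using le by (intro tendsto_sandwich[OF _ _ tendsto_const z]) (auto intro!: always_eventually)
  qed
qed

lemma square_in_F:
  assumes u: "u \<in> F" and c: "\<And>x. \<bar>u x\<bar> \<le> c"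
  shows "(\<lambda>x. (u x)\<^sup>2) \<in> F"
proof -
  \<comment> \<open>The truncation level has to be positive, also when \<open>c = 0\<close>.\<close>
  define d where "d = \<bar>c\<bar> + 1"
  have d: "d > 0" "\<bar>u x\<bar> \<le> d" for x using c[of x] unfolding d_def by linarith+
  let ?p = "\<lambda>x. min (max (u x) 0) d" and ?q = "\<lambda>x. min (max ((-1) * u x) 0) d"
  have "(\<lambda>x. (-1) * u x) \<in> F" by (rule F_scale[OF u])
  from contraction(1)[OF this d(1)] contraction(1)[OF u d(1)]
  have "(\<lambda>x. (?p x)\<^sup>2) \<in> F" "(\<lambda>x. (?q x)\<^sup>2) \<in> F"
    using d(1) by (auto intro!: square_in_F_nonneg[where c = d])
  then have "(\<lambda>x. (?p x)\<^sup>2 + (?q x)\<^sup>2) \<in> F" by (rule F_add)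
  \<comment> \<open>At each point one of the two parts is 0, so their squares add up to the square
    of \<open>u\<close>.\<close>
  moreover have "(?p x)\<^sup>2 + (?q x)\<^sup>2 = (u x)\<^sup>2" for x using d(2)[of x] by (auto simp: min_def max_def)
  ultimately show ?thesis by simp
qed

lemma mult_in_F:
  assumes u: "u \<in> F" "\<And>x. \<bar>u x\<bar> \<le> c" and v: "v \<in> F" "\<And>x. \<bar>v x\<bar> \<le> d"
  shows "(\<lambda>x. u x * v x) \<in> F"
proof -
  have b: "\<bar>u x + v x\<bar> \<le> c + d" "\<bar>u x - v x\<bar> \<le> c + d" for x using u(2)[of x] v(2)[of x] by linarith+
  have "(\<lambda>x. (u x + v x)\<^sup>2) \<in> F" by (rule square_in_F[OF F_add[OF u(1) v(1)] b(1)])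
  moreover have "(\<lambda>x. (u x - v x)\<^sup>2) \<in> F" by (rule square_in_F[OF F_diff[OF u(1) v(1)] b(2)])
  ultimately have "(\<lambda>x. (1/4) * ((u x + v x)\<^sup>2 - (u x - v x)\<^sup>2)) \<in> F" by (intro F_scale F_diff)
  moreover have "(1/4) * ((u x + v x)\<^sup>2 - (u x - v x)\<^sup>2) = u x * v x" for x
    by (simp add: power2_eq_square algebra_simps)
  ultimately show ?thesis by simp
qed

text \<open>For an operator given by a kernel of mass at most one this follows by integrating the
  square of \<open>g x - g y\<close> in \<open>y\<close>. Without a kernel, \<open>g x\<close> is
  first replaced by a number \<open>t\<close>: the inequality
  \<open>2 * t * g - g\<^sup>2 \<le> t\<^sup>2\<close> survives \<open>res \<beta>\<close> by the
  Markov property, and \<open>t\<close> is set to \<open>g x\<close> afterwards.\<close>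

lemma res_square_le:
  assumes \<beta>: "\<beta> > 0" and g: "g \<in> L2" and K: "\<And>x. \<bar>g x\<bar> \<le> K" and g2: "(\<lambda>x. (g x)\<^sup>2) \<in> L2"
  shows "AE x in \<mu>. 2 * g x * res \<beta> g x \<le> (g x)\<^sup>2 + res \<beta> (\<lambda>x. (g x)\<^sup>2) x"
proof -
  let ?b = "res \<beta> (\<lambda>x. (g x)\<^sup>2)"
  \<comment> \<open>The case \<open>t = 0\<close> is excluded because \<open>res_markov\<close> asks
    for a positive bound, here \<open>t\<^sup>2\<close>.\<close>
  have tle: "AE x in \<mu>. 2 * t * res \<beta> g x - ?b x \<le> t\<^sup>2" if t: "t \<noteq> 0" for t
  proof -
    define k where "k x = 2 * t * g x + (-1) * (g x)\<^sup>2" for x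
    have kL: "k \<in> L2" unfolding k_def[abs_def] by (intro L2_add L2_scale g g2)
    have km: "k \<in> borel_measurable \<mu>" using kL by (simp add: L2_fun_def)
    have kt: "k x \<le> t\<^sup>2" for x
      using zero_le_power2[of "t - g x"] by (simp add: k_def power2_diff algebra_simps)
    have kK: "\<bar>k x\<bar> \<le> 2 * \<bar>t\<bar> * K + K\<^sup>2" for x
    proof -
      have "\<bar>k x\<bar> \<le> 2 * \<bar>t\<bar> * \<bar>g x\<bar> + \<bar>g x\<bar>\<^sup>2"
        unfolding k_def using abs_triangle_ineq[of "2 * t * g x" "(-1) * (g x)\<^sup>2"] by (simp add: abs_mult)
      also have "\<dots> \<le> 2 * \<bar>t\<bar> * K + K\<^sup>2" using K by (intro add_mono mult_left_mono power_mono) auto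
      finally show ?thesis .
    qed
    \<comment> \<open>\<open>res_markov\<close> concerns nonnegative functions, so \<open>k\<close>
      is split. What matters is that \<open>res \<beta> p\<close> is at most
      \<open>t\<^sup>2\<close> and \<open>res \<beta> n\<close> is nonnegative; the upper bound on
      \<open>n\<close> merely permits the application, its summand 1 keeping it positive.\<close>
    define p where "p x = max (k x) 0" for x
    define n where "n x = max (- k x) 0" for x
    have pL: "p \<in> L2" unfolding p_def[abs_def]
      using km by (intro L2_fun_bound[OF _ kL, of _ 1]) auto
    have nL: "n \<in> L2" unfolding n_def[abs_def]
      using km by (intro L2_fun_bound[OF _ kL, of _ 1]) auto
    have p1: "AE x in \<mu>. 0 \<le> res \<beta> p x \<and> res \<beta> p x \<le> t\<^sup>2"
      using t kt by (intro res_markov \<beta> pL) (auto simp: p_def)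
    have n1: "AE x in \<mu>. 0 \<le> res \<beta> n x \<and> res \<beta> n x \<le> 2 * \<bar>t\<bar> * K + K\<^sup>2 + 1"
    proof (rule res_markov[OF \<beta> nL])
      show "n x \<le> 2 * \<bar>t\<bar> * K + K\<^sup>2 + 1" for x using kK[of x] by (auto simp: n_def)
      show "0 < 2 * \<bar>t\<bar> * K + K\<^sup>2 + 1" using kK[of undefined] by linarith
    qed (simp add: n_def)
    have kpn: "k = (\<lambda>x. 1 * p x + (-1) * n x)" by (auto simp: p_def n_def fun_eq_iff)
    have "AE x in \<mu>. res \<beta> k x = 1 * res \<beta> p x + (-1) * res \<beta> n x"
      unfolding kpn by (rule res_linear[OF \<beta> pL nL])
    moreover have "AE x in \<mu>. res \<beta> k x = 2 * t * res \<beta> g x + (-1) * ?b x"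
      unfolding k_def[abs_def] by (rule res_linear[OF \<beta> g g2])
    ultimately show ?thesis using p1 n1 by eventually_elim auto
  qed
  have pos: "AE x in \<mu>. 0 \<le> ?b x \<and> ?b x \<le> K\<^sup>2 + 1"
  proof (rule res_markov[OF \<beta> g2])
    show "(g x)\<^sup>2 \<le> K\<^sup>2 + 1" for x using power_mono[OF K[of x], of 2] by simp
  qed (auto simp: add_nonneg_pos)
  \<comment> \<open>The exceptional set depends on \<open>t\<close>; restricting to rationals leaves
    a common one. The value 0, missing in \<open>tle\<close>, is supplied below by nonnegativity of
    \<open>?b\<close>.\<close>
  have "AE x in \<mu>. \<forall>q. q \<noteq> (0::rat) \<longrightarrow> 2 * of_rat q * res \<beta> g x - ?b x \<le> (of_rat q)\<^sup>2"
    unfolding AE_all_countable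
  proof (intro allI AE_impI)
    fix q :: rat assume "q \<noteq> 0"
    then show "AE x in \<mu>. 2 * of_rat q * res \<beta> g x - ?b x \<le> (of_rat q)\<^sup>2" by (intro tle) simp
  qed
  then show ?thesis using pos
  proof eventually_elim
    case (elim x)
    have q: "2 * of_rat q * res \<beta> g x - ?b x \<le> (of_rat q)\<^sup>2" for q :: rat
      using elim by (cases "q = 0") auto
    have "\<exists>q. g x < of_rat q \<and> of_rat q < g x + 1 / real (Suc n)" for n
      using of_rat_dense[of "g x" "g x + 1 / real (Suc n)"] by auto
    then obtain q where qn: "\<And>n. g x < of_rat (q n)" "\<And>n. of_rat (q n) < g x + 1 / real (Suc n)" by metis
    have "(\<lambda>n. g x + 1 / real (Suc n)) \<longlonglongrightarrow> g x + 0"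
      using LIMSEQ_inverse_real_of_nat by (intro tendsto_intros) (simp add: inverse_eq_divide)
    then have up: "(\<lambda>n. g x + 1 / real (Suc n)) \<longlonglongrightarrow> g x" by simp
    have lim: "(\<lambda>n. of_rat (q n)) \<longlonglongrightarrow> g x"
    proof (rule tendsto_sandwich[OF _ _ tendsto_const up])
      show "\<forall>\<^sub>F n in sequentially. g x \<le> of_rat (q n)"
        by (intro always_eventually allI less_imp_le qn)
      show "\<forall>\<^sub>F n in sequentially. of_rat (q n) \<le> g x + 1 / real (Suc n)"
        by (intro always_eventually allI less_imp_le qn)
    qed
    have "(\<lambda>n. 2 * of_rat (q n) * res \<beta> g x - ?b x) \<longlonglongrightarrow> 2 * g x * res \<beta> g x - ?b x"
      by (intro tendsto_intros lim)
    moreover have "(\<lambda>n. (of_rat (q n) :: real)\<^sup>2) \<longlonglongrightarrow> (g x)\<^sup>2" by (intro tendsto_intros lim)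
    ultimately have "2 * g x * res \<beta> g x - ?b x \<le> (g x)\<^sup>2"
      using q by (intro LIMSEQ_le) auto
    then show ?case by simp
  qed
qed

end

section \<open>Regular forms: the algebra of core functions and the key inequality\<close>

locale regular_dirichlet_form = dirichlet_form \<mu> F E
  for \<mu> :: "'a::{metric_space, second_countable_topology} measure" and F E +
  assumes locally_compact: "locally compact (UNIV :: 'a set)"
    and radon: "radon_measure \<mu>"
    and regular: "regular_form \<mu> F E"
begin

abbreviation "\<C> \<equiv> core F"

lemma sets_\<mu>: "sets \<mu> = sets borel"
  using radon by (simp add: radon_measure_def)

lemma core_F: "u \<in> \<C> \<Longrightarrow> u \<in> F"
  and core_C0: "u \<in> \<C> \<Longrightarrow> u \<in> C0_fun"
  by (auto simp: core_def)

lemma core_bb: "u \<in> \<C> \<Longrightarrow> u \<in> bounded_borel"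
  using core_C0 C0_fun_bounded_borel by blast

lemma C0_fun_subset:
  assumes "u \<in> C0_fun" "continuous_on UNIV v" "{x. v x \<noteq> 0} \<subseteq> {x. u x \<noteq> (0::real)}"
  shows "v \<in> C0_fun"
proof -
  have "compact (closure {x. u x \<noteq> 0} \<inter> closure {x. v x \<noteq> 0})"
    using assms(1) by (intro compact_Int_closed) (auto simp: C0_fun_def)
  moreover have "closure {x. u x \<noteq> 0} \<inter> closure {x. v x \<noteq> 0} = closure {x. v x \<noteq> 0}"
    using closure_mono[OF assms(3)] by blast
  ultimately show ?thesis using assms(2) by (simp add: C0_fun_def)
qed

lemma subspace_core: "fun_subspace \<C>"
proof -
  have "(\<lambda>x. u x + v x) \<in> C0_fun" if "u \<in> C0_fun" "v \<in> C0_fun" for u v :: "'a \<Rightarrow> real"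
  proof -
    have "compact ((closure {x. u x \<noteq> 0} \<union> closure {x. v x \<noteq> 0}) \<inter> closure {x. u x + v x \<noteq> 0})"
      using that by (intro compact_Int_closed compact_Un) (auto simp: C0_fun_def)
    moreover have "closure {x. u x + v x \<noteq> 0} \<subseteq> closure {x. u x \<noteq> 0} \<union> closure {x. v x \<noteq> 0}"
      unfolding closure_Un[symmetric] by (intro closure_mono) auto
    ultimately show ?thesis using that by (auto simp: C0_fun_def Int_absorb1 intro: continuous_on_add)
  qed
  moreover have "(\<lambda>x. c * u x) \<in> C0_fun" if "u \<in> C0_fun" for c and u :: "'a \<Rightarrow> real"
    using that by (intro C0_fun_subset[OF that]) (auto simp: C0_fun_def intro!: continuous_intros)
  moreover have "(\<lambda>_. 0 :: real) \<in> C0_fun" by (simp add: C0_fun_def)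
  ultimately show ?thesis using F_subspace unfolding core_def fun_subspace_def by auto
qed

text \<open>Every term of the defining identity of the energy measures has a product as an argument
  of \<open>E\<close>; this closure puts such products into the domain, where bilinearity of
  \<open>E\<close> is available.\<close>

lemma core_mult:
  assumes "u \<in> \<C>" "v \<in> \<C>"
  shows "(\<lambda>x. u x * v x) \<in> \<C>"
proof -
  obtain c where "\<And>x. \<bar>u x\<bar> \<le> c" using bounded_borelE[OF core_bb[OF assms(1)]] by metis
  moreover obtain d where "\<And>x. \<bar>v x\<bar> \<le> d" using bounded_borelE[OF core_bb[OF assms(2)]] by metis
  ultimately have "(\<lambda>x. u x * v x) \<in> F" using mult_in_F core_F assms by metis
  moreover have "(\<lambda>x. u x * v x) \<in> C0_fun"
    using core_C0[OF assms(1)] core_C0[OF assms(2)]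
    by (intro C0_fun_subset[OF core_C0[OF assms(1)]]) (auto simp: C0_fun_def intro!: continuous_intros)
  ultimately show ?thesis by (simp add: core_def)
qed

lemma core_contraction:
  assumes "u \<in> \<C>"
  shows "(\<lambda>x. min (max (u x) 0) 1) \<in> \<C>"
proof -
  have "continuous_on UNIV u" using core_C0[OF assms] by (simp add: C0_fun_def)
  then have "continuous_on UNIV (\<lambda>x. min (max (u x) 0) 1)" by (intro continuous_intros)
  then have "(\<lambda>x. min (max (u x) 0) 1) \<in> C0_fun" by (rule C0_fun_subset[OF core_C0[OF assms]]) auto
  then show ?thesis using markov[OF core_F[OF assms]] by (simp add: core_def)
qed

text \<open>Replacing the form by \<open>\<beta> \<langle>u - \<beta> G\<^sub>\<beta> u, v\<rangle>\<close>, the inequality reads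
  \<open>\<langle>(1 - \<phi>) g, g - \<beta> G\<^sub>\<beta> g\<rangle> + \<langle>\<phi> - \<beta> G\<^sub>\<beta> \<phi>, g\<^sup>2\<rangle> / 2 \<ge> 0\<close>; it follows from the Markov property
  \<open>\<beta> G\<^sub>\<beta> \<theta> \<le> 1\<close> of \<open>\<theta> = \<phi> + 1\<^sub>S (1 - \<phi>)\<close>, where \<open>S\<close> is the support of \<open>g\<close>.\<close>

lemma energy_le:
  assumes g: "g \<in> \<C>" and \<phi>: "\<phi> \<in> \<C>" "\<And>x. 0 \<le> \<phi> x" "\<And>x. \<phi> x \<le> 1"
  shows "E (\<lambda>x. \<phi> x * g x) g - E (\<lambda>x. g x * g x) \<phi> / 2 \<le> E g g"
proof -
  define S where "S = closure {x. g x \<noteq> 0}"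
  have S: "compact S" using core_C0[OF g] by (simp add: S_def C0_fun_def)
  have Sb: "S \<in> sets \<mu>" using S by (simp add: sets_\<mu> compact_imp_closed)
  have Sfin: "emeasure \<mu> S < \<infinity>" using radon S by (auto simp: radon_measure_def)
  have gS: "g x = 0" if "x \<notin> S" for x using that closure_subset[of "{x. g x \<noteq> 0}"] by (auto simp: S_def)
  \<comment> \<open>\<open>1 - \<phi>\<close> need not be square integrable; cutting it to the
    compact support of \<open>g\<close> makes it so, without changing its product with
    \<open>g\<close>.\<close>
  define \<psi> where "\<psi> x = indicator S x * (1 - \<phi> x)" for x
  define \<theta> where "\<theta> x = \<phi> x + \<psi> x" for x
  define g2 where "g2 x = (g x)\<^sup>2" for x
  \<comment> \<open>Equal to the product of \<open>\<psi>\<close> and \<open>g\<close>, but in this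
    form visibly an element of \<open>F\<close>.\<close>
  define \<psi>g where "\<psi>g x = g x - \<phi> x * g x" for x
  note gF = core_F[OF g] and \<phi>F = core_F[OF \<phi>(1)]
  have \<phi>gF: "(\<lambda>x. \<phi> x * g x) \<in> F" by (intro core_F core_mult g \<phi>)
  have g2F: "g2 \<in> F" using core_F[OF core_mult[OF g g]] by (simp add: g2_def[abs_def] power2_eq_square)
  have \<psi>gF: "\<psi>g \<in> F" unfolding \<psi>g_def[abs_def] by (intro F_diff gF \<phi>gF)
  note L = gF[THEN F_L2] \<phi>F[THEN F_L2] g2F[THEN F_L2] \<psi>gF[THEN F_L2]
  have \<phi>m: "\<phi> \<in> borel_measurable \<mu>" using L(2) by (simp add: L2_fun_def)
  have indL: "(\<lambda>x. indicator S x) \<in> L2"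
    using Sb Sfin by (auto simp: L2_fun_def power2_eq_square indicator_inter_arith[symmetric])
  have \<psi>L: "\<psi> \<in> L2"
  proof (rule L2_fun_bound[OF _ indL])
    show "\<psi> \<in> borel_measurable \<mu>" unfolding \<psi>_def[abs_def] using Sb \<phi>m by measurable
    show "\<bar>\<psi> x\<bar> \<le> 1 * \<bar>indicator S x\<bar>" for x using \<phi>(2,3)[of x] by (auto simp: \<psi>_def indicator_def)
  qed
  have \<theta>L: "\<theta> \<in> L2" unfolding \<theta>_def[abs_def] by (intro L2_add L \<psi>L)
  have \<psi>0: "0 \<le> \<psi> x" for x using \<phi>(3)[of x] by (simp add: \<psi>_def)
  have \<theta>01: "0 \<le> \<theta> x" "\<theta> x \<le> 1" for x using \<phi>(2,3)[of x] by (auto simp: \<theta>_def \<psi>_def indicator_def)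
  obtain K where K: "\<And>x. \<bar>g x\<bar> \<le> K" using bounded_borelE[OF core_bb[OF g]] by metis
  have nonneg: "0 \<le> E (res \<beta> g) \<psi>g + E (res \<beta> \<phi>) g2 / 2" if \<beta>: "\<beta> > 0" for \<beta>
  proof -
    have R: "res \<beta> g \<in> L2" "res \<beta> \<phi> \<in> L2" "res \<beta> g2 \<in> L2" "res \<beta> \<theta> \<in> L2"
      using res_L2[OF \<beta>] L \<theta>L by auto
    \<comment> \<open>\<open>res_square_le\<close> multiplied by \<open>\<psi> \<ge> 0\<close> and
      integrated; it trades \<open>res \<beta> g\<close> for \<open>res \<beta> g2\<close>, which
      \<open>b\<close> controls.\<close>
    have a: "ip (res \<beta> g) \<psi>g \<le> ip g \<psi>g / 2 + ip \<psi> (res \<beta> g2) / 2"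
    proof -
      have "ip (res \<beta> g) \<psi>g \<le> (\<integral>x. (1/2) * (g x * \<psi>g x) + (1/2) * (\<psi> x * res \<beta> g2 x) \<partial>\<mu>)"
        unfolding L2_inner_def
      proof (rule integral_mono_AE)
        show "integrable \<mu> (\<lambda>x. res \<beta> g x * \<psi>g x)" by (intro L2_mult_integrable R L)
        show "integrable \<mu> (\<lambda>x. (1/2) * (g x * \<psi>g x) + (1/2) * (\<psi> x * res \<beta> g2 x))"
          using L2_mult_integrable[OF L(1,4)] L2_mult_integrable[OF \<psi>L R(3)] by simp
        have "AE x in \<mu>. 2 * g x * res \<beta> g x \<le> (g x)\<^sup>2 + res \<beta> g2 x"
          using res_square_le[OF \<beta> L(1) K] L(3) by (simp add: g2_def[abs_def])
        then show "AE x in \<mu>. res \<beta> g x * \<psi>g x \<le> (1/2) * (g x * \<psi>g x) + (1/2) * (\<psi> x * res \<beta> g2 x)"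
        proof eventually_elim
          case (elim x)
          have eq: "\<psi>g x = \<psi> x * g x" using gS[of x] by (auto simp: \<psi>g_def \<psi>_def indicator_def algebra_simps)
          have "\<psi> x * (2 * g x * res \<beta> g x) \<le> \<psi> x * ((g x)\<^sup>2 + res \<beta> g2 x)"
            by (intro mult_left_mono elim \<psi>0)
          then show ?case unfolding eq by (simp add: power2_eq_square algebra_simps)
        qed
      qed
      also have "\<dots> = (1/2) * ip g \<psi>g + (1/2) * ip \<psi> (res \<beta> g2)"
        using L2_mult_integrable[OF L(1,4)] L2_mult_integrable[OF \<psi>L R(3)] by (simp add: L2_inner_def)
      finally show ?thesis by simp
    qed
    \<comment> \<open>Symmetry moves the resolvent onto \<open>\<theta>\<close>, whose image is at
      most 1.\<close>
    have b: "ip \<theta> (res \<beta> g2) \<le> (\<integral>x. g2 x \<partial>\<mu>)"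
    proof -
      have "ip \<theta> (res \<beta> g2) = ip (res \<beta> \<theta>) g2" using res_symmetric[OF \<beta> \<theta>L L(3)] by simp
      also have "\<dots> \<le> (\<integral>x. g2 x \<partial>\<mu>)"
        unfolding L2_inner_def
      proof (rule integral_mono_AE)
        show "integrable \<mu> (\<lambda>x. res \<beta> \<theta> x * g2 x)" by (intro L2_mult_integrable R L)
        show "integrable \<mu> g2" using L(1) by (simp add: L2_fun_def g2_def[abs_def])
        have "AE x in \<mu>. 0 \<le> res \<beta> \<theta> x \<and> res \<beta> \<theta> x \<le> 1" using \<theta>01 by (intro res_markov \<beta> \<theta>L) auto
        then show "AE x in \<mu>. res \<beta> \<theta> x * g2 x \<le> g2 x"
          by eventually_elim (simp add: g2_def mult_left_le_one_le)
      qed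
      finally show ?thesis .
    qed
    have c: "ip \<theta> (res \<beta> g2) = ip \<phi> (res \<beta> g2) + ip \<psi> (res \<beta> g2)"
      unfolding \<theta>_def[abs_def] using Lt.S.inner_add_left[of \<phi> \<psi> "res \<beta> g2"] L \<psi>L R by simp
    have d: "(\<integral>x. g2 x \<partial>\<mu>) = ip g \<psi>g + ip \<phi> g2"
    proof -
      have "(\<integral>x. g2 x \<partial>\<mu>) = (\<integral>x. g x * \<psi>g x + \<phi> x * g2 x \<partial>\<mu>)"
        by (intro Bochner_Integration.integral_cong) (auto simp: g2_def \<psi>g_def power2_eq_square algebra_simps)
      also have "\<dots> = ip g \<psi>g + ip \<phi> g2"
        using L2_mult_integrable[OF L(1,4)] L2_mult_integrable[OF L(2,3)] by (simp add: L2_inner_def)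
      finally show ?thesis .
    qed
    have "ip (res \<beta> \<phi>) g2 = ip \<phi> (res \<beta> g2)" by (rule res_symmetric[OF \<beta> L(2,3)])
    \<comment> \<open>The halves of \<open>ip g \<psi>g\<close> and
      \<open>ip \<psi> (res \<beta> g2)\<close> left over by \<open>a\<close> cancel against those
      from \<open>b\<close>, \<open>c\<close> and \<open>d\<close>.\<close>
    then have "0 \<le> (ip g \<psi>g - ip (res \<beta> g) \<psi>g) + (ip \<phi> g2 - ip (res \<beta> \<phi>) g2) / 2"
      using a b c d by argo
    then have "0 \<le> \<beta> * ((ip g \<psi>g - ip (res \<beta> g) \<psi>g) + (ip \<phi> g2 - ip (res \<beta> \<phi>) g2) / 2)"
      using \<beta> by simp
    then show ?thesis unfolding res_E[OF \<beta> L(1) \<psi>gF] res_E[OF \<beta> L(2) g2F] by (simp add: algebra_simps)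
  qed
  have "(\<lambda>n. E (res (real (Suc n)) g) \<psi>g + E (res (real (Suc n)) \<phi>) g2 / 2) \<longlonglongrightarrow> E g \<psi>g + E \<phi> g2 / 2"
    by (intro tendsto_intros res_tendsto gF \<phi>F \<psi>gF g2F) simp
  moreover have "0 \<le> E (res (real (Suc n)) g) \<psi>g + E (res (real (Suc n)) \<phi>) g2 / 2" for n
    by (rule nonneg) simp
  ultimately have "0 \<le> E g \<psi>g + E \<phi> g2 / 2" by (intro LIMSEQ_le_const) auto
  moreover have "E g \<psi>g = E g g - E (\<lambda>x. \<phi> x * g x) g"
    using E_diff_left[OF gF \<phi>gF gF] E_sym[OF gF \<psi>gF] by (simp add: \<psi>g_def[abs_def])
  moreover have "E \<phi> g2 = E (\<lambda>x. g x * g x) \<phi>"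
    using E_sym[OF \<phi>F g2F] by (simp add: g2_def[abs_def] power2_eq_square)
  ultimately show ?thesis by simp
qed

end

section \<open>Energy measures\<close>

lemma nonneg_signed_measure:
  assumes \<nu>: "finite_signed_measure \<nu>" and nn: "\<And>A. A \<in> sets borel \<Longrightarrow> 0 \<le> \<nu> A"
  shows "A \<in> sets borel \<Longrightarrow> measure (positive_variation \<nu>) A = \<nu> A"
    and "b \<in> bounded_borel \<Longrightarrow> signed_integral \<nu> b = (\<integral>x. b x \<partial>positive_variation \<nu>)"
proof -
  note \<nu>' = fsm_uminus[OF \<nu>]
  have z: "measure (positive_variation (\<lambda>A. - \<nu> A)) A = 0" if A: "A \<in> sets borel" for A
  proof -
    have "upper_variation (\<lambda>A. - \<nu> A) A \<le> 0" using nn by (intro upper_variation_le[OF \<nu>']) auto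
    then show ?thesis using A upper_variation_nonneg[OF \<nu>', of A] by (simp add: measure_positive_variation \<nu>')
  qed
  show "measure (positive_variation \<nu>) A = \<nu> A" if "A \<in> sets borel"
    using jordan_decomposition[OF \<nu> that] z[OF that] by simp
  show "signed_integral \<nu> b = (\<integral>x. b x \<partial>positive_variation \<nu>)" if b: "b \<in> bounded_borel"
  proof -
    obtain K where K: "\<And>x. \<bar>b x\<bar> \<le> K" using bounded_borelE[OF b] by metis
    have "\<bar>\<integral>x. b x \<partial>positive_variation (\<lambda>A. - \<nu> A)\<bar> \<le> measure (positive_variation (\<lambda>A. - \<nu> A)) UNIV * K"
      using \<nu>' by (intro integral_bounded_borel_le finite_measure_positive_variation b K) auto
    then show ?thesis by (simp add: z signed_integral_def)
  qed
qed

lemma signed_integral_mono: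
  assumes \<nu>: "finite_signed_measure \<nu>" and nn: "\<And>A. A \<in> sets borel \<Longrightarrow> 0 \<le> \<nu> A"
    and b: "b \<in> bounded_borel" "d \<in> bounded_borel" "\<And>x. b x \<le> d x"
  shows "signed_integral \<nu> b \<le> signed_integral \<nu> d"
proof -
  have "(\<integral>x. b x \<partial>positive_variation \<nu>) \<le> (\<integral>x. d x \<partial>positive_variation \<nu>)"
    using \<nu> by (intro integral_mono integrable_bounded_borel finite_measure_positive_variation b) auto
  moreover have "signed_integral \<nu> b = (\<integral>x. b x \<partial>positive_variation \<nu>)"
    "signed_integral \<nu> d = (\<integral>x. d x \<partial>positive_variation \<nu>)"
    by (rule nonneg_signed_measure(2)[OF \<nu> nn b(1)] nonneg_signed_measure(2)[OF \<nu> nn b(2)], assumption)+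
  ultimately show ?thesis by simp
qed

lemma signed_integral_cong:
  assumes "finite_signed_measure \<nu>" "finite_signed_measure \<nu>'"
    and "\<And>A. A \<in> sets borel \<Longrightarrow> \<nu> A = \<nu>' A" and "b \<in> bounded_borel"
  shows "signed_integral \<nu> b = signed_integral \<nu>' b"
  by (rule signed_integral_eqI[OF assms(1) bb_functional_signed_integral[OF assms(2)] _ assms(4)])
    (simp add: signed_integral_indicator assms)

locale energy_form = regular_dirichlet_form \<mu> F E
  for \<mu> :: "'a::{metric_space, second_countable_topology} measure" and F E +
  fixes \<Gamma> assumes energy: "energy_measures F E \<Gamma>"
begin

lemma \<Gamma>_fsm: "g \<in> \<C> \<Longrightarrow> h \<in> \<C> \<Longrightarrow> finite_signed_measure (\<Gamma> g h)"
  and \<Gamma>_integral: "g \<in> \<C> \<Longrightarrow> h \<in> \<C> \<Longrightarrow> \<phi> \<in> \<C> \<Longrightarrow> 2 * signed_integral (\<Gamma> g h) \<phi> =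
        E (\<lambda>x. \<phi> x * g x) h + E (\<lambda>x. \<phi> x * h x) g - E (\<lambda>x. g x * h x) \<phi>"
  and \<Gamma>_nonneg: "g \<in> \<C> \<Longrightarrow> A \<in> sets borel \<Longrightarrow> 0 \<le> \<Gamma> g g A"
  using energy unfolding energy_measures_def by auto

text \<open>By regularity the core is uniformly dense in \<open>C0_fun\<close>, and integration
  against a finite signed measure is continuous for uniform convergence.\<close>

lemma signed_measure_zero_core:
  assumes \<nu>: "finite_signed_measure \<nu>" and zero: "\<And>\<phi>. \<phi> \<in> \<C> \<Longrightarrow> signed_integral \<nu> \<phi> = 0"
    and A: "A \<in> sets borel"
  shows "\<nu> A = 0"
proof (rule signed_measure_zero[OF locally_compact \<nu> _ A])
  note L = bb_functional_signed_integral[OF \<nu>]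
  obtain C where C: "\<forall>b\<in>bounded_borel. \<forall>K. (\<forall>x. \<bar>b x\<bar> \<le> K) \<longrightarrow> \<bar>signed_integral \<nu> b\<bar> \<le> C * K"
    using bb_functionalD(3)[OF L] by blast
  fix \<phi> :: "'a \<Rightarrow> real" assume \<phi>: "\<phi> \<in> C0_fun"
  then have \<phi>b: "\<phi> \<in> bounded_borel" using C0_fun_bounded_borel by blast
  have "\<bar>signed_integral \<nu> \<phi>\<bar> \<le> C * (1 / real (Suc n))" for n
  proof -
    have "\<exists>g\<in>\<C>. \<forall>x. \<bar>\<phi> x - g x\<bar> < 1 / real (Suc n)"
      using regular \<phi> unfolding regular_form_def by (metis of_nat_0_less_iff zero_less_Suc zero_less_divide_1_iff)
    then obtain g where g: "g \<in> \<C>" "\<And>x. \<bar>\<phi> x - g x\<bar> < 1 / real (Suc n)" by blast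
    have d: "(\<lambda>x. \<phi> x - g x) \<in> bounded_borel" by (intro fun_subspace_diff subspace_bounded_borel \<phi>b core_bb g)
    have "signed_integral \<nu> \<phi> = signed_integral \<nu> g + signed_integral \<nu> (\<lambda>x. \<phi> x - g x)"
      using bb_functionalD(1)[OF L core_bb[OF g(1)] d] by simp
    moreover have "\<bar>signed_integral \<nu> (\<lambda>x. \<phi> x - g x)\<bar> \<le> C * (1 / real (Suc n))"
      by (rule C[rule_format, OF d]) (rule less_imp_le[OF g(2)])
    ultimately show ?thesis using zero[OF g(1)] by simp
  qed
  moreover have "(\<lambda>n. C * (1 / real (Suc n))) \<longlonglongrightarrow> C * 0"
    using LIMSEQ_inverse_real_of_nat by (intro tendsto_mult_left) (simp add: inverse_eq_divide)
  ultimately have "\<bar>signed_integral \<nu> \<phi>\<bar> \<le> C * 0" by (intro LIMSEQ_le_const) auto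
  then show "signed_integral \<nu> \<phi> = 0" by simp
qed

lemmas core_add = fun_subspace_add[OF subspace_core]
  and core_scale = fun_subspace_scale[OF subspace_core]
  and core_diff = fun_subspace_diff[OF subspace_core]

lemma E_add_left: "u \<in> F \<Longrightarrow> v \<in> F \<Longrightarrow> w \<in> F \<Longrightarrow> E (\<lambda>x. u x + v x) w = E u w + E v w"
  and E_add_right: "u \<in> F \<Longrightarrow> v \<in> F \<Longrightarrow> w \<in> F \<Longrightarrow> E w (\<lambda>x. u x + v x) = E w u + E w v"
  and E_scale_left: "u \<in> F \<Longrightarrow> w \<in> F \<Longrightarrow> E (\<lambda>x. c * u x) w = c * E u w"
  and E_scale_right: "u \<in> F \<Longrightarrow> w \<in> F \<Longrightarrow> E w (\<lambda>x. c * u x) = c * E w u"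
  using En.S.inner_add_left[of u v w] En.S.inner_add_right[of u v w]
    En.S.inner_scale_left[of u w c] En.S.inner_scale_right[of u w c] by auto

text \<open>The energy measures are known only through their integrals against the core. Their
  algebraic laws, here and in \<open>\<Gamma>_lincomb_left\<close>, are therefore uniqueness
  statements: a suitable combination of measures integrates every core function to zero.\<close>

lemma \<Gamma>_sym:
  assumes gh: "g \<in> \<C>" "h \<in> \<C>" and A: "A \<in> sets borel"
  shows "\<Gamma> g h A = \<Gamma> h g A"
proof -
  have "1 * \<Gamma> g h A + (-1) * \<Gamma> h g A = 0"
  proof (rule signed_measure_zero_core[OF _ _ A])
    show "finite_signed_measure (\<lambda>A. 1 * \<Gamma> g h A + (-1) * \<Gamma> h g A)" by (intro fsm_lincomb \<Gamma>_fsm gh)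
    fix \<phi> assume \<phi>: "\<phi> \<in> \<C>"
    have "2 * signed_integral (\<Gamma> g h) \<phi> = 2 * signed_integral (\<Gamma> h g) \<phi>"
      unfolding \<Gamma>_integral[OF gh \<phi>] \<Gamma>_integral[OF gh(2,1) \<phi>] by (simp add: mult.commute)
    then show "signed_integral (\<lambda>A. 1 * \<Gamma> g h A + (-1) * \<Gamma> h g A) \<phi> = 0"
      using signed_integral_lincomb[OF \<Gamma>_fsm[OF gh] \<Gamma>_fsm[OF gh(2,1)] core_bb[OF \<phi>], of 1 "-1"] by simp
  qed
  then show ?thesis by simp
qed

lemma \<Gamma>_lincomb_left:
  assumes g: "g \<in> \<C>" "g' \<in> \<C>" and h: "h \<in> \<C>" and A: "A \<in> sets borel"
  shows "\<Gamma> (\<lambda>x. a * g x + b * g' x) h A = a * \<Gamma> g h A + b * \<Gamma> g' h A"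
proof -
  let ?s = "\<lambda>x. a * g x + b * g' x"
  have s: "?s \<in> \<C>" by (intro core_add core_scale g)
  let ?\<nu> = "\<lambda>A. 1 * \<Gamma> ?s h A + (-1) * (a * \<Gamma> g h A + b * \<Gamma> g' h A)"
  have "?\<nu> A = 0"
  proof (rule signed_measure_zero_core[OF _ _ A])
    have f2: "finite_signed_measure (\<lambda>A. a * \<Gamma> g h A + b * \<Gamma> g' h A)" by (intro fsm_lincomb \<Gamma>_fsm g h)
    show "finite_signed_measure ?\<nu>" by (intro fsm_lincomb[OF _ f2] \<Gamma>_fsm s h)
    fix \<phi> assume \<phi>: "\<phi> \<in> \<C>"
    note bb = core_bb[OF \<phi>]
    have F: "g \<in> F" "g' \<in> F" "h \<in> F" "\<phi> \<in> F" "(\<lambda>x. \<phi> x * g x) \<in> F" "(\<lambda>x. \<phi> x * g' x) \<in> F"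
      "(\<lambda>x. \<phi> x * h x) \<in> F" "(\<lambda>x. g x * h x) \<in> F" "(\<lambda>x. g' x * h x) \<in> F"
      using g h \<phi> core_mult core_F by auto
    have lin: "E (\<lambda>x. a * u x + b * v x) w = a * E u w + b * E v w" if "u \<in> F" "v \<in> F" "w \<in> F" for u v w
      using that by (simp add: E_add_left E_scale_left F_scale)
    have lin': "E w (\<lambda>x. a * u x + b * v x) = a * E w u + b * E w v" if "u \<in> F" "v \<in> F" "w \<in> F" for u v w
      using that by (simp add: E_add_right E_scale_right F_scale)
    have e1: "(\<lambda>x. \<phi> x * ?s x) = (\<lambda>x. a * (\<phi> x * g x) + b * (\<phi> x * g' x))"
      and e2: "(\<lambda>x. ?s x * h x) = (\<lambda>x. a * (g x * h x) + b * (g' x * h x))"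
      by (auto simp: fun_eq_iff algebra_simps)
    have "2 * signed_integral (\<Gamma> ?s h) \<phi>
        = a * (2 * signed_integral (\<Gamma> g h) \<phi>) + b * (2 * signed_integral (\<Gamma> g' h) \<phi>)"
      unfolding \<Gamma>_integral[OF s h \<phi>] \<Gamma>_integral[OF g(1) h \<phi>] \<Gamma>_integral[OF g(2) h \<phi>] e1 e2
        lin[OF F(5,6,3)] lin[OF F(8,9,4)] lin'[OF F(1,2,7)]
      by (simp add: algebra_simps)
    then show "signed_integral ?\<nu> \<phi> = 0"
      using signed_integral_lincomb[OF \<Gamma>_fsm[OF s h] f2 bb, of 1 "-1"]
        signed_integral_lincomb[OF \<Gamma>_fsm[OF g(1) h] \<Gamma>_fsm[OF g(2) h] bb, of a b]
      by simp
  qed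
  then show ?thesis by simp
qed

lemma \<Gamma>_lincomb_right:
  assumes g: "g \<in> \<C>" "g' \<in> \<C>" and h: "h \<in> \<C>" and A: "A \<in> sets borel"
  shows "\<Gamma> h (\<lambda>x. a * g x + b * g' x) A = a * \<Gamma> h g A + b * \<Gamma> h g' A"
  using \<Gamma>_lincomb_left[OF assms, of a b] \<Gamma>_sym[OF _ h A] g core_add[OF core_scale core_scale, OF g]
  by simp

lemma signed_integral_\<Gamma>_sym:
  "g \<in> \<C> \<Longrightarrow> h \<in> \<C> \<Longrightarrow> b \<in> bounded_borel \<Longrightarrow> signed_integral (\<Gamma> g h) b = signed_integral (\<Gamma> h g) b"
  by (intro signed_integral_cong \<Gamma>_fsm \<Gamma>_sym)

lemma signed_integral_\<Gamma>_left:
  assumes g: "g \<in> \<C>" "g' \<in> \<C>" and h: "h \<in> \<C>" and b: "b \<in> bounded_borel"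
  shows "signed_integral (\<Gamma> (\<lambda>x. c * g x + d * g' x) h) b = c * signed_integral (\<Gamma> g h) b + d * signed_integral (\<Gamma> g' h) b"
proof -
  have "signed_integral (\<Gamma> (\<lambda>x. c * g x + d * g' x) h) b = signed_integral (\<lambda>A. c * \<Gamma> g h A + d * \<Gamma> g' h A) b"
    by (intro signed_integral_cong \<Gamma>_fsm \<Gamma>_lincomb_left fsm_lincomb core_add core_scale g h b)
  then show ?thesis by (simp add: signed_integral_lincomb[OF \<Gamma>_fsm[OF g(1) h] \<Gamma>_fsm[OF g(2) h] b])
qed

lemma \<Gamma>_mono:
  assumes g: "g \<in> \<C>" and A: "A \<in> sets borel" "B \<in> sets borel" "A \<subseteq> B"
  shows "\<Gamma> g g A \<le> \<Gamma> g g B"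
  using fsm_split[OF \<Gamma>_fsm[OF g g] A(2,1,3)] \<Gamma>_nonneg[OF g, of "B - A"] A by auto

text \<open>A cutoff of \<open>K\<close> would integrate to at least the mass of \<open>K\<close>,
  but it is merely in \<open>C0_fun\<close> and has to be approximated uniformly by the core. The
  relative loss \<open>1 / Suc n\<close> disappears in the limit.\<close>

lemma \<Gamma>_compact_le:
  assumes g: "g \<in> \<C>" and K: "compact K"
  shows "\<Gamma> g g K \<le> E g g"
proof -
  note \<nu> = \<Gamma>_fsm[OF g g]
  have Kb: "K \<in> sets borel" using K by (simp add: compact_imp_closed)
  obtain c :: "nat \<Rightarrow> 'a \<Rightarrow> real" where c: "\<And>n. c n \<in> C0_fun" "\<And>n x. x \<in> K \<Longrightarrow> c n x = 1"
    using compact_cutoff[OF locally_compact K] by metis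
  have le: "(1 - 1 / real (Suc n)) * \<Gamma> g g K \<le> E g g" for n
  proof -
    have "\<exists>u\<in>\<C>. \<forall>x. \<bar>c 0 x - u x\<bar> < 1 / real (Suc n)"
      using regular c(1)[of 0] unfolding regular_form_def by (metis of_nat_0_less_iff zero_less_Suc zero_less_divide_1_iff)
    then obtain u where u: "u \<in> \<C>" "\<And>x. \<bar>c 0 x - u x\<bar> < 1 / real (Suc n)" by blast
    \<comment> \<open>Clipping stays in the core and secures values between 0 and 1, as
      \<open>energy_le\<close> demands; on \<open>K\<close> they remain at least
      \<open>1 - 1 / Suc n\<close>.\<close>
    define \<phi> where "\<phi> x = min (max (u x) 0) 1" for x
    have \<phi>: "\<phi> \<in> \<C>" unfolding \<phi>_def[abs_def] by (rule core_contraction[OF u(1)])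
    have n1: "1 / real (Suc n) \<le> 1" by simp
    have "(1 - 1 / real (Suc n)) * indicator K x \<le> \<phi> x" for x
    proof (cases "x \<in> K")
      case True
      then have "1 - 1 / real (Suc n) \<le> u x" using u(2)[of x] c(2)[of x 0] by (simp add: abs_less_iff)
      then show ?thesis using True n1 by (simp add: \<phi>_def del: of_nat_Suc)
    qed (simp add: \<phi>_def)
    then have "signed_integral (\<Gamma> g g) (\<lambda>x. (1 - 1 / real (Suc n)) * indicator K x) \<le> signed_integral (\<Gamma> g g) \<phi>"
      by (intro signed_integral_mono \<nu> \<Gamma>_nonneg[OF g] bounded_borel_mult bounded_borel_const
          indicator_bounded_borel Kb core_bb[OF \<phi>])
    \<comment> \<open>By the defining identity the left-hand side is twice the quantity bounded in
      \<open>energy_le\<close>.\<close>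
    also have "2 * signed_integral (\<Gamma> g g) \<phi> \<le> 2 * E g g"
    proof -
      have "E (\<lambda>x. \<phi> x * g x) g - E (\<lambda>x. g x * g x) \<phi> / 2 \<le> E g g"
        by (rule energy_le[OF g \<phi>]) (auto simp: \<phi>_def)
      then show ?thesis unfolding \<Gamma>_integral[OF g g \<phi>] by simp
    qed
    then have "signed_integral (\<Gamma> g g) \<phi> \<le> E g g" by simp
    finally show ?thesis
      using bb_functionalD(2)[OF bb_functional_signed_integral[OF \<nu>] indicator_bounded_borel[OF Kb]]
        signed_integral_indicator[OF \<nu> Kb] by simp
  qed
  have "(\<lambda>n. inverse (real (Suc n))) \<longlonglongrightarrow> 0" by (rule LIMSEQ_inverse_real_of_nat)
  then have "(\<lambda>n. (1 - inverse (real (Suc n))) * \<Gamma> g g K) \<longlonglongrightarrow> (1 - 0) * \<Gamma> g g K" by (intro tendsto_intros)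
  then have "(1 - 0) * \<Gamma> g g K \<le> E g g"
    using le by (intro LIMSEQ_le_const2) (auto simp: inverse_eq_divide)
  then show ?thesis by simp
qed

lemma \<Gamma>_le:
  assumes g: "g \<in> \<C>" and A: "A \<in> sets borel"
  shows "\<Gamma> g g A \<le> E g g"
proof -
  note \<nu> = \<Gamma>_fsm[OF g g]
  obtain K :: "nat \<Rightarrow> 'a set" where K: "\<And>n. compact (K n)" "(\<Union>n. K n) = UNIV"
    using sigma_compact[OF locally_compact] by metis
  define L where "L n = (\<Union>i\<le>n. K i)" for n
  have cL: "compact (L n)" for n unfolding L_def using K by (intro compact_UN) auto
  have Lb: "range L \<subseteq> sets borel" using cL by (auto simp: compact_imp_closed)
  have inc: "incseq L" unfolding L_def incseq_def by fastforce
  have UL: "(\<Union>n. L n) = UNIV" unfolding L_def using K(2) by blast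
  interpret M: finite_measure "positive_variation (\<Gamma> g g)" by (rule finite_measure_positive_variation[OF \<nu>])
  have "(\<lambda>n. measure (positive_variation (\<Gamma> g g)) (L n)) \<longlonglongrightarrow> measure (positive_variation (\<Gamma> g g)) UNIV"
    using M.finite_Lim_measure_incseq[of L] Lb inc UL \<nu> by simp
  then have "(\<lambda>n. \<Gamma> g g (L n)) \<longlonglongrightarrow> \<Gamma> g g UNIV"
    using nonneg_signed_measure(1)[OF \<nu> \<Gamma>_nonneg[OF g]] Lb by (simp add: image_subset_iff)
  then have "\<Gamma> g g UNIV \<le> E g g" using \<Gamma>_compact_le[OF g cL] by (intro LIMSEQ_le_const2) auto
  then show ?thesis using \<Gamma>_mono[OF g A, of UNIV] by simp
qed

section \<open>Continuity of the energy measures in the energy seminorm\<close>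

lemma \<Gamma>_cauchy_schwarz:
  assumes gh: "g \<in> \<C>" "h \<in> \<C>" and A: "A \<in> sets borel"
  shows "(\<Gamma> g h A)\<^sup>2 \<le> \<Gamma> g g A * \<Gamma> h h A"
proof (rule discriminant_le)
  fix t
  let ?s = "\<lambda>x. 1 * g x + t * h x"
  have s: "?s \<in> \<C>" by (intro core_add core_scale gh)
  have "0 \<le> \<Gamma> ?s ?s A" by (rule \<Gamma>_nonneg[OF s A])
  also have "\<dots> = \<Gamma> g g A + 2 * t * \<Gamma> g h A + t\<^sup>2 * \<Gamma> h h A"
    unfolding \<Gamma>_lincomb_left[OF gh s A] \<Gamma>_lincomb_right[OF gh gh(1) A] \<Gamma>_lincomb_right[OF gh gh(2) A]
    using \<Gamma>_sym[OF gh A] by (simp add: algebra_simps power2_eq_square)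
  finally show "0 \<le> \<Gamma> g g A + 2 * t * \<Gamma> g h A + t\<^sup>2 * \<Gamma> h h A" .
qed

lemma signed_integral_\<Gamma>_le:
  assumes gh: "g \<in> \<C>" "h \<in> \<C>" and b: "b \<in> bounded_borel" "\<And>x. \<bar>b x\<bar> \<le> K"
  shows "\<bar>signed_integral (\<Gamma> g h) b\<bar> \<le> 2 * sqrt (E g g * E h h) * K"
proof (rule signed_integral_le[OF \<Gamma>_fsm[OF gh] _ b])
  fix A :: "'a set" assume A: "A \<in> sets borel"
  have "(\<Gamma> g h A)\<^sup>2 \<le> \<Gamma> g g A * \<Gamma> h h A" by (rule \<Gamma>_cauchy_schwarz[OF gh A])
  also have "\<dots> \<le> E g g * E h h"
    using gh A core_F by (intro mult_mono \<Gamma>_le \<Gamma>_nonneg E_nonneg)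
  finally show "\<bar>\<Gamma> g h A\<bar> \<le> sqrt (E g g * E h h)" by (simp add: real_le_rsqrt)
qed

text \<open>Perturbing one argument at a time costs the square root of the energy of the
  perturbation times a bounded factor, so convergence in the energy seminorm alone is
  enough.\<close>

lemma signed_integral_\<Gamma>_tendsto:
  assumes a: "a \<in> \<C>" "\<And>j. u j \<in> \<C>" "(\<lambda>j. E (\<lambda>x. a x - u j x) (\<lambda>x. a x - u j x)) \<longlonglongrightarrow> 0"
    and c: "c \<in> \<C>" "\<And>j. v j \<in> \<C>" "(\<lambda>j. E (\<lambda>x. c x - v j x) (\<lambda>x. c x - v j x)) \<longlonglongrightarrow> 0"
    and b: "b \<in> bounded_borel"
  shows "(\<lambda>j. signed_integral (\<Gamma> (u j) (v j)) b) \<longlonglongrightarrow> signed_integral (\<Gamma> a c) b"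
proof -
  obtain K where K: "\<And>x. \<bar>b x\<bar> \<le> K" using bounded_borelE[OF b] by metis
  let ?d = "\<lambda>j x. a x - u j x" and ?e = "\<lambda>j x. c x - v j x"
  have d: "?d j \<in> \<C>" "?e j \<in> \<C>" for j by (intro core_diff a c)+
  have uF: "u j \<in> F" for j using a core_F by blast
  have hd: "(\<lambda>j. hdist2 (fun_hspace F E) (u j) a) \<longlonglongrightarrow> 0"
  proof -
    have "E (?d j) (?d j) = hdist2 (fun_hspace F E) (u j) a" for j
      using En.form_diff_eq[OF core_F[OF a(1)] uF] En.S.hdist2_commute[of a "u j"] uF core_F[OF a(1)] by simp
    then show ?thesis using a(3) by simp
  qed
  then have Eu: "(\<lambda>j. E (u j) (u j)) \<longlonglongrightarrow> E a a"
    using En.S.tendsto_norm2[of u a] uF core_F[OF a(1)] by auto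
  \<comment> \<open>Telescoping in the two arguments. The second error term contains
    \<open>u j\<close> rather than \<open>a\<close>, which is why the energies of the
    \<open>u j\<close> have to stay bounded; \<open>Eu\<close> provides this.\<close>
  have eq: "signed_integral (\<Gamma> (u j) (v j)) b = signed_integral (\<Gamma> a c) b
      - signed_integral (\<Gamma> (?d j) c) b - signed_integral (\<Gamma> (u j) (?e j)) b" for j
  proof -
    have "signed_integral (\<Gamma> (?d j) c) b = signed_integral (\<Gamma> a c) b - signed_integral (\<Gamma> (u j) c) b"
      using signed_integral_\<Gamma>_left[OF a(1) a(2) c(1) b, of 1 "-1" j] by simp
    moreover have "signed_integral (\<Gamma> (?e j) (u j)) b = signed_integral (\<Gamma> c (u j)) b - signed_integral (\<Gamma> (v j) (u j)) b"
      using signed_integral_\<Gamma>_left[OF c(1) c(2) a(2) b, of 1 "-1" j j] by simp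
    ultimately show ?thesis
      using signed_integral_\<Gamma>_sym[OF a(2)[of j] d(2)[of j] b] signed_integral_\<Gamma>_sym[OF a(2)[of j] c(1) b]
        signed_integral_\<Gamma>_sym[OF a(2)[of j] c(2)[of j] b] by linarith
  qed
  have l1: "(\<lambda>j. 2 * sqrt (E (?d j) (?d j) * E c c) * K) \<longlonglongrightarrow> 2 * sqrt (0 * E c c) * K"
    by (intro tendsto_intros a)
  have t1: "(\<lambda>j. signed_integral (\<Gamma> (?d j) c) b) \<longlonglongrightarrow> 0"
  proof (rule Lim_null_comparison)
    show "\<forall>\<^sub>F j in sequentially. norm (signed_integral (\<Gamma> (?d j) c) b) \<le> 2 * sqrt (E (?d j) (?d j) * E c c) * K"
      unfolding real_norm_def by (intro always_eventually allI signed_integral_\<Gamma>_le d c b K)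
  qed (use l1 in simp)
  have l2: "(\<lambda>j. 2 * sqrt (E (u j) (u j) * E (?e j) (?e j)) * K) \<longlonglongrightarrow> 2 * sqrt (E a a * 0) * K"
    by (intro tendsto_intros c Eu)
  have t2: "(\<lambda>j. signed_integral (\<Gamma> (u j) (?e j)) b) \<longlonglongrightarrow> 0"
  proof (rule Lim_null_comparison)
    show "\<forall>\<^sub>F j in sequentially. norm (signed_integral (\<Gamma> (u j) (?e j)) b) \<le> 2 * sqrt (E (u j) (u j) * E (?e j) (?e j)) * K"
      unfolding real_norm_def by (intro always_eventually allI signed_integral_\<Gamma>_le d a b K)
  qed (use l2 in simp)
  have "(\<lambda>j. signed_integral (\<Gamma> a c) b - signed_integral (\<Gamma> (?d j) c) b - signed_integral (\<Gamma> (u j) (?e j)) b)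
      \<longlonglongrightarrow> signed_integral (\<Gamma> a c) b - 0 - 0"
    by (intro tendsto_intros t1 t2)
  then show ?thesis unfolding eq by simp
qed

end

section \<open>One-forms and the direct integral of the fibers\<close>

lemma tendsto_sum_list:
  assumes "\<And>p. p \<in> set ps \<Longrightarrow> ((\<lambda>j. g j p) \<longlongrightarrow> (G p :: real)) net"
  shows "((\<lambda>j. \<Sum>p\<leftarrow>ps. g j p) \<longlongrightarrow> (\<Sum>p\<leftarrow>ps. G p)) net"
  using assms by (induction ps) (auto intro!: tendsto_add)

lemma integrable_sum_list:
  assumes "\<And>p. p \<in> set ps \<Longrightarrow> integrable M (\<lambda>x. g x p :: real)"
  shows "integrable M (\<lambda>x. \<Sum>p\<leftarrow>ps. g x p)"
    and "(\<integral>x. (\<Sum>p\<leftarrow>ps. g x p) \<partial>M) = (\<Sum>p\<leftarrow>ps. \<integral>x. g x p \<partial>M)"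
proof -
  have "integrable M (\<lambda>x. \<Sum>p\<leftarrow>ps. g x p) \<and> (\<integral>x. (\<Sum>p\<leftarrow>ps. g x p) \<partial>M) = (\<Sum>p\<leftarrow>ps. \<integral>x. g x p \<partial>M)"
    using assms by (induction ps) auto
  then show "integrable M (\<lambda>x. \<Sum>p\<leftarrow>ps. g x p)"
    "(\<integral>x. (\<Sum>p\<leftarrow>ps. g x p) \<partial>M) = (\<Sum>p\<leftarrow>ps. \<integral>x. g x p \<partial>M)" by auto
qed

locale energy_fibers = energy_form \<mu> F E \<Gamma> + fiber_setting m \<Gamma> f \<gamma>
  for \<mu> m :: "'a::{metric_space, second_countable_topology} measure" and F E \<Gamma> f \<gamma> +
  assumes dense: "energy_dense_sequence F E f"
begin

lemma f_core: "f n \<in> \<C>"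
  using dense by (auto simp: energy_dense_sequence_def)

lemma core_approx:
  assumes "a \<in> \<C>"
  obtains k :: "nat \<Rightarrow> nat" where "(\<lambda>j. E (\<lambda>x. a x - f (k j) x) (\<lambda>x. a x - f (k j) x)) \<longlonglongrightarrow> 0"
  using dense assms by (auto simp: energy_dense_sequence_def)

lemma bb_\<gamma>_integrable:
  assumes "b \<in> bounded_borel"
  shows "integrable m (\<lambda>x. b x * \<gamma> x (f i) (f j))"
proof -
  obtain K where K: "b \<in> borel_measurable borel" "\<And>x. \<bar>b x\<bar> \<le> K" using bounded_borelE[OF assms] by metis
  show ?thesis
  proof (rule Bochner_Integration.integrable_bound)
    show "integrable m (\<lambda>x. K * \<gamma> x (f i) (f j))" using \<gamma>_integrable by simp
    show "(\<lambda>x. b x * \<gamma> x (f i) (f j)) \<in> borel_measurable m"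
      using K(1) \<gamma>_measurable[of i j] by (simp add: measurable_cong_sets[OF sets_m refl])
    have "\<bar>b x\<bar> \<le> \<bar>K\<bar>" for x using K(2)[of x] by simp
    then show "AE x in m. norm (b x * \<gamma> x (f i) (f j)) \<le> norm (K * \<gamma> x (f i) (f j))"
      by (simp add: abs_mult mult_right_mono)
  qed
qed

text \<open>Both sides are bounded functionals of \<open>b\<close>, and on indicators they agree by
  the choice of the densities.\<close>

lemma signed_integral_\<gamma>:
  assumes b: "b \<in> bounded_borel"
  shows "signed_integral (\<Gamma> (f i) (f j)) b = (\<integral>x. b x * \<gamma> x (f i) (f j) \<partial>m)"
proof (rule signed_integral_eqI[OF \<Gamma>_fsm[OF f_core f_core] _ _ b])
  show "bb_functional (\<lambda>b. \<integral>x. b x * \<gamma> x (f i) (f j) \<partial>m)"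
    unfolding bb_functional_def
  proof (intro conjI ballI allI exI impI)
    fix b b' :: "'a \<Rightarrow> real" assume "b \<in> bounded_borel" "b' \<in> bounded_borel"
    then show "(\<integral>x. (b x + b' x) * \<gamma> x (f i) (f j) \<partial>m) = (\<integral>x. b x * \<gamma> x (f i) (f j) \<partial>m) + (\<integral>x. b' x * \<gamma> x (f i) (f j) \<partial>m)"
      by (simp add: distrib_right bb_\<gamma>_integrable)
  next
    fix c and b :: "'a \<Rightarrow> real"
    show "(\<integral>x. (c * b x) * \<gamma> x (f i) (f j) \<partial>m) = c * (\<integral>x. b x * \<gamma> x (f i) (f j) \<partial>m)"
      by (simp add: mult.assoc)
  next
    fix b :: "'a \<Rightarrow> real" and K assume b: "b \<in> bounded_borel" "\<forall>x. \<bar>b x\<bar> \<le> K"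
    have "\<bar>\<integral>x. b x * \<gamma> x (f i) (f j) \<partial>m\<bar> \<le> (\<integral>x. \<bar>b x * \<gamma> x (f i) (f j)\<bar> \<partial>m)" by (rule integral_abs_bound)
    also have "\<dots> \<le> (\<integral>x. K * \<bar>\<gamma> x (f i) (f j)\<bar> \<partial>m)"
    proof (intro integral_mono integrable_abs bb_\<gamma>_integrable integrable_mult_right \<gamma>_integrable b)
      show "\<bar>b x * \<gamma> x (f i) (f j)\<bar> \<le> K * \<bar>\<gamma> x (f i) (f j)\<bar>" for x
        using b(2) by (simp add: abs_mult mult_right_mono)
    qed
    finally show "\<bar>\<integral>x. b x * \<gamma> x (f i) (f j) \<partial>m\<bar> \<le> (\<integral>x. \<bar>\<gamma> x (f i) (f j)\<bar> \<partial>m) * K"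
      by (simp add: mult.commute)
  qed
next
  fix B :: "'a set" assume "B \<in> sets borel"
  then show "(\<integral>x. indicator B x * \<gamma> x (f i) (f j) \<partial>m) = \<Gamma> (f i) (f j) B"
    using \<gamma>_density by (simp add: set_lebesgue_integral_def)
qed

abbreviation "q a b c d \<equiv> signed_integral (\<Gamma> a c) (\<lambda>x. b x * d x)"

text \<open>For members of the sequence the double sum is the integral of the pointwise nonnegative
  fiber forms. For general core functions positivity is not visible pointwise,
  \<open>\<gamma> x\<close> being a form on the span of \<open>f\<close>, so it is inherited through
  approximation in energy.\<close>

lemma q_nonneg:
  assumes ps: "set ps \<subseteq> \<C> \<times> bounded_borel"
  shows "0 \<le> (\<Sum>(a, b)\<leftarrow>ps. \<Sum>(c, d)\<leftarrow>ps. q a b c d)"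
proof -
  have "\<exists>k. (\<lambda>j. E (\<lambda>x. a x - f (k j) x) (\<lambda>x. a x - f (k j) x)) \<longlonglongrightarrow> 0" if "a \<in> \<C>" for a
    using core_approx[OF that] by blast
  then obtain k where k: "\<And>a. a \<in> \<C> \<Longrightarrow> (\<lambda>j. E (\<lambda>x. a x - f (k a j) x) (\<lambda>x. a x - f (k a j) x)) \<longlonglongrightarrow> 0"
    by metis
  have "(\<lambda>j. \<Sum>(a, b)\<leftarrow>ps. \<Sum>(c, d)\<leftarrow>ps. q (f (k a j)) b (f (k c j)) d) \<longlonglongrightarrow> (\<Sum>(a, b)\<leftarrow>ps. \<Sum>(c, d)\<leftarrow>ps. q a b c d)"
    unfolding split_def
  proof (intro tendsto_sum_list)
    fix p r assume "p \<in> set ps" "r \<in> set ps"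
    then have "fst p \<in> \<C>" "snd p \<in> bounded_borel" "fst r \<in> \<C>" "snd r \<in> bounded_borel" using ps by auto
    then show "(\<lambda>j. q (f (k (fst p) j)) (snd p) (f (k (fst r) j)) (snd r)) \<longlonglongrightarrow> q (fst p) (snd p) (fst r) (snd r)"
      by (intro signed_integral_\<Gamma>_tendsto f_core k bounded_borel_mult)
  qed
  moreover have "0 \<le> (\<Sum>(a, b)\<leftarrow>ps. \<Sum>(c, d)\<leftarrow>ps. q (f (k a j)) b (f (k c j)) d)" for j
  proof -
    let ?g = "\<lambda>x p r. snd p x * snd r x * \<gamma> x (f (k (fst p) j)) (f (k (fst r) j))"
    have int: "integrable m (\<lambda>x. ?g x p r)" if "p \<in> set ps" "r \<in> set ps" for p r
      using that ps by (intro bb_\<gamma>_integrable bounded_borel_mult) auto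
    have int2: "integrable m (\<lambda>x. \<Sum>r\<leftarrow>ps. ?g x p r)" if "p \<in> set ps" for p
      using int[OF that] by (rule integrable_sum_list(1))
    have "(\<Sum>(a, b)\<leftarrow>ps. \<Sum>(c, d)\<leftarrow>ps. q (f (k a j)) b (f (k c j)) d) = (\<Sum>p\<leftarrow>ps. \<Sum>r\<leftarrow>ps. \<integral>x. ?g x p r \<partial>m)"
      unfolding split_def
    proof (intro arg_cong[where f = sum_list] map_cong refl)
      fix p r assume "p \<in> set ps" "r \<in> set ps"
      then show "q (f (k (fst p) j)) (snd p) (f (k (fst r) j)) (snd r) = (\<integral>x. ?g x p r \<partial>m)"
        using ps by (intro signed_integral_\<gamma> bounded_borel_mult) auto
    qed
    also have "\<dots> = (\<Sum>p\<leftarrow>ps. \<integral>x. (\<Sum>r\<leftarrow>ps. ?g x p r) \<partial>m)"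
      using int by (intro arg_cong[where f = sum_list] map_cong refl integrable_sum_list(2)[symmetric]) auto
    also have "\<dots> = (\<integral>x. (\<Sum>p\<leftarrow>ps. \<Sum>r\<leftarrow>ps. ?g x p r) \<partial>m)"
      using int2 by (intro integrable_sum_list(2)[symmetric]) auto
    finally have eq: "(\<Sum>(a, b)\<leftarrow>ps. \<Sum>(c, d)\<leftarrow>ps. q (f (k a j)) b (f (k c j)) d)
        = (\<integral>x. (\<Sum>p\<leftarrow>ps. \<Sum>r\<leftarrow>ps. ?g x p r) \<partial>m)" .
    show ?thesis unfolding eq
    proof (rule Bochner_Integration.integral_nonneg)
      fix x
      let ?ps = "map (\<lambda>(a, b). (f (k a j), b)) ps"
      have "0 \<le> (\<Sum>(a, b)\<leftarrow>?ps. \<Sum>(c, d)\<leftarrow>?ps. b x * d x * \<gamma> x a c)"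
        using f_in_A by (intro fiber_nonneg) auto
      also have "\<dots> = (\<Sum>p\<leftarrow>ps. \<Sum>r\<leftarrow>ps. ?g x p r)" by (simp add: split_def comp_def)
      finally show "0 \<le> (\<Sum>p\<leftarrow>ps. \<Sum>r\<leftarrow>ps. ?g x p r)" .
    qed
  qed
  ultimately show ?thesis by (intro LIMSEQ_le_const) auto
qed

lemma tensor_bilinear_q: "tensor_bilinear \<C> bounded_borel q"
proof
  show "fun_subspace \<C>" "fun_subspace (bounded_borel :: ('a \<Rightarrow> real) set)"
    by (rule subspace_core subspace_bounded_borel)+
next
  fix c d assume c: "c \<in> \<C>" and d: "d \<in> (bounded_borel :: ('a \<Rightarrow> real) set)"
  show "bilinear_pair \<C> bounded_borel (\<lambda>a b. q a b c d)"
    unfolding bilinear_pair_def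
  proof (intro conjI ballI allI)
    fix a a' and b :: "'a \<Rightarrow> real" assume "a \<in> \<C>" "a' \<in> \<C>" "b \<in> bounded_borel"
    then show "q (\<lambda>x. a x + a' x) b c d = q a b c d + q a' b c d"
      using signed_integral_\<Gamma>_left[of a a' c "\<lambda>x. b x * d x" 1 1] c bounded_borel_mult[OF _ d] by simp
  next
    fix t a and b :: "'a \<Rightarrow> real" assume "a \<in> \<C>" "b \<in> bounded_borel"
    then show "q (\<lambda>x. t * a x) b c d = t * q a b c d"
      using signed_integral_\<Gamma>_left[of a a c "\<lambda>x. b x * d x" t 0] c bounded_borel_mult[OF _ d] by simp
  next
    fix a and b b' :: "'a \<Rightarrow> real" assume a: "a \<in> \<C>" and b: "b \<in> bounded_borel" "b' \<in> bounded_borel"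
    show "q a (\<lambda>y. b y + b' y) c d = q a b c d + q a b' c d"
      using bb_functionalD(1)[OF bb_functional_signed_integral[OF \<Gamma>_fsm[OF a c]]
          bounded_borel_mult[OF b(1) d] bounded_borel_mult[OF b(2) d]] by (simp add: distrib_right)
  next
    fix t a and b :: "'a \<Rightarrow> real" assume a: "a \<in> \<C>" and b: "b \<in> bounded_borel"
    show "q a (\<lambda>y. t * b y) c d = t * q a b c d"
      using bb_functionalD(2)[OF bb_functional_signed_integral[OF \<Gamma>_fsm[OF a c]]
          bounded_borel_mult[OF b d]] by (simp add: mult.assoc)
  qed
next
  fix a b c d assume "a \<in> \<C>" "c \<in> \<C>" "b \<in> (bounded_borel :: ('a \<Rightarrow> real) set)" "d \<in> (bounded_borel :: ('a \<Rightarrow> real) set)"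
  then show "q a b c d = q c d a b"
    using signed_integral_\<Gamma>_sym[of a c "\<lambda>x. b x * d x"] bounded_borel_mult[of b d] by (simp add: mult.commute)
qed (rule q_nonneg)

sublocale Q: tensor_bilinear \<C> bounded_borel q by (rule tensor_bilinear_q)
sublocale MF: measurable_field m "fiber A \<gamma>" e by (rule measurable_field_fiber)

lemma one_forms_eq: "one_forms F \<Gamma> = Q.HC"
  by (simp add: one_forms_def)

lemma fiber_direct_integral_eq: "fiber_direct_integral m f \<gamma> = MF.DI"
  by (simp add: fiber_direct_integral_def)

definition \<tau> :: "nat \<Rightarrow> ('a \<Rightarrow> real) \<Rightarrow> 'a \<Rightarrow> (nat \<Rightarrow> 'a \<times> 'a \<Rightarrow> real) set" where
  "\<tau> n b x = fiber_class A \<gamma> x (tensor (f n) b)"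

lemma inner_\<tau>: "b \<in> bounded_borel \<Longrightarrow> d \<in> bounded_borel \<Longrightarrow>
    hinner (fiber A \<gamma> x) (\<tau> n b x) (\<tau> k d x) = b x * d x * \<gamma> x (f n) (f k)"
  by (simp add: \<tau>_def inner_fiber_class f_in_A)

lemma \<tau>_L2S:
  assumes b: "b \<in> bounded_borel"
  shows "\<tau> n b \<in> MF.L2S"
  unfolding MF.L2S_iff
proof
  have e: "e k = \<tau> k (\<lambda>_. 1)" for k by (simp add: \<tau>_def fun_eq_iff)
  show "\<tau> n b \<in> MF.MSec"
    unfolding measurable_sections_def e
  proof (intro CollectI conjI allI)
    show "\<tau> n b x \<in> hcarrier (fiber A \<gamma> x)" for x
      unfolding \<tau>_def by (intro fiber_class_in f_in_A b)
    show "(\<lambda>x. hinner (fiber A \<gamma> x) (\<tau> n b x) (\<tau> k (\<lambda>_. 1) x)) \<in> borel_measurable m" for k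
      using bb_\<gamma>_integrable[OF b] b by (simp add: inner_\<tau> borel_measurable_integrable)
  qed
  show "integrable m (\<lambda>x. hinner (fiber A \<gamma> x) (\<tau> n b x) (\<tau> n b x))"
    using bb_\<gamma>_integrable[OF bounded_borel_mult[OF b b]] b by (simp add: inner_\<tau>)
qed

text \<open>The squared distance between the tensors of \<open>f (k j)\<close> and of
  \<open>a\<close> with \<open>b\<close> is the integral of \<open>b\<^sup>2\<close> against the
  energy measure of the difference, hence at most \<open>2 * K\<close> times its energy.
  Orthogonality to the former thus passes to the latter.\<close>

lemma total_one_forms:
  assumes h: "h \<in> hcarrier Q.HC"
    and zero: "\<And>n b. b \<in> bounded_borel \<Longrightarrow> hinner Q.HC h (completion_class Q.tspace Q.tform (tensor (f n) b)) = 0"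
  shows "hinner Q.HC h h = 0"
proof (rule Q.total_tensor[OF h])
  fix a and b :: "'a \<Rightarrow> real" assume a: "a \<in> \<C>" and b: "b \<in> bounded_borel"
  let ?c = "\<lambda>a. completion_class Q.tspace Q.tform (tensor a b)"
  have bb: "(\<lambda>x. b x * b x) \<in> bounded_borel" by (intro bounded_borel_mult b)
  obtain K where K: "\<And>x. \<bar>b x * b x\<bar> \<le> K" using bounded_borelE[OF bb] by metis
  obtain k where k: "(\<lambda>j. E (\<lambda>x. a x - f (k j) x) (\<lambda>x. a x - f (k j) x)) \<longlonglongrightarrow> 0"
    using core_approx[OF a] by blast
  have cl: "?c u \<in> hcarrier Q.HC" if "u \<in> \<C>" for u using that b by (intro Q.completion_class_in Q.tensor_in)
  have d: "hdist2 Q.HC (?c (f (k j))) (?c a) \<le> 2 * E (\<lambda>x. a x - f (k j) x) (\<lambda>x. a x - f (k j) x) * K" for j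
  proof -
    let ?u = "f (k j)" let ?d = "\<lambda>x. a x - ?u x"
    have dC: "?d \<in> \<C>" by (intro core_diff a f_core)
    have diff: "signed_integral (\<Gamma> ?d w) (\<lambda>x. b x * b x) = q a b w b - q ?u b w b" if "w \<in> \<C>" for w
      using signed_integral_\<Gamma>_left[OF a f_core that bb, of 1 "-1" "k j"] by simp
    have "hdist2 Q.HC (?c ?u) (?c a) = q ?u b ?u b - 2 * q ?u b a b + q a b a b"
      unfolding hdist2_def using a f_core b
      by (simp add: Q.inner_completion_class Q.tensor_form_tensor Q.tensor_in)
    also have "\<dots> = signed_integral (\<Gamma> ?d ?d) (\<lambda>x. b x * b x)"
      using diff[OF dC] diff[OF a] diff[OF f_core[of "k j"]] signed_integral_\<Gamma>_sym[OF a dC bb]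
        signed_integral_\<Gamma>_sym[OF f_core dC bb, of "k j"] signed_integral_\<Gamma>_sym[OF f_core a bb, of "k j"] by linarith
    also have "\<dots> \<le> 2 * sqrt (E ?d ?d * E ?d ?d) * K"
      using signed_integral_\<Gamma>_le[OF dC dC bb K] by linarith
    finally show ?thesis using E_nonneg[OF core_F[OF dC]] by simp
  qed
  have "(\<lambda>j. 2 * E (\<lambda>x. a x - f (k j) x) (\<lambda>x. a x - f (k j) x) * K) \<longlonglongrightarrow> 2 * 0 * K" by (intro tendsto_intros k)
  then have z: "(\<lambda>j. 2 * E (\<lambda>x. a x - f (k j) x) (\<lambda>x. a x - f (k j) x) * K) \<longlonglongrightarrow> 0" by simp
  have "(\<lambda>j. hdist2 Q.HC (?c (f (k j))) (?c a)) \<longlonglongrightarrow> 0"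
  proof (rule tendsto_sandwich[OF _ _ tendsto_const z])
    show "\<forall>\<^sub>F j in sequentially. 0 \<le> hdist2 Q.HC (?c (f (k j))) (?c a)"
      by (intro always_eventually allI Q.HC.hdist2_nonneg cl f_core a)
    show "\<forall>\<^sub>F j in sequentially. hdist2 Q.HC (?c (f (k j))) (?c a)
        \<le> 2 * E (\<lambda>x. a x - f (k j) x) (\<lambda>x. a x - f (k j) x) * K"
      by (intro always_eventually allI d)
  qed
  then have "(\<lambda>j. hinner Q.HC (?c (f (k j))) h) \<longlonglongrightarrow> hinner Q.HC (?c a) h"
    using cl f_core a h by (intro Q.HC.tendsto_inner_left) auto
  moreover have "hinner Q.HC (?c (f (k j))) h = 0" for j
    using zero[OF b] Q.HC.inner_commute[OF h cl[OF f_core]] by simp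
  ultimately show "hinner Q.HC h (?c a) = 0"
    using Q.HC.inner_commute[OF h cl[OF a]] by (simp add: LIMSEQ_const_iff)
qed

lemma total_sections:
  assumes P: "P \<in> hcarrier MF.DI"
    and zero: "\<And>n b. b \<in> bounded_borel \<Longrightarrow> hinner MF.DI P (MF.aecls (\<tau> n b)) = 0"
  shows "hinner MF.DI P P = 0"
proof -
  obtain \<xi> where \<xi>: "\<xi> \<in> MF.L2S" "P = MF.aecls \<xi>" using P by (metis MF.carrier_DI_E)
  have \<xi>c: "\<xi> x \<in> hcarrier (fiber A \<gamma> x)" for x by (rule MF.L2S_in[OF \<xi>(1)])
  have "AE x in m. hinner (fiber A \<gamma> x) (\<xi> x) (e n x) = 0" for n
  proof -
    define t where "t x = hinner (fiber A \<gamma> x) (\<xi> x) (e n x)" for x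
    \<comment> \<open>Testing with the sign of \<open>t\<close> turns orthogonality into a vanishing
      integral of \<open>\<bar>t\<bar>\<close>. The sign is an admissible second factor because
      \<open>t\<close> is Borel, the measurable sets of \<open>m\<close> being the Borel
      sets.\<close>
    define b where "b x = sgn (t x)" for x
    have "t \<in> borel_measurable m"
      using \<xi>(1) unfolding t_def[abs_def] by (simp add: MF.L2S_iff measurable_sections_def)
    then have [measurable]: "t \<in> borel_measurable borel" by (simp add: measurable_cong_sets[OF sets_m refl])
    have b: "b \<in> bounded_borel"
    proof (rule bounded_borelI[of _ 1])
      show "b \<in> borel_measurable borel" unfolding b_def[abs_def] by measurable
      show "\<bar>b x\<bar> \<le> 1" for x by (simp add: b_def abs_sgn_eq)
    qed
    have eq: "hinner (fiber A \<gamma> x) (\<xi> x) (\<tau> n b x) = \<bar>t x\<bar>" for x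
      unfolding \<tau>_def fiber_class_linear(1)[OF \<xi>c f_in_A b] by (simp add: b_def t_def abs_sgn mult.commute)
    have "integrable m (\<lambda>x. \<bar>t x\<bar>)" using MF.inner_integrable[OF \<xi>(1) \<tau>_L2S[OF b, of n]] unfolding eq .
    moreover have "(\<integral>x. \<bar>t x\<bar> \<partial>m) = 0"
      using zero[OF b, of n] MF.inner_aecls[OF \<xi>(1) \<tau>_L2S[OF b, of n]] unfolding \<xi>(2) eq by simp
    ultimately have "AE x in m. \<bar>t x\<bar> = 0" using integral_nonneg_eq_0_iff_AE[of m "\<lambda>x. \<bar>t x\<bar>"] by simp
    then show ?thesis by (simp add: t_def)
  qed
  \<comment> \<open>The null sets, one for each \<open>n\<close>, are countably many and are
    discarded together, so that totality within a single fiber applies.\<close>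
  then have "AE x in m. \<forall>n. hinner (fiber A \<gamma> x) (\<xi> x) (e n x) = 0" by (simp add: AE_all_countable)
  then have "AE x in m. hinner (fiber A \<gamma> x) (\<xi> x) (\<xi> x) = 0"
    by eventually_elim (use fiber_total[OF \<xi>c] in blast)
  then have "(\<integral>x. hinner (fiber A \<gamma> x) (\<xi> x) (\<xi> x) \<partial>m) = 0" by (rule integral_eq_zero_AE)
  then show ?thesis using MF.inner_aecls[OF \<xi>(1) \<xi>(1)] \<xi>(2) by simp
qed

lemma one_forms_isometric: "\<exists>\<Phi>. isometric_isomorphism \<Phi> (one_forms F \<Gamma>) (fiber_direct_integral m f \<gamma>)"
  unfolding one_forms_eq fiber_direct_integral_eq
proof (rule isometric_isomorphism_if_gram[where I = "UNIV \<times> bounded_borel"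
      and j = "\<lambda>(n, b). completion_class Q.tspace Q.tform (tensor (f n) b)"
      and T = "\<lambda>(n, b). MF.aecls (\<tau> n b)"])
  show "hilbert_space Q.HC" by (rule Q.hilbert_space_HC)
  show "hilbert_space MF.DI" by (rule MF.hilbert_space_DI)
  show "(\<lambda>(n, b). completion_class Q.tspace Q.tform (tensor (f n) b)) ` (UNIV \<times> bounded_borel) \<subseteq> hcarrier Q.HC"
    by (auto intro!: Q.completion_class_in Q.tensor_in f_core)
  show "(\<lambda>(n, b). MF.aecls (\<tau> n b)) ` (UNIV \<times> bounded_borel) \<subseteq> hcarrier MF.DI"
    by (auto simp del: Image_singleton_iff intro!: MF.aecls_in \<tau>_L2S)
next
  fix i k :: "nat \<times> ('a \<Rightarrow> real)" assume "i \<in> UNIV \<times> bounded_borel" "k \<in> UNIV \<times> bounded_borel"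
  then obtain n b l d where ik: "i = (n, b)" "k = (l, d)" "b \<in> bounded_borel" "d \<in> bounded_borel" by auto
  have "hinner MF.DI (MF.aecls (\<tau> n b)) (MF.aecls (\<tau> l d)) = (\<integral>x. b x * d x * \<gamma> x (f n) (f l) \<partial>m)"
    using ik MF.inner_aecls[OF \<tau>_L2S \<tau>_L2S] by (simp add: inner_\<tau>)
  also have "\<dots> = q (f n) b (f l) d" using ik by (intro signed_integral_\<gamma>[symmetric] bounded_borel_mult)
  also have "\<dots> = hinner Q.HC (completion_class Q.tspace Q.tform (tensor (f n) b)) (completion_class Q.tspace Q.tform (tensor (f l) d))"
    using ik f_core by (simp add: Q.inner_completion_class Q.tensor_form_tensor Q.tensor_in)
  finally show "hinner Q.HC (case i of (n, b) \<Rightarrow> completion_class Q.tspace Q.tform (tensor (f n) b))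
      (case k of (n, b) \<Rightarrow> completion_class Q.tspace Q.tform (tensor (f n) b))
    = hinner MF.DI (case i of (n, b) \<Rightarrow> MF.aecls (\<tau> n b)) (case k of (n, b) \<Rightarrow> MF.aecls (\<tau> n b))"
    by (simp add: ik)
next
  fix h assume "h \<in> hcarrier Q.HC"
    "\<And>i. i \<in> UNIV \<times> bounded_borel \<Longrightarrow> hinner Q.HC h (case i of (n, b) \<Rightarrow> completion_class Q.tspace Q.tform (tensor (f n) b)) = 0"
  then show "hinner Q.HC h h = 0" by (intro total_one_forms) fastforce+
next
  fix P assume "P \<in> hcarrier MF.DI"
    "\<And>i. i \<in> UNIV \<times> bounded_borel \<Longrightarrow> hinner MF.DI P (case i of (n, b) \<Rightarrow> MF.aecls (\<tau> n b)) = 0"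
  then show "hinner MF.DI P P = 0" by (intro total_sections) fastforce+
qed

text \<open>\<open>\<Phi> \<omega>\<close> is a class of sections, and every member represents it,
  so the fiberwise inner products of any members integrate to the inner product in the direct
  integral. A Bochner integral value is stated in order to include integrability.\<close>

lemma has_integral_isometry:
  assumes iso: "isometric_isomorphism \<Phi> (one_forms F \<Gamma>) (fiber_direct_integral m f \<gamma>)"
    and \<omega>: "\<omega> \<in> hcarrier (one_forms F \<Gamma>)" "\<eta> \<in> hcarrier (one_forms F \<Gamma>)" and \<xi>: "\<xi> \<in> \<Phi> \<omega>" "\<zeta> \<in> \<Phi> \<eta>"
  shows "has_bochner_integral m (\<lambda>x. hinner (fiber A \<gamma> x) (\<xi> x) (\<zeta> x)) (hinner (one_forms F \<Gamma>) \<omega> \<eta>)"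
proof -
  have rep: "\<theta> \<in> MF.L2S \<and> \<Phi> \<alpha> = MF.aecls \<theta>" if \<alpha>: "\<alpha> \<in> hcarrier (one_forms F \<Gamma>)" and \<theta>: "\<theta> \<in> \<Phi> \<alpha>" for \<alpha> \<theta>
  proof -
    have "\<Phi> \<alpha> \<in> hcarrier MF.DI"
      using iso \<alpha> unfolding isometric_isomorphism_def fiber_direct_integral_eq by (auto dest: bij_betwE)
    then obtain \<theta>' where \<theta>': "\<theta>' \<in> MF.L2S" "\<Phi> \<alpha> = MF.aecls \<theta>'" by (metis MF.carrier_DI_E)
    then have r: "(\<theta>', \<theta>) \<in> ae_rel m (fiber A \<gamma>) e" using \<theta> by simp
    then have "MF.aecls \<theta>' = MF.aecls \<theta>" by (rule equiv_class_eq[OF MF.equiv_ae_rel])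
    then show ?thesis using r \<theta>' by (simp add: ae_rel_def)
  qed
  note r = rep[OF \<omega>(1) \<xi>(1)] rep[OF \<omega>(2) \<xi>(2)]
  have "(\<integral>x. hinner (fiber A \<gamma> x) (\<xi> x) (\<zeta> x) \<partial>m) = hinner MF.DI (\<Phi> \<omega>) (\<Phi> \<eta>)"
    using r MF.inner_aecls[of \<xi> \<zeta>] by simp
  also have "\<dots> = hinner (one_forms F \<Gamma>) \<omega> \<eta>"
    using iso \<omega> unfolding isometric_isomorphism_def fiber_direct_integral_eq by blast
  finally show ?thesis using r MF.inner_integrable[of \<xi> \<zeta>] by (simp add: has_bochner_integral_iff)
qed

end

theorem theorem2p1:
  fixes \<mu> m :: "'a :: {metric_space, second_countable_topology} measure"
    and F :: "('a \<Rightarrow> real) set"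
    and E :: "('a \<Rightarrow> real) \<Rightarrow> ('a \<Rightarrow> real) \<Rightarrow> real"
    and \<Gamma> :: "('a \<Rightarrow> real) \<Rightarrow> ('a \<Rightarrow> real) \<Rightarrow> 'a set \<Rightarrow> real"
    and f :: "nat \<Rightarrow> 'a \<Rightarrow> real"
    and \<gamma> :: "'a \<Rightarrow> ('a \<Rightarrow> real) \<Rightarrow> ('a \<Rightarrow> real) \<Rightarrow> real"
  assumes "locally compact (UNIV :: 'a set)"
    and "admissible_reference_measure \<mu>"
    and "symmetric_dirichlet_form \<mu> F E"
    and "regular_form \<mu> F E"
    and "energy_measures F E \<Gamma>"
    and "admissible_reference_measure m"
    and "\<forall>g\<in>core F. \<forall>A\<in>null_sets m. \<Gamma> g g A = 0"
    and "energy_dense_sequence F E f"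
    and "energy_density_versions m \<Gamma> f \<gamma>"
  shows "\<exists>\<Phi>. isometric_isomorphism \<Phi> (one_forms F \<Gamma>) (fiber_direct_integral m f \<gamma>)
    \<and> (\<forall>\<omega>\<in>hcarrier (one_forms F \<Gamma>). \<forall>\<eta>\<in>hcarrier (one_forms F \<Gamma>). \<forall>\<xi>\<in>\<Phi> \<omega>. \<forall>\<zeta>\<in>\<Phi> \<eta>.
          has_bochner_integral m
            (\<lambda>x. hinner (fiber (fun_span (range f)) \<gamma> x) (\<xi> x) (\<zeta> x))
            (hinner (one_forms F \<Gamma>) \<omega> \<eta>))"
proof -
  interpret energy_fibers \<mu> m F E \<Gamma> f \<gamma>
    using assms
    by (intro energy_fibers.intro energy_form.intro regular_dirichlet_form.intro dirichlet_form.intro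
        regular_dirichlet_form_axioms.intro energy_form_axioms.intro fiber_setting.intro
        energy_fibers_axioms.intro) (auto simp: admissible_reference_measure_def radon_measure_def)
  obtain \<Phi> where "isometric_isomorphism \<Phi> (one_forms F \<Gamma>) (fiber_direct_integral m f \<gamma>)"
    using one_forms_isometric by blast
  then show ?thesis using has_integral_isometry by blast
qed

end
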